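(* Let $H=\int_\Omega^\oplus H_\omega\,d\mu(\omega)$ satisfy condition (A) (defined in the context). Let $u$ be an admissible function on $X$ (defined in the context). Then there exists a unique measure $\nu_H$ on $\mathbb{R}$ with $$\nu_H(\varphi)=\frac{1}{\operatorname{dens}(m)}\int_\Omega \operatorname{Tr}\big(u\,\varphi(H_\omega)\big)\,d\mu(\omega)$$ for all $\varphi\in C_c(\mathbb{R})$. The measure $\nu_H$ does not depend on $u$, provided $u$ is admissible. It is a spectral measure for $H$, i.e. $\nu_H(B)=0$ if and only if $E_H(B)=0$, where $E_H$ is the spectral family of $H$.
   Context: Geometric setting. $(X,d)$ is a locally compact metric space with a countable basis of the topology. $\Gamma$ is a locally compact amenable unimodular group with an invariant metric $d_\Gamma$ such that every ball is precompact; $|A|$ denotes the invariant Haar measure of a Borel set $A\subset\Gamma$ and $d\gamma$ integration against it. $\Gamma$ acts continuously by isometries on $X$ such that: (1) there is a fundamental domain $F'\subset X$ (every $x\in X$ can be written uniquely as $x=\gamma x_0$ with $\gamma\in\Gamma$, $x_0\in F'$) which is a countable union of compact sets and has compact closure $F$; (2) the map $\Phi:X\to\Gamma$, $\Phi(x)=\gamma$ whenever $x\in\gamma F'$, is a rough isometry: there are $a\ge 1$, $b\ge 0$ with $\frac1a d_\Gamma(\Phi(x),\Phi(y))-b\le d(x,y)\le a\,d_\Gamma(\Phi(x),\Phi(y))+b$ for all $x,y\in X$. Configurations. $\mathcal{D}$ is the set of all $A\subset X$ with $d(x,y)\ge 1$ for all distinct $x,y\in A$. For a compact space $Y$ let $\mathcal{D}_Y$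 be the set of all functions $f:A\to Y$ with $A\in\mathcal{D}$, identified with the measures $\sum_{x\in A}\delta_{(x,f(x))}$ on $X\times Y$ and given the induced vague topology (the coarsest one making integration against each $\varphi\in C_c(X\times Y)$ continuous). Fix a compactification $\mathbb{C}^*$ of $\mathbb{C}$. The set $\tilde{\mathcal{D}}=\{(A,h): A\in\mathcal{D},\ h:A\times A\to\mathbb{C}^*\}$ is identified, via $f(x)(y)=h(x,y)$, with the set of those $f:A\to\mathcal{D}_{\mathbb{C}^*}$ in $\mathcal{D}_{\mathcal{D}_{\mathbb{C}^*}}$ for which $f(x)$ has domain $A$ for all $x\in A$; with the resulting vague topology it is compact. $\Gamma$ acts on $\tilde{\mathcal D}$ by $\gamma(A,h)=(\gamma A,\gamma h)$, $(\gamma h)(x,y)=h(\gamma^{-1}x,\gamma^{-1}y)$. $\mu$ is a $\Gamma$-invariant probability measure on $\tilde{\mathcal{D}}$ and $\Omega$ is its topological support. For $\omega=(A,h)$ write $X(\omega)=A$; for $\Lambda\subset X$ write $\omega(\Lambda)$ for the cardinality of $\Lambda\cap X(\omega)$. It is assumed that $\Omega$ does not consist of the empty set only. The measure $m(\Lambda)=\int_\Omega\omega(\Lambda)\,d\mu(\omega)$ on $X$ is $\Gamma$-invariant and finite on bounded sets, and $\operatorname{dens}(m)>0$ is the constant with $m(IF')=\operatorname{dens}(m)|I|$ for all compact $I\subset\Gamma$ with $|I|\ne0$. Admissible functions. A function $u$ on $X$ is called admissible if it has compact support and $\int_\Gamma u(\gamma^{-1}x)\,d\gamma=1$ for all $x\in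 X$. In $\operatorname{Tr}(u\,\varphi(H_\omega))$, $u$ acts as a multiplication operator on $\ell^2(X(\omega))$. Operators. $\mathcal{H}=\int_\Omega^\oplus \ell^2(X(\omega))\,d\mu(\omega)$. Each $\omega=(X(\omega),h)$ gives an operator $(H_\omega v)(x)=\sum_{y\in X(\omega)}H_\omega(x,y)v(y)$ with $H_\omega(x,y)=h(x,y)$, for compactly supported functions $v$ on $X(\omega)$. Condition (A): the $H_\omega$ are bounded operators on $\ell^2(X(\omega))$ with norm bounded by one constant for all $\omega\in\Omega$; $H=\int_\Omega^\oplus H_\omega\,d\mu(\omega)$ is selfadjoint on $\mathcal{H}$; $H$ has finite hopping range, i.e. there is $R<\infty$ such that $H_\omega(x,y)=0$ for all $\omega\in\Omega$ and $x,y\in X(\omega)$ with $d(x,y)\ge R$; and $H$ is equivariant with respect to a given family of functions $s_\gamma:X\to\{z\in\mathbb{C}:|z|=1\}$, $\gamma\in\Gamma$, i.e. $s_\gamma(x)H_{\gamma\omega}(\gamma x,\gamma y)\overline{s_\gamma(y)}=H_\omega(x,y)$ for all $\gamma\in\Gamma$, $\omega\in\Omega$, $x,y\in X(\omega)$.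
   Formalization: Admissible functions u are additionally required to be Borel measurable and to have the integrals of |u(γ^{-1}x)| over Γ bounded uniformly in x (automatic if u ≥ 0 or u is bounded); without this the integral of Tr(u φ(H_ω)) over Ω can fail to exist. *)

theory Defs
  imports "HOL-Probability.Probability"
begin

section \<open>The group and the space\<close>

text \<open>
  Groups are written additively, as the topological group classes of the library are; they are
  not assumed commutative.  The metric of the type class is \<open>d\<^sub>\<Gamma>\<close>, so it
  induces the group topology.
\<close>

definition unimodular_haar_measure :: "'g::{metric_space, topological_group_add} measure \<Rightarrow> bool" where
  "unimodular_haar_measure haar \<longleftrightarrow>
     sets haar = sets borel \<and>
     (\<forall>K. compact K \<longrightarrow> emeasure haar K < \<infinity>) \<and>
     (\<forall>U. open U \<longrightarrow> U \<noteq> {} \<longrightarrow> emeasure haar U > 0) \<and>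
     (\<forall>g. \<forall>B\<in>sets borel. emeasure haar ((\<lambda>x. g + x) ` B) = emeasure haar B) \<and>
     (\<forall>g. \<forall>B\<in>sets borel. emeasure haar ((\<lambda>x. x + g) ` B) = emeasure haar B)"

text \<open>
  Amenability: there is a left invariant mean on \<open>L\<^sup>\<infinity>\<close>.  Classes are represented by bounded
  Borel functions; positivity is required modulo null sets, so that (by linearity) the mean
  depends on the class only.
\<close>

definition bounded_borel :: "('g::topological_space \<Rightarrow> real) set" where
  "bounded_borel = {f. f \<in> borel_measurable borel \<and> bounded (range f)}"

definition amenable :: "'g::{metric_space, topological_group_add} measure \<Rightarrow> bool" where
  "amenable haar \<longleftrightarrow> (\<exists>M :: ('g \<Rightarrow> real) \<Rightarrow> real.
     (\<forall>f\<in>bounded_borel. \<forall>f'\<in>bounded_borel. \<forall>a b.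
        M (\<lambda>x. a * f x + b * f' x) = a * M f + b * M f') \<and>
     (\<forall>f\<in>bounded_borel. (AE x in haar. 0 \<le> f x) \<longrightarrow> 0 \<le> M f) \<and>
     M (\<lambda>_. 1) = 1 \<and>
     (\<forall>f\<in>bounded_borel. \<forall>g. M (\<lambda>x. f (g + x)) = M f))"

definition translate :: "('g \<Rightarrow> 'x \<Rightarrow> 'x) \<Rightarrow> 'g set \<Rightarrow> 'x set \<Rightarrow> 'x set" where
  "translate act I S = (\<Union>g\<in>I. act g ` S)"

definition group_coord :: "('g \<Rightarrow> 'x \<Rightarrow> 'x) \<Rightarrow> 'x set \<Rightarrow> 'x \<Rightarrow> 'g" where
  "group_coord act F' x = (THE g. x \<in> act g ` F')"

locale geometric_setting =
  fixes act :: "'g::{metric_space, topological_group_add} \<Rightarrow>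
      'x::{metric_space, second_countable_topology} \<Rightarrow> 'x"
    and F' :: "'x set"
    and haar :: "'g measure"
  assumes X_locally_compact: "locally compact (UNIV :: 'x set)"
    and G_locally_compact: "locally compact (UNIV :: 'g set)"
    and G_metric_invariant: "dist (g + h) (g + k) = dist h k"
    and G_balls_precompact: "compact (closure (ball g r))"
    and G_haar: "unimodular_haar_measure haar"
    and G_amenable: "amenable haar"
    and act_zero: "act 0 x = x"
    and act_add: "act (g + h) x = act g (act h x)"
    and act_continuous: "continuous_on UNIV (\<lambda>(g, x). act g x)"
    and act_isometry: "dist (act g x) (act g y) = dist x y"
    and fundamental_domain: "\<exists>!p. snd p \<in> F' \<and> x = act (fst p) (snd p)"
    and fundamental_domain_sigma_compact: "\<exists>K :: nat \<Rightarrow> 'x set. (\<forall>n. compact (K n)) \<and> F' = (\<Union>n. K n)"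
    and fundamental_domain_precompact: "compact (closure F')"
    and rough_isometry: "\<exists>a b :: real. a \<ge> 1 \<and> b \<ge> 0 \<and> (\<forall>x y.
        1 / a * dist (group_coord act F' x) (group_coord act F' y) - b \<le> dist x y \<and>
        dist x y \<le> a * dist (group_coord act F' x) (group_coord act F' y) + b)"

text \<open>
  The third condition says that the integrals of \<open>\<bar>u(\<gamma>\<^sup>-\<^sup>1 x)\<bar>\<close> are bounded in \<open>x\<close>.  It is automatic
  for \<open>u \<ge> 0\<close> and for bounded \<open>u\<close> of compact support.  For unbounded \<open>u\<close> of varying sign, the
  integrals over \<open>\<Omega>\<close> of the traces below need not exist without it.
\<close>

definition admissible ::
    "('g::{metric_space, topological_group_add} \<Rightarrow> 'x::metric_space \<Rightarrow> 'x) \<Rightarrow> 'g measure \<Rightarrow>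
     ('x \<Rightarrow> complex) \<Rightarrow> bool" where
  "admissible act haar u \<longleftrightarrow>
     u \<in> borel_measurable borel \<and>
     compact (closure {x. u x \<noteq> 0}) \<and>
     (\<exists>C :: real. \<forall>x. (\<integral>\<^sup>+ g. ennreal (cmod (u (act (- g) x))) \<partial>haar) \<le> ennreal C) \<and>
     (\<forall>x. (LINT g|haar. u (act (- g) x)) = 1)"


section \<open>Configurations\<close>

definition Cc :: "'a topology \<Rightarrow> ('a \<Rightarrow> complex) set" where
  "Cc T = {\<phi>. continuous_map T euclidean \<phi> \<and>
              (\<exists>K. compactin T K \<and> (\<forall>p \<in> topspace T - K. \<phi> p = 0))}"

definition separated_sets :: "'x::metric_space set set" where
  "separated_sets = {A. \<forall>x\<in>A. \<forall>y\<in>A. x \<noteq> y \<longrightarrow> dist x y \<ge> 1}"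

text \<open>Functions defined on \<open>A\<close> only are represented by extensional functions.\<close>

definition marked_sets :: "'y topology \<Rightarrow> ('x::metric_space set \<times> ('x \<Rightarrow> 'y)) set" where
  "marked_sets Y = {(A, f). A \<in> separated_sets \<and> f \<in> A \<rightarrow>\<^sub>E topspace Y}"

text \<open>
  The sum below is the integral of \<open>\<phi>\<close> against the sum of the point masses at \<open>(x, f x)\<close>,
  \<open>x \<in> A\<close>; it has only finitely many nonzero terms.
\<close>

definition vague_topology :: "'y topology \<Rightarrow> ('x::metric_space set \<times> ('x \<Rightarrow> 'y)) topology" where
  "vague_topology Y = topology_generated_by
     {{(A, f). (A, f) \<in> marked_sets Y \<and> (\<Sum>\<^sub>\<infinity>x\<in>A. \<phi> (x, f x)) \<in> U} |\<phi> U.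
        \<phi> \<in> Cc (prod_topology euclidean Y) \<and> open U}"

type_synonym ('x, 'c) config = "'x set \<times> ('x \<times> 'x \<Rightarrow> 'c)"

definition configs :: "('x::metric_space, 'c) config set" where
  "configs = {(A, h). A \<in> separated_sets \<and> h \<in> A \<times> A \<rightarrow>\<^sub>E UNIV}"

definition nested :: "('x, 'c) config \<Rightarrow> 'x set \<times> ('x \<Rightarrow> 'x set \<times> ('x \<Rightarrow> 'c))" where
  "nested = (\<lambda>(A, h). (A, \<lambda>x\<in>A. (A, \<lambda>y\<in>A. h (x, y))))"

definition config_topology :: "('x::metric_space, 'c::topological_space) config topology" where
  "config_topology = pullback_topology configs nested (vague_topology (vague_topology euclidean))"

definition act_config :: "('g::group_add \<Rightarrow> 'x \<Rightarrow> 'x) \<Rightarrow> 'g \<Rightarrow> ('x, 'c) config \<Rightarrow> ('x, 'c) config" where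
  "act_config act g = (\<lambda>(A, h).
     (act g ` A, \<lambda>(x, y) \<in> act g ` A \<times> act g ` A. h (act (- g) x, act (- g) y)))"

definition compactification :: "(complex \<Rightarrow> 'c::t2_space) \<Rightarrow> bool" where
  "compactification \<iota> \<longleftrightarrow>
     compact (UNIV :: 'c set) \<and> embedding_map euclidean euclidean \<iota> \<and> closure (range \<iota>) = UNIV"

text \<open>
  The topological support is the smallest closed set of full measure.  Its existence is not
  automatic for Borel measures on non-metrizable spaces (it is for Radon measures).
\<close>

definition is_topological_support :: "'a topology \<Rightarrow> 'a measure \<Rightarrow> 'a set \<Rightarrow> bool" where
  "is_topological_support T \<mu> S \<longleftrightarrow>
     closedin T S \<and> emeasure \<mu> (topspace T - S) = 0 \<and>
     (\<forall>C. closedin T C \<longrightarrow> emeasure \<mu> (topspace T - C) = 0 \<longrightarrow> S \<subseteq> C)"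

locale random_configuration =
  fixes act :: "'g::{metric_space, topological_group_add} \<Rightarrow>
      'x::{metric_space, second_countable_topology} \<Rightarrow> 'x"
    and \<iota> :: "complex \<Rightarrow> 'c::t2_space"
    and \<mu> :: "('x, 'c) config measure"
    and \<Omega> :: "('x, 'c) config set"
  assumes compactification: "compactification \<iota>"
    and probability: "prob_space \<mu>"
    and borel: "sets \<mu> = sets (sigma configs {U. openin config_topology U})"
    and invariant: "distr \<mu> \<mu> (act_config act g) = \<mu>"
    and support: "is_topological_support config_topology \<mu> \<Omega>"
    and not_only_empty: "\<exists>\<omega>\<in>\<Omega>. fst \<omega> \<noteq> {}"

text \<open>\<open>intensity \<mu> \<Omega>\<close> is the set function \<open>m\<close>; \<open>density_of\<close> is \<open>dens(m)\<close>.\<close>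

definition intensity :: "('x, 'c) config measure \<Rightarrow> ('x, 'c) config set \<Rightarrow> 'x set \<Rightarrow> ennreal" where
  "intensity \<mu> \<Omega> \<Lambda> =
     (\<integral>\<^sup>+ \<omega>. emeasure (count_space UNIV) (\<Lambda> \<inter> fst \<omega>) \<partial>restrict_space \<mu> \<Omega>)"

definition density_of ::
    "('g::{metric_space, topological_group_add} \<Rightarrow> 'x \<Rightarrow> 'x) \<Rightarrow> 'x set \<Rightarrow> 'g measure \<Rightarrow>
     ('x, 'c) config measure \<Rightarrow> ('x, 'c) config set \<Rightarrow> real" where
  "density_of act F' haar \<mu> \<Omega> = (THE c. c > 0 \<and>
     (\<forall>I. compact I \<longrightarrow> emeasure haar I \<noteq> 0 \<longrightarrow>
        intensity \<mu> \<Omega> (translate act I F') = ennreal c * emeasure haar I))"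


section \<open>Operators on spaces of functions\<close>

text \<open>
  A Hilbert space is given by a set \<open>Vec\<close> of functions (with the pointwise vector space
  operations) and a positive semidefinite form \<open>Ip\<close>, linear in the second argument.  Vectors at
  distance 0 are identified by means of \<open>veq\<close>, and operators accordingly.
\<close>

record 'i hilbert =
  Vec :: "('i \<Rightarrow> complex) set"
  Ip :: "('i \<Rightarrow> complex) \<Rightarrow> ('i \<Rightarrow> complex) \<Rightarrow> complex"

type_synonym 'i operator = "('i \<Rightarrow> complex) \<Rightarrow> ('i \<Rightarrow> complex)"

definition vnorm :: "'i hilbert \<Rightarrow> ('i \<Rightarrow> complex) \<Rightarrow> real" where
  "vnorm V v = sqrt (Re (Ip V v v))"

definition veq :: "'i hilbert \<Rightarrow> ('i \<Rightarrow> complex) \<Rightarrow> ('i \<Rightarrow> complex) \<Rightarrow> bool" where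
  "veq V v w \<longleftrightarrow> vnorm V (\<lambda>i. v i - w i) = 0"

definition operator_bounded_by :: "'i hilbert \<Rightarrow> real \<Rightarrow> 'i operator \<Rightarrow> bool" where
  "operator_bounded_by V c T \<longleftrightarrow>
     (\<forall>v\<in>Vec V. T v \<in> Vec V \<and> vnorm V (T v) \<le> c * vnorm V v) \<and>
     (\<forall>v\<in>Vec V. \<forall>w\<in>Vec V. \<forall>a. veq V (T (\<lambda>i. a * v i + w i)) (\<lambda>i. a * T v i + T w i))"

definition selfadjoint :: "'i hilbert \<Rightarrow> 'i operator \<Rightarrow> bool" where
  "selfadjoint V T \<longleftrightarrow>
     (\<exists>c. operator_bounded_by V c T) \<and> (\<forall>v\<in>Vec V. \<forall>w\<in>Vec V. Ip V (T v) w = Ip V v (T w))"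

definition orthogonal_projection :: "'i hilbert \<Rightarrow> 'i operator \<Rightarrow> bool" where
  "orthogonal_projection V P \<longleftrightarrow> selfadjoint V P \<and> (\<forall>v\<in>Vec V. veq V (P (P v)) (P v))"

definition projection_valued_measure :: "'i hilbert \<Rightarrow> (real set \<Rightarrow> 'i operator) \<Rightarrow> bool" where
  "projection_valued_measure V E \<longleftrightarrow>
     (\<forall>B\<in>sets borel. orthogonal_projection V (E B)) \<and>
     (\<forall>v\<in>Vec V. veq V (E UNIV v) v) \<and>
     (\<forall>B\<in>sets borel. \<forall>C\<in>sets borel. \<forall>v\<in>Vec V. veq V (E (B \<inter> C) v) (E B (E C v))) \<and>
     (\<forall>B :: nat \<Rightarrow> real set. range B \<subseteq> sets borel \<longrightarrow> disjoint_family B \<longrightarrow>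
        (\<forall>v\<in>Vec V. \<forall>w\<in>Vec V. (\<lambda>n. Ip V v (E (B n) w)) sums Ip V v (E (\<Union>n. B n) w)))"

definition scalar_spectral_measure ::
    "'i hilbert \<Rightarrow> (real set \<Rightarrow> 'i operator) \<Rightarrow> ('i \<Rightarrow> complex) \<Rightarrow> real measure" where
  "scalar_spectral_measure V E v =
     measure_of UNIV (sets borel) (\<lambda>B. ennreal (Re (Ip V v (E B v))))"

text \<open>
  \<open>E\<close> is the spectral family of the everywhere defined selfadjoint operator \<open>T\<close>: every vector is
  in the domain of the integral of \<open>t\<close> with respect to \<open>E\<close>, and this integral is \<open>T\<close>.
  The spectral family is determined up to \<open>veq\<close>.
\<close>

definition is_spectral_family ::
    "'i hilbert \<Rightarrow> 'i operator \<Rightarrow> (real set \<Rightarrow> 'i operator) \<Rightarrow> bool" where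
  "is_spectral_family V T E \<longleftrightarrow>
     projection_valued_measure V E \<and>
     (\<forall>v\<in>Vec V. integrable (scalar_spectral_measure V E v) (\<lambda>t. t\<^sup>2) \<and>
        Ip V v (T v) = complex_of_real (LINT t|scalar_spectral_measure V E v. t))"

definition spectral_family :: "'i hilbert \<Rightarrow> 'i operator \<Rightarrow> real set \<Rightarrow> 'i operator" where
  "spectral_family V T = (SOME E. is_spectral_family V T E)"

definition functional_calculus :: "'i hilbert \<Rightarrow> 'i operator \<Rightarrow> (real \<Rightarrow> complex) \<Rightarrow> 'i operator" where
  "functional_calculus V T \<phi> = (SOME S. (\<exists>c. operator_bounded_by V c S) \<and>
     (\<forall>v\<in>Vec V. Ip V v (S v) =
        (LINT t|scalar_spectral_measure V (spectral_family V T) v. \<phi> t)))"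

definition operator_zero :: "'i hilbert \<Rightarrow> 'i operator \<Rightarrow> bool" where
  "operator_zero V T \<longleftrightarrow> (\<forall>v\<in>Vec V. veq V (T v) (\<lambda>_. 0))"

text \<open>Elements of \<open>\<ell>\<^sup>2(A)\<close> are extended by 0 outside of \<open>A\<close>.\<close>

definition l2 :: "'x set \<Rightarrow> 'x hilbert" where
  "l2 A = \<lparr> Vec = {v. (\<forall>x. x \<notin> A \<longrightarrow> v x = 0) \<and> (\<lambda>x. (cmod (v x))\<^sup>2) summable_on A},
            Ip = (\<lambda>v w. \<Sum>\<^sub>\<infinity>x\<in>A. cnj (v x) * w x) \<rparr>"

definition l2_trace :: "'x set \<Rightarrow> 'x operator \<Rightarrow> complex" where
  "l2_trace A T = (\<Sum>\<^sub>\<infinity>x\<in>A. let e = (\<lambda>y. if y = x then 1 else 0) in Ip (l2 A) e (T e))"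

text \<open>
  The direct integral of the spaces \<open>\<ell>\<^sup>2(X(\<omega>))\<close> over \<open>\<Omega>\<close>: the square integrable measurable
  sections, where the measurable structure is the one in which the restrictions of functions
  \<open>f \<in> C\<^sub>c(X)\<close> form a fundamental family.  The section with value \<open>v\<^sub>\<omega>\<close> at \<open>\<omega>\<close> is written
  as the function \<open>(\<omega>, x) \<mapsto> v\<^sub>\<omega>(x)\<close>.
\<close>

definition direct_integral ::
    "('x::metric_space, 'c) config measure \<Rightarrow> ('x, 'c) config set \<Rightarrow> (('x, 'c) config \<times> 'x) hilbert" where
  "direct_integral \<mu> \<Omega> =
     \<lparr> Vec = {v.
         (\<forall>\<omega>\<in>\<Omega>. (\<lambda>x. v (\<omega>, x)) \<in> Vec (l2 (fst \<omega>))) \<and>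
         (\<forall>f\<in>Cc euclidean. (\<lambda>\<omega>. Ip (l2 (fst \<omega>)) f (\<lambda>x. v (\<omega>, x)))
            \<in> borel_measurable (restrict_space \<mu> \<Omega>)) \<and>
         integrable (restrict_space \<mu> \<Omega>) (\<lambda>\<omega>. (vnorm (l2 (fst \<omega>)) (\<lambda>x. v (\<omega>, x)))\<^sup>2)},
       Ip = (\<lambda>v w. LINT \<omega>|restrict_space \<mu> \<Omega>.
               Ip (l2 (fst \<omega>)) (\<lambda>x. v (\<omega>, x)) (\<lambda>x. w (\<omega>, x))) \<rparr>"

text \<open>
  The matrix of a configuration, and its operator on \<open>\<ell>\<^sup>2(X(\<omega>))\<close>.  If the operator given by the
  matrix on compactly supported functions is bounded, then its rows are square summable, and its
  continuous extension to all of \<open>\<ell>\<^sup>2(X(\<omega>))\<close> is given by the same formula.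
\<close>

definition hopping :: "(complex \<Rightarrow> 'c) \<Rightarrow> ('x, 'c) config \<Rightarrow> 'x \<Rightarrow> 'x \<Rightarrow> complex" where
  "hopping \<iota> \<omega> x y = inv \<iota> (snd \<omega> (x, y))"

definition fiber_op :: "(complex \<Rightarrow> 'c) \<Rightarrow> ('x, 'c) config \<Rightarrow> 'x operator" where
  "fiber_op \<iota> \<omega> v = (\<lambda>x. if x \<in> fst \<omega> then \<Sum>\<^sub>\<infinity>y\<in>fst \<omega>. hopping \<iota> \<omega> x y * v y else 0)"

definition direct_integral_op :: "(complex \<Rightarrow> 'c) \<Rightarrow> (('x, 'c) config \<times> 'x) operator" where
  "direct_integral_op \<iota> v = (\<lambda>(\<omega>, x). fiber_op \<iota> \<omega> (\<lambda>y. v (\<omega>, y)) x)"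

text \<open>
  The first clause makes sense of \<open>h\<close> as a complex matrix: on \<open>\<Omega>\<close> it has no values in the
  boundary of the compactification.
\<close>

definition condition_A ::
    "('g::group_add \<Rightarrow> 'x::metric_space \<Rightarrow> 'x) \<Rightarrow> ('g \<Rightarrow> 'x \<Rightarrow> complex) \<Rightarrow> (complex \<Rightarrow> 'c) \<Rightarrow>
     ('x, 'c) config measure \<Rightarrow> ('x, 'c) config set \<Rightarrow> bool" where
  "condition_A act s \<iota> \<mu> \<Omega> \<longleftrightarrow>
     (\<forall>\<omega>\<in>\<Omega>. \<forall>x\<in>fst \<omega>. \<forall>y\<in>fst \<omega>. snd \<omega> (x, y) \<in> range \<iota>) \<and>
     (\<exists>c. \<forall>\<omega>\<in>\<Omega>. operator_bounded_by (l2 (fst \<omega>)) c (fiber_op \<iota> \<omega>)) \<and>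
     selfadjoint (direct_integral \<mu> \<Omega>) (direct_integral_op \<iota>) \<and>
     (\<exists>R. \<forall>\<omega>\<in>\<Omega>. \<forall>x\<in>fst \<omega>. \<forall>y\<in>fst \<omega>. dist x y \<ge> R \<longrightarrow> hopping \<iota> \<omega> x y = 0) \<and>
     (\<forall>g. \<forall>\<omega>\<in>\<Omega>. \<forall>x\<in>fst \<omega>. \<forall>y\<in>fst \<omega>.
        s g x * hopping \<iota> (act_config act g \<omega>) (act g x) (act g y) * cnj (s g y) = hopping \<iota> \<omega> x y)"


section \<open>The density of states\<close>

text \<open>
  Measures on the real line are Borel measures that are finite on compact sets.  Existence of
  the integral over \<open>\<Omega>\<close> is part of the defining formula.
\<close>

definition is_nu ::
    "real \<Rightarrow> (complex \<Rightarrow> 'c) \<Rightarrow> ('x, 'c) config measure \<Rightarrow> ('x, 'c) config set \<Rightarrow>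
     ('x \<Rightarrow> complex) \<Rightarrow> real measure \<Rightarrow> bool" where
  "is_nu dens \<iota> \<mu> \<Omega> u \<nu> \<longleftrightarrow>
     sets \<nu> = sets borel \<and> (\<forall>K. compact K \<longrightarrow> emeasure \<nu> K < \<infinity>) \<and>
     (\<forall>\<phi>\<in>Cc euclidean.
        let tr = (\<lambda>\<omega>. l2_trace (fst \<omega>)
                   (\<lambda>v x. u x * functional_calculus (l2 (fst \<omega>)) (fiber_op \<iota> \<omega>) \<phi> v x))
        in integrable (restrict_space \<mu> \<Omega>) tr \<and>
           (LINT t|\<nu>. \<phi> t) = complex_of_real (1 / dens) * (LINT \<omega>|restrict_space \<mu> \<Omega>. tr \<omega>))"

definition nu ::
    "real \<Rightarrow> (complex \<Rightarrow> 'c) \<Rightarrow> ('x, 'c) config measure \<Rightarrow> ('x, 'c) config set \<Rightarrow>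
     ('x \<Rightarrow> complex) \<Rightarrow> real measure" where
  "nu dens \<iota> \<mu> \<Omega> u = (THE \<nu>. is_nu dens \<iota> \<mu> \<Omega> u \<nu>)"

end

theory Submission
  imports Defs "HOL-Computational_Algebra.Polynomial" "HOL-Real_Asymp.Real_Asymp"
begin

text \<open>
  The Hausdorff moment problem attaches to every vector of a bounded selfadjoint operator its
  spectral measure, which gives the Borel functional calculus and the uniqueness of the spectral
  family.  Applied in each fibre, it yields measurable decompositions, so that the spectral family
  of \<open>H\<close> acts fibrewise; for this the symmetry of \<open>H\<close>, which holds almost everywhere, is extended to
  every configuration in \<open>\<Omega>\<close> by continuity of the matrix elements.  The weights
  \<open>\<langle>\<delta>\<^sub>x, E\<^sub>\<omega>(B) \<delta>\<^sub>x\<rangle>\<close> are covariant under the group, since the phases \<open>s\<^sub>\<gamma>\<close> cancel on the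
  diagonal.  Hence the measure on \<open>X\<close> obtained by averaging them over the points of the random
  configuration is invariant, and averaging over the unimodular group replaces an admissible \<open>u\<close> by
  the normalised indicator function of the translates of \<open>F'\<close> by a compact ball.  This defines
  \<open>\<nu>\<^sub>H\<close> without reference to \<open>u\<close>.  Finally, \<open>\<nu>\<^sub>H(B) = 0\<close> means that almost surely all these weights
  vanish, which says that \<open>E\<^sub>\<omega>(B) = 0\<close> for almost all \<open>\<omega>\<close>.
\<close>

section \<open>Bounded Borel functions and moments\<close>

text \<open>Only powers of \<open>H\<close> act visibly in each fibre: the section of
  \<open>H^k v\<close> at \<omega> is \<open>H_\<omega>^k\<close> applied to the section of
  \<open>v\<close>. Hence measurability in \<omega>, decomposition over \<Omega> and covariance are
  all checked on moments and carried to bounded Borel functions by monotone class arguments;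
  functionals continuous under bounded pointwise convergence (\<open>sigma_functional\<close>) take
  the place of complex measures. Since \<open>spectral_family\<close> and
  \<open>functional_calculus\<close> are choices, uniqueness is what makes their values computable
  at all. A second obstacle is that sums over the points of \<omega> have a moving index set. The
  space is cut into countably many Borel pieces of diameter below 1; each holds at most one point of
  a configuration, so the pieces serve as fixed labels and a statement about all points becomes
  countably many statements about measurable functions. A third is that \<open>u\<close> may be
  complex and unbounded: it is split into four nonnegative parts, to which Tonelli applies, and only
  the recombined parts have constant orbit integrals.\<close>

definition bdd_borel :: "(real \<Rightarrow> complex) set" where
  "bdd_borel = {f. f \<in> borel_measurable borel \<and> (\<exists>C. \<forall>t. cmod (f t) \<le> C)}"

lemma bdd_borelI: "f \<in> borel_measurable borel \<Longrightarrow> (\<And>t. cmod (f t) \<le> C) \<Longrightarrow> f \<in> bdd_borel"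
  unfolding bdd_borel_def by auto

lemma bdd_borel_measurable [measurable_dest]: "f \<in> bdd_borel \<Longrightarrow> f \<in> borel_measurable borel"
  unfolding bdd_borel_def by auto

lemma bdd_borel_bound:
  assumes "f \<in> bdd_borel"
  obtains C where "C \<ge> 0" "\<And>t. cmod (f t) \<le> C"
proof -
  from assms obtain C where "\<And>t. cmod (f t) \<le> C"
    unfolding bdd_borel_def by auto
  moreover from this[of 0] have "C \<ge> 0"
    using norm_ge_zero order_trans by blast
  ultimately show ?thesis using that by blast
qed

lemma bdd_borel_indicator [intro]: "B \<in> sets borel \<Longrightarrow> indicator B \<in> bdd_borel"
  by (rule bdd_borelI[where C=1]) (auto split: split_indicator)

lemma bdd_borel_const [intro]: "(\<lambda>_. a) \<in> bdd_borel"
  by (rule bdd_borelI[where C="cmod a"]) auto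

lemma bdd_borel_mult [intro]:
  assumes "f \<in> bdd_borel" "g \<in> bdd_borel" shows "(\<lambda>t. f t * g t) \<in> bdd_borel"
proof -
  obtain C D where "C \<ge> 0" "\<And>t. cmod (f t) \<le> C" "D \<ge> 0" "\<And>t. cmod (g t) \<le> D"
    using assms by (metis bdd_borel_bound)
  then have "cmod (f t * g t) \<le> C * D" for t
    by (simp add: norm_mult mult_mono)
  then show ?thesis using assms by (intro bdd_borelI) (auto intro: bdd_borel_measurable)
qed

lemma bdd_borel_scale [intro]: "f \<in> bdd_borel \<Longrightarrow> (\<lambda>t. a * f t) \<in> bdd_borel"
  by (intro bdd_borel_mult bdd_borel_const)

lemma bdd_borel_add [intro]:
  assumes "f \<in> bdd_borel" "g \<in> bdd_borel" shows "(\<lambda>t. f t + g t) \<in> bdd_borel"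
proof -
  obtain C D where "C \<ge> 0" "\<And>t. cmod (f t) \<le> C" "D \<ge> 0" "\<And>t. cmod (g t) \<le> D"
    using assms by (metis bdd_borel_bound)
  then have "cmod (f t + g t) \<le> C + D" for t
    by (meson add_mono norm_triangle_le)
  then show ?thesis using assms by (intro bdd_borelI) (auto intro: bdd_borel_measurable)
qed

lemma bdd_borel_sum [intro]:
  "(\<And>i. i \<in> I \<Longrightarrow> f i \<in> bdd_borel) \<Longrightarrow> (\<lambda>t. \<Sum>i\<in>I. f i t) \<in> bdd_borel"
  by (induction I rule: infinite_finite_induct) auto

lemma bdd_borel_integrable [intro]:
  assumes "finite_measure m" "sets m = sets borel" "f \<in> bdd_borel"
  shows "integrable m f"
proof -
  interpret finite_measure m by fact
  obtain C where "\<And>t. cmod (f t) \<le> C" using assms(3) by (metis bdd_borel_bound)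
  then show ?thesis
    using assms by (intro integrable_const_bound[where B=C])
      (auto simp: measurable_cong_sets[OF assms(2) refl] intro: bdd_borel_measurable)
qed

text \<open>A bounded Borel function is a pointwise limit of simple functions \<open>F i\<close>
  with modulus at most twice that of \<open>f\<close>. This yields the uniform bound
  \<open>C\<close> of the \<open>lim\<close> case, which later lets dominated convergence
  apply.\<close>

lemma bdd_borel_induct [consumes 1, case_names indicator add scale lim]:
  fixes P :: "(real \<Rightarrow> complex) \<Rightarrow> bool"
  assumes f: "f \<in> bdd_borel"
    and ind: "\<And>B. B \<in> sets borel \<Longrightarrow> P (indicator B)"
    and add: "\<And>f g. f \<in> bdd_borel \<Longrightarrow> g \<in> bdd_borel \<Longrightarrow> P f \<Longrightarrow> P g \<Longrightarrow> P (\<lambda>t. f t + g t)"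
    and scale: "\<And>a f. f \<in> bdd_borel \<Longrightarrow> P f \<Longrightarrow> P (\<lambda>t. a * f t)"
    and lim: "\<And>F f C. f \<in> bdd_borel \<Longrightarrow> (\<And>n. F n \<in> bdd_borel) \<Longrightarrow> (\<And>n. P (F n)) \<Longrightarrow>
       (\<And>n t. cmod (F n t) \<le> C) \<Longrightarrow> (\<And>t. (\<lambda>n. F n t) \<longlonglongrightarrow> f t) \<Longrightarrow> P f"
  shows "P f"
proof -
  have "f \<in> borel_measurable borel" using f by auto
  from borel_measurable_implies_sequence_metric[OF this, of 0] obtain F
    where F: "\<And>i. simple_function borel (F i)" "\<And>x. (\<lambda>i. F i x) \<longlonglongrightarrow> f x"
      "\<And>i x. dist (F i x) 0 \<le> 2 * dist (f x) 0" by auto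
  obtain C where C: "\<And>t. cmod (f t) \<le> C" using f by (metis bdd_borel_bound)
  have FC: "cmod (F n t) \<le> 2 * C" for n t
    using F(3)[of n t] C[of t] by simp
  have Fb: "F n \<in> bdd_borel" for n
    using F(1)[of n] FC by (intro bdd_borelI[where C="2*C"]) (auto intro: borel_measurable_simple_function)
  have zero: "P (\<lambda>_. 0)" using scale[OF bdd_borel_indicator ind, of "{}" 0] by simp
  have sum: "P (\<lambda>t. \<Sum>y\<in>Y. y * indicator (F n -` {y}) t)" if "finite Y" for n Y
    using that
  proof induction
    case empty then show ?case using zero by simp
  next
    case (insert y Y)
    have B: "F n -` {z} \<in> sets borel" for z
      using simple_functionD(2)[OF F(1)[of n], of "{z}"] by simp
    show ?case
      unfolding sum.insert[OF insert(1,2)]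
      by (intro add scale ind B insert.IH bdd_borel_scale bdd_borel_sum bdd_borel_indicator)
  qed
  have "P (F n)" for n
  proof -
    have fin: "finite (range (F n))" using simple_functionD(1)[OF F(1)[of n]] by simp
    have "F n = (\<lambda>t. \<Sum>y\<in>range (F n). y * indicator (F n -` {y}) t)"
    proof
      fix t
      have "(\<Sum>y\<in>range (F n). y * indicator (F n -` {y}) t) = (\<Sum>y\<in>range (F n). if y = F n t then y else 0)"
        by (intro sum.cong) (auto split: split_indicator)
      also have "\<dots> = F n t" using fin by simp
      finally show "F n t = (\<Sum>y\<in>range (F n). y * indicator (F n -` {y}) t)" ..
    qed
    then show ?thesis using sum[OF fin, of n] by metis
  qed
  from lim[OF f Fb this FC F(2)] show ?thesis .
qed

lemma integral_complex_indicator: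
  "(LINT t|m. indicator B t :: complex) = complex_of_real (measure m (B \<inter> space m))"
proof -
  have "(LINT t|m. indicator B t :: complex) = (LINT t|m. complex_of_real (indicator B t))"
    by (intro Bochner_Integration.integral_cong) (auto split: split_indicator)
  then show ?thesis by simp
qed

text \<open>A monomial is made bounded by cutting it off outside [-c, c]. For a measure carried by
  that interval the integral is still the \<open>k\<close>-th moment.\<close>

definition trunc_power :: "real \<Rightarrow> nat \<Rightarrow> real \<Rightarrow> complex" where
  "trunc_power c k t = (if \<bar>t\<bar> \<le> c then complex_of_real (t ^ k) else 0)"

lemma trunc_power_bdd_borel [intro]: "trunc_power c k \<in> bdd_borel"
proof (rule bdd_borelI)
  show "trunc_power c k \<in> borel_measurable borel"
    unfolding trunc_power_def[abs_def] by measurable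
  show "cmod (trunc_power c k t) \<le> \<bar>c\<bar> ^ k" for t
    unfolding trunc_power_def by (auto simp: norm_power intro!: power_mono)
qed

text \<open>Weierstrass approximation followed by a monotone class argument.\<close>

lemma bdd_borel_moment_induct [consumes 1, case_names off power add scale lim]:
  fixes P :: "(real \<Rightarrow> complex) \<Rightarrow> bool"
  assumes f: "f \<in> bdd_borel"
    and off: "\<And>f. f \<in> bdd_borel \<Longrightarrow> (\<And>t. \<bar>t\<bar> \<le> c \<Longrightarrow> f t = 0) \<Longrightarrow> P f"
    and power: "\<And>k. P (trunc_power c k)"
    and add: "\<And>f g. f \<in> bdd_borel \<Longrightarrow> g \<in> bdd_borel \<Longrightarrow> P f \<Longrightarrow> P g \<Longrightarrow> P (\<lambda>t. f t + g t)"
    and scale: "\<And>a f. f \<in> bdd_borel \<Longrightarrow> P f \<Longrightarrow> P (\<lambda>t. a * f t)"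
    and lim: "\<And>F f C. f \<in> bdd_borel \<Longrightarrow> (\<And>n. F n \<in> bdd_borel) \<Longrightarrow> (\<And>n. P (F n)) \<Longrightarrow>
       (\<And>n t. cmod (F n t) \<le> C) \<Longrightarrow> (\<And>t. (\<lambda>n. F n t) \<longlonglongrightarrow> f t) \<Longrightarrow> P f"
  shows "P f"
proof -
  have zero: "P (\<lambda>_. 0)" by (rule off) auto
  define I where "I = {t::real. \<bar>t\<bar> \<le> c}"
  have Ieq: "I = {-c..c}" unfolding I_def by auto
  have I [measurable]: "I \<in> sets borel" unfolding Ieq by simp
  have sum: "P (\<lambda>t. \<Sum>i\<in>A. f i t)"
    if "finite A" "\<And>i. i \<in> A \<Longrightarrow> f i \<in> bdd_borel" "\<And>i. i \<in> A \<Longrightarrow> P (f i)" for A :: "nat set" and f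
    using that by (induction A) (auto intro!: zero add)
  have cont: "P (\<lambda>t. indicator I t * complex_of_real (g t))" if g: "continuous_on UNIV g" for g :: "real \<Rightarrow> real"
  proof -
    have "\<exists>p. \<forall>n. real_polynomial_function (p n) \<and> (\<forall>x\<in>I. \<bar>g x - p n x\<bar> < inverse (real (Suc n)))"
    proof (intro choice allI)
      fix n
      show "\<exists>p. real_polynomial_function p \<and> (\<forall>x\<in>I. \<bar>g x - p x\<bar> < inverse (real (Suc n)))"
      proof -
        have "compact I" "continuous_on I g" "0 < inverse (real (Suc n))"
          using continuous_on_subset[OF g, of I] unfolding Ieq by auto
        from Stone_Weierstrass_real_polynomial_function[OF this] show ?thesis by metis
      qed
    qed
    then obtain p where p: "\<And>n. real_polynomial_function (p n)"
      "\<And>n x. x \<in> I \<Longrightarrow> \<bar>g x - p n x\<bar> < inverse (real (Suc n))" by blast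
    have "bounded (g ` I)"
      using compact_continuous_image[OF continuous_on_subset[OF g, of I]] compact_imp_bounded Ieq by auto
    then obtain D where D: "\<And>x. x \<in> I \<Longrightarrow> \<bar>g x\<bar> \<le> D" unfolding bounded_iff by auto
    define F where "F n t = indicator I t * complex_of_real (p n t)" for n t
    have FD: "cmod (F n t) \<le> \<bar>D\<bar> + 1" for n t
    proof (cases "t \<in> I")
      case True
      have "inverse (real (Suc n)) \<le> 1" by (simp add: field_simps)
      then show ?thesis using D[OF True] p(2)[OF True, of n] True unfolding F_def by simp
    qed (simp add: F_def)
    have lim1: "(\<lambda>n. F n t) \<longlonglongrightarrow> indicator I t * complex_of_real (g t)" for t
    proof (cases "t \<in> I")
      case True
      have "(\<lambda>n. p n t) \<longlonglongrightarrow> g t"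
      proof (rule LIMSEQ_I)
        fix r :: real assume "r > 0"
        from reals_Archimedean[OF this] obtain N where N: "inverse (real (Suc N)) < r" by auto
        have "norm (p n t - g t) < r" if "n \<ge> N" for n
        proof -
          have "inverse (real (Suc n)) \<le> inverse (real (Suc N))" using that by (simp add: field_simps)
          then show ?thesis using p(2)[OF True, of n] N unfolding real_norm_def by linarith
        qed
        then show "\<exists>no. \<forall>n\<ge>no. norm (p n t - g t) < r" by auto
      qed
      then show ?thesis unfolding F_def by (intro tendsto_intros)
    qed (simp add: F_def)
    have Fb: "F n \<in> bdd_borel" "P (F n)" for n
    proof -
      obtain a N where a: "p n = (\<lambda>x. \<Sum>i\<le>N. a i * x ^ i)"
        using p(1)[of n] real_polynomial_function_iff_sum by blast
      have eq: "F n = (\<lambda>t. \<Sum>i\<in>{..N}. complex_of_real (a i) * trunc_power c i t)"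
        unfolding F_def a trunc_power_def I_def by (auto simp: fun_eq_iff split: split_indicator)
      show "F n \<in> bdd_borel" unfolding eq by (intro bdd_borel_sum bdd_borel_scale) auto
      show "P (F n)" unfolding eq by (intro sum bdd_borel_scale scale power) auto
    qed
    have "(\<lambda>t. indicator I t * complex_of_real (g t)) \<in> borel_measurable borel"
      using borel_measurable_continuous_onI[OF g] by measurable
    moreover have "cmod (indicator I t * complex_of_real (g t)) \<le> \<bar>D\<bar>" for t
      using D[of t] by (auto split: split_indicator)
    ultimately show ?thesis
      by (intro lim[OF _ Fb(1) Fb(2) FD lim1] bdd_borelI)
  qed
  have closed: "P (indicator C)" if C: "closed C" for C
  proof (cases "C = {}")
    case True then show ?thesis using zero by (simp add: indicator_def[abs_def])
  next
    case False
    \<comment> \<open>These tents decrease to the indicator of \<open>C\<close>: off the closed set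
      \<open>C\<close> the distance is positive, so the value is eventually 0.\<close>
    define G where "G n t = max 0 (1 - real n * infdist t C)" for n t
    have Gc: "continuous_on UNIV (G n)" for n
      unfolding G_def by (intro continuous_intros)
    have G1: "cmod (indicator I t * complex_of_real (G n t)) \<le> 1" for n t
      unfolding G_def using infdist_nonneg[of t C] by (auto split: split_indicator)
    have Glim: "(\<lambda>n. indicator I t * complex_of_real (G n t)) \<longlonglongrightarrow> indicator (I \<inter> C) t" for t
    proof (cases "t \<in> C")
      case True
      then show ?thesis unfolding G_def by (auto split: split_indicator)
    next
      case F: False
      then have pos: "infdist t C > 0" using False C
        by (metis in_closed_iff_infdist_zero infdist_nonneg order_le_less)
      obtain N where N: "1 < real N * infdist t C" using reals_Archimedean3[OF pos] by auto
      have "G n t = 0" if "n \<ge> N" for n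
      proof -
        have "real N * infdist t C \<le> real n * infdist t C" using that pos by simp
        then show ?thesis unfolding G_def using N by simp
      qed
      then have "eventually (\<lambda>n. indicator I t * complex_of_real (G n t) = indicator (I \<inter> C) t) sequentially"
        unfolding eventually_sequentially using F by (intro exI[of _ N]) auto
      then show ?thesis by (rule tendsto_eventually)
    qed
    have [measurable]: "C \<in> sets borel" using C by simp
    have Gm: "G n \<in> borel_measurable borel" for n
      using borel_measurable_continuous_onI[OF Gc] .
    have 1: "P (indicator (I \<inter> C))"
    proof (rule lim[OF _ _ cont[OF Gc] G1 Glim])
      show "indicator (I \<inter> C) \<in> bdd_borel" by (rule bdd_borel_indicator) measurable
      show "(\<lambda>a. indicator I a * complex_of_real (G n a)) \<in> bdd_borel" for n
        using Gm[of n] by (intro bdd_borelI[OF _ G1]) measurable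
    qed
    have 2: "P (indicator (C - I))"
      by (rule off) (auto simp: I_def)
    have "P (\<lambda>t. indicator (I \<inter> C) t + indicator (C - I) t)"
      by (intro add 1 2 bdd_borel_indicator) measurable
    also have "(\<lambda>t. indicator (I \<inter> C) t + indicator (C - I) t) = (indicator C :: real \<Rightarrow> complex)"
      by (auto simp: fun_eq_iff split: split_indicator)
    finally show ?thesis .
  qed
  have borel: "P (indicator B)" if "B \<in> sets borel" for B
  proof -
    \<comment> \<open>Closed sets are stable under intersection and generate the Borel sets, so only
      complements and disjoint unions remain; the partial sums for a disjoint union stay bounded by
      1.\<close>
    have "Int_stable (Collect closed :: real set set)" by (auto simp: Int_stable_def)
    moreover have "Collect closed \<subseteq> Pow (UNIV :: real set)" by simp
    moreover have "B \<in> sigma_sets UNIV (Collect closed)" using that unfolding borel_eq_closed by simp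
    ultimately show ?thesis
    proof (induction B rule: sigma_sets_induct_disjoint)
      case (basic A) then show ?case using closed by simp
    next
      case empty show ?case by (rule closed) simp
    next
      case (compl A)
      then have A: "A \<in> sets borel" unfolding borel_eq_closed by simp
      have "P (\<lambda>t. indicator UNIV t + (-1) * indicator A t)"
        using A by (intro add scale compl closed bdd_borel_indicator bdd_borel_scale) auto
      also have "(\<lambda>t. indicator UNIV t + (-1) * indicator A t) = (indicator (UNIV - A) :: real \<Rightarrow> complex)"
        by (auto simp: fun_eq_iff split: split_indicator)
      finally show ?case .
    next
      case (union A)
      then have A: "A i \<in> sets borel" for i unfolding borel_eq_closed by auto
      show ?case
      proof (rule lim[where F="\<lambda>n t. \<Sum>i<n. indicator (A i) t" and C=1])
        show "(\<lambda>t. \<Sum>i<n. indicator (A i) t) \<in> bdd_borel" for n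
          using A by (intro bdd_borel_sum bdd_borel_indicator)
        show "P (\<lambda>t. \<Sum>i<n. indicator (A i) t)" for n
          using A union by (intro sum bdd_borel_indicator) auto
        have eq: "(\<Sum>i<n. indicator (A i) t) = (indicator (\<Union>i<n. A i) t :: complex)" for n t
          using union(1) by (intro indicator_UN_disjoint[symmetric]) (auto intro: disjoint_family_on_mono)
        show "cmod (\<Sum>i<n. indicator (A i) t) \<le> 1" for n t
          unfolding eq by (auto split: split_indicator)
        show "(\<lambda>n. \<Sum>i<n. indicator (A i) t) \<longlonglongrightarrow> (indicator (\<Union>i. A i) t :: complex)" for t
          unfolding eq by (rule LIMSEQ_indicator_UN)
        show "indicator (\<Union>i. A i) \<in> bdd_borel" using A by (intro bdd_borel_indicator) auto
      qed
    qed
  qed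
  show ?thesis
    using f
  proof (induction rule: bdd_borel_induct)
    case (lim F f C)
    \<comment> \<open>Inside this case \<open>lim\<close> names the facts of the induction, so the
      hypothesis of the same name is reached as \<open>assms(6)\<close>.\<close>
    show ?case by (rule assms(6)[OF lim(1,2,5,3,4)])
  qed (auto intro: borel add scale)
qed

section \<open>The Hausdorff moment problem\<close>

text \<open>Both quantities are products of \<open>m\<close> factors of modulus at most 1, namely
  \<open>(k - i) / (n - i)\<close> and \<open>k / n\<close>. Corresponding factors differ by at most
  \<open>m / (n - m)\<close>, and the products differ at most by the sum of these differences. The
  estimate trades the exact factorial moments of the Bernstein weights for power moments.\<close>

lemma choose_ratio_approx:
  assumes "k \<le> n" "2 * m < n"
  shows "\<bar>real (k choose m) / real (n choose m) - (real k / real n) ^ m\<bar> \<le> (real m)\<^sup>2 / (real n - real m)"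
proof -
  have ratio: "real (k choose m) / real (n choose m) = (\<Prod>i<m. (real k - real i) / (real n - real i))"
  proof -
    have "real (j choose m) = (\<Prod>i<m. real j - real i) / fact m" for j
      using gbinomial_prod_rev[of "real j" m] by (simp add: binomial_gbinomial atLeast0LessThan)
    then show ?thesis by (simp add: prod_dividef)
  qed
  have "norm ((\<Prod>i<m. (real k - real i) / (real n - real i)) - (\<Prod>i<m. real k / real n))
     \<le> (\<Sum>i<m. norm ((real k - real i) / (real n - real i) - real k / real n))"
  proof (rule norm_prod_diff)
    fix i assume "i \<in> {..<m}"
    then have i: "real i < real m" by simp
    have n: "2 * real m < real n" "real k \<le> real n" using assms by linarith+
    \<comment> \<open>For \<open>k < i\<close> the numerator is negative, but then
      \<open>i - k \<le> i < m < n - m < n - i\<close>; the factor 2 in \<open>2 * m < n\<close>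
      covers this case.\<close>
    have "\<bar>real k - real i\<bar> \<le> \<bar>real n - real i\<bar>" using i n by linarith
    then show "norm ((real k - real i) / (real n - real i)) \<le> 1" using i n by (simp add: divide_le_eq)
    show "norm (real k / real n) \<le> 1" using n by (simp add: divide_le_eq)
  qed
  also have "\<dots> \<le> (\<Sum>i<m. real m / (real n - real m))"
  proof (rule sum_mono)
    fix i assume "i \<in> {..<m}"
    then have i: "real i < real m" by simp
    have n: "2 * real m < real n" "real k \<le> real n" using assms by linarith+
    have pos: "real n > 0" "real n - real i > 0" "real n - real m > 0" using i n by linarith+
    have "(real k - real i) / (real n - real i) - real k / real n
       = - (real i / (real n - real i)) * ((real n - real k) / real n)"
      using pos by (simp add: field_simps)
    then have "norm ((real k - real i) / (real n - real i) - real k / real n)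
       = (real i / (real n - real i)) * ((real n - real k) / real n)"
      using pos n by (simp add: abs_mult)
    also have "\<dots> \<le> (real i / (real n - real i)) * 1"
      using pos n by (intro mult_left_mono) auto
    also have "\<dots> \<le> real m / (real n - real m)"
      using pos i n by (simp add: frac_le)
    finally show "norm ((real k - real i) / (real n - real i) - real k / real n) \<le> real m / (real n - real m)" .
  qed
  also have "\<dots> = (real m)\<^sup>2 / (real n - real m)" by (simp add: power2_eq_square)
  finally show ?thesis unfolding ratio by simp
qed

text \<open>
  The Bernstein weights of the functional are nonnegative, and the factorial moments of the
  resulting discrete measures are exact; a weak limit of these measures has the given moments.
\<close>

lemma hausdorff_moment_unit:
  fixes L :: "real poly \<Rightarrow> real"
  assumes add: "\<And>p q. L (p + q) = L p + L q"
    and smult: "\<And>a p. L (smult a p) = a * L p"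
    and pos: "\<And>j k. 0 \<le> L ([:0, 1:] ^ j * [:1, -1:] ^ k)"
    and L1: "L 1 = 1"
  shows "\<exists>m. finite_measure m \<and> sets m = sets borel \<and> emeasure m (- {0..1}) = 0 \<and>
    (\<forall>p. (LINT t|m. poly p t) = L p)"
proof -
  have L0: "L 0 = 0" using smult[of 0 0] by simp
  have Lsum: "L (\<Sum>i\<in>A. f i) = (\<Sum>i\<in>A. L (f i))" for A :: "nat set" and f
    by (induction A rule: infinite_finite_induct) (auto simp: add L0)
  define X Y :: "real poly" where "X = [:0, 1:]" and "Y = [:1, -1:]"
  have XY: "X + Y = 1" unfolding X_def Y_def by simp
  define w where "w n k = (if k \<le> n then real (n choose k) * L (X ^ k * Y ^ (n - k)) else 0)" for n k
  have w0: "w n k \<ge> 0" for n k using pos unfolding w_def X_def Y_def by simp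
  \<comment> \<open>\<open>choose_mult\<close> rewrites the product of two binomial coefficients so
    that \<open>n choose m\<close> factors out; what remains is \<open>X ^ m\<close> times the
    binomial expansion of \<open>(X + Y) ^ (n - m)\<close>, and \<open>X + Y = 1\<close>.\<close>
  have choose_moment: "(\<Sum>k\<le>n. real (k choose m) * w n k) = real (n choose m) * L (X ^ m)" if "m \<le> n" for m n
  proof -
    have "(\<Sum>k\<le>n. real (k choose m) * w n k) = (\<Sum>k\<in>{m..n}. real (k choose m) * w n k)"
      using that by (intro sum.mono_neutral_right) auto
    also have "\<dots> = (\<Sum>k\<in>{m..n}. real (n choose m) * (real ((n - m) choose (k - m)) * L (X ^ k * Y ^ (n - k))))"
    proof (intro sum.cong refl)
      fix k assume k: "k \<in> {m..n}"
      then have "real (n choose k) * real (k choose m) = real (n choose m) * real ((n - m) choose (k - m))"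
        using choose_mult[of m k n] by (simp flip: of_nat_mult)
      then show "real (k choose m) * w n k = real (n choose m) * (real ((n - m) choose (k - m)) * L (X ^ k * Y ^ (n - k)))"
        using k unfolding w_def by (simp add: algebra_simps)
    qed
    also have "\<dots> = real (n choose m) * (\<Sum>k\<in>{m..n}. real ((n - m) choose (k - m)) * L (X ^ k * Y ^ (n - k)))"
      by (simp add: sum_distrib_left)
    also have "(\<Sum>k\<in>{m..n}. real ((n - m) choose (k - m)) * L (X ^ k * Y ^ (n - k)))
       = (\<Sum>j\<le>n - m. real ((n - m) choose j) * L (X ^ (j + m) * Y ^ (n - m - j)))"
      using that by (intro sum.reindex_bij_witness[of _ "\<lambda>j. j + m" "\<lambda>k. k - m"]) (auto intro: arg_cong2)
    also have "\<dots> = L (\<Sum>j\<le>n - m. smult (real ((n - m) choose j)) (X ^ (j + m) * Y ^ (n - m - j)))"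
      by (simp add: Lsum smult)
    also have "(\<Sum>j\<le>n - m. smult (real ((n - m) choose j)) (X ^ (j + m) * Y ^ (n - m - j))) = X ^ m * (X + Y) ^ (n - m)"
      unfolding binomial_ring sum_distrib_left
      by (intro sum.cong) (auto simp: power_add algebra_simps of_nat_poly)
    finally show ?thesis by (simp add: XY)
  qed
  have wsum: "(\<Sum>k\<le>n. w n k) = 1" for n
    using choose_moment[of 0 n] L1 by simp
  define D where "D n = embed_pmf (w n)" for n
  have wnn: "(\<integral>\<^sup>+k. ennreal (w n k) \<partial>count_space UNIV) = 1" for n
  proof -
    have "(\<integral>\<^sup>+k. ennreal (w n k) \<partial>count_space UNIV) = (\<Sum>k\<le>n. ennreal (w n k))"
      by (rule nn_integral_count_space'[of "{..n}"]) (auto simp: w_def)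
    also have "\<dots> = ennreal (\<Sum>k\<le>n. w n k)" using w0 by (simp add: sum_ennreal)
    finally show ?thesis by (simp add: wsum)
  qed
  have pmfD: "pmf (D n) k = w n k" for n k
    unfolding D_def by (rule pmf_embed_pmf[OF w0 wnn])
  have setD: "set_pmf (D n) \<subseteq> {..n}" for n
    by (auto simp: set_pmf_eq pmfD w_def split: if_splits)
  \<comment> \<open>The weight \<open>w n k\<close> sits at \<open>k / n\<close>. For
    \<open>n = 0\<close> division by zero puts the only atom at 0, which is still in the unit
    interval.\<close>
  define \<mu> where "\<mu> n = distr (measure_pmf (D n)) borel (\<lambda>k. real k / real n)" for n
  have \<mu>int: "(LINT t|\<mu> n. f t) = (\<Sum>k\<le>n. w n k * f (real k / real n))"
    if "f \<in> borel_measurable borel" for n and f :: "real \<Rightarrow> real"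
    unfolding \<mu>_def using that setD[of n]
    by (subst integral_distr) (auto simp: pmfD intro!: trans[OF integral_measure_pmf[of "{..n}"]])
  have rd: "real_distribution (\<mu> n)" for n
    unfolding \<mu>_def real_distribution_def real_distribution_axioms_def
    by (auto intro: prob_space.prob_space_distr measure_pmf.prob_space_axioms)
  \<comment> \<open>Tightness is phrased with half-open intervals \<open>{a<..b}\<close>; the left
    end -1 makes sure that mass at 0 is counted.\<close>
  have mass: "measure (\<mu> n) {-1<..1} = 1" for n
  proof -
    have "measure (\<mu> n) {-1<..1} = measure (measure_pmf (D n)) ((\<lambda>k. real k / real n) -` {-1<..1})"
      unfolding \<mu>_def by (subst measure_distr) auto
    also have "\<dots> = 1"
    proof -
      have "set_pmf (D n) \<subseteq> (\<lambda>k. real k / real n) -` {-1<..1}"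
      proof
        fix k assume "k \<in> set_pmf (D n)"
        then have k: "k \<le> n" using setD by auto
        have "0 \<le> real k / real n" by simp
        moreover have "real k / real n \<le> 1" using k by (cases "n = 0") auto
        ultimately show "k \<in> (\<lambda>k. real k / real n) -` {-1<..1}" by (auto intro: less_le_trans[of _ 0])
      qed
      then show ?thesis by (intro measure_pmf.prob_eq_1[THEN iffD2]) (auto simp: AE_measure_pmf_iff)
    qed
    finally show ?thesis .
  qed
  have tight: "tight \<mu>"
    unfolding tight_def
  proof (intro conjI allI impI)
    fix \<epsilon> :: real assume "\<epsilon> > 0"
    then have "- 1 < (1 :: real) \<and> (\<forall>n. 1 - \<epsilon> < measure (\<mu> n) {-1<..1})" by (simp add: mass)
    then show "\<exists>a b. a < b \<and> (\<forall>n. 1 - \<epsilon> < measure (\<mu> n) {a<..b})" by blast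
  qed (rule rd)
  obtain r M where r: "strict_mono r" and M: "real_distribution M" and wc: "weak_conv_m (\<mu> \<circ> id \<circ> r) M"
    using tight_imp_convergent_subsubsequence[OF tight strict_mono_id] by auto
  interpret M: real_distribution M by fact
  have conv: "(\<lambda>n. LINT t|\<mu> (r n). f t) \<longlonglongrightarrow> (LINT t|M. f t)"
    if f: "\<And>x. isCont f x" "\<And>x. \<bar>f x\<bar> \<le> B" for f :: "real \<Rightarrow> real" and B
    using weak_conv_imp_integral_bdd_continuous_conv[of "\<mu> \<circ> id \<circ> r" M f B] rd M wc f by (auto simp: comp_def)
  have unit: "real k / real n \<in> {0..1}" if "k \<le> n" for k n :: nat
    using that by (cases "n = 0") auto
  have supp: "emeasure M (- {0..1}) = 0"
  proof -
    \<comment> \<open>A bounded continuous function that vanishes exactly on the unit interval. Its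
      integrals against all \<open>\<mu> n\<close> are 0, hence so is the integral against the weak
      limit.\<close>
    define f where "f t = min 1 (infdist t {0..1::real})" for t
    have cf: "isCont f x" for x unfolding f_def by (intro continuous_intros)
    have f0: "f t \<ge> 0" "\<bar>f t\<bar> \<le> 1" for t using infdist_nonneg[of t "{0..1}"] unfolding f_def by auto
    have fm: "f \<in> borel_measurable borel"
      using cf by (intro borel_measurable_continuous_onI) (simp add: continuous_at_imp_continuous_on)
    have "(LINT t|\<mu> (r n). f t) = 0" for n
      unfolding \<mu>int[OF fm] by (rule sum.neutral) (use unit in \<open>auto simp: f_def\<close>)
    then have "(LINT t|M. f t) = 0"
      using conv[of f 1, OF cf f0(2)] LIMSEQ_unique[OF _ tendsto_const] by simp
    then have "AE t in M. f t = 0"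
      using fm f0 by (intro integral_nonneg_eq_0_iff_AE[THEN iffD1] M.integrable_const_bound[of _ 1]) auto
    then have "AE t in M. t \<in> {0..1}"
    proof eventually_elim
      fix t assume "f t = 0"
      then have "infdist t {0..1} = 0" unfolding f_def by (auto simp: min_def split: if_splits)
      then show "t \<in> {0..1}" by (subst in_closed_iff_infdist_zero) auto
    qed
    then show ?thesis by (subst (asm) AE_iff_measurable[of "- {0..1}"]) auto
  qed
  have moments: "(LINT t|M. t ^ m) = L (X ^ m)" for m
  proof -
    \<comment> \<open>Clamping to the unit interval makes the monomial bounded and continuous on the
      whole line, as weak convergence requires; it agrees with \<open>t ^ m\<close> almost
      everywhere for \<open>M\<close>.\<close>
    define f where "f t = (max 0 (min 1 t)) ^ m" for t :: real
    have cf: "isCont f x" for x unfolding f_def by (intro continuous_intros)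
    have f0: "\<bar>f t\<bar> \<le> 1" for t unfolding f_def by (auto simp: power_abs[symmetric] intro!: power_le_one)
    have fm [measurable]: "f \<in> borel_measurable borel"
      using cf by (intro borel_measurable_continuous_onI) (simp add: continuous_at_imp_continuous_on)
    have "AE t in M. t \<in> {0..1}"
      using supp by (intro AE_I[of _ _ "- {0..1}"]) auto
    then have "(LINT t|M. t ^ m) = (LINT t|M. f t)"
      by (intro integral_cong_AE) (auto simp: f_def)
    moreover have "(\<lambda>n. LINT t|\<mu> n. f t) \<longlonglongrightarrow> L (X ^ m)"
    proof -
      have bound: "norm ((LINT t|\<mu> n. f t) - L (X ^ m)) \<le> (real m)\<^sup>2 / (real n - real m)" if n: "2 * m < n" for n
      proof -
        have "(LINT t|\<mu> n. f t) = (\<Sum>k\<le>n. w n k * (real k / real n) ^ m)"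
          unfolding \<mu>int[OF fm] using unit[of _ n] by (intro sum.cong) (simp_all add: f_def)
        moreover have "L (X ^ m) = (\<Sum>k\<le>n. w n k * (real (k choose m) / real (n choose m)))"
          using choose_moment[of m n] n by (simp add: sum_divide_distrib[symmetric] mult.commute field_simps)
        ultimately have "norm ((LINT t|\<mu> n. f t) - L (X ^ m)) =
            \<bar>\<Sum>k\<le>n. w n k * ((real k / real n) ^ m - real (k choose m) / real (n choose m))\<bar>"
          by (simp add: sum_subtractf right_diff_distrib)
        also have "\<dots> \<le> (\<Sum>k\<le>n. w n k * ((real m)\<^sup>2 / (real n - real m)))"
        proof (rule order.trans[OF sum_abs], rule sum_mono)
          fix k assume "k \<in> {..n}"
          then have "\<bar>(real k / real n) ^ m - real (k choose m) / real (n choose m)\<bar> \<le> (real m)\<^sup>2 / (real n - real m)"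
            using choose_ratio_approx[OF _ n] by (simp add: abs_minus_commute)
          then show "\<bar>w n k * ((real k / real n) ^ m - real (k choose m) / real (n choose m))\<bar>
             \<le> w n k * ((real m)\<^sup>2 / (real n - real m))"
            unfolding abs_mult abs_of_nonneg[OF w0] by (rule mult_left_mono) (rule w0)
        qed
        also have "\<dots> = (real m)\<^sup>2 / (real n - real m)"
          unfolding sum_distrib_right[symmetric] wsum by simp
        finally show ?thesis .
      qed
      have "(\<lambda>n. (real m)\<^sup>2 / (real n - real m)) \<longlonglongrightarrow> 0" by real_asymp
      then have "(\<lambda>n. (LINT t|\<mu> n. f t) - L (X ^ m)) \<longlonglongrightarrow> 0"
        by (rule Lim_null_comparison[rotated])
           (use bound in \<open>auto simp: eventually_sequentially intro!: exI[of _ "2 * m + 1"]\<close>)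
      then show ?thesis by (simp add: LIM_zero_iff)
    qed
    then have "(\<lambda>n. LINT t|\<mu> (r n). f t) \<longlonglongrightarrow> L (X ^ m)"
      using LIMSEQ_subseq_LIMSEQ[OF _ r, of "\<lambda>n. LINT t|\<mu> n. f t"] by (simp add: comp_def)
    ultimately show ?thesis using LIMSEQ_unique[OF conv[OF cf f0]] by simp
  qed
  have integrable: "integrable M (\<lambda>t. t ^ k)" for k
  proof (rule M.integrable_const_bound[where B=1])
    have "AE t in M. t \<in> {0..1}"
      using supp by (intro AE_I[of _ _ "- {0..1}"]) auto
    then show "AE t in M. norm (t ^ k) \<le> 1"
      by eventually_elim (simp add: power_le_one)
  qed simp
  have "(LINT t|M. poly p t) = L p" for p
  proof -
    have "(LINT t|M. poly p t) = (\<Sum>i\<le>degree p. coeff p i * (LINT t|M. t ^ i))"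
      unfolding poly_altdef using integrable by (subst Bochner_Integration.integral_sum) auto
    also have "\<dots> = (\<Sum>i\<le>degree p. L (monom (coeff p i) i))"
      unfolding moments by (intro sum.cong refl) (simp add: X_def monom_altdef smult)
    also have "\<dots> = L p" by (simp add: Lsum[symmetric] poly_as_sum_of_monoms)
    finally show ?thesis .
  qed
  then show ?thesis using supp M.finite_measure_axioms by (intro exI[of _ M]) auto
qed

text \<open>The affine map \<open>q\<close> sends [-c, c] onto [0, 1] and turns
  \<open>c + t\<close>, \<open>c - t\<close> into multiples of the factors \<open>t\<close>,
  \<open>1 - t\<close> of the unit case. The total mass \<open>K 1\<close> is divided out if it is
  positive; if it is 0, positivity makes the whole functional vanish and the null measure
  serves.\<close>

lemma hausdorff_moment_interval:
  fixes L :: "real poly \<Rightarrow> real"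
  assumes add: "\<And>p q. L (p + q) = L p + L q"
    and smult: "\<And>a p. L (smult a p) = a * L p"
    and c: "c > 0" and pos: "\<And>j k. 0 \<le> L ([:c, 1:] ^ j * [:c, -1:] ^ k)"
  shows "\<exists>m. finite_measure m \<and> sets m = sets borel \<and> emeasure m (- {-c..c}) = 0 \<and>
    (\<forall>p. (LINT t|m. poly p t) = L p)"
proof -
  define q where "q = [:1/2, 1/(2*c):]"
  define K where "K p = L (pcompose p q)" for p
  have Kadd: "K (p + r) = K p + K r" for p r unfolding K_def by (simp add: pcompose_add add)
  have Ksmult: "K (smult a p) = a * K p" for a p unfolding K_def by (simp add: pcompose_smult smult)
  have pow: "pcompose (p ^ n) q = pcompose p q ^ n" for p n
    by (induction n) (auto simp: pcompose_1 pcompose_mult)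
  have q1: "pcompose [:0, 1:] q = smult (1/(2*c)) [:c, 1:]" "pcompose [:1, -1:] q = smult (1/(2*c)) [:c, -1:]"
    using c unfolding q_def by (simp_all add: pcompose_pCons)
  have Kpos: "0 \<le> K ([:0, 1:] ^ j * [:1, -1:] ^ k)" for j k
  proof -
    have "K ([:0, 1:] ^ j * [:1, -1:] ^ k) = (1/(2*c)) ^ j * ((1/(2*c)) ^ k * L ([:c, 1:] ^ j * [:c, -1:] ^ k))"
      by (simp only: K_def pcompose_mult pow q1 smult_power mult_smult_left mult_smult_right smult mult.left_commute)
    then show ?thesis using pos[of j k] c by (simp only: zero_le_mult_iff zero_le_power zero_le_divide_1_iff) auto
  qed
  have ex: "\<exists>m. finite_measure m \<and> sets m = sets borel \<and> emeasure m (- {0..1}) = 0 \<and>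
    (\<forall>p. (LINT t|m. poly p t) = K p)"
  proof (cases "K 1 = 0")
    case False
    have "K 1 \<ge> 0" using Kpos[of 0 0] by simp
    with False have K1: "K 1 > 0" by simp
    obtain m where m: "finite_measure m" "sets m = sets borel" "emeasure m (- {0..1}) = 0"
        "\<And>p. (LINT t|m. poly p t) = K p / K 1"
      using hausdorff_moment_unit[of "\<lambda>p. K p / K 1"] Kpos K1
      by (auto simp: Kadd Ksmult add_divide_distrib)
    interpret finite_measure m by fact
    define m' where "m' = density m (\<lambda>_. ennreal (K 1))"
    have em: "emeasure m' A = ennreal (K 1) * emeasure m A" if "A \<in> sets m" for A
      unfolding m'_def using that by (simp add: emeasure_density nn_integral_cmult_indicator)
    show ?thesis
    proof (intro exI[of _ m'] conjI allI)
      show "finite_measure m'"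
        using em[of "space m"] emeasure_finite[of "space m"]
        by (intro finite_measureI) (auto simp: m'_def ennreal_mult_eq_top_iff)
      show "sets m' = sets borel" using m(2) by (simp add: m'_def)
      show "emeasure m' (- {0..1}) = 0" using em[of "- {0..1}"] m(2,3) by simp
      show "(LINT t|m'. poly p t) = K p" for p
      proof -
        have "poly p \<in> borel_measurable m"
          unfolding measurable_cong_sets[OF m(2) refl]
          by (intro borel_measurable_continuous_onI continuous_intros)
        then have "(LINT t|m'. poly p t) = (LINT t|m. K 1 * poly p t)"
          unfolding m'_def using K1 by (subst integral_density) auto
        then show ?thesis using m(4)[of p] K1 by simp
      qed
    qed
  next
    case True
    have K0: "K 0 = 0" using Ksmult[of 0 0] by simp
    have Ksum: "K (\<Sum>i\<in>A. f i) = (\<Sum>i\<in>A. K (f i))" for A :: "nat set" and f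
      by (induction A rule: infinite_finite_induct) (auto simp: Kadd K0)
    \<comment> \<open>Since \<open>t ^ n = t ^ (n + 1) + t ^ n * (1 - t)\<close> and both summands
      have nonnegative value, the value 0 at \<open>t ^ n\<close> forces the value 0 at the next
      power.\<close>
    have decr: "K ([:0, 1:] ^ n) = 0" for n
    proof (induction n)
      case (Suc n)
      have "[:0, 1:] ^ n = [:0, 1:] ^ n * ([:0, 1:] + [:1, -1:] :: real poly)" by simp
      then have "[:0, 1:] ^ n = [:0, 1:] ^ Suc n + [:0, 1:] ^ n * ([:1, -1:] :: real poly) ^ 1"
        by (simp only: power_Suc2 power_one_right distrib_left)
      then have "K ([:0, 1:] ^ n) = K ([:0, 1:] ^ Suc n) + K ([:0, 1:] ^ n * [:1, -1:] ^ 1)"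
        using Kadd by metis
      then show ?case using Suc Kpos[of "Suc n" 0] Kpos[of n 1] by simp
    qed (use True in simp)
    have "K p = 0" for p
    proof -
      have "K p = (\<Sum>i\<le>degree p. K (monom (coeff p i) i))" by (simp add: Ksum[symmetric] poly_as_sum_of_monoms)
      then show ?thesis by (simp add: monom_altdef Ksmult decr)
    qed
    then show ?thesis
      by (intro exI[of _ "null_measure borel"]) (auto intro!: finite_measureI)
  qed
  then obtain m where m: "finite_measure m" "sets m = sets borel" "emeasure m (- {0..1}) = 0"
      "\<And>p. (LINT t|m. poly p t) = K p" by blast
  interpret finite_measure m by fact
  have sp: "space m = UNIV" using sets_eq_imp_space_eq[OF m(2)] by simp
  define h where "h t = 2 * c * t - c" for t :: real
  have h [measurable]: "h \<in> measurable m borel"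
    unfolding measurable_cong_sets[OF m(2) refl] h_def by simp
  show ?thesis
  proof (intro exI[of _ "distr m borel h"] conjI allI)
    show "finite_measure (distr m borel h)" by (rule finite_measure_distr) measurable
    show "sets (distr m borel h) = sets borel" by simp
    have "h -` (- {-c..c}) \<subseteq> - {0..1}"
    proof safe
      fix t assume "h t \<notin> {-c..c}" "t \<in> {0..1}"
      moreover have "0 \<le> c * t" "c * t \<le> c * 1" using c calculation by (auto intro!: mult_left_mono simp del: mult_1_right)
      ultimately show False unfolding h_def by auto
    qed
    then have "emeasure m (h -` (- {-c..c})) \<le> emeasure m (- {0..1})"
      using m(2) by (intro emeasure_mono) auto
    then show "emeasure (distr m borel h) (- {-c..c}) = 0"
      using m(3) sp by (subst emeasure_distr) auto
    show "(LINT t|distr m borel h. poly p t) = L p" for p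
    proof -
      have "(LINT t|distr m borel h. poly p t) = (LINT t|m. poly p (h t))"
        by (intro integral_distr h borel_measurable_continuous_onI continuous_intros)
      also have "\<dots> = (LINT t|m. poly (pcompose p [:-c, 2*c:]) t)"
        by (simp add: poly_pcompose h_def algebra_simps)
      also have "\<dots> = L (pcompose (pcompose p [:-c, 2*c:]) q)" using m(4) K_def by simp
      also have "pcompose (pcompose p [:-c, 2*c:]) q = pcompose p (pcompose [:-c, 2*c:] q)"
        by (simp add: pcompose_assoc)
      also have "pcompose [:-c, 2*c:] q = [:0, 1:]" using c unfolding q_def by (simp add: pcompose_pCons)
      finally show ?thesis by simp
    qed
  qed
qed

section \<open>Radon measures on the real line\<close>

text \<open>Compact intervals form an intersection-stable generator and exhaust the line with finite
  measure. The indicator of one is the limit of tent functions in \<open>Cc euclidean\<close>, all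
  dominated by the indicator of a slightly larger interval, so dominated convergence recovers its
  measure.\<close>

lemma radon_measure_eqI:
  fixes \<nu> \<nu>' :: "real measure"
  assumes sets: "sets \<nu> = sets borel" "sets \<nu>' = sets borel"
    and fin: "\<And>K. compact K \<Longrightarrow> emeasure \<nu> K < \<infinity>" "\<And>K. compact K \<Longrightarrow> emeasure \<nu>' K < \<infinity>"
    and eq: "\<And>\<phi>. \<phi> \<in> Cc euclidean \<Longrightarrow> (LINT t|\<nu>. \<phi> t) = (LINT t|\<nu>'. \<phi> t)"
  shows "\<nu> = \<nu>'"
proof (rule measure_eqI_generator_eq[where E="range (\<lambda>(l, u). {l..u::real})" and \<Omega>=UNIV and A="\<lambda>i. {- real i..real i}"])
  show "Int_stable (range (\<lambda>(l, u). {l..u::real}))"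
  proof (rule Int_stableI)
    fix A B assume "A \<in> range (\<lambda>(l, u). {l..u::real})" "B \<in> range (\<lambda>(l, u). {l..u::real})"
    then obtain a b c d where "A = {a..b}" "B = {c..d}" by auto
    then have "A \<inter> B = (\<lambda>(l, u). {l..u}) (max a c, min b d)" by auto
    then show "A \<inter> B \<in> range (\<lambda>(l, u). {l..u::real})" by blast
  qed
  show "sets \<nu> = sigma_sets UNIV (range (\<lambda>(l, u). {l..u}))" "sets \<nu>' = sigma_sets UNIV (range (\<lambda>(l, u). {l..u}))"
    unfolding sets borel_eq_atLeastAtMost by simp_all
  show "(\<Union>i. {- real i..real i}) = UNIV"
  proof safe
    fix x :: real
    obtain n where "\<bar>x\<bar> \<le> real n" using real_arch_simple by blast
    then show "x \<in> (\<Union>i. {- real i..real i})" by (intro UN_I[of n]) auto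
  qed simp_all
  show "emeasure \<nu> {- real i..real i} \<noteq> \<infinity>" for i using fin(1)[of "{- real i..real i}"] by simp
  fix K assume "K \<in> range (\<lambda>(l, u). {l..u::real})"
  then obtain a b where K: "K = {a..b}" by auto
  show "emeasure \<nu> K = emeasure \<nu>' K"
  proof (cases "a \<le> b")
    case True
    \<comment> \<open>The slope is \<open>Suc n\<close> rather than \<open>n\<close>, so that
      already the first tent is supported in \<open>{a-1..b+1}\<close>.\<close>
    define g where "g n t = complex_of_real (max 0 (1 - real (Suc n) * infdist t K))" for n t
    have K1: "K \<subseteq> {a-1..b+1}" unfolding K by auto
    have near: "t \<in> {a-1..b+1}" if "infdist t K \<le> 1" for t
    proof -
      obtain y where "y \<in> K" "infdist t K = dist t y"
        using infdist_attains_inf[of K t] True unfolding K by auto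
      then show ?thesis using that unfolding K by (auto simp: dist_real_def)
    qed
    have gb: "cmod (g n t) \<le> indicator {a-1..b+1} t" for n t
    proof (cases "t \<in> {a-1..b+1}")
      case False
      then have "1 < infdist t K" using near by force
      then have "1 * 1 < real (Suc n) * infdist t K" by (intro mult_le_less_imp_less) auto
      then show ?thesis unfolding g_def by simp
    qed (use infdist_nonneg[of t K] in \<open>auto simp: g_def\<close>)
    have gCc: "g n \<in> Cc euclidean" for n
    proof -
      have "continuous_on UNIV (g n)" unfolding g_def by (intro continuous_intros)
      moreover have "g n t = 0" if "t \<notin> {a-1..b+1}" for t using gb[of n t] that by simp
      ultimately show ?thesis unfolding Cc_def
        by (auto simp: compactin_euclidean_iff intro!: exI[of _ "{a-1..b+1}"])
    qed
    have glim: "(\<lambda>n. g n t) \<longlonglongrightarrow> indicator K t" for t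
    proof (cases "t \<in> K")
      case False
      then have pos: "infdist t K > 0" using True unfolding K
        by (metis atLeastatMost_empty_iff2 closed_atLeastAtMost in_closed_iff_infdist_zero infdist_nonneg not_less order_le_less)
      obtain N where N: "1 < real N * infdist t K" using reals_Archimedean3[OF pos] by auto
      have "g n t = 0" if "n \<ge> N" for n
      proof -
        have "real N * infdist t K \<le> real (Suc n) * infdist t K" using that pos by (intro mult_right_mono) auto
        then show ?thesis unfolding g_def using N by simp
      qed
      then show ?thesis using False
        by (intro tendsto_eventually) (auto simp: eventually_sequentially intro!: exI[of _ N])
    qed (simp add: g_def)
    have lim: "(\<lambda>n. LINT t|\<rho>. g n t) \<longlonglongrightarrow> complex_of_real (measure \<rho> K)"
      if \<rho>: "sets \<rho> = sets borel" "\<And>K. compact K \<Longrightarrow> emeasure \<rho> K < \<infinity>" for \<rho> :: "real measure"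
    proof -
      have sp: "space \<rho> = UNIV" using sets_eq_imp_space_eq[OF \<rho>(1)] by simp
      have "(\<lambda>n. LINT t|\<rho>. g n t) \<longlonglongrightarrow> (LINT t|\<rho>. indicator K t)"
      proof (rule integral_dominated_convergence[where w="indicator {a-1..b+1}"])
        show "g n \<in> borel_measurable \<rho>" for n
          unfolding measurable_cong_sets[OF \<rho>(1) refl] g_def
          by (intro borel_measurable_continuous_onI continuous_intros)
        show "integrable \<rho> (indicator {a-1..b+1} :: real \<Rightarrow> real)"
          using \<rho>(2)[of "{a-1..b+1}"] \<rho>(1) by (intro integrable_real_indicator) auto
      qed (use glim gb \<rho>(1) K in \<open>auto simp: measurable_cong_sets[OF \<rho>(1) refl]\<close>)
      then show ?thesis by (simp add: integral_complex_indicator sp)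
    qed
    have "measure \<nu> K = measure \<nu>' K"
      using LIMSEQ_unique[OF lim[OF sets(1) fin(1)], of "complex_of_real (measure \<nu>' K)"]
        lim[OF sets(2) fin(2)] eq[OF gCc] by simp
    then show ?thesis
      using fin[of K] K by (simp add: emeasure_eq_ennreal_measure less_top)
  qed (simp add: K)
qed auto

section \<open>Functionals on bounded Borel functions\<close>

text \<open>These are the integrals against finite complex measures carried by [-c, c]; countable
  additivity appears as continuity under bounded pointwise convergence.\<close>

definition sigma_functional :: "real \<Rightarrow> ((real \<Rightarrow> complex) \<Rightarrow> complex) \<Rightarrow> bool" where
  "sigma_functional c \<Phi> \<longleftrightarrow>
     (\<forall>f\<in>bdd_borel. \<forall>g\<in>bdd_borel. \<forall>a. \<Phi> (\<lambda>t. a * f t + g t) = a * \<Phi> f + \<Phi> g) \<and>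
     (\<forall>f\<in>bdd_borel. (\<forall>t. \<bar>t\<bar> \<le> c \<longrightarrow> f t = 0) \<longrightarrow> \<Phi> f = 0) \<and>
     (\<forall>F f C. f \<in> bdd_borel \<longrightarrow> (\<forall>n. F n \<in> bdd_borel) \<longrightarrow> (\<forall>n t. cmod (F n t) \<le> C) \<longrightarrow>
        (\<forall>t. (\<lambda>n. F n t) \<longlonglongrightarrow> f t) \<longrightarrow> (\<lambda>n. \<Phi> (F n)) \<longlonglongrightarrow> \<Phi> f)"

lemma sigma_functionalD:
  assumes "sigma_functional c \<Phi>"
  shows "\<And>f g a. f \<in> bdd_borel \<Longrightarrow> g \<in> bdd_borel \<Longrightarrow> \<Phi> (\<lambda>t. a * f t + g t) = a * \<Phi> f + \<Phi> g"
    and "\<And>f. f \<in> bdd_borel \<Longrightarrow> (\<And>t. \<bar>t\<bar> \<le> c \<Longrightarrow> f t = 0) \<Longrightarrow> \<Phi> f = 0"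
    and "\<And>F f C. f \<in> bdd_borel \<Longrightarrow> (\<And>n. F n \<in> bdd_borel) \<Longrightarrow> (\<And>n t. cmod (F n t) \<le> C) \<Longrightarrow>
        (\<And>t. (\<lambda>n. F n t) \<longlonglongrightarrow> f t) \<Longrightarrow> (\<lambda>n. \<Phi> (F n)) \<longlonglongrightarrow> \<Phi> f"
  using assms unfolding sigma_functional_def by blast+

lemma sigma_functional_zero: "sigma_functional c \<Phi> \<Longrightarrow> \<Phi> (\<lambda>_. 0) = 0"
  by (erule sigma_functionalD(2)) auto

lemma sigma_functional_add:
  "sigma_functional c \<Phi> \<Longrightarrow> f \<in> bdd_borel \<Longrightarrow> g \<in> bdd_borel \<Longrightarrow> \<Phi> (\<lambda>t. f t + g t) = \<Phi> f + \<Phi> g"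
  using sigma_functionalD(1)[of c \<Phi> f g 1] by simp

lemma sigma_functional_scale:
  "sigma_functional c \<Phi> \<Longrightarrow> f \<in> bdd_borel \<Longrightarrow> \<Phi> (\<lambda>t. a * f t) = a * \<Phi> f"
  using sigma_functionalD(1)[of c \<Phi> f "\<lambda>_. 0" a] sigma_functional_zero[of c \<Phi>] by auto

lemma sigma_functional_sum:
  "sigma_functional c \<Phi> \<Longrightarrow> (\<And>i. i \<in> I \<Longrightarrow> f i \<in> bdd_borel) \<Longrightarrow> \<Phi> (\<lambda>t. \<Sum>i\<in>I. f i t) = (\<Sum>i\<in>I. \<Phi> (f i))"
proof (induction I rule: infinite_finite_induct)
  case (insert i I)
  then have "\<Phi> (\<lambda>t. f i t + (\<Sum>i\<in>I. f i t)) = \<Phi> (f i) + \<Phi> (\<lambda>t. \<Sum>i\<in>I. f i t)"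
    by (intro sigma_functional_add) auto
  with insert show ?case by simp
qed (auto simp: sigma_functional_zero)

text \<open>Moments on a bounded interval determine the measure: the functions on which two such
  functionals agree satisfy every rule of \<open>bdd_borel_moment_induct\<close>.\<close>

lemma sigma_functional_eqI:
  assumes \<Phi>: "sigma_functional c \<Phi>" and \<Psi>: "sigma_functional c \<Psi>"
    and eq: "\<And>k. \<Phi> (trunc_power c k) = \<Psi> (trunc_power c k)" and f: "f \<in> bdd_borel"
  shows "\<Phi> f = \<Psi> f"
  using f
proof (induction f rule: bdd_borel_moment_induct[where c=c])
  case (off f) then show ?case using sigma_functionalD(2)[OF \<Phi>] sigma_functionalD(2)[OF \<Psi>] by simp
next
  case (power k) show ?case by (rule eq)
next
  case (add f g) then show ?case using \<Phi> \<Psi> by (simp add: sigma_functional_add)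
next
  case (scale a f) then show ?case using \<Phi> \<Psi> by (simp add: sigma_functional_scale)
next
  case (lim F f C)
  have "(\<lambda>n. \<Psi> (F n)) \<longlonglongrightarrow> \<Phi> f"
    using sigma_functionalD(3)[OF \<Phi> lim(1,2,3,4)] unfolding lim(5) .
  then show ?case using sigma_functionalD(3)[OF \<Psi> lim(1,2,3,4)] by (rule LIMSEQ_unique)
qed

lemma sigma_functional_eqI_indicator:
  assumes \<Phi>: "sigma_functional c \<Phi>" and \<Psi>: "sigma_functional c \<Psi>"
    and eq: "\<And>B. B \<in> sets borel \<Longrightarrow> \<Phi> (indicator B) = \<Psi> (indicator B)" and f: "f \<in> bdd_borel"
  shows "\<Phi> f = \<Psi> f"
  using f
proof (induction f rule: bdd_borel_induct)
  case (indicator B) then show ?case by (rule eq)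
next
  case (add f g) then show ?case using \<Phi> \<Psi> by (simp add: sigma_functional_add)
next
  case (scale a f) then show ?case using \<Phi> \<Psi> by (simp add: sigma_functional_scale)
next
  case (lim F f C)
  have "(\<lambda>n. \<Psi> (F n)) \<longlonglongrightarrow> \<Phi> f"
    using sigma_functionalD(3)[OF \<Phi> lim(1,2,3,4)] unfolding lim(5) .
  then show ?case using sigma_functionalD(3)[OF \<Psi> lim(1,2,3,4)] by (rule LIMSEQ_unique)
qed

lemma sigma_functional_lincomb:
  assumes "sigma_functional c \<Phi>" "sigma_functional c \<Psi>"
  shows "sigma_functional c (\<lambda>f. a * \<Phi> f + \<Psi> f)"
  unfolding sigma_functional_def
proof (intro conjI ballI allI impI)
  fix F f C assume "f \<in> bdd_borel" "\<forall>n. F n \<in> bdd_borel" "\<forall>n t. cmod (F n t) \<le> C" "\<forall>t. (\<lambda>n. F n t) \<longlonglongrightarrow> f t"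
  then show "(\<lambda>n. a * \<Phi> (F n) + \<Psi> (F n)) \<longlonglongrightarrow> a * \<Phi> f + \<Psi> f"
    by (intro tendsto_intros sigma_functionalD(3)[OF assms(1), where C=C] sigma_functionalD(3)[OF assms(2), where C=C]) auto
next
  fix f g b assume f: "f \<in> bdd_borel" "g \<in> bdd_borel"
  show "a * \<Phi> (\<lambda>t. b * f t + g t) + \<Psi> (\<lambda>t. b * f t + g t) = b * (a * \<Phi> f + \<Psi> f) + (a * \<Phi> g + \<Psi> g)"
    unfolding sigma_functionalD(1)[OF assms(1) f] sigma_functionalD(1)[OF assms(2) f] by (simp add: algebra_simps)
qed (use sigma_functionalD(2)[OF assms(1)] sigma_functionalD(2)[OF assms(2)] in auto)

lemma sigma_functional_0 [simp]: "sigma_functional c (\<lambda>_. 0)"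
  unfolding sigma_functional_def by simp

lemma sigma_functional_cmult: "sigma_functional c \<Phi> \<Longrightarrow> sigma_functional c (\<lambda>f. a * \<Phi> f)"
  using sigma_functional_lincomb[of c \<Phi> "\<lambda>_. 0" a] by simp

lemma sigma_functional_sums:
  "(\<And>k. k \<in> K \<Longrightarrow> sigma_functional c (\<Phi> k)) \<Longrightarrow> sigma_functional c (\<lambda>f. \<Sum>k\<in>K. a k * \<Phi> k f)"
  by (induction K rule: infinite_finite_induct) (auto intro!: sigma_functional_lincomb)

text \<open>This is the passage from a complex measure to its product with the density
  \<open>g\<close>.\<close>

lemma sigma_functional_mult:
  assumes \<Phi>: "sigma_functional c \<Phi>" and g: "g \<in> bdd_borel"
  shows "sigma_functional c (\<lambda>f. \<Phi> (\<lambda>t. f t * g t))"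
  unfolding sigma_functional_def
proof (intro conjI ballI allI impI)
  fix f h a assume f: "f \<in> bdd_borel" "h \<in> bdd_borel"
  have "\<Phi> (\<lambda>t. (a * f t + h t) * g t) = \<Phi> (\<lambda>t. a * (f t * g t) + h t * g t)" by (simp add: algebra_simps)
  also have "\<dots> = a * \<Phi> (\<lambda>t. f t * g t) + \<Phi> (\<lambda>t. h t * g t)"
    using f g by (intro sigma_functionalD(1)[OF \<Phi>]) auto
  finally show "\<Phi> (\<lambda>t. (a * f t + h t) * g t) = a * \<Phi> (\<lambda>t. f t * g t) + \<Phi> (\<lambda>t. h t * g t)" .
next
  fix f assume f: "f \<in> bdd_borel" "\<forall>t. \<bar>t\<bar> \<le> c \<longrightarrow> f t = 0"
  then show "\<Phi> (\<lambda>t. f t * g t) = 0" using g by (intro sigma_functionalD(2)[OF \<Phi>]) auto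
next
  fix F f C assume F: "f \<in> bdd_borel" "\<forall>n. F n \<in> bdd_borel" "\<forall>n t. cmod (F n t) \<le> C" "\<forall>t. (\<lambda>n. F n t) \<longlonglongrightarrow> f t"
  obtain D where D: "D \<ge> 0" "\<And>t. cmod (g t) \<le> D" using g by (metis bdd_borel_bound)
  show "(\<lambda>n. \<Phi> (\<lambda>t. F n t * g t)) \<longlonglongrightarrow> \<Phi> (\<lambda>t. f t * g t)"
  proof (rule sigma_functionalD(3)[OF \<Phi>, where C="C * D"])
    show "cmod (F n t * g t) \<le> C * D" for n t
      unfolding norm_mult using F(3) D by (intro mult_mono) (auto intro: order_trans[OF norm_ge_zero])
  qed (use F g in \<open>auto intro!: tendsto_intros\<close>)
qed

lemma bdd_borel_cnj [intro]: "f \<in> bdd_borel \<Longrightarrow> (\<lambda>t. cnj (f t)) \<in> bdd_borel"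
  by (metis bdd_borelI bdd_borel_bound bdd_borel_measurable complex_mod_cnj
      borel_measurable_continuous_on[OF continuous_on_cnj[OF continuous_on_id]])

lemma sigma_functional_cnj:
  assumes \<Phi>: "sigma_functional c \<Phi>"
  shows "sigma_functional c (\<lambda>f. cnj (\<Phi> (\<lambda>t. cnj (f t))))"
  unfolding sigma_functional_def
proof (intro conjI ballI allI impI)
  fix f h a assume f: "f \<in> bdd_borel" "h \<in> bdd_borel"
  then show "cnj (\<Phi> (\<lambda>t. cnj (a * f t + h t))) = a * cnj (\<Phi> (\<lambda>t. cnj (f t))) + cnj (\<Phi> (\<lambda>t. cnj (h t)))"
    using sigma_functionalD(1)[OF \<Phi> bdd_borel_cnj[OF f(1)] bdd_borel_cnj[OF f(2)], of "cnj a"] by simp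
next
  fix f assume f: "f \<in> bdd_borel" "\<forall>t. \<bar>t\<bar> \<le> c \<longrightarrow> f t = 0"
  then show "cnj (\<Phi> (\<lambda>t. cnj (f t))) = 0" using sigma_functionalD(2)[OF \<Phi> bdd_borel_cnj[OF f(1)]] by simp
next
  fix F f C assume F: "f \<in> bdd_borel" "\<forall>n. F n \<in> bdd_borel" "\<forall>n t. cmod (F n t) \<le> C" "\<forall>t. (\<lambda>n. F n t) \<longlonglongrightarrow> f t"
  then show "(\<lambda>n. cnj (\<Phi> (\<lambda>t. cnj (F n t)))) \<longlonglongrightarrow> cnj (\<Phi> (\<lambda>t. cnj (f t)))"
    by (intro tendsto_cnj sigma_functionalD(3)[OF \<Phi>, where C=C]) auto
qed

lemma sigma_functional_integral:
  assumes m: "finite_measure m" "sets m = sets borel" and supp: "emeasure m (- {-c..c}) = 0"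
  shows "sigma_functional c (\<lambda>f. LINT t|m. f t)"
  unfolding sigma_functional_def
proof (intro conjI ballI allI impI)
  interpret finite_measure m by fact
  have meas: "f \<in> borel_measurable m" if "f \<in> bdd_borel" for f
    using that unfolding measurable_cong_sets[OF m(2) refl] by auto
  fix f h :: "real \<Rightarrow> complex" and a assume f: "f \<in> bdd_borel" "h \<in> bdd_borel"
  then show "(LINT t|m. a * f t + h t) = a * (LINT t|m. f t) + (LINT t|m. h t)"
    using bdd_borel_integrable[OF m] by simp
next
  interpret finite_measure m by fact
  fix f :: "real \<Rightarrow> complex" assume f: "f \<in> bdd_borel" "\<forall>t. \<bar>t\<bar> \<le> c \<longrightarrow> f t = 0"
  have "AE t in m. t \<in> {-c..c}" using supp m(2) by (intro AE_I[of _ _ "- {-c..c}"]) auto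
  then have "AE t in m. f t = 0" by eventually_elim (use f in auto)
  then show "(LINT t|m. f t) = 0" by (rule integral_eq_zero_AE)
next
  interpret finite_measure m by fact
  have meas: "f \<in> borel_measurable m" if "f \<in> bdd_borel" for f
    using that unfolding measurable_cong_sets[OF m(2) refl] by auto
  fix F f C assume F: "f \<in> bdd_borel" "\<forall>n. F n \<in> bdd_borel" "\<forall>n t. cmod (F n t) \<le> C" "\<forall>t. (\<lambda>n. F n t) \<longlonglongrightarrow> f t"
  then show "(\<lambda>n. LINT t|m. F n t) \<longlonglongrightarrow> (LINT t|m. f t)"
    by (intro integral_dominated_convergence[where w="\<lambda>_. C"]) (auto intro: meas)
qed

lemma finite_measure_eqI_integral:
  fixes m m' :: "real measure"
  assumes "finite_measure m" "sets m = sets borel" "finite_measure m'" "sets m' = sets borel"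
    and eq: "\<And>f. f \<in> bdd_borel \<Longrightarrow> (LINT t|m. f t) = (LINT t|m'. f t)"
  shows "m = m'"
proof (rule measure_eqI)
  fix A assume "A \<in> sets m"
  then have A: "A \<in> sets borel" using assms by simp
  have sp: "space m = UNIV" "space m' = UNIV"
    using assms sets_eq_imp_space_eq[of m borel] sets_eq_imp_space_eq[of m' borel] by auto
  have "complex_of_real (measure m A) = complex_of_real (measure m' A)"
    using eq[OF bdd_borel_indicator[OF A]] by (simp add: integral_complex_indicator sp)
  then show "emeasure m A = emeasure m' A"
    by (simp add: assms finite_measure.emeasure_eq_measure)
qed (use assms in simp)

section \<open>Spaces with a positive semidefinite form\<close>

text \<open>The form may be degenerate. It is so for the direct integral, where sections that agree
  almost everywhere are at distance 0.\<close>

locale semi_hilbert =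
  fixes V :: "'i hilbert"
  assumes Vec_zero: "(\<lambda>_. 0) \<in> Vec V"
    and Vec_lin: "v \<in> Vec V \<Longrightarrow> w \<in> Vec V \<Longrightarrow> (\<lambda>i. a * v i + w i) \<in> Vec V"
    and Ip_lin: "u \<in> Vec V \<Longrightarrow> v \<in> Vec V \<Longrightarrow> w \<in> Vec V \<Longrightarrow> Ip V u (\<lambda>i. a * v i + w i) = a * Ip V u v + Ip V u w"
    and Ip_cnj: "v \<in> Vec V \<Longrightarrow> w \<in> Vec V \<Longrightarrow> Ip V w v = cnj (Ip V v w)"
    and Ip_nonneg: "v \<in> Vec V \<Longrightarrow> 0 \<le> Re (Ip V v v)"
begin

lemma Vec_diff: "v \<in> Vec V \<Longrightarrow> w \<in> Vec V \<Longrightarrow> (\<lambda>i. v i - w i) \<in> Vec V"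
  using Vec_lin[of w v "-1"] by simp

lemma Vec_scale: "v \<in> Vec V \<Longrightarrow> (\<lambda>i. a * v i) \<in> Vec V"
  using Vec_lin[of v "\<lambda>_. 0" a] Vec_zero by simp

lemma Ip_zero_right: "u \<in> Vec V \<Longrightarrow> Ip V u (\<lambda>_. 0) = 0"
  using Ip_lin[of u "\<lambda>_. 0" "\<lambda>_. 0" 1] Vec_zero by simp

lemma Ip_scale: "u \<in> Vec V \<Longrightarrow> v \<in> Vec V \<Longrightarrow> Ip V u (\<lambda>i. a * v i) = a * Ip V u v"
  using Ip_lin[of u v "\<lambda>_. 0" a] Vec_zero Ip_zero_right by simp

lemma Ip_diff: "u \<in> Vec V \<Longrightarrow> v \<in> Vec V \<Longrightarrow> w \<in> Vec V \<Longrightarrow> Ip V u (\<lambda>i. v i - w i) = Ip V u v - Ip V u w"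
  using Ip_lin[of u w v "-1"] by simp

lemma Ip_lin_left:
  assumes "u \<in> Vec V" "v \<in> Vec V" "w \<in> Vec V"
  shows "Ip V (\<lambda>i. a * v i + w i) u = cnj a * Ip V v u + Ip V w u"
proof -
  have "Ip V (\<lambda>i. a * v i + w i) u = cnj (Ip V u (\<lambda>i. a * v i + w i))"
    using assms by (intro Ip_cnj Vec_lin)
  also have "\<dots> = cnj a * cnj (Ip V u v) + cnj (Ip V u w)" using assms by (simp add: Ip_lin)
  finally show ?thesis using assms Ip_cnj[of u v] Ip_cnj[of u w] by simp
qed

lemma vnorm_nonneg [simp]: "0 \<le> vnorm V v \<longleftrightarrow> 0 \<le> Re (Ip V v v)"
  unfolding vnorm_def by simp

lemma Ip_self: "v \<in> Vec V \<Longrightarrow> Ip V v v = complex_of_real ((vnorm V v)\<^sup>2)"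
  using Ip_cnj[of v v] Ip_nonneg[of v] unfolding vnorm_def
  by (simp add: complex_eq_iff)

lemma vnorm_lin_sq:
  assumes "v \<in> Vec V" "w \<in> Vec V"
  shows "(vnorm V (\<lambda>i. a * v i + w i))\<^sup>2 = (cmod a)\<^sup>2 * (vnorm V v)\<^sup>2 + 2 * Re (cnj a * Ip V v w) + (vnorm V w)\<^sup>2"
proof -
  let ?z = "\<lambda>i. a * v i + w i"
  have "Ip V ?z ?z = cnj a * (a * Ip V v v + Ip V v w) + (a * Ip V w v + Ip V w w)"
    using assms by (simp add: Ip_lin_left Ip_lin Vec_lin)
  also have "\<dots> = complex_of_real ((cmod a)\<^sup>2 * (vnorm V v)\<^sup>2 + 2 * Re (cnj a * Ip V v w) + (vnorm V w)\<^sup>2)"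
  proof -
    have "cnj a * (a * Ip V v v + Ip V v w) + (a * Ip V w v + Ip V w w)
       = (a * cnj a) * Ip V v v + (cnj a * Ip V v w + cnj (cnj a * Ip V v w)) + Ip V w w"
      using assms Ip_cnj[of v w] by (simp add: algebra_simps)
    then show ?thesis
      unfolding complex_add_cnj complex_norm_square[symmetric] using assms by (simp add: Ip_self)
  qed
  finally have "complex_of_real ((vnorm V ?z)\<^sup>2) = complex_of_real ((cmod a)\<^sup>2 * (vnorm V v)\<^sup>2 + 2 * Re (cnj a * Ip V v w) + (vnorm V w)\<^sup>2)"
    using assms by (simp add: Ip_self Vec_lin)
  then show ?thesis by (simp only: of_real_eq_iff)
qed

lemma Cauchy_Schwarz:
  assumes v: "v \<in> Vec V" and w: "w \<in> Vec V"
  shows "cmod (Ip V v w) \<le> vnorm V v * vnorm V w"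
proof -
  define z where "z = Ip V v w"
  define A where "A = vnorm V v" define B where "B = vnorm V w"
  have AB: "A \<ge> 0" "B \<ge> 0" unfolding A_def B_def using assms Ip_nonneg by auto
  \<comment> \<open>The squared norm of \<open>w - t z v\<close> is a real quadratic polynomial in
    \<open>t\<close>, because the phase of \<open>z\<close> is absorbed into the scalar.\<close>
  have pos: "0 \<le> t\<^sup>2 * (cmod z)\<^sup>2 * A\<^sup>2 - 2 * t * (cmod z)\<^sup>2 + B\<^sup>2" for t :: real
  proof -
    have "0 \<le> (vnorm V (\<lambda>i. (- complex_of_real t * z) * v i + w i))\<^sup>2" by simp
    also have "\<dots> = (cmod (- complex_of_real t * z))\<^sup>2 * A\<^sup>2 + 2 * Re (cnj (- complex_of_real t * z) * z) + B\<^sup>2"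
      unfolding A_def B_def z_def using assms by (rule vnorm_lin_sq)
    also have "(cmod (- complex_of_real t * z))\<^sup>2 = t\<^sup>2 * (cmod z)\<^sup>2" by (simp add: norm_mult power_mult_distrib)
    also have "Re (cnj (- complex_of_real t * z) * z) = - t * (cmod z)\<^sup>2"
    proof -
      have "cnj (- complex_of_real t * z) * z = - complex_of_real t * (z * cnj z)" by simp
      also have "\<dots> = complex_of_real (- t * (cmod z)\<^sup>2)" unfolding complex_norm_square[symmetric] by simp
      finally show ?thesis by (simp only: Re_complex_of_real)
    qed
    finally show ?thesis by (simp add: algebra_simps)
  qed
  have "(cmod z)\<^sup>2 \<le> A\<^sup>2 * B\<^sup>2"
  proof (cases "A = 0")
    case True
    have "z = 0"
    proof (rule ccontr)
      assume "z \<noteq> 0"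
      then have z: "(cmod z)\<^sup>2 > 0" by simp
      \<comment> \<open>If \<open>v\<close> has norm 0 it need not be the zero vector. The quadratic
        polynomial is then affine in \<open>t\<close>, with slope negative for nonzero
        \<open>z\<close>; this value of \<open>t\<close> makes it negative.\<close>
      have "0 \<le> B\<^sup>2 - 2 * ((B\<^sup>2 + 1) / (cmod z)\<^sup>2) * (cmod z)\<^sup>2"
        using pos[of "(B\<^sup>2 + 1) / (cmod z)\<^sup>2"] True by simp
      also have "\<dots> = - B\<^sup>2 - 2" using z by (simp add: field_simps)
      finally show False by (smt (verit) zero_le_power2)
    qed
    then show ?thesis by simp
  next
    case False
    have "0 \<le> (1 / A\<^sup>2)\<^sup>2 * (cmod z)\<^sup>2 * A\<^sup>2 - 2 * (1 / A\<^sup>2) * (cmod z)\<^sup>2 + B\<^sup>2" by (rule pos)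
    also have "\<dots> = B\<^sup>2 - (cmod z)\<^sup>2 / A\<^sup>2" using False by (simp add: field_simps power2_eq_square)
    finally show ?thesis using False by (simp add: field_simps)
  qed
  then have "(cmod z)\<^sup>2 \<le> (A * B)\<^sup>2" by (simp add: power_mult_distrib)
  then have "cmod z \<le> A * B" using AB by (rule power2_le_imp_le[OF _ mult_nonneg_nonneg])
  then show ?thesis unfolding z_def A_def B_def .
qed

lemma vnorm_lin_le:
  assumes v: "v \<in> Vec V" and w: "w \<in> Vec V"
  shows "vnorm V (\<lambda>i. a * v i + w i) \<le> cmod a * vnorm V v + vnorm V w"
proof (rule power2_le_imp_le)
  have "Re (cnj a * Ip V v w) \<le> cmod (cnj a * Ip V v w)" by (rule complex_Re_le_cmod)
  also have "\<dots> \<le> cmod a * (vnorm V v * vnorm V w)"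
    using Cauchy_Schwarz[OF assms] by (simp add: norm_mult mult_left_mono)
  finally show "(vnorm V (\<lambda>i. a * v i + w i))\<^sup>2 \<le> (cmod a * vnorm V v + vnorm V w)\<^sup>2"
    unfolding vnorm_lin_sq[OF assms] by (simp add: power2_sum power_mult_distrib algebra_simps)
  show "0 \<le> cmod a * vnorm V v + vnorm V w" using assms Ip_nonneg by simp
qed

text \<open>One direction is Cauchy-Schwarz, the other tests with the difference
  \<open>v - w\<close> itself. Operator identities up to \<open>veq\<close> are thereby reduced to
  identities between matrix elements.\<close>

lemma veq_iff:
  assumes v: "v \<in> Vec V" and w: "w \<in> Vec V"
  shows "veq V v w \<longleftrightarrow> (\<forall>u\<in>Vec V. Ip V u v = Ip V u w)"
proof
  assume eq: "veq V v w"
  show "\<forall>u\<in>Vec V. Ip V u v = Ip V u w"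
  proof
    fix u assume u: "u \<in> Vec V"
    have "cmod (Ip V u (\<lambda>i. v i - w i)) \<le> vnorm V u * vnorm V (\<lambda>i. v i - w i)"
      using u assms by (intro Cauchy_Schwarz Vec_diff)
    then show "Ip V u v = Ip V u w" using eq u assms unfolding veq_def by (simp add: Ip_diff)
  qed
next
  assume "\<forall>u\<in>Vec V. Ip V u v = Ip V u w"
  then have "Ip V (\<lambda>i. v i - w i) (\<lambda>i. v i - w i) = 0"
    using assms by (simp add: Ip_diff Vec_diff)
  then show "veq V v w" unfolding veq_def vnorm_def by simp
qed

text \<open>In the \<open>k\<close>-th term \<open>B v w\<close> carries the factor
  \<open>\<i> ^ k * cnj (\<i> ^ k) = 1\<close>, while the other three coefficients run through
  powers of \<i> and of -1 that sum to 0. The statement is for an arbitrary sesquilinear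
  \<open>B\<close> because it is applied to the powers of an operator and to its spectral
  projections.\<close>

lemma polarization:
  assumes lin: "\<And>u v w a. u \<in> Vec V \<Longrightarrow> v \<in> Vec V \<Longrightarrow> w \<in> Vec V \<Longrightarrow> B u (\<lambda>i. a * v i + w i) = a * B u v + B u w"
    and cnj: "\<And>u v w a. u \<in> Vec V \<Longrightarrow> v \<in> Vec V \<Longrightarrow> w \<in> Vec V \<Longrightarrow> B (\<lambda>i. a * v i + w i) u = cnj a * B v u + B w u"
    and v: "v \<in> Vec V" and w: "w \<in> Vec V"
  shows "(\<Sum>k<4. \<i> ^ k * B (\<lambda>i. \<i> ^ k * v i + w i) (\<lambda>i. \<i> ^ k * v i + w i)) / 4 = B v w"
proof -
  have "B (\<lambda>i. a * v i + w i) (\<lambda>i. a * v i + w i) = cnj a * (a * B v v + B v w) + (a * B w v + B w w)" for a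
  proof -
    have "B (\<lambda>i. a * v i + w i) (\<lambda>i. a * v i + w i)
       = cnj a * B v (\<lambda>i. a * v i + w i) + B w (\<lambda>i. a * v i + w i)"
      using v w by (intro cnj Vec_lin)
    then show ?thesis using v w by (simp add: lin)
  qed
  then have "(\<Sum>k<4. \<i> ^ k * B (\<lambda>i. \<i> ^ k * v i + w i) (\<lambda>i. \<i> ^ k * v i + w i))
     = (\<Sum>k<4. \<i> ^ k * (cnj (\<i> ^ k) * (\<i> ^ k * B v v + B v w) + (\<i> ^ k * B w v + B w w)))"
    by (simp only:)
  then show ?thesis by (simp add: numeral_eq_Suc algebra_simps)
qed

end

section \<open>Moments of a bounded selfadjoint operator\<close>

definition moment_functional :: "(nat \<Rightarrow> real) \<Rightarrow> real poly \<Rightarrow> real" where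
  "moment_functional M p = (\<Sum>i\<le>degree p. coeff p i * M i)"

lemma moment_functional_ge:
  "degree p \<le> n \<Longrightarrow> moment_functional M p = (\<Sum>i\<le>n. coeff p i * M i)"
  unfolding moment_functional_def by (intro sum.mono_neutral_left) (auto simp: coeff_eq_0)

lemma moment_functional_add: "moment_functional M (p + q) = moment_functional M p + moment_functional M q"
proof -
  define n where "n = max (degree p) (degree q)"
  have "degree (p + q) \<le> n" "degree p \<le> n" "degree q \<le> n" unfolding n_def by (auto intro: degree_add_le)
  then show ?thesis by (simp add: moment_functional_ge[where n=n] sum.distrib algebra_simps)
qed

lemma moment_functional_smult: "moment_functional M (smult a p) = a * moment_functional M p"
  using moment_functional_ge[of "smult a p" "degree p" M] degree_smult_le[of a p]
  by (simp add: moment_functional_def sum_distrib_left mult.assoc)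

lemma moment_functional_monom [simp]: "moment_functional M (monom a n) = a * M n"
proof -
  have "moment_functional M (monom a n) = (\<Sum>i\<le>n. coeff (monom a n) i * M i)"
    by (rule moment_functional_ge) (rule degree_monom_le)
  also have "\<dots> = (\<Sum>i\<le>n. if i = n then a * M n else 0)" by (intro sum.cong) auto
  finally show ?thesis by simp
qed

lemma moment_functional_sum: "moment_functional M (\<Sum>i\<in>A. f i) = (\<Sum>i\<in>A. moment_functional M (f i))"
proof (induction A rule: infinite_finite_induct)
  case (insert x F) then show ?case by (simp add: moment_functional_add)
qed (simp_all add: moment_functional_def)

lemma moment_functional_square:
  "moment_functional M (monom 1 r * (q * q)) =
     (\<Sum>i\<le>degree q. \<Sum>j\<le>degree q. coeff q i * coeff q j * M (r + i + j))"
proof -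
  have "monom 1 r * (q * q) = monom 1 r * ((\<Sum>i\<le>degree q. monom (coeff q i) i) * (\<Sum>j\<le>degree q. monom (coeff q j) j))"
    by (simp only: poly_as_sum_of_monoms)
  also have "\<dots> = (\<Sum>i\<le>degree q. \<Sum>j\<le>degree q. monom (coeff q i * coeff q j) (r + i + j))"
    by (simp only: sum_product) (simp add: sum_distrib_left mult_monom add.assoc)
  finally show ?thesis by (simp add: moment_functional_sum)
qed

text \<open>The choice depends on \<open>c\<close> and the moment sequence alone, not on a vector or
  a space. Vectors of different spaces with equal moments thus receive literally the same measure,
  which is how covariance is obtained in \<open>spec_fib_covariant\<close>.\<close>

definition moment_measure :: "real \<Rightarrow> (nat \<Rightarrow> real) \<Rightarrow> real measure" where
  "moment_measure c M = (SOME m. finite_measure m \<and> sets m = sets borel \<and> emeasure m (- {-c..c}) = 0 \<and>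
     (\<forall>p. (LINT t|m. poly p t) = moment_functional M p))"

locale bounded_selfadjoint = semi_hilbert V for V :: "'i hilbert" +
  fixes T :: "'i operator" and c :: real
  assumes T_bounded: "operator_bounded_by V c T"
    and T_sym: "v \<in> Vec V \<Longrightarrow> w \<in> Vec V \<Longrightarrow> Ip V (T v) w = Ip V v (T w)"
    and c_pos: "c > 0"
begin

lemma T_Vec: "v \<in> Vec V \<Longrightarrow> T v \<in> Vec V"
  using T_bounded unfolding operator_bounded_by_def by blast

lemma T_norm: "v \<in> Vec V \<Longrightarrow> vnorm V (T v) \<le> c * vnorm V v"
  using T_bounded unfolding operator_bounded_by_def by blast

lemma pow_Vec: "v \<in> Vec V \<Longrightarrow> (T ^^ k) v \<in> Vec V"
  by (induction k) (auto intro: T_Vec)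

lemma pow_sym: "v \<in> Vec V \<Longrightarrow> w \<in> Vec V \<Longrightarrow> Ip V ((T ^^ k) v) w = Ip V v ((T ^^ k) w)"
proof (induction k arbitrary: v w)
  case (Suc k)
  have "Ip V ((T ^^ Suc k) v) w = Ip V ((T ^^ k) v) (T w)" using Suc.prems by (simp add: T_sym pow_Vec)
  also have "\<dots> = Ip V v ((T ^^ k) (T w))" using Suc by (simp add: T_Vec)
  finally show ?case by (simp add: funpow_swap1)
qed simp

text \<open>An operator is linear only up to \<open>veq\<close>. Moving the power to the left
  argument by symmetry turns the claim into linearity of the form.\<close>

lemma pow_lin:
  assumes "u \<in> Vec V" "v \<in> Vec V" "w \<in> Vec V"
  shows "Ip V u ((T ^^ k) (\<lambda>i. a * v i + w i)) = a * Ip V u ((T ^^ k) v) + Ip V u ((T ^^ k) w)"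
  using assms by (simp add: pow_sym[symmetric] Vec_lin pow_Vec Ip_lin)

lemma pow_real: "v \<in> Vec V \<Longrightarrow> Ip V v ((T ^^ k) v) = complex_of_real (Re (Ip V v ((T ^^ k) v)))"
  using Ip_cnj[of v "(T ^^ k) v"] pow_sym[of v v k] pow_Vec[of v k] by (simp add: complex_eq_iff)

definition moment :: "('i \<Rightarrow> complex) \<Rightarrow> nat \<Rightarrow> real" where
  "moment v k = Re (Ip V v ((T ^^ k) v))"

definition poly_vec :: "real poly \<Rightarrow> ('i \<Rightarrow> complex) \<Rightarrow> ('i \<Rightarrow> complex)" where
  "poly_vec q v = (\<lambda>i. \<Sum>k\<le>degree q. complex_of_real (coeff q k) * (T ^^ k) v i)"

lemma sum_Vec_Ip:
  assumes v: "v \<in> Vec V" and u: "u \<in> Vec V"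
  shows "(\<lambda>i. \<Sum>k\<le>n. a k * (T ^^ k) v i) \<in> Vec V \<and>
    Ip V u (\<lambda>i. \<Sum>k\<le>n. a k * (T ^^ k) v i) = (\<Sum>k\<le>n. a k * Ip V u ((T ^^ k) v))"
proof (induction n)
  case 0 then show ?case using v u by (simp add: Vec_scale Ip_scale)
next
  case (Suc n)
  then show ?case
    using Vec_lin[of "(T ^^ Suc n) v" "\<lambda>i. \<Sum>k\<le>n. a k * (T ^^ k) v i" "a (Suc n)"]
      Ip_lin[of u "(T ^^ Suc n) v" "\<lambda>i. \<Sum>k\<le>n. a k * (T ^^ k) v i" "a (Suc n)"]
      pow_Vec[OF v, of "Suc n"] u
    by (simp add: add.commute)
qed

lemma poly_vec_Vec: "v \<in> Vec V \<Longrightarrow> poly_vec q v \<in> Vec V"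
  using sum_Vec_Ip[of v v "\<lambda>k. complex_of_real (coeff q k)" "degree q"] unfolding poly_vec_def by blast

lemma Ip_poly_vec:
  "v \<in> Vec V \<Longrightarrow> u \<in> Vec V \<Longrightarrow> Ip V u (poly_vec q v) = (\<Sum>k\<le>degree q. complex_of_real (coeff q k) * Ip V u ((T ^^ k) v))"
  using sum_Vec_Ip[of v u "\<lambda>k. complex_of_real (coeff q k)" "degree q"] unfolding poly_vec_def by blast

text \<open>With real coefficients \<open>q(T)\<close> is symmetric, so the quadratic form of
  \<open>T^r\<close> at \<open>q(T) v\<close> is that of \<open>T^r q(T)^2\<close> at
  \<open>v\<close>. This makes the moment functional of a square accessible to norm
  estimates.\<close>

lemma poly_vec_moment:
  assumes v: "v \<in> Vec V"
  shows "Re (Ip V (poly_vec q v) ((T ^^ r) (poly_vec q v))) = moment_functional (moment v) (monom 1 r * (q * q))"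
proof -
  let ?w = "poly_vec q v"
  have w: "?w \<in> Vec V" using v by (rule poly_vec_Vec)
  have "Ip V ?w ((T ^^ r) ?w) = Ip V ((T ^^ r) ?w) ?w" using w by (simp add: pow_sym)
  also have "\<dots> = (\<Sum>k\<le>degree q. complex_of_real (coeff q k) * Ip V ((T ^^ r) ?w) ((T ^^ k) v))"
    using v w by (intro Ip_poly_vec pow_Vec)
  also have "\<dots> = (\<Sum>k\<le>degree q. complex_of_real (coeff q k) *
      (\<Sum>j\<le>degree q. complex_of_real (coeff q j) * complex_of_real (moment v (r + k + j))))"
  proof (intro sum.cong refl arg_cong2[where f="(*)"])
    fix k
    let ?x = "(T ^^ (r + k)) v"
    have x: "?x \<in> Vec V" using v by (rule pow_Vec)
    have "Ip V ((T ^^ r) ?w) ((T ^^ k) v) = Ip V ?w ?x"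
      using v w by (simp add: pow_sym pow_Vec funpow_add)
    also have "\<dots> = cnj (Ip V ?x ?w)" using w x by (intro Ip_cnj)
    also have "\<dots> = (\<Sum>j\<le>degree q. complex_of_real (coeff q j) * cnj (Ip V ?x ((T ^^ j) v)))"
      using v x by (simp add: Ip_poly_vec)
    also have "\<dots> = (\<Sum>j\<le>degree q. complex_of_real (coeff q j) * complex_of_real (moment v (r + k + j)))"
    proof (intro sum.cong refl arg_cong2[where f="(*)"])
      fix j
      have "Ip V ?x ((T ^^ j) v) = Ip V v ((T ^^ (r + k + j)) v)"
        using v pow_sym[of v "(T ^^ j) v" "r + k"] by (simp add: pow_Vec funpow_add)
      then show "cnj (Ip V ?x ((T ^^ j) v)) = complex_of_real (moment v (r + k + j))"
        using pow_real[OF v, of "r + k + j"] unfolding moment_def by (metis complex_cnj_complex_of_real)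
    qed
    finally show "Ip V ((T ^^ r) ?w) ((T ^^ k) v) =
      (\<Sum>j\<le>degree q. complex_of_real (coeff q j) * complex_of_real (moment v (r + k + j)))" .
  qed
  also have "\<dots> = complex_of_real (\<Sum>k\<le>degree q. \<Sum>j\<le>degree q. coeff q k * coeff q j * moment v (r + k + j))"
    by (simp add: sum_distrib_left mult.assoc)
  finally show ?thesis by (simp add: moment_functional_square)
qed

text \<open>Even powers are squares: splitting \<open>j\<close> and \<open>k\<close> by parity
  leaves a square \<open>q * q\<close> times one of 1, \<open>c + t\<close>, \<open>c - t\<close>
  and \<open>c^2 - t^2\<close>. With \<open>w = q(T) v\<close> the four values are nonnegative
  because \<open>c\<close> bounds the norm of \<open>T\<close>, so that
  \<open>\<langle>w, T w\<rangle>\<close> is at most \<open>c\<close> and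
  \<open>\<langle>T w, T w\<rangle>\<close> at most \<open>c^2\<close> times the squared norm of
  \<open>w\<close>.\<close>

lemma moment_pos:
  assumes v: "v \<in> Vec V"
  shows "0 \<le> moment_functional (moment v) ([:c, 1:] ^ j * [:c, -1:] ^ k)"
proof -
  define a b e f where "a = j div 2" "b = k div 2" "e = j mod 2" "f = k mod 2"
  note abef = this
  define q where "q = [:c, 1:] ^ a * [:c, -1:] ^ b"
  have jk: "j = 2 * a + e" "k = 2 * b + f" "e < 2" "f < 2" unfolding abef by auto
  have eq: "[:c, 1:] ^ j * [:c, -1:] ^ k = (q * q) * ([:c, 1:] ^ e * [:c, -1:] ^ f)"
    unfolding jk(1,2) q_def power_add mult_2 by (simp only: mult_ac)
  let ?w = "poly_vec q v"
  have w: "?w \<in> Vec V" using v by (rule poly_vec_Vec)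
  have Tw: "T ?w \<in> Vec V" using w by (rule T_Vec)
  define N0 N1 N2 where "N0 = Re (Ip V ?w ?w)" "N1 = Re (Ip V ?w (T ?w))" "N2 = Re (Ip V ?w (T (T ?w)))"
  note N = this
  have m0: "moment_functional (moment v) (q * q) = N0"
    using poly_vec_moment[OF v, of q 0] unfolding N by (simp add: monom_0 one_pCons[symmetric])
  have m1: "moment_functional (moment v) (monom 1 1 * (q * q)) = N1"
    using poly_vec_moment[OF v, of q 1] unfolding N by simp
  have m2: "moment_functional (moment v) (monom 1 2 * (q * q)) = N2"
    using poly_vec_moment[OF v, of q 2] unfolding N by (simp add: numeral_2_eq_2)
  have N0: "N0 = (vnorm V ?w)\<^sup>2" unfolding N using w by (simp add: Ip_self)
  have N2: "N2 = (vnorm V (T ?w))\<^sup>2" unfolding N using w Tw by (simp add: T_sym[symmetric] Ip_self)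
  have Tn: "vnorm V (T ?w) \<le> c * vnorm V ?w" using w by (rule T_norm)
  have n0: "0 \<le> vnorm V ?w" "0 \<le> vnorm V (T ?w)" using w Tw Ip_nonneg by auto
  have N2c: "N2 \<le> c\<^sup>2 * N0" unfolding N0 N2 power_mult_distrib[symmetric] using Tn n0 by (intro power_mono)
  have N1c: "\<bar>N1\<bar> \<le> c * N0"
  proof -
    have "\<bar>N1\<bar> \<le> cmod (Ip V ?w (T ?w))" unfolding N by (rule abs_Re_le_cmod)
    also have "\<dots> \<le> vnorm V ?w * vnorm V (T ?w)" using w Tw by (rule Cauchy_Schwarz)
    also have "\<dots> \<le> vnorm V ?w * (c * vnorm V ?w)" using Tn n0 by (intro mult_left_mono)
    finally show ?thesis unfolding N0 by (simp add: power2_eq_square algebra_simps)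
  qed
  have "e = 0 \<or> e = 1" "f = 0 \<or> f = 1" using jk by auto
  then consider "e = 0" "f = 0" | "e = 1" "f = 0" | "e = 0" "f = 1" | "e = 1" "f = 1" by blast
  then show ?thesis
  proof cases
    case 1
    then show ?thesis unfolding eq using m0 N0 by simp
  next
    case 2
    have "(q * q) * ([:c, 1:] ^ e * [:c, -1:] ^ f) = smult c (q * q) + monom 1 1 * (q * q)"
      unfolding 2 by (simp add: monom_altdef algebra_simps)
    then show ?thesis unfolding eq using m0 m1 N1c by (simp add: moment_functional_add moment_functional_smult)
  next
    case 3
    have "(q * q) * ([:c, 1:] ^ e * [:c, -1:] ^ f) = smult c (q * q) + smult (-1) (monom 1 1 * (q * q))"
      unfolding 3 by (simp add: monom_altdef algebra_simps)
    then show ?thesis unfolding eq using m0 m1 N1c by (simp only: moment_functional_add moment_functional_smult)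
  next
    case 4
    have prod: "[:c, 1:] ^ e * [:c, -1:] ^ f = [:c\<^sup>2:] + smult (-1) (monom 1 2)"
      unfolding 4 by (simp add: monom_altdef numeral_2_eq_2 algebra_simps)
    have "(q * q) * ([:c, 1:] ^ e * [:c, -1:] ^ f) = smult (c\<^sup>2) (q * q) + smult (-1) (monom 1 2 * (q * q))"
      unfolding prod by (simp add: algebra_simps)
    then show ?thesis unfolding eq using m0 m2 N2c by (simp only: moment_functional_add moment_functional_smult)
  qed
qed

definition spec :: "('i \<Rightarrow> complex) \<Rightarrow> real measure" where
  "spec v = moment_measure c (moment v)"

lemma spec:
  assumes v: "v \<in> Vec V"
  shows spec_finite: "finite_measure (spec v)" and spec_sets [simp]: "sets (spec v) = sets borel"
    and spec_supp: "emeasure (spec v) (- {-c..c}) = 0"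
    and spec_poly: "(LINT t|spec v. poly p t) = moment_functional (moment v) p"
proof -
  have "\<exists>m. finite_measure m \<and> sets m = sets borel \<and> emeasure m (- {-c..c}) = 0 \<and>
     (\<forall>p. (LINT t|m. poly p t) = moment_functional (moment v) p)"
    by (rule hausdorff_moment_interval)
       (auto intro: c_pos moment_pos[OF v] moment_functional_add moment_functional_smult)
  from someI_ex[OF this] show "finite_measure (spec v)" "sets (spec v) = sets borel"
    "emeasure (spec v) (- {-c..c}) = 0" "(LINT t|spec v. poly p t) = moment_functional (moment v) p"
    unfolding spec_def moment_measure_def by auto
qed

lemma spec_sigma: "v \<in> Vec V \<Longrightarrow> sigma_functional c (\<lambda>f. LINT t|spec v. f t)"
  by (intro sigma_functional_integral spec_finite spec_sets spec_supp)

lemma spec_power: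
  assumes v: "v \<in> Vec V"
  shows "(LINT t|spec v. trunc_power c k t) = Ip V v ((T ^^ k) v)"
proof -
  have AE: "AE t in spec v. t \<in> {-c..c}"
    using spec_supp[OF v] v by (intro AE_I[of _ _ "- {-c..c}"]) auto
  have meas: "(\<lambda>t. complex_of_real (t ^ k)) \<in> borel_measurable (spec v)" "trunc_power c k \<in> borel_measurable (spec v)"
    unfolding measurable_cong_sets[OF spec_sets[OF v] refl] by (auto intro: bdd_borel_measurable)
  have "(LINT t|spec v. trunc_power c k t) = (LINT t|spec v. complex_of_real (t ^ k))"
  proof (rule integral_cong_AE[OF meas(2,1)])
    show "AE t in spec v. trunc_power c k t = complex_of_real (t ^ k)"
      using AE by eventually_elim (auto simp: trunc_power_def)
  qed
  also have "\<dots> = complex_of_real (LINT t|spec v. poly (monom 1 k) t)"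
    by (simp only: poly_monom mult_1_left integral_complex_of_real)
  also have "\<dots> = complex_of_real (moment v k)" unfolding spec_poly[OF v] by simp
  finally show ?thesis using pow_real[OF v, of k] unfolding moment_def by simp
qed

end

lemma trunc_power_mult: "trunc_power c j t * trunc_power c k t = trunc_power c (j + k) t"
  unfolding trunc_power_def by (simp add: power_add)

lemma trunc_power_cnj: "cnj (trunc_power c k t) = trunc_power c k t"
  unfolding trunc_power_def by simp

lemma bdd_borel_outside: "(\<lambda>t. if \<bar>t\<bar> \<le> c then 0 else 1) \<in> bdd_borel"
  by (rule bdd_borelI[where C=1]) auto

context bounded_selfadjoint
begin

subsection \<open>Polarised spectral integrals\<close>

text \<open>This is the complex measure \<open>\<langle>v, E(.) w\<rangle>\<close>, written as a
  functional and obtained by polarising the measures \<open>spec\<close>; it is available before any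
  projection \<open>E(B)\<close> has been constructed.\<close>

definition Q :: "('i \<Rightarrow> complex) \<Rightarrow> ('i \<Rightarrow> complex) \<Rightarrow> (real \<Rightarrow> complex) \<Rightarrow> complex" where
  "Q v w f = (\<Sum>k<4. \<i> ^ k / 4 * (LINT t|spec (\<lambda>i. \<i> ^ k * v i + w i). f t))"

lemma Q_sigma: "v \<in> Vec V \<Longrightarrow> w \<in> Vec V \<Longrightarrow> sigma_functional c (Q v w)"
  unfolding Q_def[abs_def] by (intro sigma_functional_sums spec_sigma Vec_lin)

lemma Q_power:
  assumes v: "v \<in> Vec V" and w: "w \<in> Vec V"
  shows "Q v w (trunc_power c k) = Ip V v ((T ^^ k) w)"
proof -
  have "Q v w (trunc_power c k) =
    (\<Sum>j<4. \<i> ^ j * Ip V (\<lambda>i. \<i> ^ j * v i + w i) ((T ^^ k) (\<lambda>i. \<i> ^ j * v i + w i))) / 4"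
    unfolding Q_def sum_divide_distrib using v w by (intro sum.cong) (simp_all add: spec_power Vec_lin)
  also have "\<dots> = Ip V v ((T ^^ k) w)"
    using pow_lin by (rule polarization) (auto intro: Ip_lin_left pow_Vec v w)
  finally show ?thesis .
qed

text \<open>By determinacy of moments, identities for \<open>Q\<close> have to be checked only on
  powers of \<open>T\<close>, where they are algebra. The sesquilinearity, symmetry and
  multiplicativity below all follow this pattern.\<close>

lemma Q_eqI:
  assumes "v \<in> Vec V" "w \<in> Vec V" "f \<in> bdd_borel" "sigma_functional c \<Phi>"
    and "\<And>k. \<Phi> (trunc_power c k) = Ip V v ((T ^^ k) w)"
  shows "\<Phi> f = Q v w f"
  by (rule sigma_functional_eqI[OF assms(4) Q_sigma[OF assms(1,2)] _ assms(3)]) (simp add: Q_power assms)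

lemma Q_self: "v \<in> Vec V \<Longrightarrow> f \<in> bdd_borel \<Longrightarrow> Q v v f = (LINT t|spec v. f t)"
  by (rule Q_eqI[symmetric, where \<Phi>="\<lambda>f. LINT t|spec v. f t"]) (auto intro: spec_sigma simp: spec_power)

lemma Q_lin:
  assumes "u \<in> Vec V" "v \<in> Vec V" "w \<in> Vec V" "f \<in> bdd_borel"
  shows "Q u (\<lambda>i. a * v i + w i) f = a * Q u v f + Q u w f"
  using assms by (intro Q_eqI[symmetric, where \<Phi>="\<lambda>f. a * Q u v f + Q u w f"] sigma_functional_lincomb Q_sigma Vec_lin)
    (auto simp: pow_lin Q_power)

lemma Q_cnj:
  assumes "v \<in> Vec V" "w \<in> Vec V" "f \<in> bdd_borel"
  shows "cnj (Q v w (\<lambda>t. cnj (f t))) = Q w v f"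
proof (rule Q_eqI[where \<Phi>="\<lambda>f. cnj (Q v w (\<lambda>t. cnj (f t)))"])
  show "sigma_functional c (\<lambda>f. cnj (Q v w (\<lambda>t. cnj (f t))))"
    using assms by (intro sigma_functional_cnj Q_sigma)
  show "cnj (Q v w (\<lambda>t. cnj (trunc_power c k t))) = Ip V w ((T ^^ k) v)" for k
    unfolding trunc_power_cnj using assms Ip_cnj[of v "(T ^^ k) w"] pow_sym[of w v k] pow_Vec
    by (simp add: Q_power)
qed (use assms in auto)

lemma Q_lin_left:
  assumes "u \<in> Vec V" "v \<in> Vec V" "w \<in> Vec V" "f \<in> bdd_borel"
  shows "Q (\<lambda>i. a * v i + w i) u f = cnj a * Q v u f + Q w u f"
proof -
  have "Q (\<lambda>i. a * v i + w i) u f = cnj (Q u (\<lambda>i. a * v i + w i) (\<lambda>t. cnj (f t)))"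
    using assms by (intro Q_cnj[symmetric] Vec_lin)
  also have "\<dots> = cnj a * cnj (Q u v (\<lambda>t. cnj (f t))) + cnj (Q u w (\<lambda>t. cnj (f t)))"
    using assms by (simp add: Q_lin bdd_borel_cnj)
  finally show ?thesis using assms by (simp add: Q_cnj)
qed

lemma Q_scale: "u \<in> Vec V \<Longrightarrow> v \<in> Vec V \<Longrightarrow> f \<in> bdd_borel \<Longrightarrow> Q u (\<lambda>i. a * v i) f = a * Q u v f"
  using Q_lin[of u v "\<lambda>_. 0" f a] Q_lin[of u "\<lambda>_. 0" "\<lambda>_. 0" f 1] Vec_zero by simp

lemma Q_scale_left: "u \<in> Vec V \<Longrightarrow> v \<in> Vec V \<Longrightarrow> f \<in> bdd_borel \<Longrightarrow> Q (\<lambda>i. a * v i) u f = cnj a * Q v u f"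
  using Q_lin_left[of u v "\<lambda>_. 0" f a] Q_lin_left[of u "\<lambda>_. 0" "\<lambda>_. 0" f 1] Vec_zero by simp

lemma Q_one:
  assumes "v \<in> Vec V" "w \<in> Vec V"
  shows "Q v w (\<lambda>_. 1) = Ip V v w"
proof -
  \<comment> \<open>The constant 1 is the truncated power of exponent 0 plus a function supported
    off [-c, c], on which the functional vanishes.\<close>
  have "Q v w (\<lambda>t. trunc_power c 0 t + (if \<bar>t\<bar> \<le> c then 0 else 1)) = Q v w (trunc_power c 0) + Q v w (\<lambda>t. if \<bar>t\<bar> \<le> c then 0 else 1)"
    by (intro sigma_functional_add[OF Q_sigma] assms) (auto intro: bdd_borel_outside)
  moreover have "Q v w (\<lambda>t. if \<bar>t\<bar> \<le> c then 0 else 1) = 0"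
    by (intro sigma_functionalD(2)[OF Q_sigma] assms) (auto intro: bdd_borel_outside)
  moreover have "(\<lambda>t. trunc_power c 0 t + (if \<bar>t\<bar> \<le> c then 0 else 1)) = (\<lambda>_. 1)"
    unfolding trunc_power_def by auto
  ultimately show ?thesis using assms Q_power[of v w 0] by simp
qed

lemma spec_UNIV: "v \<in> Vec V \<Longrightarrow> measure (spec v) UNIV = (vnorm V v)\<^sup>2"
proof -
  assume v: "v \<in> Vec V"
  have "space (spec v) = UNIV" using sets_eq_imp_space_eq[OF spec_sets[OF v]] by simp
  then have "complex_of_real (measure (spec v) UNIV) = Q v v (\<lambda>_. 1)"
    using integral_complex_indicator[of "spec v" UNIV] v Q_self[OF v bdd_borel_const[of 1]] by simp
  also have "\<dots> = complex_of_real ((vnorm V v)\<^sup>2)" using v by (simp add: Q_one Ip_self)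
  finally show ?thesis by (simp only: of_real_eq_iff)
qed

text \<open>Polarisation alone gives the bound \<open>C * (vnorm V v + vnorm V w)^2\<close>. The
  value is unchanged when \<open>v\<close> is multiplied by a real \<open>a > 0\<close> and
  \<open>w\<close> by \<open>1 / a\<close>, and \<open>a = sqrt (B / A)\<close> balances the two
  terms into \<open>4 * C * A * B\<close>. Strictly positive \<open>A\<close> and \<open>B\<close>
  above the norms avoid division by a vanishing norm; they are then let tend to the norms. The
  constant 4 is an artefact of polarisation.\<close>

lemma Q_bound:
  assumes v: "v \<in> Vec V" and w: "w \<in> Vec V" and f: "f \<in> bdd_borel" "\<And>t. cmod (f t) \<le> C"
  shows "cmod (Q v w f) \<le> 4 * C * vnorm V v * vnorm V w"
proof -
  have C: "C \<ge> 0" using f(2)[of 0] norm_ge_zero order_trans by blast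
  have n0: "0 \<le> vnorm V u" if "u \<in> Vec V" for u using that Ip_nonneg by simp
  have spec_bound: "cmod (LINT t|spec u. f t) \<le> C * (vnorm V u)\<^sup>2" if u: "u \<in> Vec V" for u
  proof -
    interpret finite_measure "spec u" by (rule spec_finite[OF u])
    have sp: "space (spec u) = UNIV" using sets_eq_imp_space_eq[OF spec_sets[OF u]] by simp
    have "cmod (LINT t|spec u. f t) \<le> (LINT t|spec u. C)"
      using bdd_borel_integrable[OF spec_finite[OF u] spec_sets[OF u] f(1)] f(2)
      by (intro order.trans[OF integral_norm_bound] integral_mono) auto
    then show ?thesis using spec_UNIV[OF u] sp by (simp add: mult.commute)
  qed
  have crude: "cmod (Q v w f) \<le> C * (vnorm V v + vnorm V w)\<^sup>2" if v: "v \<in> Vec V" and w: "w \<in> Vec V" for v w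
  proof -
    have "cmod (Q v w f) \<le> (\<Sum>k<4::nat. C * (vnorm V v + vnorm V w)\<^sup>2 / 4)"
      unfolding Q_def
    proof (rule sum_norm_le)
      fix k :: nat
      have V: "(\<lambda>i. \<i> ^ k * v i + w i) \<in> Vec V" using v w by (rule Vec_lin)
      have "vnorm V (\<lambda>i. \<i> ^ k * v i + w i) \<le> vnorm V v + vnorm V w"
        using vnorm_lin_le[OF v w, of "\<i> ^ k"] by (simp add: norm_power)
      then have "(vnorm V (\<lambda>i. \<i> ^ k * v i + w i))\<^sup>2 \<le> (vnorm V v + vnorm V w)\<^sup>2"
        using n0[OF V] by (intro power_mono)
      then have "C * (vnorm V (\<lambda>i. \<i> ^ k * v i + w i))\<^sup>2 \<le> C * (vnorm V v + vnorm V w)\<^sup>2"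
        using C by (rule mult_left_mono)
      with spec_bound[OF V] show "cmod (\<i> ^ k / 4 * (LINT t|spec (\<lambda>i. \<i> ^ k * v i + w i). f t)) \<le> C * (vnorm V v + vnorm V w)\<^sup>2 / 4"
        by (simp add: norm_mult norm_divide norm_power)
    qed
    then show ?thesis by simp
  qed
  have scaled: "cmod (Q v w f) \<le> 4 * C * A * B" if A: "vnorm V v \<le> A" "A > 0" and B: "vnorm V w \<le> B" "B > 0" for A B
  proof -
    define a where "a = sqrt (B / A)"
    have a: "a > 0" using A B unfolding a_def by simp
    have "Q v w f = Q (\<lambda>i. complex_of_real a * v i) (\<lambda>i. complex_of_real (1 / a) * w i) f"
    proof -
      have "Q (\<lambda>i. complex_of_real a * v i) (\<lambda>i. complex_of_real (1 / a) * w i) f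
          = cnj (complex_of_real a) * (complex_of_real (1 / a) * Q v w f)"
        using v w f(1) by (simp only: Q_scale_left Q_scale Vec_scale)
      then show ?thesis using a by simp
    qed
    also have "cmod \<dots> \<le> C * (vnorm V (\<lambda>i. complex_of_real a * v i) + vnorm V (\<lambda>i. complex_of_real (1 / a) * w i))\<^sup>2"
      using v w by (intro crude Vec_scale)
    also have "\<dots> \<le> C * (a * A + (1 / a) * B)\<^sup>2"
    proof (intro mult_left_mono power_mono add_mono add_nonneg_nonneg n0 Vec_scale v w C)
      have sc: "vnorm V (\<lambda>i. complex_of_real r * u i) \<le> r * vnorm V u" if "u \<in> Vec V" "r > 0" for r u
        using vnorm_lin_le[OF that(1) Vec_zero, of "complex_of_real r"] that Vec_zero Ip_zero_right[OF Vec_zero]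
        by (simp add: vnorm_def[of V "\<lambda>_. 0"])
      show "vnorm V (\<lambda>i. complex_of_real a * v i) \<le> a * A"
        using sc[OF v a] A(1) a by (meson mult_left_mono order.trans less_imp_le)
      have "vnorm V (\<lambda>i. complex_of_real (1 / a) * w i) \<le> (1 / a) * vnorm V w"
        using a by (intro sc[OF w]) auto
      also have "\<dots> \<le> (1 / a) * B" using B(1) a by (intro mult_left_mono) auto
      finally show "vnorm V (\<lambda>i. complex_of_real (1 / a) * w i) \<le> (1 / a) * B" .
    qed
    also have "(a * A + (1 / a) * B)\<^sup>2 = 4 * A * B"
    proof -
      have "a\<^sup>2 = B / A" using A B unfolding a_def by simp
      then have "B = a\<^sup>2 * A" using A by simp
      then show ?thesis using a by (simp add: power2_eq_square field_simps)
    qed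
    finally show ?thesis by (simp add: mult_ac)
  qed
  have "(\<lambda>n. 4 * C * (vnorm V v + 1 / real (Suc n)) * (vnorm V w + 1 / real (Suc n))) \<longlonglongrightarrow> 4 * C * (vnorm V v + 0) * (vnorm V w + 0)"
    by (intro tendsto_intros LIMSEQ_Suc[OF lim_1_over_n])
  moreover have "cmod (Q v w f) \<le> 4 * C * (vnorm V v + 1 / real (Suc n)) * (vnorm V w + 1 / real (Suc n))" for n
    using n0[OF v] n0[OF w] by (intro scaled) (auto intro: add_nonneg_pos)
  ultimately show ?thesis
    by (intro LIMSEQ_le_const) auto
qed

lemma Q_pow_left:
  assumes "v \<in> Vec V" "w \<in> Vec V" "f \<in> bdd_borel"
  shows "Q ((T ^^ k) v) w f = Q v w (\<lambda>t. f t * trunc_power c k t)"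
proof (rule Q_eqI[symmetric, where \<Phi>="\<lambda>f. Q v w (\<lambda>t. f t * trunc_power c k t)"])
  show "Q v w (\<lambda>t. trunc_power c j t * trunc_power c k t) = Ip V ((T ^^ k) v) ((T ^^ j) w)" for j
    using assms by (simp add: trunc_power_mult Q_power pow_sym pow_Vec funpow_add add.commute[of j])
qed (use assms in \<open>auto intro!: sigma_functional_mult Q_sigma pow_Vec\<close>)

text \<open>Multiplicativity of the functional calculus, with \<open>w'\<close> in the role of
  \<open>g(T) w\<close>. For a power,
  \<open>\<langle>v, T^k w'\<rangle> = \<langle>T^k v, w'\<rangle>\<close> is
  \<open>Q (T^k v) w g\<close>, and \<open>Q_pow_left\<close> moves the power into the
  integrand.\<close>

lemma Q_mult:
  assumes v: "v \<in> Vec V" and w: "w \<in> Vec V" "w' \<in> Vec V" and f: "f \<in> bdd_borel" "g \<in> bdd_borel"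
    and w': "\<And>u. u \<in> Vec V \<Longrightarrow> Ip V u w' = Q u w g"
  shows "Q v w' f = Q v w (\<lambda>t. f t * g t)"
proof (rule Q_eqI[symmetric, where \<Phi>="\<lambda>f. Q v w (\<lambda>t. f t * g t)"])
  show "Q v w (\<lambda>t. trunc_power c k t * g t) = Ip V v ((T ^^ k) w')" for k
  proof -
    have "Ip V v ((T ^^ k) w') = Ip V ((T ^^ k) v) w'" using v w by (simp add: pow_sym)
    also have "\<dots> = Q ((T ^^ k) v) w g" using v by (intro w' pow_Vec)
    finally show ?thesis using v w f by (simp add: Q_pow_left mult.commute)
  qed
qed (use assms in \<open>auto intro!: sigma_functional_mult Q_sigma\<close>)

subsection \<open>Existence and uniqueness of the spectral family\<close>

lemma Q_indicator_self:
  assumes v: "v \<in> Vec V" and B: "B \<in> sets borel"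
  shows "Q v v (indicator B) = complex_of_real (measure (spec v) B)"
  using v B sets_eq_imp_space_eq[OF spec_sets[OF v]]
  by (simp add: Q_self bdd_borel_indicator integral_complex_indicator)

text \<open>The operators \<open>E B\<close> enter through hypotheses, since nothing in
  \<open>semi_hilbert\<close> produces a vector from a functional. They are supplied by a Riesz
  argument in ell^2, and fibre by fibre in the direct integral.\<close>

lemma spectral_familyI:
  assumes E: "\<And>B w. B \<in> sets borel \<Longrightarrow> w \<in> Vec V \<Longrightarrow> E B w \<in> Vec V"
    and EQ: "\<And>B v w. B \<in> sets borel \<Longrightarrow> v \<in> Vec V \<Longrightarrow> w \<in> Vec V \<Longrightarrow> Ip V v (E B w) = Q v w (indicator B)"
  shows "is_spectral_family V T E"
proof -
  have ind: "indicator B \<in> bdd_borel" if "B \<in> sets borel" for B using that by auto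
  have n0: "0 \<le> vnorm V u" if "u \<in> Vec V" for u using that Ip_nonneg by simp
  have bounded: "operator_bounded_by V 4 (E B)" if B: "B \<in> sets borel" for B
    unfolding operator_bounded_by_def
  proof (intro conjI ballI allI)
    fix v assume v: "v \<in> Vec V"
    show Ev: "E B v \<in> Vec V" using B v by (rule E)
    \<comment> \<open>The squared norm of \<open>E B v\<close> is a matrix element against
      \<open>v\<close>; \<open>Q_bound\<close> with \<open>C = 1\<close> bounds it, and one factor
      of the norm cancels.\<close>
    have "(vnorm V (E B v))\<^sup>2 = cmod (Q (E B v) v (indicator B))"
      using EQ[OF B Ev v] Ip_self[OF Ev] by (metis abs_of_nonneg norm_of_real zero_le_power2)
    also have "\<dots> \<le> 4 * 1 * vnorm V (E B v) * vnorm V v"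
      by (rule Q_bound[OF Ev v ind[OF B]]) (auto split: split_indicator)
    finally have "vnorm V (E B v) * vnorm V (E B v) \<le> vnorm V (E B v) * (4 * vnorm V v)"
      by (simp add: power2_eq_square)
    then show "vnorm V (E B v) \<le> 4 * vnorm V v"
      using n0[OF Ev] n0[OF v] by (cases "vnorm V (E B v) = 0") auto
    fix w a assume w: "w \<in> Vec V"
    show "veq V (E B (\<lambda>i. a * v i + w i)) (\<lambda>i. a * E B v i + E B w i)"
      using v w B by (subst veq_iff) (auto simp: E Vec_lin EQ Ip_lin Q_lin ind)
  qed
  have sym: "Ip V (E B v) w = Ip V v (E B w)" if "B \<in> sets borel" "v \<in> Vec V" "w \<in> Vec V" for B v w
  proof -
    have "Ip V (E B v) w = cnj (Q w v (indicator B))"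
      using that Ip_cnj[of w "E B v"] by (simp add: E EQ)
    also have "(indicator B :: real \<Rightarrow> complex) = (\<lambda>t. cnj (indicator B t))"
      by (auto split: split_indicator)
    finally show ?thesis using that Q_cnj[of w v "indicator B"] by (simp add: EQ ind)
  qed
  have mult: "veq V (E (B \<inter> C) v) (E B (E C v))" if BC: "B \<in> sets borel" "C \<in> sets borel" and v: "v \<in> Vec V" for B C v
  proof (subst veq_iff)
    show "\<forall>u\<in>Vec V. Ip V u (E (B \<inter> C) v) = Ip V u (E B (E C v))"
    proof
      fix u assume u: "u \<in> Vec V"
      have "Ip V u (E B (E C v)) = Q u (E C v) (indicator B)" using BC u v by (simp add: EQ E)
      also have "\<dots> = Q u v (\<lambda>t. indicator B t * indicator C t)"
        using BC u v by (intro Q_mult) (auto simp: EQ E)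
      also have "(\<lambda>t. indicator B t * indicator C t) = (indicator (B \<inter> C) :: real \<Rightarrow> complex)"
        by (auto split: split_indicator)
      finally show "Ip V u (E (B \<inter> C) v) = Ip V u (E B (E C v))" using BC u v by (simp add: EQ)
    qed
  qed (use that in \<open>auto intro!: E\<close>)
  have pvm: "projection_valued_measure V E"
    unfolding projection_valued_measure_def
  proof (intro conjI ballI allI impI)
    fix B :: "real set" assume B: "B \<in> sets borel"
    show "orthogonal_projection V (E B)"
      unfolding orthogonal_projection_def selfadjoint_def
    proof (intro conjI ballI)
      show "\<exists>c. operator_bounded_by V c (E B)" using bounded[OF B] by blast
      show "veq V (E B (E B v)) (E B v)" if v: "v \<in> Vec V" for v
        using mult[OF B B v] E[OF B v] E[OF B E[OF B v]] by (simp add: veq_iff)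
    qed (use sym B in auto)
  next
    fix v assume v: "v \<in> Vec V"
    have "Q u v (indicator UNIV) = Ip V u v" if "u \<in> Vec V" for u
      using Q_one[OF that v] by (simp add: indicator_def[abs_def])
    then show "veq V (E UNIV v) v"
      using v by (subst veq_iff) (auto intro: E simp: EQ)
  next
    fix B :: "nat \<Rightarrow> real set" and v w
    assume B: "range B \<subseteq> sets borel" "disjoint_family B" and v: "v \<in> Vec V" and w: "w \<in> Vec V"
    have Bn: "B n \<in> sets borel" for n using B by auto
    have "(\<lambda>n. Q v w (\<lambda>t. \<Sum>i<n. indicator (B i) t)) \<longlonglongrightarrow> Q v w (indicator (\<Union>i. B i))"
    proof (rule sigma_functionalD(3)[OF Q_sigma[OF v w], where C=1])
      have eq: "(\<Sum>i<n. indicator (B i) t) = (indicator (\<Union>i<n. B i) t :: complex)" for n t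
        using B(2) by (intro indicator_UN_disjoint[symmetric]) (auto intro: disjoint_family_on_mono)
      show "cmod (\<Sum>i<n. indicator (B i) t) \<le> 1" for n t
        unfolding eq by (auto split: split_indicator)
      show "(\<lambda>t. \<Sum>i<n. indicator (B i) t) \<in> bdd_borel" for n
        using Bn by (intro bdd_borel_sum bdd_borel_indicator)
      show "(\<lambda>n. \<Sum>i<n. indicator (B i) t) \<longlonglongrightarrow> (indicator (\<Union>i. B i) t :: complex)" for t
        unfolding eq by (rule LIMSEQ_indicator_UN)
    qed (use Bn in auto)
    moreover have "Q v w (\<lambda>t. \<Sum>i<n. indicator (B i) t) = (\<Sum>i<n. Ip V v (E (B i) w))" for n
      using v w Bn by (subst sigma_functional_sum[OF Q_sigma[OF v w]]) (auto simp: EQ)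
    moreover have "Q v w (indicator (\<Union>i. B i)) = Ip V v (E (\<Union>n. B n) w)"
      using v w Bn by (subst EQ) auto
    ultimately show "(\<lambda>n. Ip V v (E (B n) w)) sums Ip V v (E (\<Union>n. B n) w)"
      unfolding sums_def by simp
  qed (use mult in auto)
  have ssm: "scalar_spectral_measure V E v = spec v" if v: "v \<in> Vec V" for v
  proof -
    interpret finite_measure "spec v" by (rule spec_finite[OF v])
    have sp: "space (spec v) = UNIV" using sets_eq_imp_space_eq[OF spec_sets[OF v]] by simp
    have "scalar_spectral_measure V E v = measure_of UNIV (sets borel) (emeasure (spec v))"
      unfolding scalar_spectral_measure_def
    proof (rule measure_of_eq)
      fix B :: "real set" assume "B \<in> sigma_sets UNIV (sets borel)"
      then have B: "B \<in> sets borel" using sets.sigma_sets_eq[of "borel :: real measure"] by simp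
      then show "ennreal (Re (Ip V v (E B v))) = emeasure (spec v) B"
        using v by (simp add: EQ Q_indicator_self emeasure_eq_measure)
    qed simp
    also have "\<dots> = spec v" using measure_of_of_measure[of "spec v"] sp v by simp
    finally show ?thesis .
  qed
  show ?thesis
    unfolding is_spectral_family_def
  proof (intro conjI ballI pvm)
    fix v assume v: "v \<in> Vec V"
    interpret finite_measure "spec v" by (rule spec_finite[OF v])
    have AE: "AE t in spec v. t \<in> {-c..c}"
      using spec_supp[OF v] v by (intro AE_I[of _ _ "- {-c..c}"]) auto
    have meas: "f \<in> borel_measurable borel \<Longrightarrow> f \<in> borel_measurable (spec v)" for f :: "real \<Rightarrow> real"
      unfolding measurable_cong_sets[OF spec_sets[OF v] refl] .
    show "integrable (scalar_spectral_measure V E v) (\<lambda>t. t\<^sup>2)"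
      unfolding ssm[OF v]
    proof (rule integrable_const_bound[where B="c\<^sup>2"])
      show "AE t in spec v. norm (t\<^sup>2) \<le> c\<^sup>2"
        using AE by eventually_elim (auto intro!: abs_le_square_iff[THEN iffD1])
    qed (rule meas, simp)
    have "moment_functional (moment v) (monom 1 1) = (LINT t|spec v. t)"
      using spec_poly[OF v, of "monom 1 1"] by (simp add: poly_monom)
    then show "Ip V v (T v) = complex_of_real (LINT t|scalar_spectral_measure V E v. t)"
      unfolding ssm[OF v] using pow_real[OF v, of 1] by (simp add: moment_def)
  qed
qed

text \<open>The definition of a spectral family fixes only the first moments
  \<open>\<langle>v, T v\<rangle>\<close>. Multiplicativity of \<open>E\<close> upgrades them to all
  moments, once the measures are known to live on [-c, c], and then the moments determine the
  measures. Values of \<open>spectral_family\<close>, which is a mere choice, can be computed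
  through this uniqueness.\<close>

lemma
  assumes E: "is_spectral_family V T E" and v: "v \<in> Vec V"
  shows projection_measure_unique: "scalar_spectral_measure V E v = spec v"
    and projection_measure_norm: "B \<in> sets borel \<Longrightarrow> measure (spec v) B = (vnorm V (E B v))\<^sup>2"
proof -
  have pvm: "projection_valued_measure V E"
    and int: "\<And>v. v \<in> Vec V \<Longrightarrow> integrable (scalar_spectral_measure V E v) (\<lambda>t. t\<^sup>2)"
    and TE: "\<And>v. v \<in> Vec V \<Longrightarrow> Ip V v (T v) = complex_of_real (LINT t|scalar_spectral_measure V E v. t)"
    using E unfolding is_spectral_family_def by auto
  define \<rho> where "\<rho> = scalar_spectral_measure V E"
  have sa: "selfadjoint V (E B)" if "B \<in> sets borel" for B
    using pvm that unfolding projection_valued_measure_def orthogonal_projection_def by simp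
  have E_Vec: "E B v \<in> Vec V" if "B \<in> sets borel" "v \<in> Vec V" for B v
    using sa[OF that(1)] that(2) unfolding selfadjoint_def operator_bounded_by_def by blast
  have E_sym: "Ip V (E B v) w = Ip V v (E B w)" if "B \<in> sets borel" "v \<in> Vec V" "w \<in> Vec V" for B v w
    using sa[OF that(1)] that(2,3) unfolding selfadjoint_def by blast
  have E_one: "Ip V u (E UNIV v) = Ip V u v" if "u \<in> Vec V" "v \<in> Vec V" for u v
    using pvm that E_Vec[of UNIV v] unfolding projection_valued_measure_def by (auto simp: veq_iff)
  have E_mult: "Ip V u (E B (E C v)) = Ip V u (E (B \<inter> C) v)"
    if "B \<in> sets borel" "C \<in> sets borel" "u \<in> Vec V" "v \<in> Vec V" for B C u v
  proof -
    have "veq V (E (B \<inter> C) v) (E B (E C v))" using pvm that unfolding projection_valued_measure_def by blast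
    then show ?thesis using that E_Vec[of "B \<inter> C" v] E_Vec[of B "E C v"] E_Vec[of C v] by (simp add: veq_iff)
  qed
  have E_sums: "(\<lambda>n. Ip V v (E (B n) v)) sums Ip V v (E (\<Union>n. B n) v)"
    if "range B \<subseteq> sets borel" "disjoint_family B" "v \<in> Vec V" for v and B :: "nat \<Rightarrow> real set"
    using pvm that unfolding projection_valued_measure_def by blast
  have E_self: "Ip V v (E B v) = complex_of_real ((vnorm V (E B v))\<^sup>2)" if "B \<in> sets borel" "v \<in> Vec V" for B v
    using that E_mult[of B B v v] E_sym[of B v "E B v"] Ip_self[of "E B v"] E_Vec[of B v] by simp
  \<comment> \<open>\<open>measure_of\<close> gives the zero measure unless the set function is a
    measure, so countable additivity has to be drawn from \<open>E\<close> before any value can be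
    read off.\<close>
  have \<rho>_emeasure: "emeasure (\<rho> v) B = ennreal ((vnorm V (E B v))\<^sup>2)" if v: "v \<in> Vec V" and B: "B \<in> sets borel" for v B
  proof -
    have 1: "\<rho> v = measure_of UNIV (sets borel) (\<lambda>B. ennreal ((vnorm V (E B v))\<^sup>2))"
      unfolding \<rho>_def scalar_spectral_measure_def
      using v sets.sigma_sets_eq[of "borel :: real measure"] by (intro measure_of_eq) (auto simp: E_self)
    show ?thesis
      unfolding 1
    proof (rule emeasure_measure_of_sigma)
      show "sigma_algebra UNIV (sets (borel :: real measure))"
        using sets.sigma_algebra_axioms[of "borel :: real measure"] by simp
      have "Ip V v (E {} v) = 0"
      proof -
        have "(\<lambda>n. Ip V v (E {} v)) sums Ip V v (E {} v)"
          using E_sums[of "\<lambda>_. {}" v] v by (simp add: disjoint_family_on_def)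
        then have "(\<lambda>n. Ip V v (E {} v)) \<longlonglongrightarrow> 0" by (intro summable_LIMSEQ_zero sums_summable)
        then show ?thesis by (simp add: LIMSEQ_const_iff)
      qed
      then show "positive (sets borel) (\<lambda>B. ennreal ((vnorm V (E B v))\<^sup>2))"
        unfolding positive_def using E_self[of "{}" v] v by simp
      show "countably_additive (sets borel) (\<lambda>B. ennreal ((vnorm V (E B v))\<^sup>2))"
      proof (rule countably_additiveI)
        fix A :: "nat \<Rightarrow> real set" assume A: "range A \<subseteq> sets borel" "disjoint_family A"
        have "(\<lambda>n. complex_of_real ((vnorm V (E (A n) v))\<^sup>2)) sums complex_of_real ((vnorm V (E (\<Union>n. A n) v))\<^sup>2)"
          using E_sums[OF A v] E_self[OF _ v] A(1) by (simp add: range_subsetD sets.countable_UN)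
        then have "(\<lambda>n. (vnorm V (E (A n) v))\<^sup>2) sums (vnorm V (E (\<Union>n. A n) v))\<^sup>2"
          by (simp only: sums_of_real_iff)
        then show "(\<Sum>i. ennreal ((vnorm V (E (A i) v))\<^sup>2)) = ennreal ((vnorm V (E (\<Union>i. A i) v))\<^sup>2)"
          by (intro suminf_ennreal_eq) auto
      qed
    qed (rule B)
  qed
  have \<rho>_sets: "sets (\<rho> v) = sets borel" for v
    unfolding \<rho>_def scalar_spectral_measure_def using sets.sigma_sets_eq[of "borel :: real measure"] by simp
  have \<rho>_space: "space (\<rho> v) = UNIV" for v using sets_eq_imp_space_eq[OF \<rho>_sets[of v]] by simp
  have \<rho>_finite: "finite_measure (\<rho> v)" if "v \<in> Vec V" for v
    using that by (intro finite_measureI) (simp add: \<rho>_space \<rho>_emeasure)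
  have \<rho>_measure: "complex_of_real (measure (\<rho> v) B) = Ip V v (E B v)" if "v \<in> Vec V" "B \<in> sets borel" for v B
    using that by (simp add: measure_def \<rho>_emeasure E_self)
  \<comment> \<open>The measure of \<open>E B v\<close> is the measure of \<open>v\<close>
    restricted to \<open>B\<close>, by symmetry and multiplicativity of the projections.\<close>
  have \<rho>_restrict: "emeasure (\<rho> (E B v)) C = emeasure (\<rho> v) (C \<inter> B)"
    if "v \<in> Vec V" "B \<in> sets borel" "C \<in> sets borel" for v B C
  proof -
    have "complex_of_real ((vnorm V (E C (E B v)))\<^sup>2) = Ip V (E B v) (E C (E B v))"
      using that by (intro E_self[symmetric] E_Vec)
    also have "\<dots> = Ip V v (E B (E C (E B v)))" using that by (intro E_sym E_Vec)
    also have "\<dots> = Ip V v (E (B \<inter> C) (E B v))" using that E_Vec by (intro E_mult)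
    also have "\<dots> = Ip V v (E (B \<inter> C \<inter> B) v)" using that E_Vec by (intro E_mult) auto
    also have "\<dots> = complex_of_real ((vnorm V (E (C \<inter> B) v))\<^sup>2)"
      using that E_self[of "C \<inter> B" v] by (simp add: Int_commute Int_left_commute)
    finally have "(vnorm V (E C (E B v)))\<^sup>2 = (vnorm V (E (C \<inter> B) v))\<^sup>2" by (simp only: of_real_eq_iff)
    then show ?thesis using that E_Vec[of B v] by (simp add: \<rho>_emeasure)
  qed
  \<comment> \<open>Project \<open>v\<close> to the part \<open>w\<close> with spectrum beyond
    \<open>c\<close> on one side. Its measure sees only \<open>\<sigma> t > c\<close>, while the
    norm bound gives \<open>\<bar>\<langle>w, T w\<rangle>\<bar> \<le> c * (vnorm V w)^2\<close>. So
    the nonnegative function \<open>\<sigma> t - c\<close> has integral 0 although it is positive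
    almost everywhere, and the measure vanishes.\<close>
  have half: "emeasure (\<rho> v) {t. \<sigma> * t > c} = 0" if v: "v \<in> Vec V" and \<sigma>: "\<sigma> = 1 \<or> \<sigma> = -1" for v and \<sigma> :: real
  proof -
    define B where "B = {t. \<sigma> * t > c}"
    have B: "B \<in> sets borel" unfolding B_def by measurable
    define w where "w = E B v"
    have w: "w \<in> Vec V" unfolding w_def using B v by (intro E_Vec)
    interpret finite_measure "\<rho> w" by (rule \<rho>_finite[OF w])
    have "(\<lambda>t. t) \<in> borel_measurable (\<rho> w)"
      unfolding measurable_cong_sets[OF \<rho>_sets refl] by simp
    then have int_t: "integrable (\<rho> w) (\<lambda>t. t)"
      using int[OF w] unfolding \<rho>_def[symmetric] by (rule square_integrable_imp_integrable)
    have AEB: "AE t in \<rho> w. t \<in> B"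
      using \<rho>_restrict[OF v B, of "- B"] B by (intro AE_I[of _ _ "- B"]) (auto simp: w_def \<rho>_sets)
    have mass: "measure (\<rho> w) UNIV = (vnorm V w)\<^sup>2"
    proof -
      have "complex_of_real (measure (\<rho> w) UNIV) = Ip V w w" using w by (simp add: \<rho>_measure E_one)
      then show ?thesis using w by (simp only: Ip_self of_real_eq_iff)
    qed
    have n0: "0 \<le> vnorm V w" using w Ip_nonneg by simp
    have "\<bar>LINT t|\<rho> w. t\<bar> = cmod (Ip V w (T w))" using TE[OF w] unfolding \<rho>_def by simp
    also have "\<dots> \<le> vnorm V w * vnorm V (T w)" using w by (intro Cauchy_Schwarz T_Vec)
    also have "\<dots> \<le> vnorm V w * (c * vnorm V w)" using T_norm[OF w] n0 by (rule mult_left_mono)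
    finally have "\<bar>LINT t|\<rho> w. t\<bar> \<le> c * measure (\<rho> w) UNIV" unfolding mass by (simp add: power2_eq_square mult_ac)
    then have "(LINT t|\<rho> w. \<sigma> * t - c) \<le> 0" using int_t \<sigma> by (auto simp: \<rho>_space mult.commute)
    moreover have pos: "AE t in \<rho> w. \<sigma> * t - c \<ge> 0" using AEB by eventually_elim (auto simp: B_def)
    moreover have it: "integrable (\<rho> w) (\<lambda>t. \<sigma> * t - c)" using int_t by auto
    ultimately have "(LINT t|\<rho> w. \<sigma> * t - c) = 0" using integral_nonneg_AE[OF pos] by simp
    then have "AE t in \<rho> w. \<sigma> * t - c = 0" using integral_nonneg_eq_0_iff_AE[OF it pos] by simp
    then have "AE t in \<rho> w. False" using AEB by eventually_elim (auto simp: B_def)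
    then have "emeasure (\<rho> w) UNIV = 0" by (subst (asm) AE_iff_null) (auto simp: \<rho>_space \<rho>_sets null_sets_def)
    then show ?thesis using \<rho>_restrict[OF v B, of UNIV] unfolding w_def B_def by simp
  qed
  have \<rho>_supp: "emeasure (\<rho> v) (- {-c..c}) = 0" if v: "v \<in> Vec V" for v
  proof -
    have "- {-c..c} = {t. 1 * t > c} \<union> {t. -1 * t > c}" by auto
    moreover have "{t. 1 * t > c} \<union> {t. -1 * t > c} \<in> null_sets (\<rho> v)"
    proof (intro null_sets.Un null_setsI half v)
      show "{t. 1 * t > c} \<in> sets (\<rho> v)" "{t. -1 * t > c} \<in> sets (\<rho> v)"
        unfolding \<rho>_sets by measurable
    qed auto
    ultimately show ?thesis by (simp add: null_sets_def)
  qed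
  have \<rho>_sigma: "sigma_functional c (\<lambda>f. LINT t|\<rho> v. f t)" if "v \<in> Vec V" for v
    using that by (intro sigma_functional_integral \<rho>_finite \<rho>_sets \<rho>_supp)
  define P where "P v w f = (\<Sum>k<4. \<i> ^ k / 4 * (LINT t|\<rho> (\<lambda>i. \<i> ^ k * v i + w i). f t))" for v w and f :: "real \<Rightarrow> complex"
  have P_sigma: "sigma_functional c (P v w)" if "v \<in> Vec V" "w \<in> Vec V" for v w
    unfolding P_def[abs_def] using that by (intro sigma_functional_sums \<rho>_sigma Vec_lin)
  have E_lin_right: "Ip V u (E B (\<lambda>i. a * v i + w i)) = a * Ip V u (E B v) + Ip V u (E B w)"
    if "B \<in> sets borel" "u \<in> Vec V" "v \<in> Vec V" "w \<in> Vec V" for B u v w a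
    using that by (simp add: E_sym[symmetric] Vec_lin Ip_lin E_Vec)
  have P_ind: "P v w (indicator B) = Ip V v (E B w)" if v: "v \<in> Vec V" and w: "w \<in> Vec V" and B: "B \<in> sets borel" for v w B
  proof -
    have "P v w (indicator B) = (\<Sum>k<4. \<i> ^ k * Ip V (\<lambda>i. \<i> ^ k * v i + w i) (E B (\<lambda>i. \<i> ^ k * v i + w i))) / 4"
      unfolding P_def sum_divide_distrib using v w B
      by (intro sum.cong) (simp_all add: integral_complex_indicator \<rho>_space \<rho>_measure Vec_lin)
    also have "\<dots> = Ip V v (E B w)"
      using E_lin_right[OF B] by (rule polarization) (auto intro!: Ip_lin_left E_Vec B v w)
    finally show ?thesis .
  qed
  have P_T: "P v w (trunc_power c 1) = Ip V v (T w)" if v: "v \<in> Vec V" and w: "w \<in> Vec V" for v w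
  proof -
    have T1: "(LINT t|\<rho> u. trunc_power c 1 t) = Ip V u (T u)" if u: "u \<in> Vec V" for u
    proof -
      have AE: "AE t in \<rho> u. t \<in> {-c..c}"
        using \<rho>_supp[OF u] by (intro AE_I[of _ _ "- {-c..c}"]) (auto simp: \<rho>_sets)
      have meas: "(\<lambda>t. complex_of_real t) \<in> borel_measurable (\<rho> u)" "trunc_power c 1 \<in> borel_measurable (\<rho> u)"
        unfolding measurable_cong_sets[OF \<rho>_sets refl] by (auto intro: bdd_borel_measurable)
      have "(LINT t|\<rho> u. trunc_power c 1 t) = (LINT t|\<rho> u. complex_of_real t)"
      proof (rule integral_cong_AE[OF meas(2,1)])
        show "AE t in \<rho> u. trunc_power c 1 t = complex_of_real t"
          using AE by eventually_elim (auto simp: trunc_power_def)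
      qed
      then show ?thesis using TE[OF u] unfolding \<rho>_def by simp
    qed
    have "P v w (trunc_power c 1) = (\<Sum>k<4. \<i> ^ k * Ip V (\<lambda>i. \<i> ^ k * v i + w i) (T (\<lambda>i. \<i> ^ k * v i + w i))) / 4"
      unfolding P_def sum_divide_distrib using v w by (intro sum.cong) (simp_all only: T1 Vec_lin times_divide_eq_left)
    also have "\<dots> = Ip V v (T w)"
      using pow_lin[where k=1] by (intro polarization) (auto intro: Ip_lin_left T_Vec v w)
    finally show ?thesis .
  qed
  have P_E: "P (E B v) w f = P v w (\<lambda>t. f t * indicator B t)"
    if v: "v \<in> Vec V" and w: "w \<in> Vec V" and B: "B \<in> sets borel" and f: "f \<in> bdd_borel" for v w B f
  proof (rule sigma_functional_eqI_indicator[OF _ _ _ f])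
    fix C :: "real set" assume C: "C \<in> sets borel"
    have "(\<lambda>t. indicator C t * indicator B t) = (indicator (B \<inter> C) :: real \<Rightarrow> complex)"
      by (auto split: split_indicator)
    then have "P v w (\<lambda>t. indicator C t * indicator B t) = Ip V v (E (B \<inter> C) w)"
      using v w B C by (simp add: P_ind)
    moreover have "P (E B v) w (indicator C) = Ip V v (E (B \<inter> C) w)"
      using v w B C E_Vec[of C w] by (simp add: P_ind E_Vec E_sym E_mult)
    ultimately show "P (E B v) w (indicator C) = P v w (\<lambda>t. indicator C t * indicator B t)" by simp
  qed (use v w B in \<open>auto intro!: P_sigma sigma_functional_mult E_Vec\<close>)
  \<comment> \<open>Applying \<open>T\<close> to \<open>w\<close> multiplies the measure by
    \<open>t\<close>. On indicators this is the first moment identity for the pair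
    \<open>E B v\<close>, \<open>w\<close>; induction on \<open>k\<close> then gives all
    moments.\<close>
  have P_Tf: "P v (T w) f = P v w (\<lambda>t. f t * trunc_power c 1 t)"
    if v: "v \<in> Vec V" and w: "w \<in> Vec V" and f: "f \<in> bdd_borel" for v w f
  proof (rule sigma_functional_eqI_indicator[OF _ _ _ f])
    fix B :: "real set" assume B: "B \<in> sets borel"
    have "P v (T w) (indicator B) = Ip V (E B v) (T w)"
      using v w B by (simp add: P_ind T_Vec E_sym)
    also have "\<dots> = P (E B v) w (trunc_power c 1)" using v w B by (intro P_T[symmetric] E_Vec)
    also have "\<dots> = P v w (\<lambda>t. trunc_power c 1 t * indicator B t)" using v w B by (intro P_E) auto
    finally show "P v (T w) (indicator B) = P v w (\<lambda>t. indicator B t * trunc_power c 1 t)"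
      by (simp add: mult.commute)
  qed (use v w in \<open>auto intro!: P_sigma sigma_functional_mult T_Vec\<close>)
  have P_power: "P v w (trunc_power c k) = Ip V v ((T ^^ k) w)" if v: "v \<in> Vec V" and w: "w \<in> Vec V" for v w k
    using w
  proof (induction k arbitrary: w)
    case 0
    have "P v w (\<lambda>t. trunc_power c 0 t + (if \<bar>t\<bar> \<le> c then 0 else 1)) = P v w (trunc_power c 0) + P v w (\<lambda>t. if \<bar>t\<bar> \<le> c then 0 else 1)"
      by (intro sigma_functional_add[OF P_sigma] v 0) (auto intro: bdd_borel_outside)
    moreover have "P v w (\<lambda>t. if \<bar>t\<bar> \<le> c then 0 else 1) = 0"
      by (intro sigma_functionalD(2)[OF P_sigma] v 0) (auto intro: bdd_borel_outside)
    moreover have "(\<lambda>t. trunc_power c 0 t + (if \<bar>t\<bar> \<le> c then 0 else 1)) = indicator UNIV"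
      unfolding trunc_power_def by auto
    ultimately show ?case using P_ind[OF v 0, of UNIV] E_one[OF v 0] by simp
  next
    case (Suc k)
    have "P v w (trunc_power c (Suc k)) = P v w (\<lambda>t. trunc_power c k t * trunc_power c 1 t)"
      by (simp add: trunc_power_mult)
    also have "\<dots> = P v (T w) (trunc_power c k)" using v Suc.prems by (intro P_Tf[symmetric]) auto
    also have "\<dots> = Ip V v ((T ^^ k) (T w))" using Suc by (simp add: T_Vec)
    finally show ?case by (simp add: funpow_swap1)
  qed
  have "\<rho> v = spec v"
  proof (rule finite_measure_eqI_integral[OF \<rho>_finite[OF v] \<rho>_sets spec_finite[OF v] spec_sets[OF v]])
    fix f assume f: "f \<in> bdd_borel"
    have "(LINT t|\<rho> v. f t) = P v v f"
      by (rule sigma_functional_eqI_indicator[OF \<rho>_sigma P_sigma _ f])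
         (simp_all add: v P_ind integral_complex_indicator \<rho>_space \<rho>_measure)
    also have "\<dots> = Q v v f" using v f by (intro Q_eqI[where \<Phi>="P v v"] P_sigma P_power)
    also have "\<dots> = (LINT t|spec v. f t)" using v f by (rule Q_self)
    finally show "(LINT t|\<rho> v. f t) = (LINT t|spec v. f t)" .
  qed
  then show "scalar_spectral_measure V E v = spec v"
    and "B \<in> sets borel \<Longrightarrow> measure (spec v) B = (vnorm V (E B v))\<^sup>2"
    using \<rho>_emeasure[OF v, of B] unfolding \<rho>_def by (simp_all add: measure_def)
qed

end

section \<open>Operators on square summable functions\<close>

definition delta :: "'x \<Rightarrow> 'x \<Rightarrow> complex" where
  "delta x = (\<lambda>y. if y = x then 1 else 0)"

lemma l2_Vec: "v \<in> Vec (l2 A) \<longleftrightarrow> (\<forall>x. x \<notin> A \<longrightarrow> v x = 0) \<and> (\<lambda>x. (cmod (v x))\<^sup>2) summable_on A"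
  unfolding l2_def by simp

lemma l2_Ip: "Ip (l2 A) v w = (\<Sum>\<^sub>\<infinity>x\<in>A. cnj (v x) * w x)"
  unfolding l2_def by simp

lemma l2_abs_summable:
  assumes "v \<in> Vec (l2 A)" "w \<in> Vec (l2 A)"
  shows "(\<lambda>x. norm (cnj (v x) * w x)) summable_on A"
proof (rule Infinite_Sum.abs_summable_on_comparison_test')
  show "(\<lambda>x. (cmod (v x))\<^sup>2 + (cmod (w x))\<^sup>2) summable_on A"
    using assms by (intro summable_on_add) (auto simp: l2_Vec)
  show "norm (cnj (v x) * w x) \<le> (cmod (v x))\<^sup>2 + (cmod (w x))\<^sup>2" for x
  proof -
    have "0 \<le> (cmod (v x) - cmod (w x))\<^sup>2 + (cmod (v x))\<^sup>2 + (cmod (w x))\<^sup>2" by simp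
    then show ?thesis by (simp add: norm_mult power2_diff)
  qed
qed

lemma l2_summable:
  "v \<in> Vec (l2 A) \<Longrightarrow> w \<in> Vec (l2 A) \<Longrightarrow> (\<lambda>x. cnj (v x) * w x) summable_on A"
  by (rule abs_summable_summable[OF l2_abs_summable])

lemma infsum_complex_of_real:
  "(\<Sum>\<^sub>\<infinity>x\<in>A. complex_of_real (f x)) = complex_of_real (\<Sum>\<^sub>\<infinity>x\<in>A. f x)"
proof (cases "f summable_on A")
  case True
  then show ?thesis by (intro infsumI has_sum_of_real has_sum_infsum)
next
  case False
  then have "\<not> (\<lambda>x. complex_of_real (f x)) summable_on A"
    using summable_on_Re[of "\<lambda>x. complex_of_real (f x)" A] by auto
  with False show ?thesis by (simp add: infsum_not_exists)
qed

lemma l2_Ip_self: "Ip (l2 A) v v = complex_of_real (\<Sum>\<^sub>\<infinity>x\<in>A. (cmod (v x))\<^sup>2)"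
proof -
  have "cnj (v x) * v x = complex_of_real ((cmod (v x))\<^sup>2)" for x
    by (simp add: complex_norm_square[symmetric] mult.commute del: of_real_power)
  then show ?thesis unfolding l2_Ip by (simp only: infsum_complex_of_real)
qed

lemma l2_vnorm_sq: "(vnorm (l2 A) v)\<^sup>2 = (\<Sum>\<^sub>\<infinity>x\<in>A. (cmod (v x))\<^sup>2)"
  unfolding vnorm_def l2_Ip_self by (simp add: infsum_nonneg)

lemma semi_hilbert_l2: "semi_hilbert (l2 A)"
proof
  show "(\<lambda>_. 0) \<in> Vec (l2 A)" by (simp add: l2_Vec)
  fix v w :: "'a \<Rightarrow> complex" and a assume v: "v \<in> Vec (l2 A)" and w: "w \<in> Vec (l2 A)"
  have "(\<lambda>x. norm ((cmod (a * v x + w x))\<^sup>2)) summable_on A"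
  proof (rule Infinite_Sum.abs_summable_on_comparison_test')
    show "(\<lambda>x. (2 * (cmod a)\<^sup>2) * (cmod (v x))\<^sup>2 + 2 * (cmod (w x))\<^sup>2) summable_on A"
      using v w by (intro summable_on_add summable_on_cmult_right) (auto simp: l2_Vec)
    show "norm ((cmod (a * v x + w x))\<^sup>2) \<le> (2 * (cmod a)\<^sup>2) * (cmod (v x))\<^sup>2 + 2 * (cmod (w x))\<^sup>2" for x
    proof -
      have "cmod (a * v x + w x) \<le> cmod a * cmod (v x) + cmod (w x)"
        by (metis norm_mult norm_triangle_ineq)
      then have "(cmod (a * v x + w x))\<^sup>2 \<le> (cmod a * cmod (v x) + cmod (w x))\<^sup>2"
        by (intro power_mono) auto
      also have "\<dots> \<le> 2 * (cmod a * cmod (v x))\<^sup>2 + 2 * (cmod (w x))\<^sup>2"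
        using zero_le_power2[of "cmod a * cmod (v x) - cmod (w x)"] by (simp add: power2_sum power2_diff)
      finally show ?thesis by (simp add: power_mult_distrib)
    qed
  qed
  then show "(\<lambda>i. a * v i + w i) \<in> Vec (l2 A)" using v w by (auto simp: l2_Vec)
next
  fix u v w :: "'a \<Rightarrow> complex" and a
  assume "u \<in> Vec (l2 A)" "v \<in> Vec (l2 A)" "w \<in> Vec (l2 A)"
  then have s: "(\<lambda>x. cnj (u x) * v x) summable_on A" "(\<lambda>x. cnj (u x) * w x) summable_on A"
    by (auto intro: l2_summable)
  have "Ip (l2 A) u (\<lambda>i. a * v i + w i) = (\<Sum>\<^sub>\<infinity>x\<in>A. a * (cnj (u x) * v x) + cnj (u x) * w x)"
    unfolding l2_Ip by (simp add: algebra_simps)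
  also have "\<dots> = a * Ip (l2 A) u v + Ip (l2 A) u w"
    unfolding l2_Ip using s by (simp add: infsum_add summable_on_cmult_right infsum_cmult_right)
  finally show "Ip (l2 A) u (\<lambda>i. a * v i + w i) = a * Ip (l2 A) u v + Ip (l2 A) u w" .
next
  fix v w :: "'a \<Rightarrow> complex"
  show "Ip (l2 A) w v = cnj (Ip (l2 A) v w)"
    unfolding l2_Ip infsum_cnj[symmetric] by (simp add: mult.commute)
  show "0 \<le> Re (Ip (l2 A) v v)" unfolding l2_Ip_self by (simp add: infsum_nonneg)
qed

lemma finite_restrict_l2:
  assumes "finite F" "F \<subseteq> A"
  shows "(\<lambda>y. if y \<in> F then r y else 0) \<in> Vec (l2 A)"
    "Ip (l2 A) (\<lambda>y. if y \<in> F then r y else 0) w = (\<Sum>x\<in>F. cnj (r x) * w x)"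
proof -
  have "(\<lambda>y. (cmod (if y \<in> F then r y else 0))\<^sup>2) summable_on F" using assms by simp
  then have "(\<lambda>y. (cmod (if y \<in> F then r y else 0))\<^sup>2) summable_on A"
    using assms by (subst summable_on_cong_neutral[of F A]) auto
  then show "(\<lambda>y. if y \<in> F then r y else 0) \<in> Vec (l2 A)" using assms by (auto simp: l2_Vec)
  have "Ip (l2 A) (\<lambda>y. if y \<in> F then r y else 0) w = infsum (\<lambda>x. cnj (r x) * w x) F"
    unfolding l2_Ip using assms by (intro infsum_cong_neutral) auto
  then show "Ip (l2 A) (\<lambda>y. if y \<in> F then r y else 0) w = (\<Sum>x\<in>F. cnj (r x) * w x)" using assms by simp
qed

lemma delta_Vec: "x \<in> A \<Longrightarrow> delta x \<in> Vec (l2 A)"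
  using finite_restrict_l2(1)[of "{x}" A "\<lambda>_. 1"] by (simp add: delta_def)

lemma l2_Ip_delta: "x \<in> A \<Longrightarrow> Ip (l2 A) (delta x) w = w x"
proof -
  assume "x \<in> A"
  then have "Ip (l2 A) (delta x) w = infsum w {x}"
    unfolding l2_Ip delta_def by (intro infsum_cong_neutral) auto
  then show ?thesis by simp
qed

lemma vnorm_delta: "x \<in> A \<Longrightarrow> vnorm (l2 A) (delta x) = 1"
  unfolding vnorm_def by (simp add: l2_Ip_delta) (simp add: delta_def)

lemma l2_veq:
  assumes "v \<in> Vec (l2 A)" "w \<in> Vec (l2 A)" "veq (l2 A) v w"
  shows "v = w"
proof
  fix x
  show "v x = w x"
  proof (cases "x \<in> A")
    case True
    interpret semi_hilbert "l2 A" by (rule semi_hilbert_l2)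
    show ?thesis using assms veq_iff[of v w] delta_Vec[OF True] l2_Ip_delta[OF True] by metis
  qed (use assms in \<open>auto simp: l2_Vec\<close>)
qed

text \<open>The representing vector must have the coordinates \<open>l (delta x)\<close>. Tested on
  the finite truncations of this vector, the bound on \<open>l\<close> gives partial sums of squares
  at most \<open>C^2\<close>. The representation is exact on finitely supported vectors and extends
  by approximation.\<close>

lemma l2_riesz:
  fixes l :: "('x \<Rightarrow> complex) \<Rightarrow> complex" and A :: "'x set"
  assumes lin: "\<And>v w a. v \<in> Vec (l2 A) \<Longrightarrow> w \<in> Vec (l2 A) \<Longrightarrow> l (\<lambda>i. a * v i + w i) = cnj a * l v + l w"
    and bound: "\<And>v. v \<in> Vec (l2 A) \<Longrightarrow> cmod (l v) \<le> C * vnorm (l2 A) v"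
    and C: "C \<ge> 0"
  defines "r \<equiv> (\<lambda>x. if x \<in> A then l (delta x) else 0)"
  shows "r \<in> Vec (l2 A)" and "vnorm (l2 A) r \<le> C" and "\<And>v. v \<in> Vec (l2 A) \<Longrightarrow> Ip (l2 A) v r = l v"
proof -
  interpret semi_hilbert "l2 A" by (rule semi_hilbert_l2)
  have l0: "l (\<lambda>_. 0) = 0" using bound[OF Vec_zero] by (simp add: vnorm_def Ip_zero_right Vec_zero)
  have lF: "l (\<lambda>y. if y \<in> F then q y else 0) = (\<Sum>x\<in>F. cnj (q x) * r x)" if "finite F" "F \<subseteq> A" for F q
    using that
  proof (induction F)
    case (insert x F)
    have "(\<lambda>y. if y \<in> insert x F then q y else 0) = (\<lambda>i. q x * delta x i + (if i \<in> F then q i else 0))"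
      using insert by (auto simp: delta_def)
    then have "l (\<lambda>y. if y \<in> insert x F then q y else 0) = cnj (q x) * l (delta x) + l (\<lambda>i. if i \<in> F then q i else 0)"
      using insert by (simp add: lin delta_Vec finite_restrict_l2)
    then show ?case using insert by (simp add: r_def)
  qed (simp add: l0)
  \<comment> \<open>For the truncation of \<open>r\<close> to \<open>F\<close>, the value of
    \<open>l\<close> is the squared norm; comparing with \<open>C\<close> times the norm and
    cancelling bounds the norm by \<open>C\<close>.\<close>
  have sumF: "(\<Sum>x\<in>F. (cmod (r x))\<^sup>2) \<le> C\<^sup>2" if F: "finite F" "F \<subseteq> A" for F
  proof -
    let ?v = "\<lambda>y. if y \<in> F then r y else 0"
    have eq: "cnj (r x) * r x = complex_of_real ((cmod (r x))\<^sup>2)" for x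
      by (simp add: complex_norm_square[symmetric] mult.commute del: of_real_power)
    have v: "?v \<in> Vec (l2 A)" using F by (rule finite_restrict_l2)
    have s: "l ?v = complex_of_real (\<Sum>x\<in>F. (cmod (r x))\<^sup>2)" unfolding lF[OF F] eq by simp
    have "Ip (l2 A) ?v ?v = (\<Sum>x\<in>F. cnj (r x) * r x)"
      unfolding finite_restrict_l2(2)[OF F] by (intro sum.cong) auto
    then have n: "(vnorm (l2 A) ?v)\<^sup>2 = (\<Sum>x\<in>F. (cmod (r x))\<^sup>2)"
      using Ip_self[OF v] unfolding eq by (simp only: of_real_eq_iff of_real_sum[symmetric])
    have "cmod (l ?v) = (\<Sum>x\<in>F. (cmod (r x))\<^sup>2)"
      unfolding s norm_of_real by (simp add: sum_nonneg)
    then have "(vnorm (l2 A) ?v)\<^sup>2 \<le> C * vnorm (l2 A) ?v"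
      using bound[OF v] unfolding n by simp
    moreover have n0: "0 \<le> vnorm (l2 A) ?v" using v Ip_nonneg by simp
    ultimately have "vnorm (l2 A) ?v \<le> C"
      using C n0 by (cases "vnorm (l2 A) ?v = 0") (auto simp: power2_eq_square)
    then have "(vnorm (l2 A) ?v)\<^sup>2 \<le> C\<^sup>2" using v Ip_nonneg by (intro power_mono) auto
    then show ?thesis unfolding n .
  qed
  have sr: "(\<lambda>x. (cmod (r x))\<^sup>2) summable_on A"
    by (rule nonneg_bdd_above_summable_on) (auto intro!: bdd_aboveI[of _ "C\<^sup>2"] sumF)
  show r: "r \<in> Vec (l2 A)" using sr by (auto simp: l2_Vec r_def)
  have "(vnorm (l2 A) r)\<^sup>2 \<le> C\<^sup>2"
    unfolding l2_vnorm_sq by (rule infsum_le_finite_sums[OF sr sumF])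
  then show rC: "vnorm (l2 A) r \<le> C" using C by (rule power2_le_imp_le)
  fix v assume v: "v \<in> Vec (l2 A)"
  have sv: "(\<lambda>x. (cmod (v x))\<^sup>2) summable_on A" using v by (simp add: l2_Vec)
  have close: "cmod (l v - Ip (l2 A) v r) \<le> 2 * C * e" if e: "e > 0" for e
  proof -
    obtain F where F: "finite F" "F \<subseteq> A" and d: "dist (\<Sum>x\<in>F. (cmod (v x))\<^sup>2) (\<Sum>\<^sub>\<infinity>x\<in>A. (cmod (v x))\<^sup>2) \<le> e\<^sup>2"
      using infsum_finite_approximation[OF sv, of "e\<^sup>2"] e by auto
    let ?w = "\<lambda>y. if y \<in> F then v y else 0"
    let ?z = "\<lambda>y. v y - ?w y"
    have w: "?w \<in> Vec (l2 A)" using F by (rule finite_restrict_l2)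
    have z: "?z \<in> Vec (l2 A)" using v w by (rule Vec_diff)
    have "(vnorm (l2 A) ?z)\<^sup>2 = (\<Sum>\<^sub>\<infinity>x\<in>A. (cmod (v x))\<^sup>2) - (\<Sum>x\<in>F. (cmod (v x))\<^sup>2)"
    proof -
      have "(vnorm (l2 A) ?z)\<^sup>2 = infsum (\<lambda>x. (cmod (v x))\<^sup>2) (A - F)"
        unfolding l2_vnorm_sq by (intro infsum_cong_neutral) auto
      also have "\<dots> = infsum (\<lambda>x. (cmod (v x))\<^sup>2) A - infsum (\<lambda>x. (cmod (v x))\<^sup>2) F"
      proof -
        have "A = (A - F) \<union> F" using F by auto
        moreover have "infsum (\<lambda>x. (cmod (v x))\<^sup>2) ((A - F) \<union> F) =
            infsum (\<lambda>x. (cmod (v x))\<^sup>2) (A - F) + infsum (\<lambda>x. (cmod (v x))\<^sup>2) F"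
          using sv F by (intro infsum_Un_disjoint summable_on_subset_banach[OF sv]) auto
        ultimately show ?thesis by simp
      qed
      finally show ?thesis using F by simp
    qed
    also have "\<dots> \<le> e\<^sup>2" using d by (simp add: dist_real_def)
    finally have ze: "vnorm (l2 A) ?z \<le> e" using less_imp_le[OF e] by (rule power2_le_imp_le)
    have vz: "v = (\<lambda>i. 1 * ?w i + ?z i)" by auto
    have "l v = l ?w + l ?z" by (subst vz, subst lin[OF w z]) simp
    moreover have "Ip (l2 A) v r = Ip (l2 A) ?w r + Ip (l2 A) ?z r" by (subst vz, subst Ip_lin_left[OF r w z]) simp
    moreover have "l ?w = Ip (l2 A) ?w r" unfolding lF[OF F] finite_restrict_l2(2)[OF F] ..
    ultimately have "cmod (l v - Ip (l2 A) v r) \<le> cmod (l ?z) + cmod (Ip (l2 A) ?z r)"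
      using norm_triangle_ineq4[of "l ?z" "Ip (l2 A) ?z r"] by simp
    also have "\<dots> \<le> C * vnorm (l2 A) ?z + vnorm (l2 A) ?z * vnorm (l2 A) r"
      using bound[OF z] Cauchy_Schwarz[OF z r] by simp
    also have "\<dots> \<le> C * e + e * C"
      using ze rC C r z e Ip_nonneg by (intro add_mono mult_mono) auto
    finally show ?thesis by simp
  qed
  have "cmod (l v - Ip (l2 A) v r) \<le> 0"
  proof (rule field_le_epsilon)
    fix e :: real assume "e > 0"
    \<comment> \<open>The denominator \<open>2 * C + 1\<close> keeps the quotient meaningful when
      \<open>C = 0\<close>.\<close>
    then have "cmod (l v - Ip (l2 A) v r) \<le> 2 * C * (e / (2 * C + 1))" using C by (intro close) auto
    also have "\<dots> \<le> e" using C \<open>e > 0\<close> by (simp add: field_simps)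
    finally show "cmod (l v - Ip (l2 A) v r) \<le> 0 + e" by simp
  qed
  then show "Ip (l2 A) v r = l v" by simp
qed

locale l2_selfadjoint = bounded_selfadjoint "l2 A" T c for A :: "'x set" and T c
begin

text \<open>This is \<open>f(T) w\<close>: the Riesz vector of the conjugate linear functional
  \<open>v \<mapsto> Q v w f\<close>, given by its coordinates.\<close>

definition fun_op :: "(real \<Rightarrow> complex) \<Rightarrow> 'x operator" where
  "fun_op f w = (\<lambda>x. if x \<in> A then Q (delta x) w f else 0)"

lemma fun_op:
  assumes f: "f \<in> bdd_borel" "\<And>t. cmod (f t) \<le> C" and w: "w \<in> Vec (l2 A)"
  shows fun_op_Vec: "fun_op f w \<in> Vec (l2 A)"
    and fun_op_norm: "vnorm (l2 A) (fun_op f w) \<le> 4 * C * vnorm (l2 A) w"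
    and fun_op_Ip: "v \<in> Vec (l2 A) \<Longrightarrow> Ip (l2 A) v (fun_op f w) = Q v w f"
proof -
  have C: "C \<ge> 0" using f(2)[of 0] norm_ge_zero order_trans by blast
  have lin: "Q (\<lambda>i. a * v i + w' i) w f = cnj a * Q v w f + Q w' w f"
    if "v \<in> Vec (l2 A)" "w' \<in> Vec (l2 A)" for v w' a
    using that w f by (intro Q_lin_left)
  have bound: "cmod (Q v w f) \<le> 4 * C * vnorm (l2 A) w * vnorm (l2 A) v" if "v \<in> Vec (l2 A)" for v
    using Q_bound[OF that w f] by (simp add: mult_ac)
  have pos: "0 \<le> 4 * C * vnorm (l2 A) w" using C w Ip_nonneg by simp
  show "fun_op f w \<in> Vec (l2 A)"
    unfolding fun_op_def using lin bound pos by (rule l2_riesz(1)[where l="\<lambda>v. Q v w f" and C="4 * C * vnorm (l2 A) w"])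
  show "vnorm (l2 A) (fun_op f w) \<le> 4 * C * vnorm (l2 A) w"
    unfolding fun_op_def using lin bound pos by (rule l2_riesz(2)[where l="\<lambda>v. Q v w f" and C="4 * C * vnorm (l2 A) w"])
  show "Ip (l2 A) v (fun_op f w) = Q v w f" if "v \<in> Vec (l2 A)"
    unfolding fun_op_def using lin bound pos that by (rule l2_riesz(3)[where l="\<lambda>v. Q v w f" and C="4 * C * vnorm (l2 A) w"])
qed

lemma is_spectral_family_fun_op: "is_spectral_family (l2 A) T (\<lambda>B. fun_op (indicator B))"
  by (rule spectral_familyI) (auto intro!: fun_op_Vec fun_op_Ip split: split_indicator)

lemma scalar_spectral_measure_l2:
  "v \<in> Vec (l2 A) \<Longrightarrow> scalar_spectral_measure (l2 A) (spectral_family (l2 A) T) v = spec v"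
  unfolding spectral_family_def
  by (intro projection_measure_unique someI[where P="is_spectral_family (l2 A) T", OF is_spectral_family_fun_op])

text \<open>The functional calculus is a choice of an operator by its quadratic form, so exhibiting
  \<open>fun_op\<close> as one bounded operator with this form suffices. The diagonal entries, which
  are all that the trace uses, are values of the form.\<close>

lemma functional_calculus_l2:
  assumes "\<phi> \<in> bdd_borel" and v: "v \<in> Vec (l2 A)"
  shows "Ip (l2 A) v (functional_calculus (l2 A) T \<phi> v) = (LINT t|spec v. \<phi> t)"
proof -
  obtain C where C: "\<And>t. cmod (\<phi> t) \<le> C" using assms by (metis bdd_borel_bound)
  note op = fun_op[OF assms(1) C]
  have "operator_bounded_by (l2 A) (4 * C) (fun_op \<phi>)"
    unfolding operator_bounded_by_def
  proof (intro conjI ballI allI op(1,2))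
    fix v w a assume v: "v \<in> Vec (l2 A)" and w: "w \<in> Vec (l2 A)"
    then show "veq (l2 A) (fun_op \<phi> (\<lambda>i. a * v i + w i)) (\<lambda>i. a * fun_op \<phi> v i + fun_op \<phi> w i)"
      by (subst veq_iff) (auto simp: op Vec_lin Ip_lin Q_lin assms)
  qed
  then have "(\<exists>c. operator_bounded_by (l2 A) c (fun_op \<phi>)) \<and>
     (\<forall>v\<in>Vec (l2 A). Ip (l2 A) v (fun_op \<phi> v) =
        (LINT t|scalar_spectral_measure (l2 A) (spectral_family (l2 A) T) v. \<phi> t))"
    using assms by (auto simp: op Q_self scalar_spectral_measure_l2)
  from someI[of "\<lambda>S. (\<exists>c. operator_bounded_by (l2 A) c S) \<and> (\<forall>v\<in>Vec (l2 A). Ip (l2 A) v (S v) =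
        (LINT t|scalar_spectral_measure (l2 A) (spectral_family (l2 A) T) v. \<phi> t))", OF this]
  show ?thesis unfolding functional_calculus_def using v by (auto simp: scalar_spectral_measure_l2)
qed

lemma l2_trace_functional_calculus:
  assumes "\<phi> \<in> bdd_borel"
  shows "l2_trace A (\<lambda>v x. u x * functional_calculus (l2 A) T \<phi> v x) =
    (\<Sum>\<^sub>\<infinity>x\<in>A. u x * (LINT t|spec (delta x). \<phi> t))"
  unfolding l2_trace_def Let_def delta_def[symmetric]
proof (rule infsum_cong)
  fix x assume x: "x \<in> A"
  let ?S = "functional_calculus (l2 A) T \<phi>"
  have "Ip (l2 A) (delta x) (?S (delta x)) = ?S (delta x) x" using x by (rule l2_Ip_delta)
  then show "Ip (l2 A) (delta x) (\<lambda>y. u y * ?S (delta x) y) = u x * (LINT t|spec (delta x). \<phi> t)"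
    using functional_calculus_l2[OF assms delta_Vec[OF x]] by (simp add: l2_Ip_delta[OF x])
qed

end

section \<open>Fibre operators with Hermitian matrices\<close>

lemma fiber_op_delta:
  "x \<in> fst \<omega> \<Longrightarrow> y \<in> fst \<omega> \<Longrightarrow> fiber_op \<iota> \<omega> (delta y) x = hopping \<iota> \<omega> x y"
proof -
  assume x: "x \<in> fst \<omega>" and y: "y \<in> fst \<omega>"
  have "fiber_op \<iota> \<omega> (delta y) x = (\<Sum>\<^sub>\<infinity>z\<in>fst \<omega>. hopping \<iota> \<omega> x z * (if z = y then 1 else 0))"
    using x by (simp add: fiber_op_def delta_def)
  also have "\<dots> = infsum (\<lambda>z. hopping \<iota> \<omega> x z) {y}"
    using y by (intro infsum_cong_neutral) auto
  finally show ?thesis by simp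
qed

text \<open>For fixed \<open>w\<close> the functional
  \<open>v \<mapsto> \<langle>T v, w\<rangle>\<close> is bounded and conjugate linear. Its Riesz
  vector has at \<open>y\<close> the coordinate \<open>\<langle>T (delta y), w\<rangle>\<close>, and
  Hermitian symmetry of the matrix turns this sum into \<open>(T w) y\<close>. No double sum has to
  be interchanged.\<close>

lemma l2_selfadjoint_fiber_op:
  assumes bounded: "operator_bounded_by (l2 (fst \<omega>)) c (fiber_op \<iota> \<omega>)" and c: "c > 0"
    and sym: "\<And>x y. x \<in> fst \<omega> \<Longrightarrow> y \<in> fst \<omega> \<Longrightarrow> hopping \<iota> \<omega> x y = cnj (hopping \<iota> \<omega> y x)"
  shows "l2_selfadjoint (fst \<omega>) (fiber_op \<iota> \<omega>) c"
proof -
  interpret semi_hilbert "l2 (fst \<omega>)" by (rule semi_hilbert_l2)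
  let ?A = "fst \<omega>" and ?T = "fiber_op \<iota> \<omega>"
  have TV: "?T v \<in> Vec (l2 ?A)" "vnorm (l2 ?A) (?T v) \<le> c * vnorm (l2 ?A) v" if "v \<in> Vec (l2 ?A)" for v
    using bounded that unfolding operator_bounded_by_def by auto
  have T_lin: "veq (l2 ?A) (?T (\<lambda>i. a * v i + w i)) (\<lambda>i. a * ?T v i + ?T w i)"
    if "v \<in> Vec (l2 ?A)" "w \<in> Vec (l2 ?A)" for v w a
    using bounded that unfolding operator_bounded_by_def by auto
  show ?thesis
  proof (unfold_locales, rule bounded)
    fix v w assume v: "v \<in> Vec (l2 ?A)" and w: "w \<in> Vec (l2 ?A)"
    let ?l = "\<lambda>v. Ip (l2 ?A) (?T v) w"
    have lin: "?l (\<lambda>i. a * u i + v i) = cnj a * ?l u + ?l v" if u: "u \<in> Vec (l2 ?A)" and v: "v \<in> Vec (l2 ?A)" for u v a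
    proof -
      have "?T (\<lambda>i. a * u i + v i) = (\<lambda>i. a * ?T u i + ?T v i)"
        by (rule l2_veq[OF TV(1)[OF Vec_lin[OF u v]] Vec_lin[OF TV(1)[OF u] TV(1)[OF v]] T_lin[OF u v]])
      then show ?thesis using u v w by (simp add: Ip_lin_left TV)
    qed
    have bound: "cmod (?l u) \<le> c * vnorm (l2 ?A) w * vnorm (l2 ?A) u" if u: "u \<in> Vec (l2 ?A)" for u
    proof -
      have "cmod (?l u) \<le> vnorm (l2 ?A) (?T u) * vnorm (l2 ?A) w" by (rule Cauchy_Schwarz[OF TV(1)[OF u] w])
      also have "\<dots> \<le> (c * vnorm (l2 ?A) u) * vnorm (l2 ?A) w"
        using TV(2)[OF u] w Ip_nonneg by (intro mult_right_mono) auto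
      finally show ?thesis by (simp add: mult_ac)
    qed
    have pos: "0 \<le> c * vnorm (l2 ?A) w" using c w Ip_nonneg by simp
    have eq: "(\<lambda>x. if x \<in> ?A then ?l (delta x) else 0) = ?T w"
    proof
      fix y
      show "(if y \<in> ?A then ?l (delta y) else 0) = ?T w y"
      proof (cases "y \<in> ?A")
        case True
        have "?l (delta y) = (\<Sum>\<^sub>\<infinity>x\<in>?A. hopping \<iota> \<omega> y x * w x)"
          unfolding l2_Ip using True by (intro infsum_cong) (simp add: fiber_op_delta sym[of _ y])
        then show ?thesis using True by (simp add: fiber_op_def)
      qed (simp add: fiber_op_def)
    qed
    have "Ip (l2 ?A) v (\<lambda>x. if x \<in> ?A then ?l (delta x) else 0) = ?l v"
    proof (rule l2_riesz(3)[where l="?l" and C="c * vnorm (l2 ?A) w"])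
      show "?l (\<lambda>i. a * u i + v i) = cnj a * ?l u + ?l v" if "u \<in> Vec (l2 ?A)" "v \<in> Vec (l2 ?A)" for u v a
        using that by (rule lin)
      show "cmod (?l u) \<le> c * vnorm (l2 ?A) w * vnorm (l2 ?A) u" if "u \<in> Vec (l2 ?A)" for u
        using that by (rule bound)
    qed (rule pos, rule v)
    then show "Ip (l2 ?A) (?T v) w = Ip (l2 ?A) v (?T w)" unfolding eq by simp
  qed (rule c)
qed

section \<open>Compactness of the space of marked sets\<close>

definition has_fip :: "'a set set \<Rightarrow> bool" where
  "has_fip S \<longleftrightarrow> (\<forall>G. finite G \<longrightarrow> G \<subseteq> S \<longrightarrow> \<Inter>G \<noteq> {})"

lemma has_fipD: "has_fip S \<Longrightarrow> finite G \<Longrightarrow> G \<subseteq> S \<Longrightarrow> \<Inter>G \<noteq> {}"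
  unfolding has_fip_def by (elim allE impE)

locale set_ultrafilter =
  fixes U :: "'a set set"
  assumes Int: "A \<in> U \<Longrightarrow> B \<in> U \<Longrightarrow> A \<inter> B \<in> U"
    and mono: "A \<in> U \<Longrightarrow> A \<subseteq> B \<Longrightarrow> B \<in> U"
    and ultra: "A \<in> U \<or> - A \<in> U"
    and nonempty: "{} \<notin> U"

text \<open>Zorn's lemma gives a maximal family with the finite intersection property. By maximality
  a set outside it is disjoint from some finite intersection of members (\<open>ex\<close>), and
  each ultrafilter axiom follows by combining such finite intersections.\<close>

lemma set_ultrafilter_exists:
  assumes "has_fip S"
  obtains U where "set_ultrafilter U" "S \<subseteq> U"
proof -
  let ?\<A> = "{G. S \<subseteq> G \<and> has_fip G}"
  have "\<exists>M\<in>?\<A>. \<forall>X\<in>?\<A>. M \<subseteq> X \<longrightarrow> X = M"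
  proof (rule subset_Zorn_nonempty)
    show "?\<A> \<noteq> {}" using assms by auto
    fix \<C> assume \<C>: "\<C> \<noteq> {}" "subset.chain ?\<A> \<C>"
    then have sub: "\<C> \<subseteq> ?\<A>" by (simp add: subset_chain_def)
    have "has_fip (\<Union>\<C>)"
      unfolding has_fip_def
    proof (intro allI impI)
      fix G assume G: "finite G" "G \<subseteq> \<Union>\<C>"
      show "\<Inter>G \<noteq> {}"
      proof (rule finite_subset_Union_chain[OF G \<C>])
        fix C assume C: "C \<in> \<C>" "G \<subseteq> C"
        from sub C(1) have "C \<in> ?\<A>" by (rule subsetD)
        then have "has_fip C" by simp
        then show "\<Inter>G \<noteq> {}" using G(1) C(2) by (rule has_fipD)
      qed
    qed
    moreover have "S \<subseteq> \<Union>\<C>"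
    proof -
      obtain C where C: "C \<in> \<C>" using \<C>(1) by (meson ex_in_conv)
      from sub C have "C \<in> ?\<A>" by (rule subsetD)
      then have "S \<subseteq> C" by simp
      then show ?thesis using C by (meson Union_upper order_trans)
    qed
    ultimately show "\<Union>\<C> \<in> ?\<A>" by simp
  qed
  then obtain M where M': "M \<in> ?\<A>" "\<forall>X\<in>?\<A>. M \<subseteq> X \<longrightarrow> X = M" by (elim bexE)
  then have M: "S \<subseteq> M" "has_fip M" and max: "\<And>X. S \<subseteq> X \<Longrightarrow> has_fip X \<Longrightarrow> M \<subseteq> X \<Longrightarrow> X = M"
    by simp_all
  have ex: "\<exists>G. finite G \<and> G \<subseteq> M \<and> A \<inter> \<Inter>G = {}" if "A \<notin> M" for A
  proof -
    have "S \<subseteq> insert A M" using M(1) by (rule subset_insertI2)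
    then have "\<not> has_fip (insert A M)" using max[of "insert A M"] that by (metis insertI1 subset_insertI)
    then obtain G where G: "finite G" "G \<subseteq> insert A M" "\<Inter>G = {}" unfolding has_fip_def by metis
    have "A \<inter> \<Inter>(G - {A}) = {}" using G(3) by blast
    then show ?thesis using G by (intro exI[of _ "G - {A}"]) auto
  qed
  have fip: "\<Inter>G \<noteq> {}" if "finite G" "G \<subseteq> M" for G
    using M(2) that by (rule has_fipD)
  have "set_ultrafilter M"
  proof
    fix A B assume A: "A \<in> M"
    show "A \<inter> B \<in> M" if B: "B \<in> M"
    proof (rule ccontr)
      assume "A \<inter> B \<notin> M"
      from ex[OF this] obtain G where G: "finite G" "G \<subseteq> M" "A \<inter> B \<inter> \<Inter>G = {}" by (elim exE conjE)
      have "\<Inter>(insert A (insert B G)) \<noteq> {}" using A B G(1,2) by (intro fip) simp_all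
      then show False using G(3) by (simp add: Int_assoc)
    qed
    show "B \<in> M" if B: "A \<subseteq> B"
    proof (rule ccontr)
      assume "B \<notin> M"
      from ex[OF this] obtain G where G: "finite G" "G \<subseteq> M" "B \<inter> \<Inter>G = {}" by (elim exE conjE)
      have "\<Inter>(insert A G) \<noteq> {}" using A G(1,2) by (intro fip) simp_all
      then show False using G(3) B by auto
    qed
  next
    fix A
    show "A \<in> M \<or> - A \<in> M"
    proof (rule ccontr)
      assume "\<not> (A \<in> M \<or> - A \<in> M)"
      then have nA: "A \<notin> M" "- A \<notin> M" by simp_all
      from ex[OF nA(1)] obtain G where G: "finite G" "G \<subseteq> M" "A \<inter> \<Inter>G = {}" by (elim exE conjE)
      from ex[OF nA(2)] obtain H where H: "finite H" "H \<subseteq> M" "- A \<inter> \<Inter>H = {}" by (elim exE conjE)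
      have "\<Inter>(G \<union> H) \<noteq> {}" using G(1,2) H(1,2) by (intro fip) simp_all
      moreover have "\<Inter>G \<subseteq> - A" "\<Inter>H \<subseteq> A" using G(3) H(3) by auto
      ultimately show False by auto
    qed
  next
    show "{} \<notin> M"
    proof
      assume "{} \<in> M"
      then have "\<Inter>{{}} \<noteq> ({} :: 'a set)" by (intro fip) simp_all
      then show False by simp
    qed
  qed
  then show ?thesis using M(1) by (rule that)
qed

text \<open>A family of closed sets with the finite intersection property lies in an ultrafilter.
  Its limit belongs to each closed \<open>C\<close> of the family, because otherwise both
  \<open>C\<close> and its complement would be members.\<close>

lemma compact_space_ultrafilterI:
  assumes "\<And>U. set_ultrafilter U \<Longrightarrow> topspace T \<in> U \<Longrightarrow> \<exists>x\<in>topspace T. \<forall>W. openin T W \<longrightarrow> x \<in> W \<longrightarrow> W \<in> U"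
  shows "compact_space T"
  unfolding compact_space_fip
proof (intro allI impI)
  fix \<U> assume \<U>: "(\<forall>C\<in>\<U>. closedin T C) \<and> (\<forall>\<F>. finite \<F> \<and> \<F> \<subseteq> \<U> \<longrightarrow> \<Inter>\<F> \<noteq> {})"
  show "\<Inter>\<U> \<noteq> {}"
  proof (cases "\<U> = {}")
    case False
    then obtain C0 where C0: "C0 \<in> \<U>" by blast
    have "has_fip \<U>" using conjunct2[OF \<U>] unfolding has_fip_def by simp
    then obtain U where U: "set_ultrafilter U" "\<U> \<subseteq> U" by (rule set_ultrafilter_exists)
    interpret set_ultrafilter U by fact
    have "closedin T C0" using bspec[OF conjunct1[OF \<U>] C0] .
    then have "C0 \<subseteq> topspace T" by (rule closedin_subset)
    then have top: "topspace T \<in> U" using subsetD[OF U(2) C0] by (rule mono[rotated])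
    from assms[OF U(1) top] obtain x where "x \<in> topspace T" "\<forall>W. openin T W \<longrightarrow> x \<in> W \<longrightarrow> W \<in> U"
      by (elim bexE)
    then have x: "x \<in> topspace T" "\<And>W. openin T W \<Longrightarrow> x \<in> W \<Longrightarrow> W \<in> U" by simp_all
    have "x \<in> C" if C: "C \<in> \<U>" for C
    proof (rule ccontr)
      assume "x \<notin> C"
      have "closedin T C" using C conjunct1[OF \<U>] by simp
      then have "topspace T - C \<in> U" using x(1) \<open>x \<notin> C\<close> by (intro x(2)) auto
      then have "(topspace T - C) \<inter> C \<in> U" using subsetD[OF U(2) C] by (rule Int)
      moreover have "(topspace T - C) \<inter> C = {}" by auto
      ultimately show False using nonempty by simp
    qed
    then have "x \<in> \<Inter>\<U>" by (rule InterI)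
    then show ?thesis by auto
  qed simp
qed

text \<open>A ball of radius 1/2 contains at most one point of a separated set. The size of one
  finite cover of \<open>K\<close> by such balls therefore bounds all configurations at once, which
  is what makes the intensity locally finite.\<close>

lemma separated_sets_card_compact:
  fixes K :: "'x::metric_space set"
  assumes "compact K"
  obtains N where "\<And>A. A \<in> separated_sets \<Longrightarrow> finite (A \<inter> K) \<and> card (A \<inter> K) \<le> N"
proof -
  have "K \<subseteq> (\<Union>x\<in>K. ball x (1/2))" by auto
  then obtain k where k: "k \<subseteq> K" "finite k" "K \<subseteq> (\<Union>x\<in>k. ball x (1/2))"
    using compactE_image[OF assms, of K "\<lambda>x. ball x (1/2)"] by auto
  have "finite (A \<inter> K) \<and> card (A \<inter> K) \<le> card k" if A: "A \<in> separated_sets" for A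
  proof -
    have "\<forall>z\<in>A \<inter> K. \<exists>x\<in>k. z \<in> ball x (1/2)" using k(3) by blast
    then obtain c where c: "\<And>z. z \<in> A \<inter> K \<Longrightarrow> c z \<in> k \<and> z \<in> ball (c z) (1/2)" by metis
    have "inj_on c (A \<inter> K)"
    proof (rule inj_onI)
      fix z z' assume z: "z \<in> A \<inter> K" "z' \<in> A \<inter> K" "c z = c z'"
      have "dist z z' \<le> dist (c z) z + dist (c z) z'" by (metis dist_triangle3 dist_commute)
      also have "\<dots> < 1" using c[OF z(1)] c[OF z(2)] z(3) by auto
      finally show "z = z'" using A z unfolding separated_sets_def by force
    qed
    moreover have "c ` (A \<inter> K) \<subseteq> k" using c by auto
    ultimately show ?thesis using k(2) by (meson card_inj_on_le inj_on_finite)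
  qed
  then show ?thesis using that by blast
qed

lemma separated_sets_finite: "compact K \<Longrightarrow> A \<in> separated_sets \<Longrightarrow> finite (A \<inter> K)"
  by (metis separated_sets_card_compact)

lemma separated_sets_eq: "A \<in> separated_sets \<Longrightarrow> x \<in> A \<Longrightarrow> y \<in> A \<Longrightarrow> dist x y < 1 \<Longrightarrow> x = y"
  unfolding separated_sets_def by force

section \<open>The vague topology on marked sets\<close>

lemma Cc_zero: "(\<lambda>_. 0) \<in> Cc T"
  unfolding Cc_def by (auto intro: exI[of _ "{}"])

lemma topspace_vague [simp]: "topspace (vague_topology Y) = marked_sets Y"
proof -
  have "marked_sets Y \<subseteq> topspace (vague_topology Y)"
  proof -
    have "marked_sets Y \<in> {{(A, f). (A, f) \<in> marked_sets Y \<and> (\<Sum>\<^sub>\<infinity>x\<in>A. \<phi> (x, f x)) \<in> U} |\<phi> U.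
        \<phi> \<in> Cc (prod_topology euclidean Y) \<and> open U}"
      by (intro CollectI exI[of _ "\<lambda>_. 0"] exI[of _ UNIV]) (auto simp: Cc_zero)
    then show ?thesis unfolding vague_topology_def topology_generated_by_topspace by blast
  qed
  then show ?thesis unfolding vague_topology_def topology_generated_by_topspace by blast
qed

lemma continuous_map_vague:
  assumes "\<phi> \<in> Cc (prod_topology euclidean Y)"
  shows "continuous_map (vague_topology Y) euclidean (\<lambda>(A, f). \<Sum>\<^sub>\<infinity>x\<in>A. \<phi> (x, f x))"
  unfolding continuous_map_def
proof (intro conjI allI impI)
  fix U :: "complex set" assume "openin euclidean U"
  then have "open U" by simp
  have "{p \<in> topspace (vague_topology Y). (case p of (A, f) \<Rightarrow> \<Sum>\<^sub>\<infinity>x\<in>A. \<phi> (x, f x)) \<in> U}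
     = {(A, f). (A, f) \<in> marked_sets Y \<and> (\<Sum>\<^sub>\<infinity>x\<in>A. \<phi> (x, f x)) \<in> U}" by auto
  moreover have "openin (vague_topology Y) \<dots>"
    unfolding vague_topology_def using assms \<open>open U\<close> by (intro topology_generated_by_Basis) blast
  ultimately show "openin (vague_topology Y) {p \<in> topspace (vague_topology Y). (case p of (A, f) \<Rightarrow> \<Sum>\<^sub>\<infinity>x\<in>A. \<phi> (x, f x)) \<in> U}"
    by simp
qed simp

text \<open>
  Along an ultrafilter, the limit consists of the points of \<open>X \<times> Y\<close> each neighbourhood of which
  is eventually visited by the graphs.
\<close>

lemma compact_space_vague:
  fixes Y :: "'y topology"
  assumes Y: "Hausdorff_space Y"
  shows "compact_space (vague_topology Y :: ('x::metric_space set \<times> ('x \<Rightarrow> 'y)) topology)"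
proof (rule compact_space_ultrafilterI)
  fix U :: "('x set \<times> ('x \<Rightarrow> 'y)) set set"
  assume "set_ultrafilter U" and top: "topspace (vague_topology Y) \<in> U"
  interpret set_ultrafilter U by fact
  let ?P = "prod_topology euclidean Y :: ('x \<times> 'y) topology"
  \<comment> \<open>\<open>hit W\<close> collects the marked sets whose graph meets
    \<open>W\<close>; membership of \<open>hit W\<close> in the ultrafilter means that the graphs
    eventually visit \<open>W\<close>.\<close>
  define hit :: "('x \<times> 'y) set \<Rightarrow> ('x set \<times> ('x \<Rightarrow> 'y)) set"
    where "hit W = {\<omega>. \<exists>x\<in>fst \<omega>. (x, snd \<omega> x) \<in> W}" for W
  have marked: "marked_sets Y \<in> U" using top by simp
  have ex: "\<exists>\<omega>. \<omega> \<in> S" if "S \<in> U" for S using that nonempty by (metis ex_in_conv)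
  define B where "B = {p \<in> topspace ?P. \<forall>W. openin ?P W \<longrightarrow> p \<in> W \<longrightarrow> hit W \<in> U}"
  have open_ball: "openin ?P (ball x e \<times> V)" if "openin Y V" for x e V
    using that by (simp add: openin_prod_Times_iff)
  have B_unique: "x = x' \<and> y = y'" if B: "(x, y) \<in> B" "(x', y') \<in> B" and d: "dist x x' < 1" for x x' y y'
  proof -
    have x: "x = x'"
    proof (rule ccontr)
      assume "x \<noteq> x'"
      \<comment> \<open>Points of one configuration within \<open>e\<close> of \<open>x\<close> and
        of \<open>x'\<close> have distance below \<open>dist x x' + 2 * e \<le> 1\<close>, so they
        coincide; then \<open>dist x x' < 2 * e \<le> dist x x'\<close>, a contradiction.\<close>
      define e where "e = min (dist x x' / 2) ((1 - dist x x') / 2)"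
      have e: "e > 0" using \<open>x \<noteq> x'\<close> d unfolding e_def by simp
      have "hit (ball x e \<times> topspace Y) \<in> U" "hit (ball x' e \<times> topspace Y) \<in> U"
        using B e open_ball[of "topspace Y"] unfolding B_def by auto
      then have "hit (ball x e \<times> topspace Y) \<inter> (hit (ball x' e \<times> topspace Y) \<inter> marked_sets Y) \<in> U"
        using marked by (intro Int)
      then obtain \<omega> where \<omega>: "\<omega> \<in> hit (ball x e \<times> topspace Y)" "\<omega> \<in> hit (ball x' e \<times> topspace Y)" "\<omega> \<in> marked_sets Y"
        using ex by blast
      obtain z z' where z: "z \<in> fst \<omega>" "dist x z < e" "z' \<in> fst \<omega>" "dist x' z' < e"
        using \<omega>(1,2) unfolding hit_def by auto
      have A: "fst \<omega> \<in> separated_sets" using \<omega>(3) unfolding marked_sets_def by auto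
      have "dist z z' \<le> dist x z + dist x x' + dist x' z'"
        by (smt (verit) dist_commute dist_triangle)
      also have "\<dots> < 1" using z unfolding e_def by (auto simp: min_def field_simps split: if_splits)
      finally have "z = z'" using A z by (intro separated_sets_eq) auto
      then have "dist x x' < 2 * e" using z by (smt (verit) dist_commute dist_triangle)
      then show False unfolding e_def by (simp add: min_def split: if_splits)
    qed
    moreover have "y = y'"
    proof (rule ccontr)
      assume "y \<noteq> y'"
      moreover have "y \<in> topspace Y" "y' \<in> topspace Y" using B unfolding B_def by auto
      ultimately obtain V V' where V: "openin Y V" "openin Y V'" "y \<in> V" "y' \<in> V'" "disjnt V V'"
        using Y unfolding Hausdorff_space_def by blast
      have "hit (ball x (1/2) \<times> V) \<in> U" "hit (ball x (1/2) \<times> V') \<in> U"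
        using B V open_ball x unfolding B_def by auto
      then have "hit (ball x (1/2) \<times> V) \<inter> (hit (ball x (1/2) \<times> V') \<inter> marked_sets Y) \<in> U"
        using marked by (intro Int)
      then obtain \<omega> where \<omega>: "\<omega> \<in> hit (ball x (1/2) \<times> V)" "\<omega> \<in> hit (ball x (1/2) \<times> V')" "\<omega> \<in> marked_sets Y"
        using ex by blast
      obtain z z' where z: "z \<in> fst \<omega>" "dist x z < 1/2" "snd \<omega> z \<in> V" "z' \<in> fst \<omega>" "dist x z' < 1/2" "snd \<omega> z' \<in> V'"
        using \<omega>(1,2) unfolding hit_def by auto
      have A: "fst \<omega> \<in> separated_sets" using \<omega>(3) unfolding marked_sets_def by auto
      have "dist z z' \<le> dist x z + dist x z'" by (rule dist_triangle3)
      also have "\<dots> < 1" using z by simp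
      finally have "z = z'" using A z by (intro separated_sets_eq) auto
      then show False using z V by (auto simp: disjnt_iff)
    qed
    ultimately show ?thesis ..
  qed
  define A where "A = fst ` B"
  define f where "f = (\<lambda>x\<in>A. THE y. (x, y) \<in> B)"
  have fB: "y = f x" "x \<in> A" if "(x, y) \<in> B" for x y
  proof -
    show x: "x \<in> A" using that unfolding A_def by force
    show "y = f x" unfolding f_def using x that B_unique
      by (auto intro!: the_equality[symmetric])
  qed
  have fA: "(x, f x) \<in> B" if "x \<in> A" for x using that fB unfolding A_def by auto
  have sep: "A \<in> separated_sets"
    unfolding separated_sets_def by (auto simp: not_less[symmetric] dest: B_unique[OF fA fA])
  have limit: "(A, f) \<in> marked_sets Y"
    unfolding marked_sets_def using sep fA unfolding B_def f_def by auto
  have conv: "{(A, f). (A, f) \<in> marked_sets Y \<and> (\<Sum>\<^sub>\<infinity>x\<in>A. \<phi> (x, f x)) \<in> G} \<in> U"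
    if \<phi>: "\<phi> \<in> Cc ?P" and G: "open G" "(\<Sum>\<^sub>\<infinity>x\<in>A. \<phi> (x, f x)) \<in> G" for \<phi> G
  proof -
    obtain K where K: "compactin ?P K" "\<And>p. p \<in> topspace ?P - K \<Longrightarrow> \<phi> p = 0" and cont: "continuous_map ?P euclidean \<phi>"
      using \<phi> unfolding Cc_def by auto
    have Ktop: "K \<subseteq> topspace ?P" using K compactin_subset_topspace by blast
    have "compactin euclidean (fst ` K)"
      using image_compactin[OF K(1) continuous_map_fst] .
    then have K1: "compact (fst ` K)" by (simp add: compactin_euclidean_iff)
    define F where "F = A \<inter> fst ` K"
    have finF: "finite F" unfolding F_def using K1 sep by (rule separated_sets_finite)
    obtain \<epsilon> where \<epsilon>: "\<epsilon> > 0" "ball (\<Sum>\<^sub>\<infinity>x\<in>A. \<phi> (x, f x)) \<epsilon> \<subseteq> G"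
      using G open_contains_ball by blast
    \<comment> \<open>The sum has at most \<open>card F\<close> terms, each off by at most \<delta>.
      The extra 1 makes the total strictly smaller than \<epsilon> and covers an empty
      \<open>F\<close>.\<close>
    define \<delta> where "\<delta> = \<epsilon> / (real (card F) + 1)"
    have \<delta>: "\<delta> > 0" unfolding \<delta>_def using \<epsilon> by simp
    \<comment> \<open>Radius 1/4 forces two points of a configuration seen from the same
      \<open>x\<close> to coincide, and likewise two limit points that share a nearby point.\<close>
    define W where "W x = {p \<in> topspace ?P. \<phi> p \<in> ball (\<phi> (x, f x)) \<delta>} \<inter> (ball x (1/4) \<times> topspace Y)" for x
    have W_open: "openin ?P (W x)" for x
      unfolding W_def using cont by (intro openin_Int open_ball openin_continuous_map_preimage[OF cont]) auto
    have xW: "(x, f x) \<in> W x" if "x \<in> A" for x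
      using fA[OF that] \<delta> unfolding W_def B_def by auto
    have hitW: "hit (W x) \<in> U" if "x \<in> F" for x
      using fA[of x] xW[of x] W_open[of x] that unfolding B_def F_def by blast
    define K' where "K' = K - (\<Union>x\<in>F. W x)"
    have "compactin ?P K'"
    proof -
      have "K' = (topspace ?P - (\<Union>x\<in>F. W x)) \<inter> K" unfolding K'_def using Ktop by auto
      moreover have "openin ?P (\<Union>x\<in>F. W x)" using W_open by (intro openin_Union) auto
      then have "closedin ?P (topspace ?P - (\<Union>x\<in>F. W x))" by (intro closedin_diff closedin_topspace)
      ultimately show ?thesis using K(1) by (simp only: closed_Int_compactin)
    qed
    \<comment> \<open>A point of \<open>K'\<close> is not a limit point, so it has a neighbourhood
      that the graphs eventually avoid. By compactness finitely many of these cover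
      \<open>K'\<close>, and eventually no point outside the \<open>W x\<close> contributes to the
      sum.\<close>
    moreover have "K' \<subseteq> \<Union>{W'. openin ?P W' \<and> - hit W' \<in> U}"
    proof
      fix q assume q: "q \<in> K'"
      obtain x y where xy: "q = (x, y)" by fastforce
      have "q \<notin> B"
      proof
        assume "q \<in> B"
        then have "x \<in> A" "y = f x" using fB xy by auto
        moreover have "x \<in> fst ` K" using q xy unfolding K'_def by force
        ultimately show False using q xW xy unfolding K'_def F_def by auto
      qed
      then obtain W' where "openin ?P W'" "q \<in> W'" "hit W' \<notin> U"
        using q Ktop unfolding B_def K'_def by blast
      then show "q \<in> \<Union>{W'. openin ?P W' \<and> - hit W' \<in> U}" using ultra by blast
    qed
    ultimately obtain \<F> where \<F>: "finite \<F>" "\<F> \<subseteq> {W'. openin ?P W' \<and> - hit W' \<in> U}" "K' \<subseteq> \<Union>\<F>"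
      using compactinD[of ?P K' "{W'. openin ?P W' \<and> - hit W' \<in> U}"] by blast
    have fin_Int': "(\<Inter>i\<in>I. S i) \<in> U" if "finite I" "\<And>i. i \<in> I \<Longrightarrow> S i \<in> U" for I :: "('x \<times> 'y) set set" and S
      using that
    proof (induction I)
      case empty
      then show ?case using mono[OF marked] by auto
    qed (auto intro: Int)
    have fin_Int'': "(\<Inter>i\<in>I. S i) \<in> U" if "finite I" "\<And>i. i \<in> I \<Longrightarrow> S i \<in> U" for I :: "'x set" and S
      using that
    proof (induction I)
      case empty
      then show ?case using mono[OF marked] by auto
    qed (auto intro: Int)
    have "(\<Inter>W'\<in>\<F>. - hit W') \<inter> ((\<Inter>x\<in>F. hit (W x)) \<inter> marked_sets Y) \<in> U"
      using \<F> finF hitW marked by (intro Int fin_Int' fin_Int'') auto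
    then show ?thesis
    proof (rule mono)
      show "(\<Inter>W'\<in>\<F>. - hit W') \<inter> ((\<Inter>x\<in>F. hit (W x)) \<inter> marked_sets Y)
        \<subseteq> {(A, f). (A, f) \<in> marked_sets Y \<and> (\<Sum>\<^sub>\<infinity>x\<in>A. \<phi> (x, f x)) \<in> G}"
      proof
        fix \<omega> assume \<omega>: "\<omega> \<in> (\<Inter>W'\<in>\<F>. - hit W') \<inter> ((\<Inter>x\<in>F. hit (W x)) \<inter> marked_sets Y)"
        obtain A' f' where \<omega>eq: "\<omega> = (A', f')" by fastforce
        have A': "A' \<in> separated_sets" "\<And>z. z \<in> A' \<Longrightarrow> f' z \<in> topspace Y"
          using \<omega> \<omega>eq unfolding marked_sets_def by auto
        have "\<forall>x\<in>F. \<exists>z\<in>A'. (z, f' z) \<in> W x" using \<omega> \<omega>eq unfolding hit_def by auto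
        then obtain \<zeta> where \<zeta>: "\<And>x. x \<in> F \<Longrightarrow> \<zeta> x \<in> A' \<and> (\<zeta> x, f' (\<zeta> x)) \<in> W x" by metis
        have near: "dist x z < 1/4" if "(z, y) \<in> W x" for x y z using that unfolding W_def by simp
        have same: "z = \<zeta> x" if "z \<in> A'" "(z, f' z) \<in> W x" "x \<in> F" for x z
        proof -
          have "dist z (\<zeta> x) \<le> dist x z + dist x (\<zeta> x)" by (rule dist_triangle3)
          also have "\<dots> < 1" using near[OF that(2)] near[of "\<zeta> x" "f' (\<zeta> x)" x] \<zeta>[OF that(3)] by linarith
          finally show ?thesis using A'(1) that \<zeta> by (intro separated_sets_eq) auto
        qed
        have inj: "inj_on \<zeta> F"
        proof (rule inj_onI)
          fix x x' assume xx: "x \<in> F" "x' \<in> F" "\<zeta> x = \<zeta> x'"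
          have "dist x x' \<le> dist x (\<zeta> x) + dist x' (\<zeta> x')" using xx(3) dist_triangle2[of x x' "\<zeta> x"] by simp
          also have "\<dots> < 1"
            using near[of "\<zeta> x" "f' (\<zeta> x)" x] near[of "\<zeta> x'" "f' (\<zeta> x')" x'] \<zeta>[OF xx(1)] \<zeta>[OF xx(2)] by linarith
          finally show "x = x'" using sep xx unfolding F_def by (intro separated_sets_eq) auto
        qed
        have zero: "\<phi> (z, f' z) = 0" if "z \<in> A' - \<zeta> ` F" for z
        proof (rule ccontr)
          assume "\<phi> (z, f' z) \<noteq> 0"
          then have zK: "(z, f' z) \<in> K" using K(2)[of "(z, f' z)"] A'(2)[of z] that by auto
          have "(z, f' z) \<notin> K'"
          proof
            assume "(z, f' z) \<in> K'"
            then obtain W' where "W' \<in> \<F>" "(z, f' z) \<in> W'" using \<F>(3) by blast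
            then show False using \<omega> \<omega>eq that unfolding hit_def by auto
          qed
          then obtain x where "x \<in> F" "(z, f' z) \<in> W x" using zK unfolding K'_def by blast
          then show False using same that by blast
        qed
        have "(\<Sum>\<^sub>\<infinity>z\<in>A'. \<phi> (z, f' z)) = (\<Sum>\<^sub>\<infinity>z\<in>\<zeta> ` F. \<phi> (z, f' z))"
          using \<zeta> zero by (intro infsum_cong_neutral) auto
        also have "\<dots> = (\<Sum>x\<in>F. \<phi> (\<zeta> x, f' (\<zeta> x)))"
          using finF inj by (simp add: sum.reindex)
        finally have 1: "(\<Sum>\<^sub>\<infinity>z\<in>A'. \<phi> (z, f' z)) = (\<Sum>x\<in>F. \<phi> (\<zeta> x, f' (\<zeta> x)))" .
        have "(\<Sum>\<^sub>\<infinity>x\<in>A. \<phi> (x, f x)) = (\<Sum>\<^sub>\<infinity>x\<in>F. \<phi> (x, f x))"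
        proof (rule infsum_cong_neutral)
          fix x assume x: "x \<in> A - F"
          then have "(x, f x) \<notin> K" unfolding F_def by force
          then show "\<phi> (x, f x) = 0" using K(2)[of "(x, f x)"] fA[of x] x unfolding B_def by auto
        qed (auto simp: F_def)
        then have 2: "(\<Sum>\<^sub>\<infinity>x\<in>A. \<phi> (x, f x)) = (\<Sum>x\<in>F. \<phi> (x, f x))" using finF by simp
        have "dist (\<Sum>\<^sub>\<infinity>x\<in>A. \<phi> (x, f x)) (\<Sum>\<^sub>\<infinity>z\<in>A'. \<phi> (z, f' z)) \<le> (\<Sum>x\<in>F. \<delta>)"
          unfolding 1 2 dist_norm sum_subtractf[symmetric]
        proof (rule sum_norm_le)
          fix x assume "x \<in> F"
          then have "(\<zeta> x, f' (\<zeta> x)) \<in> W x" using \<zeta> by blast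
          then show "norm (\<phi> (x, f x) - \<phi> (\<zeta> x, f' (\<zeta> x))) \<le> \<delta>" unfolding W_def by (simp add: dist_norm)
        qed
        also have "\<dots> < \<epsilon>" unfolding \<delta>_def using \<epsilon> by (simp add: field_simps)
        finally show "\<omega> \<in> {(A, f). (A, f) \<in> marked_sets Y \<and> (\<Sum>\<^sub>\<infinity>x\<in>A. \<phi> (x, f x)) \<in> G}"
          using \<omega> \<omega>eq \<epsilon> by auto
      qed
    qed
  qed
  show "\<exists>\<omega>\<in>topspace (vague_topology Y). \<forall>W. openin (vague_topology Y) W \<longrightarrow> \<omega> \<in> W \<longrightarrow> W \<in> U"
  proof (intro bexI[of _ "(A, f)"] allI impI)
    fix W assume W: "openin (vague_topology Y) W" "(A, f) \<in> W"
    from W(1) have "generate_topology_on {{(A, f). (A, f) \<in> marked_sets Y \<and> (\<Sum>\<^sub>\<infinity>x\<in>A. \<phi> (x, f x)) \<in> U} |\<phi> U.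
        \<phi> \<in> Cc ?P \<and> open U} W"
      unfolding vague_topology_def openin_topology_generated_by_iff .
    then show "W \<in> U" using W(2)
    proof induction
      case (Int a b) then show ?case using set_ultrafilter.Int[OF \<open>set_ultrafilter U\<close>] by blast
    next
      case (UN K)
      then obtain k where "k \<in> K" "(A, f) \<in> k" by blast
      then show ?case using UN mono[of k "\<Union>K"] by blast
    next
      case (Basis s)
      then show ?case using conv by auto
    qed simp
  qed (use limit in simp)
qed

section \<open>Continuous functions of configurations\<close>

lemma topspace_config [simp]:
  "topspace (config_topology :: ('x::metric_space, 'c::topological_space) config topology) = configs"
proof -
  have "nested ` (configs :: ('x, 'c) config set) \<subseteq> marked_sets (vague_topology euclidean)"
    by (auto simp: nested_def configs_def marked_sets_def)
  then show ?thesis unfolding config_topology_def topspace_pullback_topology by auto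
qed

lemma continuous_map_config:
  assumes "\<phi> \<in> Cc (prod_topology euclidean (vague_topology euclidean))"
  shows "continuous_map (config_topology :: ('x::metric_space, 'c::topological_space) config topology) euclidean
    (\<lambda>\<omega>. \<Sum>\<^sub>\<infinity>x\<in>fst \<omega>. \<phi> (x, (fst \<omega>, \<lambda>y\<in>fst \<omega>. snd \<omega> (x, y))))"
proof -
  have "continuous_map (config_topology :: ('x, 'c) config topology) euclidean ((\<lambda>(A, f). \<Sum>\<^sub>\<infinity>x\<in>A. \<phi> (x, f x)) \<circ> nested)"
    unfolding config_topology_def by (intro continuous_map_pullback continuous_map_vague assms)
  also have "((\<lambda>(A, f). \<Sum>\<^sub>\<infinity>x\<in>A. \<phi> (x, f x)) \<circ> nested)
     = (\<lambda>\<omega>. \<Sum>\<^sub>\<infinity>x\<in>fst \<omega>. \<phi> (x, (fst \<omega>, \<lambda>y\<in>fst \<omega>. snd \<omega> (x, y))))"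
    by (auto simp: nested_def fun_eq_iff intro!: infsum_cong)
  finally show ?thesis .
qed

text \<open>Compactness of the second factor makes the product compactly supported. With the compact
  space of marked sets as mark space, this is how a function of a whole configuration enters a test
  function.\<close>

lemma Cc_times:
  assumes f: "f \<in> Cc euclidean" and T: "compact_space T" and \<Psi>: "continuous_map T euclidean \<Psi>"
  shows "(\<lambda>(x, y). f x * \<Psi> y) \<in> Cc (prod_topology euclidean T)"
proof -
  obtain K where K: "compactin euclidean K" "\<And>x. x \<notin> K \<Longrightarrow> f x = 0" and cont: "continuous_map euclidean euclidean f"
    using f unfolding Cc_def by auto
  have K2: "x \<in> K" if "f x \<noteq> 0" for x using K(2) that by metis
  have "continuous_map (prod_topology euclidean T) euclidean (\<lambda>p. f (fst p) * \<Psi> (snd p))"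
    using continuous_map_compose[OF continuous_map_fst cont, of T]
      continuous_map_compose[OF continuous_map_snd \<Psi>, of euclidean]
    by (auto simp: comp_def continuous_map_atin intro!: tendsto_mult)
  moreover have "compactin (prod_topology euclidean T) (K \<times> topspace T)"
    using K(1) T by (simp add: compactin_Times compact_space_def)
  ultimately show ?thesis
    unfolding Cc_def using K2 by (auto simp: case_prod_unfold intro!: exI[of _ "K \<times> topspace T"])
qed

lemma Hausdorff_euclidean_t2: "Hausdorff_space (euclidean :: 'c::t2_space topology)"
  unfolding Hausdorff_space_def
proof (intro allI impI)
  fix x y :: 'c assume "x \<in> topspace euclidean \<and> y \<in> topspace euclidean \<and> x \<noteq> y"
  then obtain U V where "open U" "open V" "x \<in> U" "y \<in> V" "U \<inter> V = {}" using hausdorff by metis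
  then show "\<exists>U V. openin euclidean U \<and> openin euclidean V \<and> x \<in> U \<and> y \<in> V \<and> disjnt U V"
    by (intro exI[of _ U] exI[of _ V]) (simp add: disjnt_def)
qed

lemma continuous_map_point_sum:
  assumes "f \<in> Cc euclidean"
  shows "continuous_map (config_topology :: ('x::metric_space, 'c::t2_space) config topology) euclidean
    (\<lambda>\<omega>. \<Sum>\<^sub>\<infinity>x\<in>fst \<omega>. f x)"
proof -
  have "continuous_map (vague_topology euclidean :: ('x set \<times> ('x \<Rightarrow> 'c)) topology) euclidean (\<lambda>_. 1 :: complex)"
    by simp
  from continuous_map_config[OF Cc_times[OF assms compact_space_vague[OF Hausdorff_euclidean_t2] this]]
  show ?thesis by simp
qed

text \<open>The inner sum is an integral against the mark of \<open>x\<close>, which is itself a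
  marked set. It is continuous on a compact space, so together with \<open>f\<close> it is a test
  function for the outer vague topology.\<close>

lemma continuous_map_pair_sum:
  fixes \<theta> :: "'c::t2_space \<Rightarrow> complex"
  assumes C: "compact (UNIV :: 'c set)" and f: "f \<in> Cc euclidean" and g: "g \<in> Cc euclidean" and \<theta>: "continuous_on UNIV \<theta>"
  shows "continuous_map (config_topology :: ('x::metric_space, 'c) config topology) euclidean
    (\<lambda>\<omega>. \<Sum>\<^sub>\<infinity>x\<in>fst \<omega>. f x * (\<Sum>\<^sub>\<infinity>y\<in>fst \<omega>. g y * \<theta> (snd \<omega> (x, y))))"
proof -
  have "(\<lambda>(y, z). g y * \<theta> z) \<in> Cc (prod_topology euclidean euclidean)"
    using C \<theta> by (intro Cc_times g) (auto simp: compact_space_def compactin_euclidean_iff)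
  then have "continuous_map (vague_topology euclidean :: ('x set \<times> ('x \<Rightarrow> 'c)) topology) euclidean (\<lambda>(A, k). \<Sum>\<^sub>\<infinity>y\<in>A. g y * \<theta> (k y))"
    using continuous_map_vague[of "\<lambda>(y, z). g y * \<theta> z" "euclidean :: 'c topology"] by simp
  from continuous_map_config[OF Cc_times[OF f compact_space_vague[OF Hausdorff_euclidean_t2] this]]
  have "continuous_map (config_topology :: ('x, 'c) config topology) euclidean
    (\<lambda>\<omega>. \<Sum>\<^sub>\<infinity>x\<in>fst \<omega>. f x * (\<Sum>\<^sub>\<infinity>y\<in>fst \<omega>. g y * \<theta> ((\<lambda>y\<in>fst \<omega>. snd \<omega> (x, y)) y)))"
    by simp
  moreover have "(\<Sum>\<^sub>\<infinity>y\<in>A. g y * \<theta> ((\<lambda>y\<in>A. h (x, y)) y)) = (\<Sum>\<^sub>\<infinity>y\<in>A. g y * \<theta> (h (x, y)))"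
    for A x and h :: "'x \<times> 'x \<Rightarrow> 'c" by (rule infsum_cong) simp
  ultimately show ?thesis by simp
qed

text \<open>The inverse of \<iota> is defined only on the range. Multiplied by a cutoff that
  vanishes for \<open>cmod z \<ge> c + 1\<close>, it extends continuously by 0, because \<iota> maps
  bounded open sets to open sets and compact sets to closed ones.\<close>

lemma compactification_inverse:
  fixes \<iota> :: "complex \<Rightarrow> 'c::t2_space"
  assumes "compactification \<iota>" and "c \<ge> 0"
  obtains \<theta> where "continuous_on UNIV \<theta>" "\<And>z. cmod z \<le> c \<Longrightarrow> \<theta> (\<iota> z) = z"
proof -
  have emb: "embedding_map euclidean euclidean \<iota>" and dense: "closure (range \<iota>) = UNIV"
    using assms(1) unfolding compactification_def by auto
  have hom: "homeomorphic_map euclidean (subtopology euclidean (range \<iota>)) \<iota>"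
    using emb unfolding embedding_map_def by simp
  have inj: "inj \<iota>" using homeomorphic_imp_injective_map[OF hom] by simp
  have cont: "continuous_on S \<iota>" for S
    using homeomorphic_imp_continuous_map[OF hom] continuous_on_subset[of UNIV \<iota> S]
    by (simp add: continuous_map_in_subtopology)
  \<comment> \<open>An open \<open>W\<close> that meets the dense range exactly in the image of
    \<open>V\<close> lies in the closure of that image. The image of the compact set
    \<open>closure V\<close> is closed, so \<open>W\<close> lies in the range and is the image of
    \<open>V\<close>.\<close>
  have open_image: "open (\<iota> ` V)" if V: "open V" "bounded V" for V
  proof -
    have "openin (subtopology euclidean (range \<iota>)) (\<iota> ` V)"
      using homeomorphic_imp_open_map[OF hom] V(1) unfolding open_map_def by simp
    then obtain W where W: "open W" "\<iota> ` V = W \<inter> range \<iota>" by (auto simp: openin_subtopology)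
    have "W \<subseteq> closure (W \<inter> range \<iota>)"
      using open_Int_closure_subset[OF W(1), of "range \<iota>"] dense by simp
    also have "\<dots> \<subseteq> closure (\<iota> ` closure V)"
      unfolding W(2)[symmetric] by (intro closure_mono image_mono closure_subset)
    also have "\<dots> = \<iota> ` closure V"
      using V(2) by (intro closure_closed compact_imp_closed compact_continuous_image cont) (simp add: compact_closure)
    finally have "\<iota> ` V = W" using W(2) by auto
    then show ?thesis using W(1) by simp
  qed
  define q :: "complex \<Rightarrow> complex" where "q z = z * complex_of_real (max 0 (min 1 (c + 1 - cmod z)))" for z
  have q_cont: "continuous_on UNIV q" unfolding q_def by (intro continuous_intros)
  have q0: "q z = 0" if "cmod z \<ge> c + 1" for z using that unfolding q_def by simp
  have q1: "q z = z" if "cmod z \<le> c" for z using that unfolding q_def by simp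
  define \<theta> where "\<theta> p = (if p \<in> range \<iota> then q (inv \<iota> p) else 0)" for p
  have \<theta>: "\<theta> (\<iota> z) = q z" for z unfolding \<theta>_def using inj by simp
  have vimage: "{p. \<theta> p \<in> W} = \<iota> ` {z. q z \<in> W}" if "0 \<notin> W" for W
    using that \<theta> by (auto simp: image_iff \<theta>_def inv_f_f[OF inj] dest: injD[OF inj] split: if_splits)
  have bdd: "bounded {z. q z \<in> W}" if "0 \<notin> W" for W
    using that q0 by (intro boundedI[of _ "c + 1"]) (metis linear mem_Collect_eq)
  have "continuous_on UNIV \<theta>"
  proof (subst continuous_on_open_vimage[OF open_UNIV], intro allI impI)
    fix W :: "complex set" assume W: "open W"
    show "open (\<theta> -` W \<inter> UNIV)"
    proof (cases "0 \<in> W")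
      case False
      have "open {z. q z \<in> W}"
        using continuous_open_vimage[OF W, of q] q_cont by (auto simp: vimage_def continuous_on_eq_continuous_at)
      then have "open (\<iota> ` {z. q z \<in> W})" using bdd[OF False] by (rule open_image)
      then show ?thesis using vimage[OF False] by (simp add: vimage_def)
    next
      case True
      then have n: "0 \<notin> - W" by simp
      have "closed {z. q z \<in> - W}"
        using continuous_closed_vimage[of "- W" q] W q_cont by (auto simp: vimage_def continuous_on_eq_continuous_at)
      then have "compact {z. q z \<in> - W}" using bdd[OF n] by (simp add: compact_eq_bounded_closed)
      then have "closed (\<iota> ` {z. q z \<in> - W})"
        by (intro compact_imp_closed compact_continuous_image cont)
      then have "closed {p. \<theta> p \<in> - W}" using vimage[OF n] by simp
      moreover have "\<theta> -` W \<inter> UNIV = - {p. \<theta> p \<in> - W}" by auto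
      ultimately show ?thesis by (simp only: open_Compl)
    qed
  qed
  then show ?thesis using that \<theta> q1 by simp
qed

section \<open>Invariant measures on the space and on the group\<close>

text \<open>
  The type of the group is not known to be second countable as a type, so that
  \<open>borel_prod\<close> does not apply; a countable dense set suffices.
\<close>

lemma open_in_pair_borel:
  fixes W :: "('a::metric_space \<times> 'b::metric_space) set"
  assumes D: "countable D" "\<And>x e. e > 0 \<Longrightarrow> \<exists>a\<in>D. dist a (x::'a) < e"
    and E: "countable E" "\<And>y e. e > 0 \<Longrightarrow> \<exists>b\<in>E. dist b (y::'b) < e"
    and W: "open W"
  shows "W \<in> sets (borel \<Otimes>\<^sub>M borel)"
proof -
  define S where "S = {(a, b, n). a \<in> D \<and> b \<in> E \<and> ball a (1 / real (Suc n)) \<times> ball b (1 / real (Suc n)) \<subseteq> W}"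
  have "S \<subseteq> D \<times> E \<times> UNIV" unfolding S_def by auto
  then have cS: "countable S" using D(1) E(1) by (rule_tac countable_subset) auto
  have "W = (\<Union>(a, b, n)\<in>S. ball a (1 / real (Suc n)) \<times> ball b (1 / real (Suc n)))"
  proof (intro subset_antisym subsetI)
    fix p assume "p \<in> W"
    then obtain x y where p: "p = (x, y)" "(x, y) \<in> W" by (cases p) auto
    obtain A B where AB: "open A" "open B" "x \<in> A" "y \<in> B" "A \<times> B \<subseteq> W"
      using open_prod_elim[OF W p(2)] by (metis mem_Sigma_iff)
    obtain e1 where e1: "e1 > 0" "ball x e1 \<subseteq> A" using AB open_contains_ball by metis
    obtain e2 where e2: "e2 > 0" "ball y e2 \<subseteq> B" using AB open_contains_ball by metis
    \<comment> \<open>Half the smaller radius: a ball of radius \<open>1 / Suc n < e\<close> whose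
      centre is that close to \<open>x\<close> stays within distance \<open>2 * e\<close> of
      \<open>x\<close>.\<close>
    define e where "e = min e1 e2 / 2"
    have "e > 0" using e1 e2 unfolding e_def by simp
    then obtain n where n: "1 / real (Suc n) < e" using nat_approx_posE by metis
    have n0: "1 / real (Suc n) > 0" by simp
    obtain a where a: "a \<in> D" "dist a x < 1 / real (Suc n)" using D(2)[OF n0] by blast
    obtain b where b: "b \<in> E" "dist b y < 1 / real (Suc n)" using E(2)[OF n0] by blast
    have "ball a (1 / real (Suc n)) \<subseteq> ball x e1"
    proof
      fix z assume "z \<in> ball a (1 / real (Suc n))"
      then have "dist x z < 2 * e" using a(2) n dist_triangle3[of x z a] by simp
      then show "z \<in> ball x e1" unfolding e_def by simp
    qed
    moreover have "ball b (1 / real (Suc n)) \<subseteq> ball y e2"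
    proof
      fix z assume "z \<in> ball b (1 / real (Suc n))"
      then have "dist y z < 2 * e" using b(2) n dist_triangle3[of y z b] by simp
      then show "z \<in> ball y e2" unfolding e_def by simp
    qed
    ultimately have "(a, b, n) \<in> S" using a b e1 e2 AB unfolding S_def by blast
    moreover have "p \<in> ball a (1 / real (Suc n)) \<times> ball b (1 / real (Suc n))" using a b p by simp
    ultimately show "p \<in> (\<Union>(a, b, n)\<in>S. ball a (1 / real (Suc n)) \<times> ball b (1 / real (Suc n)))" by blast
  qed (auto simp: S_def)
  moreover have "(\<Union>(a, b, n)\<in>S. ball a (1 / real (Suc n)) \<times> ball b (1 / real (Suc n))) \<in> sets (borel \<Otimes>\<^sub>M borel)"
    using cS by (intro sets.countable_UN') auto
  ultimately show ?thesis by simp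
qed

lemma continuous_pair_borel_measurable:
  fixes f :: "'a::metric_space \<times> 'b::metric_space \<Rightarrow> 'c::topological_space"
  assumes D: "countable D" "\<And>x e. e > 0 \<Longrightarrow> \<exists>a\<in>D. dist a (x::'a) < e"
    and E: "countable E" "\<And>y e. e > 0 \<Longrightarrow> \<exists>b\<in>E. dist b (y::'b) < e"
    and f: "continuous_on UNIV f"
  shows "f \<in> borel \<Otimes>\<^sub>M borel \<rightarrow>\<^sub>M borel"
proof (rule borel_measurableI)
  fix S :: "'c set" assume "open S"
  then have "open (f -` S)" using f by (simp add: continuous_on_open_vimage)
  then show "f -` S \<inter> space (borel \<Otimes>\<^sub>M borel) \<in> sets (borel \<Otimes>\<^sub>M borel)"
    using open_in_pair_borel[OF D E] by (simp add: space_pair_measure)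
qed

lemma countable_dense_second_countable:
  obtains E where "countable E" "\<And>y e. e > 0 \<Longrightarrow> \<exists>b\<in>E. dist b (y::'b::{metric_space, second_countable_topology}) < e"
proof -
  obtain E :: "'b set" where E: "countable E" "\<And>X. open X \<Longrightarrow> X \<noteq> {} \<Longrightarrow> \<exists>d\<in>E. d \<in> X"
    using countable_dense_exists by metis
  have "\<exists>b\<in>E. dist b y < e" if "e > 0" for y e
    using E(2)[of "ball y e"] that by (auto simp: dist_commute)
  then show ?thesis using E(1) that by blast
qed

text \<open>The mass transport identity: Tonelli, the substitution \<open>x \<mapsto> a g x\<close>
  for fixed \<open>g\<close>, and Tonelli again. It is used for the group acting on itself and for
  the group acting on the space.\<close>

lemma transport:
  fixes a :: "'g::group_add \<Rightarrow> 'y \<Rightarrow> 'y"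
  assumes H: "sigma_finite_measure H" and M: "sigma_finite_measure M"
    and meas: "(\<lambda>(g, x). a (- g) x) \<in> H \<Otimes>\<^sub>M M \<rightarrow>\<^sub>M M" "(\<lambda>(g, x). a g x) \<in> H \<Otimes>\<^sub>M M \<rightarrow>\<^sub>M M"
    and a: "\<And>g x. a (- g) (a g x) = x"
    and inv: "\<And>g F. F \<in> borel_measurable M \<Longrightarrow> (\<integral>\<^sup>+ x. F (a g x) \<partial>M) = (\<integral>\<^sup>+ x. F x \<partial>M)"
    and p: "p \<in> borel_measurable M" and q: "q \<in> borel_measurable M"
  shows "(\<integral>\<^sup>+ x. p x * (\<integral>\<^sup>+ g. q (a (- g) x) \<partial>H) \<partial>M) = (\<integral>\<^sup>+ x. q x * (\<integral>\<^sup>+ g. p (a g x) \<partial>H) \<partial>M)"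
proof -
  interpret H: sigma_finite_measure H by fact
  interpret M: sigma_finite_measure M by fact
  interpret P: pair_sigma_finite H M ..
  have m1: "(\<lambda>(g, x). p x * q (a (- g) x)) \<in> borel_measurable (H \<Otimes>\<^sub>M M)"
    using measurable_compose[OF meas(1) q] p by (simp add: case_prod_unfold)
  have m2: "(\<lambda>(g, x). p (a g x) * q x) \<in> borel_measurable (H \<Otimes>\<^sub>M M)"
    using measurable_compose[OF meas(2) p] q by (simp add: case_prod_unfold)
  have am: "(\<lambda>x. a (- g) x) \<in> M \<rightarrow>\<^sub>M M" "(\<lambda>x. a g x) \<in> M \<rightarrow>\<^sub>M M" if "g \<in> space H" for g
    using measurable_compose[OF measurable_Pair1'[OF that] meas(1)] measurable_compose[OF measurable_Pair1'[OF that] meas(2)] by simp_all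
  have ag: "(\<lambda>g. a (- g) x) \<in> H \<rightarrow>\<^sub>M M" "(\<lambda>g. a g x) \<in> H \<rightarrow>\<^sub>M M" if "x \<in> space M" for x
    using measurable_compose[OF measurable_Pair2'[OF that] meas(1)] measurable_compose[OF measurable_Pair2'[OF that] meas(2)] by simp_all
  have "(\<integral>\<^sup>+ x. p x * (\<integral>\<^sup>+ g. q (a (- g) x) \<partial>H) \<partial>M) = (\<integral>\<^sup>+ x. (\<integral>\<^sup>+ g. p x * q (a (- g) x) \<partial>H) \<partial>M)"
    using ag q by (intro nn_integral_cong nn_integral_cmult[symmetric] measurable_compose[OF _ q])
  also have "\<dots> = (\<integral>\<^sup>+ g. (\<integral>\<^sup>+ x. p x * q (a (- g) x) \<partial>M) \<partial>H)"
    using P.Fubini'[OF m1] by simp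
  also have "\<dots> = (\<integral>\<^sup>+ g. (\<integral>\<^sup>+ x. p (a g x) * q x \<partial>M) \<partial>H)"
  proof (rule nn_integral_cong)
    fix g assume "g \<in> space H"
    then have "(\<lambda>x. p x * q (a (- g) x)) \<in> borel_measurable M"
      using am(1)[of g] p q by (intro borel_measurable_times_ennreal measurable_compose[OF _ q])
    from inv[OF this, of g] show "(\<integral>\<^sup>+ x. p x * q (a (- g) x) \<partial>M) = (\<integral>\<^sup>+ x. p (a g x) * q x \<partial>M)"
      by (simp add: a)
  qed
  also have "\<dots> = (\<integral>\<^sup>+ x. (\<integral>\<^sup>+ g. p (a g x) * q x \<partial>H) \<partial>M)"
    using P.Fubini'[OF m2] by simp
  also have "\<dots> = (\<integral>\<^sup>+ x. q x * (\<integral>\<^sup>+ g. p (a g x) \<partial>H) \<partial>M)"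
  proof (rule nn_integral_cong)
    fix x assume "x \<in> space M"
    then have "(\<lambda>g. p (a g x)) \<in> borel_measurable H" by (intro measurable_compose[OF ag(2) p])
    then show "(\<integral>\<^sup>+ g. p (a g x) * q x \<partial>H) = q x * (\<integral>\<^sup>+ g. p (a g x) \<partial>H)"
      by (subst nn_integral_multc) (auto simp: mult.commute)
  qed
  finally show ?thesis .
qed

context geometric_setting
begin

section \<open>Haar measure\<close>

lemma haar_sets [simp, measurable_cong]: "sets haar = sets borel"
  using G_haar unfolding unimodular_haar_measure_def by simp

lemma haar_space [simp]: "space haar = UNIV"
  using sets_eq_imp_space_eq[OF haar_sets] by simp

lemma haar_compact: "compact K \<Longrightarrow> emeasure haar K < \<infinity>"
  using G_haar unfolding unimodular_haar_measure_def by simp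

lemma haar_open: "open U \<Longrightarrow> U \<noteq> {} \<Longrightarrow> emeasure haar U > 0"
  using G_haar unfolding unimodular_haar_measure_def by simp

lemma haar_left_image: "B \<in> sets borel \<Longrightarrow> emeasure haar ((\<lambda>x. g + x) ` B) = emeasure haar B"
  using G_haar unfolding unimodular_haar_measure_def by simp

lemma haar_right_image: "B \<in> sets borel \<Longrightarrow> emeasure haar ((\<lambda>x. x + g) ` B) = emeasure haar B"
  using G_haar unfolding unimodular_haar_measure_def by simp

lemma measurable_add_left [measurable]: "(\<lambda>x. g + x) \<in> borel \<rightarrow>\<^sub>M (borel :: 'g measure)"
  by (intro borel_measurable_continuous_onI continuous_intros)

lemma measurable_add_right [measurable]: "(\<lambda>x. x + g) \<in> borel \<rightarrow>\<^sub>M (borel :: 'g measure)"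
  by (intro borel_measurable_continuous_onI continuous_intros)

lemma haar_left:
  assumes F: "F \<in> borel_measurable borel"
  shows "(\<integral>\<^sup>+ x. F (g + x) \<partial>haar) = (\<integral>\<^sup>+ x. F x \<partial>haar)"
proof -
  have "distr haar haar (\<lambda>x. g + x) = haar"
  proof (rule measure_eqI)
    fix B assume "B \<in> sets (distr haar haar (\<lambda>x. g + x))"
    then have B: "B \<in> sets borel" by simp
    have "(\<lambda>x. g + x) -` B = (\<lambda>x. - g + x) ` B"
      by (force simp: image_iff add.assoc[symmetric] intro: exI[of _ "g + _"])
    then show "emeasure (distr haar haar (\<lambda>x. g + x)) B = emeasure haar B"
      using B by (subst emeasure_distr) (auto simp: haar_left_image)
  qed simp
  then show ?thesis using F nn_integral_distr[of "\<lambda>x. g + x" haar haar F] by simp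
qed

lemma haar_right:
  assumes F: "F \<in> borel_measurable borel"
  shows "(\<integral>\<^sup>+ x. F (x + g) \<partial>haar) = (\<integral>\<^sup>+ x. F x \<partial>haar)"
proof -
  have "distr haar haar (\<lambda>x. x + g) = haar"
  proof (rule measure_eqI)
    fix B assume "B \<in> sets (distr haar haar (\<lambda>x. x + g))"
    then have B: "B \<in> sets borel" by simp
    have "(\<lambda>x. x + g) -` B = (\<lambda>x. x + - g) ` B"
      by (force simp: image_iff add.assoc intro: exI[of _ "_ + g"])
    then show "emeasure (distr haar haar (\<lambda>x. x + g)) B = emeasure haar B"
      using B haar_right_image[OF B, of "- g"] by (subst emeasure_distr) auto
  qed simp
  then show ?thesis using F nn_integral_distr[of "\<lambda>x. x + g" haar haar F] by simp
qed

text \<open>The radius \<open>Suc n\<close> gives even \<open>gball 0\<close> nonempty interior,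
  hence positive Haar measure; it is the reference set for all normalisations.\<close>

definition gball :: "nat \<Rightarrow> 'g set" where
  "gball n = closure (ball 0 (real (Suc n)))"

lemma gball_compact: "compact (gball n)"
  unfolding gball_def by (rule G_balls_precompact)

lemma gball_borel [measurable]: "gball n \<in> sets borel"
  unfolding gball_def by simp

lemma gball_cover: "(\<Union>n. gball n) = UNIV"
proof -
  have "g \<in> (\<Union>n. gball n)" for g
  proof -
    obtain n where "dist 0 g \<le> real n" using real_arch_simple by blast
    then have "g \<in> ball 0 (real (Suc n))" by simp
    then show ?thesis unfolding gball_def using closure_subset by blast
  qed
  then show ?thesis by auto
qed

lemma gball_pos: "emeasure haar (gball n) > 0"
proof -
  have "emeasure haar (ball 0 (real (Suc n))) > 0" by (intro haar_open) auto
  also have "emeasure haar (ball 0 (real (Suc n))) \<le> emeasure haar (gball n)"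
    unfolding gball_def by (intro emeasure_mono closure_subset) auto
  finally show ?thesis .
qed

lemma haar_sigma_finite: "sigma_finite_measure haar"
proof
  show "\<exists>A. countable A \<and> A \<subseteq> sets haar \<and> \<Union>A = space haar \<and> (\<forall>a\<in>A. emeasure haar a \<noteq> \<infinity>)"
    using gball_cover gball_compact haar_compact
    by (intro exI[of _ "range gball"]) (auto simp: less_top[symmetric])
qed

lemma G_dense: obtains D where "countable D" "\<And>x e. e > 0 \<Longrightarrow> \<exists>a\<in>D. dist a (x::'g) < e"
proof -
  have "\<exists>k. finite k \<and> gball n \<subseteq> (\<Union>a\<in>k. ball a (1 / real (Suc j)))" for n j
  proof -
    have "gball n \<subseteq> (\<Union>a\<in>gball n. ball a (1 / real (Suc j)))" by auto
    then show ?thesis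
      using compactE_image[OF gball_compact[of n], of "gball n" "\<lambda>a. ball a (1 / real (Suc j))"] by (metis open_ball)
  qed
  then obtain k where k: "\<And>n j. finite (k n j)" "\<And>n j. gball n \<subseteq> (\<Union>a\<in>k n j. ball a (1 / real (Suc j)))" by metis
  have "\<exists>a\<in>(\<Union>n j. k n j). dist a x < e" if e: "e > 0" for x e
  proof -
    obtain j where j: "1 / real (Suc j) < e" using nat_approx_posE[OF e] by metis
    obtain n where "x \<in> gball n" using gball_cover by blast
    then obtain a where "a \<in> k n j" "dist a x < 1 / real (Suc j)" using k(2)[of n j] by auto
    then show ?thesis using j by (intro bexI[of _ a]) auto
  qed
  moreover have "countable (\<Union>n j. k n j)" by (intro countable_UN countableI_type countable_finite k(1))
  ultimately show ?thesis using that by blast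
qed

text \<open>Mass transport for left translations, with \<open>p\<close> the indicator of a compact
  ball. The inner integral on one side is that of \<open>F (- g)\<close>, by left invariance; on the
  other it is the measure of the ball, by right invariance. That measure is positive and finite and
  cancels. This is how unimodularity enters.\<close>

lemma haar_uminus:
  assumes F: "F \<in> borel_measurable borel"
  shows "(\<integral>\<^sup>+ g. F (- g) \<partial>haar) = (\<integral>\<^sup>+ g. F g \<partial>haar)"
proof -
  obtain D where D: "countable D" "\<And>x e. e > 0 \<Longrightarrow> \<exists>a\<in>D. dist a (x::'g) < e" using G_dense by blast
  have m1: "(\<lambda>(g, x). - g + x) \<in> borel \<Otimes>\<^sub>M borel \<rightarrow>\<^sub>M (borel :: 'g measure)"
    by (rule continuous_pair_borel_measurable[OF D D]) (auto simp: case_prod_unfold intro!: continuous_intros)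
  have m2: "(\<lambda>(g, x). g + x) \<in> borel \<Otimes>\<^sub>M borel \<rightarrow>\<^sub>M (borel :: 'g measure)"
    by (rule continuous_pair_borel_measurable[OF D D]) (auto simp: case_prod_unfold intro!: continuous_intros)
  have um: "uminus \<in> borel \<rightarrow>\<^sub>M (borel :: 'g measure)"
    by (intro borel_measurable_continuous_onI continuous_intros)
  have cong: "measurable (haar \<Otimes>\<^sub>M haar) haar = measurable (borel \<Otimes>\<^sub>M borel) borel"
    by (intro measurable_cong_sets sets_pair_measure_cong haar_sets)
  have cong': "borel_measurable haar = borel_measurable borel"
    by (intro measurable_cong_sets haar_sets refl)
  let ?p = "indicator (gball 0) :: 'g \<Rightarrow> ennreal"
  have "(\<integral>\<^sup>+ x. ?p x * (\<integral>\<^sup>+ g. F (- g + x) \<partial>haar) \<partial>haar) = (\<integral>\<^sup>+ x. F x * (\<integral>\<^sup>+ g. ?p (g + x) \<partial>haar) \<partial>haar)"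
    by (rule transport[OF haar_sigma_finite haar_sigma_finite])
       (auto simp: cong cong' m1 m2 F haar_left add.assoc[symmetric])
  moreover have "(\<integral>\<^sup>+ g. F (- g + x) \<partial>haar) = (\<integral>\<^sup>+ g. F (- g) \<partial>haar)" for x
  proof -
    have "(\<integral>\<^sup>+ g. F (- (- x + g)) \<partial>haar) = (\<integral>\<^sup>+ g. F (- g) \<partial>haar)"
      using measurable_compose[OF um F] by (rule haar_left)
    then show ?thesis by (simp add: minus_add)
  qed
  moreover have "(\<integral>\<^sup>+ g. ?p (g + x) \<partial>haar) = emeasure haar (gball 0)" for x
    using haar_right[of ?p x] by simp
  ultimately have "(\<integral>\<^sup>+ g. F (- g) \<partial>haar) * emeasure haar (gball 0) = (\<integral>\<^sup>+ g. F g \<partial>haar) * emeasure haar (gball 0)"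
    using F by (simp add: nn_integral_multc mult.commute)
  then show ?thesis
    using gball_pos[of 0] haar_compact[OF gball_compact[of 0]]
    by (subst (asm) (1 2) mult.commute) (auto simp: ennreal_mult_cancel_left)
qed

lemma act_measurable:
  "(\<lambda>(g, x). act g x) \<in> borel \<Otimes>\<^sub>M borel \<rightarrow>\<^sub>M borel"
  "(\<lambda>(g, x). act (- g) x) \<in> borel \<Otimes>\<^sub>M borel \<rightarrow>\<^sub>M borel"
proof -
  obtain D where D: "countable D" "\<And>x e. e > 0 \<Longrightarrow> \<exists>a\<in>D. dist a (x::'g) < e" using G_dense by blast
  obtain E where E: "countable E" "\<And>y e. e > 0 \<Longrightarrow> \<exists>b\<in>E. dist b (y::'x) < e" using countable_dense_second_countable by blast
  show "(\<lambda>(g, x). act g x) \<in> borel \<Otimes>\<^sub>M borel \<rightarrow>\<^sub>M borel"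
    by (rule continuous_pair_borel_measurable[OF D E]) (auto intro: act_continuous)
  have "continuous_on UNIV ((\<lambda>(g, x). act g x) \<circ> (\<lambda>p. (- fst p, snd p)))"
    by (intro continuous_on_compose continuous_intros continuous_on_subset[OF act_continuous]) auto
  then have "continuous_on UNIV (\<lambda>(g, x). act (- g) x)" by (simp add: comp_def case_prod_unfold)
  then show "(\<lambda>(g, x). act (- g) x) \<in> borel \<Otimes>\<^sub>M borel \<rightarrow>\<^sub>M borel"
    by (intro continuous_pair_borel_measurable[OF D E]) auto
qed

lemma act_minus [simp]: "act (- g) (act g x) = x" "act g (act (- g) x) = x"
  using act_add[of "- g" g x] act_add[of g "- g" x] by (simp_all add: act_zero)

lemma act_inj: "inj (act g)"
  by (rule inj_on_inverseI[of _ "act (- g)"]) simp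

lemma transport_space:
  assumes M: "sigma_finite_measure M" "sets M = sets borel"
    and inv: "\<And>g F. F \<in> borel_measurable borel \<Longrightarrow> (\<integral>\<^sup>+ x. F (act g x) \<partial>M) = (\<integral>\<^sup>+ x. F x \<partial>M)"
    and p: "p \<in> borel_measurable borel" and q: "q \<in> borel_measurable borel"
  shows "(\<integral>\<^sup>+ x. p x * (\<integral>\<^sup>+ g. q (act (- g) x) \<partial>haar) \<partial>M) = (\<integral>\<^sup>+ x. q x * (\<integral>\<^sup>+ g. p (act g x) \<partial>haar) \<partial>M)"
proof -
  have cong: "measurable (haar \<Otimes>\<^sub>M M) M = measurable (borel \<Otimes>\<^sub>M borel) borel"
    by (intro measurable_cong_sets sets_pair_measure_cong haar_sets M)
  have cong': "borel_measurable M = borel_measurable borel"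
    by (intro measurable_cong_sets M) simp
  show ?thesis
    using inv p q by (intro transport[OF haar_sigma_finite M(1)]) (auto simp: cong cong' act_measurable)
qed

section \<open>Group coordinates and translates of the fundamental domain\<close>

abbreviation coord :: "'x \<Rightarrow> 'g" where "coord \<equiv> group_coord act F'"

lemma coord_unique: "\<exists>!g. x \<in> act g ` F'"
proof -
  obtain p where p: "snd p \<in> F'" "x = act (fst p) (snd p)"
    and uniq: "\<And>q. snd q \<in> F' \<Longrightarrow> x = act (fst q) (snd q) \<Longrightarrow> q = p"
    using fundamental_domain[of x] by blast
  show ?thesis
  proof (rule ex1I[of _ "fst p"])
    fix g assume "x \<in> act g ` F'"
    then obtain y where "y \<in> F'" "x = act g y" by blast
    then show "g = fst p" using uniq[of "(g, y)"] by auto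
  qed (use p in blast)
qed

lemma coord_iff: "x \<in> act g ` F' \<longleftrightarrow> coord x = g"
  unfolding group_coord_def using theI'[OF coord_unique[of x]] coord_unique[of x] by blast

lemma coord_act: "coord (act g x) = g + coord x"
proof -
  have "x \<in> act (coord x) ` F'" by (simp add: coord_iff)
  then obtain y where y: "y \<in> F'" "x = act (coord x) y" by blast
  have "act g x = act (g + coord x) y" using y(2) act_add by metis
  then have "act g x \<in> act (g + coord x) ` F'" using y(1) by blast
  then show ?thesis by (simp add: coord_iff)
qed

lemma translate_iff: "x \<in> translate act I F' \<longleftrightarrow> coord x \<in> I"
  unfolding translate_def by (auto simp: coord_iff)

lemma translate_precompact:
  assumes "compact I" obtains K where "compact K" "translate act I F' \<subseteq> K"
proof -
  have "compact ((\<lambda>(g, x). act g x) ` (I \<times> closure F'))"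
    by (intro compact_continuous_image continuous_on_subset[OF act_continuous] compact_Times assms fundamental_domain_precompact) auto
  moreover have "translate act I F' \<subseteq> (\<lambda>(g, x). act g x) ` (I \<times> closure F')"
    unfolding translate_def using closure_subset[of F'] by force
  ultimately show ?thesis using that by blast
qed

text \<open>Writing \<open>F'\<close> as a countable union of compact sets exhibits the translate as
  a countable union of continuous images of compact sets.\<close>

lemma translate_borel:
  assumes "compact I" shows "translate act I F' \<in> sets borel"
proof -
  obtain K :: "nat \<Rightarrow> 'x set" where K: "\<And>n. compact (K n)" "F' = (\<Union>n. K n)"
    using fundamental_domain_sigma_compact by blast
  have "translate act I F' = (\<Union>n. (\<lambda>(g, x). act g x) ` (I \<times> K n))"
    unfolding translate_def K(2) by force
  moreover have "compact ((\<lambda>(g, x). act g x) ` (I \<times> K n))" for n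
    by (intro compact_continuous_image continuous_on_subset[OF act_continuous] compact_Times assms K) auto
  then have "(\<Union>n. (\<lambda>(g, x). act g x) ` (I \<times> K n)) \<in> sets borel"
    by (intro sets.countable_UN) (auto intro: borel_compact)
  ultimately show ?thesis by (simp only:)
qed

lemma translate_cover: "(\<Union>n. translate act (gball n) F') = UNIV"
  using gball_cover translate_iff by blast

text \<open>Along the orbit of \<open>x\<close> the coordinate is \<open>g + coord x\<close>, so the
  integral is the Haar measure of a right translate of \<open>I\<close> and does not depend on
  \<open>x\<close>. The second form follows by inversion.\<close>

lemma translate_haar:
  assumes I: "compact I"
  shows "(\<integral>\<^sup>+ g. indicator (translate act I F') (act g x) \<partial>haar) = emeasure haar I"
    and "(\<integral>\<^sup>+ g. indicator (translate act I F') (act (- g) x) \<partial>haar) = emeasure haar I"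
proof -
  have I': "I \<in> sets borel" using I by (rule borel_compact)
  have eq: "indicator (translate act I F') (act g x) = (indicator I (g + coord x) :: ennreal)" for g
    by (simp add: indicator_def translate_iff coord_act)
  show 1: "(\<integral>\<^sup>+ g. indicator (translate act I F') (act g x) \<partial>haar) = emeasure haar I"
    unfolding eq using I' by (subst haar_right) auto
  have "(\<integral>\<^sup>+ g. indicator (translate act I F') (act (- g) x) \<partial>haar) = (\<integral>\<^sup>+ g. indicator I (- g + coord x) \<partial>haar)"
    unfolding eq ..
  also have "\<dots> = (\<integral>\<^sup>+ g. indicator I (g + coord x) \<partial>haar)"
    using haar_uminus[of "\<lambda>g. indicator I (g + coord x)"] I' by simp
  finally show "(\<integral>\<^sup>+ g. indicator (translate act I F') (act (- g) x) \<partial>haar) = emeasure haar I"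
    using 1 unfolding eq by simp
qed

text \<open>Mass transport between the indicators of two translates: both orbit integrals are
  constants. Thus an invariant measure of the translate by \<open>I\<close> is proportional to the
  Haar measure of \<open>I\<close>, which is the origin of the density.\<close>

lemma invariant_measure_translate:
  assumes M: "sigma_finite_measure M" "sets M = sets borel"
    and inv: "\<And>g F. F \<in> borel_measurable borel \<Longrightarrow> (\<integral>\<^sup>+ x. F (act g x) \<partial>M) = (\<integral>\<^sup>+ x. F x \<partial>M)"
    and I: "compact I" and J: "compact J"
  shows "emeasure M (translate act I F') * emeasure haar J = emeasure M (translate act J F') * emeasure haar I"
  using transport_space[OF M inv, of "indicator (translate act I F')" "indicator (translate act J F')"]
    translate_borel[OF I] translate_borel[OF J] M(2)
  by (simp add: translate_haar[OF I] translate_haar[OF J] nn_integral_multc)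

end

section \<open>Measurable enumeration of configurations\<close>

lemma infsum_compact_support:
  assumes "A \<in> separated_sets" "compact K" "\<And>x. x \<in> A \<Longrightarrow> x \<notin> K \<Longrightarrow> F x = 0"
  shows "infsum F A = sum F (A \<inter> K)"
proof -
  have "infsum F A = infsum F (A \<inter> K)" using assms by (intro infsum_cong_neutral) auto
  then show ?thesis using separated_sets_finite[OF assms(2,1)] by simp
qed

lemma Cc_euclideanI:
  assumes "continuous_on UNIV f" "compact K" "\<And>x. x \<notin> K \<Longrightarrow> f x = 0"
  shows "f \<in> Cc euclidean"
  using assms unfolding Cc_def by (auto simp: compactin_euclidean_iff)

lemma Cc_euclideanE:
  assumes "f \<in> Cc euclidean"
  obtains K where "continuous_on UNIV f" "compact K" "\<And>x. x \<notin> K \<Longrightarrow> f x = 0"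
  using assms unfolding Cc_def by (auto simp: compactin_euclidean_iff)

lemma Cc_cnj: "f \<in> Cc euclidean \<Longrightarrow> (\<lambda>x. cnj (f x)) \<in> Cc euclidean"
  by (elim Cc_euclideanE, rule Cc_euclideanI) (auto intro: continuous_intros)

locale configuration_process =
  geometric_setting act F' haar + random_configuration act \<iota> \<mu> \<Omega>
  for act :: "'g::{metric_space, topological_group_add} \<Rightarrow>
      'x::{metric_space, second_countable_topology} \<Rightarrow> 'x"
    and F' :: "'x set" and haar :: "'g measure"
    and \<iota> :: "complex \<Rightarrow> 'c::t2_space"
    and \<mu> :: "('x, 'c) config measure" and \<Omega> :: "('x, 'c) config set"
begin

abbreviation law :: "('x, 'c) config measure" where "law \<equiv> restrict_space \<mu> \<Omega>"

section \<open>The law restricted to its support\<close>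

lemma space_mu [simp]: "space \<mu> = configs"
proof -
  have "space \<mu> = space (sigma (configs :: ('x, 'c) config set) {U. openin config_topology U})"
    using sets_eq_imp_space_eq[OF borel] .
  then show ?thesis by (simp add: space_measure_of_conv)
qed

lemma open_measurable: "openin config_topology U \<Longrightarrow> U \<in> sets \<mu>"
  unfolding borel using openin_subset[of config_topology]
  by (subst sets_measure_of) (auto intro: sigma_sets.Basic)

lemma continuous_measurable:
  assumes "continuous_map config_topology euclidean (F :: _ \<Rightarrow> complex)"
  shows "F \<in> borel_measurable \<mu>"
proof (rule borel_measurableI)
  fix S :: "complex set" assume "open S"
  then have "openin config_topology {\<omega> \<in> topspace config_topology. F \<omega> \<in> S}"
    by (intro openin_continuous_map_preimage[OF assms]) simp
  then have "{\<omega> \<in> topspace config_topology. F \<omega> \<in> S} \<in> sets \<mu>" by (rule open_measurable)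
  moreover have "{\<omega> \<in> topspace config_topology. F \<omega> \<in> S} = F -` S \<inter> space \<mu>" by auto
  ultimately show "F -` S \<inter> space \<mu> \<in> sets \<mu>" by simp
qed

lemma Omega_closed: "closedin config_topology \<Omega>"
  and Omega_null: "emeasure \<mu> (configs - \<Omega>) = 0"
  and Omega_least: "closedin config_topology C \<Longrightarrow> emeasure \<mu> (configs - C) = 0 \<Longrightarrow> \<Omega> \<subseteq> C"
  using support unfolding is_topological_support_def by auto

lemma Omega_configs: "\<Omega> \<subseteq> configs"
  using closedin_subset[OF Omega_closed] by simp

lemma Omega_sets [measurable]: "\<Omega> \<in> sets \<mu>"
proof -
  have "configs - \<Omega> \<in> sets \<mu>" using Omega_closed by (intro open_measurable) (simp add: closedin_def)
  then have "space \<mu> - (configs - \<Omega>) \<in> sets \<mu>" by (rule sets.compl_sets)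
  moreover have "space \<mu> - (configs - \<Omega>) = \<Omega>" using Omega_configs by auto
  ultimately show ?thesis by simp
qed

lemma AE_Omega: "AE \<omega> in \<mu>. \<omega> \<in> \<Omega>"
  using Omega_null sets.compl_sets[OF Omega_sets] by (intro AE_I[of _ _ "configs - \<Omega>"]) auto

lemma space_law [simp]: "space law = \<Omega>"
  using Omega_configs by (auto simp: space_restrict_space)

lemma Omega_emeasure: "emeasure \<mu> \<Omega> = 1"
proof -
  interpret prob_space \<mu> by (rule probability)
  have "emeasure \<mu> \<Omega> = emeasure \<mu> (space \<mu>)"
    using AE_Omega sets.top[of \<mu>] by (intro emeasure_eq_AE) (auto elim: eventually_mono)
  then show ?thesis by (simp only: emeasure_space_1)
qed

lemma law_prob_space: "prob_space law"
  using Omega_sets Omega_configs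
  by (intro prob_spaceI) (simp add: emeasure_restrict_space Omega_emeasure Int_absorb2)

lemma law_measurable: "F \<in> measurable \<mu> N \<Longrightarrow> F \<in> measurable law N"
  by (rule measurable_restrict_space1)

text \<open>Otherwise \<open>\<Omega> - U\<close> would be a smaller closed set of full measure.
  This turns almost sure statements about continuous functions into statements about every
  configuration in \<Omega>.\<close>

lemma support_open:
  assumes U: "openin config_topology U" "\<omega> \<in> U" "\<omega> \<in> \<Omega>"
  shows "emeasure \<mu> (U \<inter> \<Omega>) > 0"
proof (rule ccontr)
  assume "\<not> emeasure \<mu> (U \<inter> \<Omega>) > 0"
  then have 0: "emeasure \<mu> (U \<inter> \<Omega>) = 0" by simp
  have Um: "U \<in> sets \<mu>" using U(1) by (rule open_measurable)
  have "configs - (\<Omega> - U) \<subseteq> (configs - \<Omega>) \<union> (U \<inter> \<Omega>)" by auto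
  moreover have "(configs - \<Omega>) \<union> (U \<inter> \<Omega>) \<in> null_sets \<mu>"
    using 0 Omega_null Um sets.compl_sets[OF Omega_sets] by (intro null_sets.Un null_setsI) auto
  ultimately have "configs - (\<Omega> - U) \<in> null_sets \<mu>"
    using Um sets.compl_sets[OF sets.Diff[OF Omega_sets Um]] by (auto intro: null_sets_subset)
  then have "\<Omega> \<subseteq> \<Omega> - U" using U(1) Omega_closed by (intro Omega_least closedin_diff) (auto simp: null_sets_def)
  then show False using U by auto
qed

lemma config_separated: "\<omega> \<in> \<Omega> \<Longrightarrow> fst \<omega> \<in> separated_sets"
  using Omega_configs unfolding configs_def by auto

lemma point_sum_measurable:
  assumes f: "f \<in> Cc euclidean"
  shows "(\<lambda>\<omega>. \<Sum>\<^sub>\<infinity>x\<in>fst \<omega>. f x) \<in> borel_measurable law"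
  by (intro law_measurable continuous_measurable continuous_map_point_sum f)

section \<open>A countable partition into small pieces\<close>

lemma small_compact_ball: "\<exists>r>0. r \<le> 1/4 \<and> compact (cball (x::'x) (2 * r))"
proof -
  obtain U K where UK: "open U" "compact K" "x \<in> U" "U \<subseteq> K"
    using X_locally_compact unfolding locally_def by (metis UNIV_I open_UNIV openin_open_eq open_openin subset_UNIV Int_UNIV_left)
  obtain e where e: "e > 0" "cball x e \<subseteq> U" using UK open_contains_cball by metis
  define r where "r = min (e / 2) (1 / 4)"
  have "cball x (2 * r) \<subseteq> K \<inter> cball x (2 * r)" using e UK unfolding r_def by (auto simp: subset_iff)
  then have "cball x (2 * r) = K \<inter> cball x (2 * r)" by auto
  moreover have "compact (K \<inter> cball x (2 * r))" using UK by (intro compact_Int_closed) auto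
  ultimately have "compact (cball x (2 * r))" by simp
  then show ?thesis using e unfolding r_def by (intro exI[of _ "min (e / 2) (1 / 4)"]) auto
qed

text \<open>The bound 1/4 keeps the diameter of a ball below 1, so that it holds at most one point
  of a configuration. Compactness of the doubled ball leaves room for a compactly supported cutoff
  around it.\<close>

definition radius :: "'x \<Rightarrow> real" where
  "radius x = (SOME r. r > 0 \<and> r \<le> 1/4 \<and> compact (cball x (2 * r)))"

lemma radius: "radius x > 0" "radius x \<le> 1/4" "compact (cball x (2 * radius x))"
  using someI_ex[OF small_compact_ball[of x]] unfolding radius_def by auto

definition center :: "nat \<Rightarrow> 'x" where
  "center = (SOME c. (\<Union>i. ball (c i) (radius (c i))) = UNIV)"

lemma center_cover: "(\<Union>i. ball (center i) (radius (center i))) = UNIV"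
proof -
  define \<F> where "\<F> = range (\<lambda>x::'x. ball x (radius x))"
  have "\<And>S. S \<in> \<F> \<Longrightarrow> open S" unfolding \<F>_def by auto
  then obtain \<F>' where \<F>': "\<F>' \<subseteq> \<F>" "countable \<F>'" "\<Union>\<F>' = \<Union>\<F>" by (rule Lindelof)
  have "x \<in> \<Union>\<F>" for x using radius(1)[of x] unfolding \<F>_def by (auto intro!: exI[of _ x])
  then have U: "\<Union>\<F> = UNIV" by blast
  then have "\<F>' \<noteq> {}" using \<F>' by auto
  then have "range (from_nat_into \<F>') = \<F>'" using \<F>'(2) by (rule range_from_nat_into)
  moreover have "\<forall>i. \<exists>c. from_nat_into \<F>' i = ball c (radius c)"
    using from_nat_into[OF \<open>\<F>' \<noteq> {}\<close>] \<F>'(1) unfolding \<F>_def by blast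
  then obtain c where "\<And>i. from_nat_into \<F>' i = ball (c i) (radius (c i))" by metis
  ultimately have "(\<Union>i. ball (c i) (radius (c i))) = UNIV" using U \<F>'(3) by (metis (no_types, lifting) image_cong)
  then show ?thesis unfolding center_def
    by (rule someI[where P="\<lambda>c. (\<Union>i. ball (c i) (radius (c i))) = UNIV"])
qed

text \<open>A countable cover by small balls made disjoint. Each piece meets a configuration in at
  most one point, so the index of the piece labels that point independently of the
  configuration.\<close>

definition piece :: "nat \<Rightarrow> 'x set" where
  "piece i = ball (center i) (radius (center i)) - (\<Union>j<i. ball (center j) (radius (center j)))"

lemma piece_borel [measurable]: "piece i \<in> sets borel"
  unfolding piece_def by (intro sets.Diff sets.finite_UN) auto

lemma piece_exists: "\<exists>i. x \<in> piece i"
proof -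
  define i where "i = (LEAST i. x \<in> ball (center i) (radius (center i)))"
  have "\<exists>i. x \<in> ball (center i) (radius (center i))" using center_cover by blast
  from LeastI_ex[OF this] have "x \<in> ball (center i) (radius (center i))" unfolding i_def .
  moreover have "x \<notin> ball (center j) (radius (center j))" if "j < i" for j
    using not_less_Least[of j "\<lambda>i. x \<in> ball (center i) (radius (center i))"] that unfolding i_def by blast
  ultimately show ?thesis unfolding piece_def by auto
qed

lemma piece_disjoint: "x \<in> piece i \<Longrightarrow> x \<in> piece j \<Longrightarrow> i = j"
  unfolding piece_def by (metis DiffD1 DiffD2 UN_I lessThan_iff nat_neq_iff)

lemma piece_small: "x \<in> piece i \<Longrightarrow> y \<in> piece i \<Longrightarrow> dist x y < 1"
proof -
  assume "x \<in> piece i" "y \<in> piece i"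
  then have "dist (center i) x < 1/4" "dist (center i) y < 1/4"
    using radius(2)[of "center i"] unfolding piece_def by auto
  then show ?thesis using dist_triangle3[of x y "center i"] by linarith
qed

lemma compact_pieces:
  assumes "compact K" obtains N where "\<And>x i. x \<in> K \<Longrightarrow> x \<in> piece i \<Longrightarrow> i < N"
proof -
  have "K \<subseteq> (\<Union>i\<in>UNIV. ball (center i) (radius (center i)))" using center_cover by auto
  then obtain I where I: "finite I" "K \<subseteq> (\<Union>i\<in>I. ball (center i) (radius (center i)))"
    using compactE_image[OF assms, of UNIV "\<lambda>i. ball (center i) (radius (center i))"] by auto
  obtain N where N: "\<And>i. i \<in> I \<Longrightarrow> i < N" using I(1) finite_nat_set_iff_bounded by metis
  have "i < N" if x: "x \<in> K" "x \<in> piece i" for x i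
  proof -
    obtain j where j: "j \<in> I" "x \<in> ball (center j) (radius (center j))" using I(2) x by blast
    then have "\<not> j < i" using x(2) unfolding piece_def by auto
    then show ?thesis using N[OF j(1)] by simp
  qed
  then show ?thesis using that by blast
qed

section \<open>Labelling the points of a configuration\<close>

definition occ :: "nat \<Rightarrow> ('x, 'c) config \<Rightarrow> bool" where
  "occ i \<omega> \<longleftrightarrow> fst \<omega> \<inter> piece i \<noteq> {}"

text \<open>For an empty piece the value is one fixed default, which keeps \<open>pt i\<close> total
  and measurable.\<close>

definition pt :: "nat \<Rightarrow> ('x, 'c) config \<Rightarrow> 'x" where
  "pt i \<omega> = (if occ i \<omega> then SOME x. x \<in> fst \<omega> \<inter> piece i else undefined)"

lemma pt: "occ i \<omega> \<Longrightarrow> pt i \<omega> \<in> fst \<omega>" "occ i \<omega> \<Longrightarrow> pt i \<omega> \<in> piece i"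
proof -
  assume o: "occ i \<omega>"
  then have "\<exists>x. x \<in> fst \<omega> \<inter> piece i" unfolding occ_def by blast
  from someI_ex[OF this] o show "pt i \<omega> \<in> fst \<omega>" "pt i \<omega> \<in> piece i" unfolding pt_def by auto
qed

lemma pt_eq: "\<omega> \<in> \<Omega> \<Longrightarrow> x \<in> fst \<omega> \<Longrightarrow> x \<in> piece i \<Longrightarrow> occ i \<omega> \<and> pt i \<omega> = x"
proof -
  assume a: "\<omega> \<in> \<Omega>" "x \<in> fst \<omega>" "x \<in> piece i"
  then have o: "occ i \<omega>" unfolding occ_def by blast
  then have "pt i \<omega> = x"
    using a pt[OF o] piece_small[of "pt i \<omega>" i x] by (intro separated_sets_eq[OF config_separated[OF a(1)]])
  with o show ?thesis by simp
qed

lemma pt_bij: "\<omega> \<in> \<Omega> \<Longrightarrow> bij_betw (\<lambda>i. pt i \<omega>) {i. occ i \<omega>} (fst \<omega>)"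
proof (rule bij_betwI')
  assume \<omega>: "\<omega> \<in> \<Omega>"
  fix y assume "y \<in> fst \<omega>"
  then show "\<exists>i\<in>{i. occ i \<omega>}. y = pt i \<omega>" using piece_exists[of y] pt_eq[OF \<omega>] by blast
next
  fix i j assume "i \<in> {i. occ i \<omega>}" "j \<in> {i. occ i \<omega>}"
  then show "(pt i \<omega> = pt j \<omega>) = (i = j)" using pt piece_disjoint by (metis mem_Collect_eq)
qed (use pt in auto)

lemma infsum_piece:
  assumes \<omega>: "\<omega> \<in> \<Omega>"
  shows "(\<Sum>\<^sub>\<infinity>x\<in>fst \<omega>. indicator (B \<inter> piece i) x * F x) = (if occ i \<omega> \<and> pt i \<omega> \<in> B then F (pt i \<omega>) else (0::complex))"
proof -
  have "(\<Sum>\<^sub>\<infinity>x\<in>fst \<omega>. indicator (B \<inter> piece i) x * F x) = (\<Sum>\<^sub>\<infinity>x\<in>(if occ i \<omega> \<and> pt i \<omega> \<in> B then {pt i \<omega>} else {}). F x)"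
    using \<omega> pt pt_eq[OF \<omega>] by (intro infsum_cong_neutral) (auto split: split_indicator if_splits)
  then show ?thesis by simp
qed

lemma infsum_pieces_finite:
  fixes F :: "'x \<Rightarrow> complex"
  assumes \<omega>: "\<omega> \<in> \<Omega>" and N: "\<And>x i. x \<in> K \<Longrightarrow> x \<in> piece i \<Longrightarrow> i < N"
    and F: "\<And>x. x \<in> fst \<omega> \<Longrightarrow> x \<notin> K \<Longrightarrow> F x = 0"
  shows "(\<Sum>\<^sub>\<infinity>x\<in>fst \<omega>. F x) = (\<Sum>i<N. if occ i \<omega> then F (pt i \<omega>) else 0)"
proof -
  have "(\<Sum>\<^sub>\<infinity>x\<in>fst \<omega>. F x) = (\<Sum>\<^sub>\<infinity>i\<in>{i. occ i \<omega>}. F (pt i \<omega>))"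
    using infsum_reindex_bij_betw[OF pt_bij[OF \<omega>], of F] by simp
  also have "\<dots> = (\<Sum>\<^sub>\<infinity>i\<in>{..<N}. if occ i \<omega> then F (pt i \<omega>) else 0)"
  proof (rule infsum_cong_neutral)
    fix i assume i: "i \<in> {i. occ i \<omega>} - {..<N}"
    then have "pt i \<omega> \<notin> K" using N pt(2)[of i \<omega>] by auto
    then show "F (pt i \<omega>) = 0" using F pt(1)[of i \<omega>] i by auto
  qed auto
  finally show ?thesis by simp
qed

lemma sums_pieces:
  fixes F :: "'x \<Rightarrow> 'b::banach"
  assumes \<omega>: "\<omega> \<in> \<Omega>" and F: "F summable_on fst \<omega>"
  shows "(\<lambda>i. if occ i \<omega> then F (pt i \<omega>) else 0) sums (\<Sum>\<^sub>\<infinity>x\<in>fst \<omega>. F x)"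
proof -
  have "((\<lambda>i. F (pt i \<omega>)) has_sum (\<Sum>\<^sub>\<infinity>x\<in>fst \<omega>. F x)) {i. occ i \<omega>}"
    using has_sum_reindex_bij_betw[OF pt_bij[OF \<omega>], of F] has_sum_infsum[OF F] by simp
  then have "((\<lambda>i. if occ i \<omega> then F (pt i \<omega>) else 0) has_sum (\<Sum>\<^sub>\<infinity>x\<in>fst \<omega>. F x)) UNIV"
    by (subst has_sum_cong_neutral[where T="{i. occ i \<omega>}" and g="\<lambda>i. F (pt i \<omega>)"]) auto
  then show ?thesis by (rule has_sum_imp_sums)
qed

text \<open>Equal to 1 on the piece and supported in the compact doubled ball: it turns an arbitrary
  continuous function into an element of \<open>Cc euclidean\<close> without changing it on the
  piece.\<close>

definition cutoff :: "nat \<Rightarrow> 'x \<Rightarrow> complex" where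
  "cutoff i x = complex_of_real (min 1 (max 0 (2 - dist x (center i) / radius (center i))))"

lemma cutoff_piece: "x \<in> piece i \<Longrightarrow> cutoff i x = 1"
  using radius(1)[of "center i"] unfolding piece_def cutoff_def
  by (auto simp: field_simps dist_commute min_def max_def)

lemma cutoff_continuous: "continuous_on UNIV (cutoff i)"
  unfolding cutoff_def using radius(1)[of "center i"] by (intro continuous_intros) auto

lemma cutoff_support: "x \<notin> cball (center i) (2 * radius (center i)) \<Longrightarrow> cutoff i x = 0"
  using radius(1)[of "center i"] unfolding cutoff_def by (auto simp: field_simps dist_commute)

text \<open>Measurability of sums against continuous functions of compact support is upgraded to
  evaluation at one labelled point. The cutoff makes all sums finite, so they pass to pointwise
  limits of \<open>f\<close>: from continuous functions to indicators of closed sets, and then to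
  Borel sets. For the indicator of \<open>B \<inter> piece i\<close> at most one term is
  left.\<close>

lemma piece_sum_measurable:
  fixes w :: "('x, 'c) config \<Rightarrow> 'x \<Rightarrow> complex"
  assumes w: "\<And>f. f \<in> Cc euclidean \<Longrightarrow> (\<lambda>\<omega>. \<Sum>\<^sub>\<infinity>x\<in>fst \<omega>. f x * w \<omega> x) \<in> borel_measurable law"
    and B: "B \<in> sets borel"
  shows "(\<lambda>\<omega>. if occ i \<omega> \<and> pt i \<omega> \<in> B then w \<omega> (pt i \<omega>) else 0) \<in> borel_measurable law"
proof -
  define K where "K = cball (center i) (2 * radius (center i))"
  have K: "compact K" unfolding K_def by (rule radius)
  define S where "S f \<omega> = (\<Sum>\<^sub>\<infinity>x\<in>fst \<omega>. (f x * cutoff i x) * w \<omega> x)" for f :: "'x \<Rightarrow> complex" and \<omega>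
  have S_sum: "S f \<omega> = (\<Sum>x\<in>fst \<omega> \<inter> K. (f x * cutoff i x) * w \<omega> x)" if "\<omega> \<in> \<Omega>" for f \<omega>
    unfolding S_def using config_separated[OF that] K cutoff_support[of _ i]
    by (intro infsum_compact_support) (auto simp: K_def)
  have S_lim: "S f \<in> borel_measurable law"
    if "\<And>n. S (F n) \<in> borel_measurable law" "\<And>x. (\<lambda>n. F n x) \<longlonglongrightarrow> f x" for F f
  proof (rule borel_measurable_LIMSEQ_metric[OF that(1)])
    fix \<omega> assume "\<omega> \<in> space law"
    then have \<omega>: "\<omega> \<in> \<Omega>" by simp
    show "(\<lambda>n. S (F n) \<omega>) \<longlonglongrightarrow> S f \<omega>"
      unfolding S_sum[OF \<omega>] by (intro tendsto_intros that(2))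
  qed
  have S_cont: "S f \<in> borel_measurable law" if "continuous_on UNIV f" for f
    unfolding S_def[abs_def] using that K cutoff_support[of _ i] cutoff_continuous[of i]
    by (intro w Cc_euclideanI[of _ K] continuous_intros) (auto simp: K_def)
  have S_closed: "S (indicator C) \<in> borel_measurable law" if C: "closed C" for C
  proof (cases "C = {}")
    case True then show ?thesis using S_cont[of "\<lambda>_. 0"] by (simp add: indicator_def[abs_def])
  next
    case False
    define G where "G n t = complex_of_real (max 0 (1 - real n * infdist t C))" for n t
    have "continuous_on UNIV (G n)" for n
      unfolding G_def by (intro continuous_intros)
    moreover have "(\<lambda>n. G n t) \<longlonglongrightarrow> indicator C t" for t
    proof (cases "t \<in> C")
      case True then show ?thesis unfolding G_def by simp
    next
      case F: False
      then have pos: "infdist t C > 0" using False C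
        by (metis in_closed_iff_infdist_zero infdist_nonneg order_le_less)
      obtain N where N: "1 < real N * infdist t C" using reals_Archimedean3[OF pos] by auto
      have "G n t = 0" if "n \<ge> N" for n
      proof -
        have "real N * infdist t C \<le> real n * infdist t C" using that pos by simp
        then show ?thesis unfolding G_def using N by simp
      qed
      then show ?thesis using F
        by (intro tendsto_eventually) (auto simp: eventually_sequentially intro!: exI[of _ N])
    qed
    ultimately show ?thesis by (rule S_lim[of G, OF S_cont])
  qed
  have S_borel: "S (indicator B) \<in> borel_measurable law" if "B \<in> sets borel" for B
  proof -
    have "Int_stable (Collect closed :: 'x set set)" by (auto simp: Int_stable_def)
    moreover have "Collect closed \<subseteq> Pow (UNIV :: 'x set)" by simp
    moreover have "B \<in> sigma_sets UNIV (Collect closed)" using that unfolding borel_eq_closed by simp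
    ultimately show ?thesis
    proof (induction B rule: sigma_sets_induct_disjoint)
      case (basic A) then show ?case using S_closed by simp
    next
      case empty show ?case by (rule S_closed) simp
    next
      case (compl A)
      have "S (indicator UNIV) \<in> borel_measurable law" by (rule S_closed) simp
      with compl.IH have "(\<lambda>\<omega>. S (indicator UNIV) \<omega> - S (indicator A) \<omega>) \<in> borel_measurable law"
        by (intro borel_measurable_diff)
      moreover have "S (indicator UNIV) \<omega> - S (indicator A) \<omega> = S (indicator (UNIV - A)) \<omega>" if "\<omega> \<in> space law" for \<omega>
        using that by (subst (1 2 3) S_sum) (auto simp: sum_subtractf[symmetric] intro!: sum.cong split: split_indicator)
      ultimately show ?case
        by (subst measurable_cong[where g="\<lambda>\<omega>. S (indicator UNIV) \<omega> - S (indicator A) \<omega>"]) simp_all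
    next
      case (union A)
      show ?case
      proof (rule S_lim[where F="\<lambda>n. indicator (\<Union>i<n. A i)"])
        show "(\<lambda>n. indicator (\<Union>i<n. A i) t) \<longlonglongrightarrow> (indicator (\<Union>i. A i) t :: complex)" for t
          by (rule LIMSEQ_indicator_UN)
        fix n
        have "(\<lambda>\<omega>. \<Sum>i<n. S (indicator (A i)) \<omega>) \<in> borel_measurable law"
          using union by (intro borel_measurable_sum) auto
        moreover have "(\<Sum>i<n. S (indicator (A i)) \<omega>) = S (indicator (\<Union>i<n. A i)) \<omega>" if "\<omega> \<in> space law" for \<omega>
        proof -
          have ind: "(indicator (\<Union>i<n. A i) t :: complex) = (\<Sum>i<n. indicator (A i) t)" for t
            using union(1) by (intro indicator_UN_disjoint) (auto intro: disjoint_family_on_mono)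
          have "(\<Sum>i<n. S (indicator (A i)) \<omega>) = (\<Sum>j<n. \<Sum>x\<in>fst \<omega> \<inter> K. indicator (A j) x * cutoff i x * w \<omega> x)"
            using that by (simp add: S_sum)
          also have "\<dots> = (\<Sum>x\<in>fst \<omega> \<inter> K. \<Sum>j<n. indicator (A j) x * cutoff i x * w \<omega> x)"
            by (rule sum.swap)
          also have "\<dots> = S (indicator (\<Union>i<n. A i)) \<omega>"
            using that by (simp only: space_law S_sum ind sum_distrib_right)
          finally show ?thesis .
        qed
        ultimately show "S (indicator (\<Union>i<n. A i)) \<in> borel_measurable law"
          by (subst measurable_cong[where g="\<lambda>\<omega>. \<Sum>i<n. S (indicator (A i)) \<omega>"]) simp_all
      qed
    qed
  qed
  have "S (indicator (B \<inter> piece i)) \<omega> = (if occ i \<omega> \<and> pt i \<omega> \<in> B then w \<omega> (pt i \<omega>) else 0)" if \<omega>: "\<omega> \<in> space law" for \<omega>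
  proof -
    have "S (indicator (B \<inter> piece i)) \<omega> = (\<Sum>\<^sub>\<infinity>x\<in>fst \<omega>. indicator (B \<inter> piece i) x * w \<omega> x)"
      unfolding S_def by (intro infsum_cong) (auto simp: cutoff_piece split: split_indicator)
    then show ?thesis using \<omega> infsum_piece[of \<omega> B i "w \<omega>"] by simp
  qed
  moreover have "S (indicator (B \<inter> piece i)) \<in> borel_measurable law" using B by (intro S_borel) auto
  ultimately show ?thesis by (subst measurable_cong[where g="S (indicator (B \<inter> piece i))"]) simp_all
qed

lemma occ_pt_sets:
  assumes "B \<in> sets borel"
  shows "{\<omega> \<in> space law. occ i \<omega> \<and> pt i \<omega> \<in> B} \<in> sets law"
proof -
  have "(\<lambda>\<omega>. if occ i \<omega> \<and> pt i \<omega> \<in> B then 1 else 0 :: complex) \<in> borel_measurable law"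
    using piece_sum_measurable[of "\<lambda>_ _. 1" B i] point_sum_measurable assms by simp
  then have "{\<omega> \<in> space law. (if occ i \<omega> \<and> pt i \<omega> \<in> B then 1 else 0 :: complex) = 1} \<in> sets law"
    by measurable
  moreover have "{\<omega> \<in> space law. (if occ i \<omega> \<and> pt i \<omega> \<in> B then 1 else 0 :: complex) = 1} = {\<omega> \<in> space law. occ i \<omega> \<and> pt i \<omega> \<in> B}"
    by auto
  ultimately show ?thesis by simp
qed

lemma occ_measurable [measurable]: "Measurable.pred law (occ i)"
  using occ_pt_sets[of UNIV i] by (simp add: pred_def)

lemma pt_measurable [measurable]: "pt i \<in> law \<rightarrow>\<^sub>M borel"
proof (rule measurableI)
  fix B :: "'x set" assume B: "B \<in> sets borel"
  have "pt i -` B \<inter> space law = {\<omega> \<in> space law. occ i \<omega> \<and> pt i \<omega> \<in> B} \<union> ({\<omega> \<in> space law. \<not> occ i \<omega>} \<inter> (if undefined \<in> B then space law else {}))"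
    by (auto simp: pt_def split: if_splits)
  also have "\<dots> \<in> sets law"
  proof (intro sets.Un sets.Int occ_pt_sets B)
    show "{\<omega> \<in> space law. \<not> occ i \<omega>} \<in> sets law" by measurable
    show "(if undefined \<in> B then space law else {}) \<in> sets law" using sets.top[of law] by auto
  qed
  finally show "pt i -` B \<inter> space law \<in> sets law" .
qed simp

end

context configuration_process
begin

subsection \<open>The direct integral\<close>

abbreviation DI :: "(('x, 'c) config \<times> 'x) hilbert" where "DI \<equiv> direct_integral \<mu> \<Omega>"

abbreviation section_at :: "(('x, 'c) config \<times> 'x \<Rightarrow> complex) \<Rightarrow> ('x, 'c) config \<Rightarrow> 'x \<Rightarrow> complex" where
  "section_at v \<omega> \<equiv> (\<lambda>x. v (\<omega>, x))"

text \<open>Measurability of a section in terms of the labelled points. It follows from the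
  measurability demanded by \<open>direct_integral\<close> (\<open>DI_coords\<close>) and implies it
  (\<open>DI_VecI\<close>), and unlike the latter it is visibly stable under pointwise
  operations.\<close>

definition coords_measurable :: "(('x, 'c) config \<times> 'x \<Rightarrow> complex) \<Rightarrow> bool" where
  "coords_measurable v \<longleftrightarrow> (\<forall>i. (\<lambda>\<omega>. if occ i \<omega> then v (\<omega>, pt i \<omega>) else 0) \<in> borel_measurable law)"

lemma DI_Vec:
  "v \<in> Vec DI \<longleftrightarrow> (\<forall>\<omega>\<in>\<Omega>. section_at v \<omega> \<in> Vec (l2 (fst \<omega>))) \<and>
     (\<forall>f\<in>Cc euclidean. (\<lambda>\<omega>. Ip (l2 (fst \<omega>)) f (section_at v \<omega>)) \<in> borel_measurable law) \<and>
     integrable law (\<lambda>\<omega>. (vnorm (l2 (fst \<omega>)) (section_at v \<omega>))\<^sup>2)"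
  unfolding direct_integral_def by simp

lemma DI_Ip: "Ip DI v w = (LINT \<omega>|law. Ip (l2 (fst \<omega>)) (section_at v \<omega>) (section_at w \<omega>))"
  unfolding direct_integral_def by simp

lemma DI_section: "v \<in> Vec DI \<Longrightarrow> \<omega> \<in> \<Omega> \<Longrightarrow> section_at v \<omega> \<in> Vec (l2 (fst \<omega>))"
  unfolding DI_Vec by blast

lemma DI_coords: "v \<in> Vec DI \<Longrightarrow> coords_measurable v"
  unfolding coords_measurable_def
proof
  fix i assume v: "v \<in> Vec DI"
  have "(\<lambda>\<omega>. \<Sum>\<^sub>\<infinity>x\<in>fst \<omega>. f x * v (\<omega>, x)) \<in> borel_measurable law" if f: "f \<in> Cc euclidean" for f
  proof -
    have "(\<lambda>\<omega>. Ip (l2 (fst \<omega>)) (\<lambda>x. cnj (f x)) (section_at v \<omega>)) \<in> borel_measurable law"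
      using v Cc_cnj[OF f] unfolding DI_Vec by blast
    then show ?thesis unfolding l2_Ip by simp
  qed
  from piece_sum_measurable[of "\<lambda>\<omega> x. v (\<omega>, x)" UNIV i, OF this]
  show "(\<lambda>\<omega>. if occ i \<omega> then v (\<omega>, pt i \<omega>) else 0) \<in> borel_measurable law" by simp
qed

lemma section_Ip_measurable:
  assumes v: "coords_measurable v" "\<And>\<omega>. \<omega> \<in> \<Omega> \<Longrightarrow> section_at v \<omega> \<in> Vec (l2 (fst \<omega>))"
    and w: "coords_measurable w" "\<And>\<omega>. \<omega> \<in> \<Omega> \<Longrightarrow> section_at w \<omega> \<in> Vec (l2 (fst \<omega>))"
  shows "(\<lambda>\<omega>. Ip (l2 (fst \<omega>)) (section_at v \<omega>) (section_at w \<omega>)) \<in> borel_measurable law"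
proof -
  let ?c = "\<lambda>v i \<omega>. if occ i \<omega> then v (\<omega>, pt i \<omega>) else 0 :: complex"
  have "(\<lambda>\<omega>. \<Sum>i. cnj (?c v i \<omega>) * ?c w i \<omega>) \<in> borel_measurable law"
  proof (rule borel_measurable_suminf)
    fix i
    have "?c v i \<in> borel_measurable law" "?c w i \<in> borel_measurable law"
      using v(1) w(1) unfolding coords_measurable_def by auto
    then show "(\<lambda>\<omega>. cnj (?c v i \<omega>) * ?c w i \<omega>) \<in> borel_measurable law"
      by (intro borel_measurable_times borel_measurable_continuous_on[OF continuous_on_cnj[OF continuous_on_id]])
  qed
  moreover have "(\<Sum>i. cnj (?c v i \<omega>) * ?c w i \<omega>) = Ip (l2 (fst \<omega>)) (section_at v \<omega>) (section_at w \<omega>)" if "\<omega> \<in> space law" for \<omega>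
  proof -
    have "(\<lambda>i. if occ i \<omega> then cnj (v (\<omega>, pt i \<omega>)) * w (\<omega>, pt i \<omega>) else 0) sums Ip (l2 (fst \<omega>)) (section_at v \<omega>) (section_at w \<omega>)"
      unfolding l2_Ip using that v(2) w(2) by (intro sums_pieces l2_summable) auto
    moreover have "(\<lambda>i. if occ i \<omega> then cnj (v (\<omega>, pt i \<omega>)) * w (\<omega>, pt i \<omega>) else 0) = (\<lambda>i. cnj (?c v i \<omega>) * ?c w i \<omega>)"
      by auto
    ultimately show ?thesis by (simp only: sums_unique[symmetric])
  qed
  ultimately show ?thesis by (subst measurable_cong[where g="\<lambda>\<omega>. \<Sum>i. cnj (?c v i \<omega>) * ?c w i \<omega>"]) simp_all
qed

lemma section_norm_measurable:
  assumes v: "coords_measurable v" "\<And>\<omega>. \<omega> \<in> \<Omega> \<Longrightarrow> section_at v \<omega> \<in> Vec (l2 (fst \<omega>))"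
  shows "(\<lambda>\<omega>. (vnorm (l2 (fst \<omega>)) (section_at v \<omega>))\<^sup>2) \<in> borel_measurable law"
proof -
  have "(\<lambda>\<omega>. Re (Ip (l2 (fst \<omega>)) (section_at v \<omega>) (section_at v \<omega>))) \<in> borel_measurable law"
    using section_Ip_measurable[OF v v] by measurable
  moreover have "Re (Ip (l2 (fst \<omega>)) (section_at v \<omega>) (section_at v \<omega>)) = (vnorm (l2 (fst \<omega>)) (section_at v \<omega>))\<^sup>2" for \<omega>
    unfolding l2_vnorm_sq l2_Ip_self by simp
  ultimately show ?thesis by simp
qed

text \<open>A function in \<open>Cc euclidean\<close> meets only finitely many pieces, so its inner
  product with the section is a finite sum of coordinates over a range that is the same for all
  configurations.\<close>

lemma DI_VecI:
  assumes v: "coords_measurable v" "\<And>\<omega>. \<omega> \<in> \<Omega> \<Longrightarrow> section_at v \<omega> \<in> Vec (l2 (fst \<omega>))"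
    and g: "integrable law g" "\<And>\<omega>. \<omega> \<in> \<Omega> \<Longrightarrow> (vnorm (l2 (fst \<omega>)) (section_at v \<omega>))\<^sup>2 \<le> g \<omega>"
  shows "v \<in> Vec DI"
  unfolding DI_Vec
proof (intro conjI ballI v(2))
  show "integrable law (\<lambda>\<omega>. (vnorm (l2 (fst \<omega>)) (section_at v \<omega>))\<^sup>2)"
    by (rule Bochner_Integration.integrable_bound[OF g(1)])
       (auto intro!: section_norm_measurable v AE_I2 order.trans[OF g(2) abs_ge_self])
  fix f :: "'x \<Rightarrow> complex" assume f: "f \<in> Cc euclidean"
  obtain K where K: "continuous_on UNIV f" "compact K" "\<And>x. x \<notin> K \<Longrightarrow> f x = 0" using Cc_euclideanE[OF f] by metis
  obtain N where N0: "\<And>x i. x \<in> K \<Longrightarrow> x \<in> piece i \<Longrightarrow> i < N" using compact_pieces[OF K(2)] by blast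
  note N = infsum_pieces_finite[OF _ N0]
  have [measurable]: "f \<in> borel_measurable borel" using K(1) by (rule borel_measurable_continuous_onI)
  have "(\<lambda>\<omega>. \<Sum>i<N. cnj (f (pt i \<omega>)) * (if occ i \<omega> then v (\<omega>, pt i \<omega>) else 0)) \<in> borel_measurable law"
  proof (intro borel_measurable_sum borel_measurable_times)
    fix i
    show "(\<lambda>\<omega>. if occ i \<omega> then v (\<omega>, pt i \<omega>) else 0) \<in> borel_measurable law"
      using v(1) unfolding coords_measurable_def by blast
    have "(\<lambda>\<omega>. f (pt i \<omega>)) \<in> borel_measurable law" by measurable
    then show "(\<lambda>\<omega>. cnj (f (pt i \<omega>))) \<in> borel_measurable law"
      by (intro borel_measurable_continuous_on[OF continuous_on_cnj[OF continuous_on_id]])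
  qed
  moreover have "(\<Sum>i<N. cnj (f (pt i \<omega>)) * (if occ i \<omega> then v (\<omega>, pt i \<omega>) else 0)) = Ip (l2 (fst \<omega>)) f (section_at v \<omega>)"
    if "\<omega> \<in> space law" for \<omega>
  proof -
    have "Ip (l2 (fst \<omega>)) f (section_at v \<omega>) = (\<Sum>i<N. if occ i \<omega> then cnj (f (pt i \<omega>)) * v (\<omega>, pt i \<omega>) else 0)"
      unfolding l2_Ip using that K(3) by (intro N) auto
    then show ?thesis by (simp add: if_distrib cong: if_cong)
  qed
  ultimately show "(\<lambda>\<omega>. Ip (l2 (fst \<omega>)) f (section_at v \<omega>)) \<in> borel_measurable law"
    by (subst measurable_cong[where g="\<lambda>\<omega>. \<Sum>i<N. cnj (f (pt i \<omega>)) * (if occ i \<omega> then v (\<omega>, pt i \<omega>) else 0)"]) simp_all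
qed

lemma DI_norm_integrable: "v \<in> Vec DI \<Longrightarrow> integrable law (\<lambda>\<omega>. (vnorm (l2 (fst \<omega>)) (section_at v \<omega>))\<^sup>2)"
  unfolding DI_Vec by blast

lemma DI_Ip_integrable:
  assumes v: "v \<in> Vec DI" and w: "w \<in> Vec DI"
  shows "integrable law (\<lambda>\<omega>. Ip (l2 (fst \<omega>)) (section_at v \<omega>) (section_at w \<omega>))"
proof (rule Bochner_Integration.integrable_bound)
  show "integrable law (\<lambda>\<omega>. (vnorm (l2 (fst \<omega>)) (section_at v \<omega>))\<^sup>2 + (vnorm (l2 (fst \<omega>)) (section_at w \<omega>))\<^sup>2)"
    using DI_norm_integrable[OF v] DI_norm_integrable[OF w] by simp
  show "(\<lambda>\<omega>. Ip (l2 (fst \<omega>)) (section_at v \<omega>) (section_at w \<omega>)) \<in> borel_measurable law"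
    using assms by (intro section_Ip_measurable DI_coords DI_section)
  show "AE \<omega> in law. norm (Ip (l2 (fst \<omega>)) (section_at v \<omega>) (section_at w \<omega>)) \<le>
     norm ((vnorm (l2 (fst \<omega>)) (section_at v \<omega>))\<^sup>2 + (vnorm (l2 (fst \<omega>)) (section_at w \<omega>))\<^sup>2)"
  proof (rule AE_I2)
    fix \<omega> assume "\<omega> \<in> space law"
    then have \<omega>: "\<omega> \<in> \<Omega>" by simp
    interpret semi_hilbert "l2 (fst \<omega>)" by (rule semi_hilbert_l2)
    let ?a = "vnorm (l2 (fst \<omega>)) (section_at v \<omega>)" and ?b = "vnorm (l2 (fst \<omega>)) (section_at w \<omega>)"
    have "cmod (Ip (l2 (fst \<omega>)) (section_at v \<omega>) (section_at w \<omega>)) \<le> ?a * ?b"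
      using DI_section[OF v \<omega>] DI_section[OF w \<omega>] by (rule Cauchy_Schwarz)
    also have "\<dots> \<le> ?a\<^sup>2 + ?b\<^sup>2"
      using zero_le_power2[of "?a - ?b"] zero_le_power2[of ?a] zero_le_power2[of ?b]
      unfolding power2_diff by linarith
    finally show "norm (Ip (l2 (fst \<omega>)) (section_at v \<omega>) (section_at w \<omega>)) \<le> norm (?a\<^sup>2 + ?b\<^sup>2)" by simp
  qed
qed

lemma semi_hilbert_DI: "semi_hilbert DI"
proof
  show "(\<lambda>_. 0) \<in> Vec DI"
    by (rule DI_VecI[where g="\<lambda>_. 0"]) (auto simp: coords_measurable_def l2_Vec l2_vnorm_sq)
  show lin: "(\<lambda>i. a * v i + w i) \<in> Vec DI" if v: "v \<in> Vec DI" and w: "w \<in> Vec DI" for v w a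
  proof (rule DI_VecI[where g="\<lambda>\<omega>. 2 * (cmod a)\<^sup>2 * (vnorm (l2 (fst \<omega>)) (section_at v \<omega>))\<^sup>2 + 2 * (vnorm (l2 (fst \<omega>)) (section_at w \<omega>))\<^sup>2"])
    show "coords_measurable (\<lambda>i. a * v i + w i)"
      unfolding coords_measurable_def
    proof
      fix i
      let ?c = "\<lambda>v \<omega>. if occ i \<omega> then v (\<omega>, pt i \<omega>) else 0 :: complex"
      have "?c v \<in> borel_measurable law" "?c w \<in> borel_measurable law"
        using DI_coords[OF v] DI_coords[OF w] unfolding coords_measurable_def by auto
      then have "(\<lambda>\<omega>. a * ?c v \<omega> + ?c w \<omega>) \<in> borel_measurable law" by measurable
      moreover have "(\<lambda>\<omega>. a * ?c v \<omega> + ?c w \<omega>) = ?c (\<lambda>i. a * v i + w i)" by auto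
      ultimately show "?c (\<lambda>i. a * v i + w i) \<in> borel_measurable law" by simp
    qed
    show "integrable law (\<lambda>\<omega>. 2 * (cmod a)\<^sup>2 * (vnorm (l2 (fst \<omega>)) (section_at v \<omega>))\<^sup>2 + 2 * (vnorm (l2 (fst \<omega>)) (section_at w \<omega>))\<^sup>2)"
      using DI_norm_integrable[OF v] DI_norm_integrable[OF w] by simp
    fix \<omega> assume \<omega>: "\<omega> \<in> \<Omega>"
    interpret semi_hilbert "l2 (fst \<omega>)" by (rule semi_hilbert_l2)
    show "section_at (\<lambda>i. a * v i + w i) \<omega> \<in> Vec (l2 (fst \<omega>))"
      using DI_section[OF v \<omega>] DI_section[OF w \<omega>] by (rule Vec_lin)
    let ?a = "vnorm (l2 (fst \<omega>)) (section_at v \<omega>)" and ?b = "vnorm (l2 (fst \<omega>)) (section_at w \<omega>)"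
    have "(vnorm (l2 (fst \<omega>)) (section_at (\<lambda>i. a * v i + w i) \<omega>))\<^sup>2 \<le> (cmod a * ?a + ?b)\<^sup>2"
      using DI_section[OF v \<omega>] DI_section[OF w \<omega>] Ip_nonneg
      by (intro power_mono vnorm_lin_le) (auto intro: Vec_lin)
    also have "\<dots> \<le> 2 * (cmod a * ?a)\<^sup>2 + 2 * ?b\<^sup>2"
      using zero_le_power2[of "cmod a * ?a - ?b"] by (simp add: power2_sum power2_diff)
    finally show "(vnorm (l2 (fst \<omega>)) (section_at (\<lambda>i. a * v i + w i) \<omega>))\<^sup>2 \<le> 2 * (cmod a)\<^sup>2 * ?a\<^sup>2 + 2 * ?b\<^sup>2"
      by (simp add: power_mult_distrib)
  qed
  show "Ip DI u (\<lambda>i. a * v i + w i) = a * Ip DI u v + Ip DI u w"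
    if u: "u \<in> Vec DI" and v: "v \<in> Vec DI" and w: "w \<in> Vec DI" for u v w a
  proof -
    have "Ip DI u (\<lambda>i. a * v i + w i) = (LINT \<omega>|law. a * Ip (l2 (fst \<omega>)) (section_at u \<omega>) (section_at v \<omega>)
        + Ip (l2 (fst \<omega>)) (section_at u \<omega>) (section_at w \<omega>))"
      unfolding DI_Ip using u v w
      by (intro Bochner_Integration.integral_cong refl) (simp add: semi_hilbert.Ip_lin[OF semi_hilbert_l2] DI_section)
    then show ?thesis unfolding DI_Ip using DI_Ip_integrable u v w by simp
  qed
  show "Ip DI w v = cnj (Ip DI v w)" if "v \<in> Vec DI" "w \<in> Vec DI" for v w
  proof -
    have "Ip DI w v = (LINT \<omega>|law. cnj (Ip (l2 (fst \<omega>)) (section_at v \<omega>) (section_at w \<omega>)))"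
      unfolding DI_Ip using that
      by (intro Bochner_Integration.integral_cong refl semi_hilbert.Ip_cnj[OF semi_hilbert_l2]) (auto intro: DI_section)
    then show ?thesis unfolding DI_Ip by (simp only: Bochner_Integration.integral_cnj)
  qed
  show "0 \<le> Re (Ip DI v v)" if "v \<in> Vec DI" for v
  proof -
    have "Re (Ip DI v v) = (LINT \<omega>|law. Re (Ip (l2 (fst \<omega>)) (section_at v \<omega>) (section_at v \<omega>)))"
      unfolding DI_Ip using DI_Ip_integrable[OF that that] by (rule integral_Re[symmetric])
    also have "\<dots> \<ge> 0"
      using that by (intro integral_nonneg_AE AE_I2) (auto intro!: semi_hilbert.Ip_nonneg[OF semi_hilbert_l2] DI_section)
    finally show ?thesis .
  qed
qed

subsection \<open>Campbell measures\<close>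

definition weight :: "(('x, 'c) config \<Rightarrow> 'x \<Rightarrow> ennreal) \<Rightarrow> bool" where
  "weight a \<longleftrightarrow> (\<forall>i. (\<lambda>\<omega>. if occ i \<omega> then a \<omega> (pt i \<omega>) else 0) \<in> borel_measurable law)"

text \<open>The measure of \<open>B\<close> is the mean of the sum of \<open>a \<omega> x\<close>
  over the points \<open>x\<close> of \<omega> in \<open>B\<close>
  (\<open>nn_integral_campbell\<close>). As an image of a measure on labels times configurations it
  is countably additive by construction.\<close>

definition campbell :: "(('x, 'c) config \<Rightarrow> 'x \<Rightarrow> ennreal) \<Rightarrow> 'x measure" where
  "campbell a = distr (density (count_space UNIV \<Otimes>\<^sub>M law) (\<lambda>(i, \<omega>). if occ i \<omega> then a \<omega> (pt i \<omega>) else 0))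
     borel (\<lambda>(i, \<omega>). pt i \<omega>)"

lemma sets_campbell [simp]: "sets (campbell a) = sets borel"
  and space_campbell [simp]: "space (campbell a) = UNIV"
  unfolding campbell_def by simp_all

lemma weight_const [simp]: "weight (\<lambda>_ _. k)"
  unfolding weight_def by measurable

lemma nn_sum_pieces:
  assumes \<omega>: "\<omega> \<in> \<Omega>"
  shows "(\<Sum>i. if occ i \<omega> then F (pt i \<omega>) else 0) = (\<integral>\<^sup>+ x. F x \<partial>count_space (fst \<omega>))"
proof -
  have "(\<Sum>i. if occ i \<omega> then F (pt i \<omega>) else 0) = (\<integral>\<^sup>+ i. (if occ i \<omega> then F (pt i \<omega>) else 0) \<partial>count_space UNIV)"
    by (rule nn_integral_count_space_nat[symmetric])
  also have "\<dots> = (\<integral>\<^sup>+ i. F (pt i \<omega>) * indicator {i. occ i \<omega>} i \<partial>count_space UNIV)"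
    by (intro nn_integral_cong) simp
  also have "\<dots> = (\<integral>\<^sup>+ i. F (pt i \<omega>) \<partial>count_space {i. occ i \<omega>})"
    by (rule nn_integral_count_space_indicator[symmetric]) simp
  also have "\<dots> = (\<integral>\<^sup>+ x. F x \<partial>count_space (fst \<omega>))"
    by (rule nn_integral_bij_count_space[OF pt_bij[OF \<omega>]])
  finally show ?thesis .
qed

lemma nn_sum_measurable:
  assumes a: "weight a" and F: "F \<in> borel_measurable borel"
  shows "(\<lambda>\<omega>. \<integral>\<^sup>+ x. F x * a \<omega> x \<partial>count_space (fst \<omega>)) \<in> borel_measurable law"
proof -
  have "(\<lambda>\<omega>. \<Sum>i. F (pt i \<omega>) * (if occ i \<omega> then a \<omega> (pt i \<omega>) else 0)) \<in> borel_measurable law"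
    using a F unfolding weight_def
    by (intro borel_measurable_suminf_order borel_measurable_times_ennreal measurable_compose[OF pt_measurable F]) auto
  moreover have "(\<Sum>i. F (pt i \<omega>) * (if occ i \<omega> then a \<omega> (pt i \<omega>) else 0)) = (\<integral>\<^sup>+ x. F x * a \<omega> x \<partial>count_space (fst \<omega>))"
    if "\<omega> \<in> space law" for \<omega>
    using nn_sum_pieces[of \<omega> "\<lambda>x. F x * a \<omega> x"] that by (simp add: if_distrib cong: if_cong)
  ultimately show ?thesis
    by (subst measurable_cong[where g="\<lambda>\<omega>. \<Sum>i. F (pt i \<omega>) * (if occ i \<omega> then a \<omega> (pt i \<omega>) else 0)"]) simp_all
qed

lemma nn_integral_campbell:
  assumes a: "weight a" and F: "F \<in> borel_measurable borel"
  shows "(\<integral>\<^sup>+ x. F x \<partial>campbell a) = (\<integral>\<^sup>+ \<omega>. (\<integral>\<^sup>+ x. F x * a \<omega> x \<partial>count_space (fst \<omega>)) \<partial>law)"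
proof -
  interpret law: prob_space law by (rule law_prob_space)
  let ?M = "count_space UNIV \<Otimes>\<^sub>M law :: (nat \<times> ('x, 'c) config) measure"
  let ?a = "\<lambda>(i, \<omega>). if occ i \<omega> then a \<omega> (pt i \<omega>) else 0"
  have am: "?a \<in> borel_measurable ?M"
    using a unfolding weight_def by (intro measurable_pair_measure_countable1) auto
  have pm: "(\<lambda>(i, \<omega>). pt i \<omega>) \<in> ?M \<rightarrow>\<^sub>M borel"
    by (intro measurable_pair_measure_countable1) auto
  have Fm: "(\<lambda>p. F (case p of (i, \<omega>) \<Rightarrow> pt i \<omega>)) \<in> borel_measurable ?M"
    using pm F by (rule measurable_compose)
  have "(\<integral>\<^sup>+ x. F x \<partial>campbell a) = (\<integral>\<^sup>+ p. F (case p of (i, \<omega>) \<Rightarrow> pt i \<omega>) \<partial>density ?M ?a)"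
    unfolding campbell_def using pm F by (intro nn_integral_distr) auto
  also have "\<dots> = (\<integral>\<^sup>+ p. ?a p * F (case p of (i, \<omega>) \<Rightarrow> pt i \<omega>) \<partial>?M)"
    using am Fm by (rule nn_integral_density)
  also have "\<dots> = (\<integral>\<^sup>+ i. (\<integral>\<^sup>+ \<omega>. ?a (i, \<omega>) * F (pt i \<omega>) \<partial>law) \<partial>count_space UNIV)"
    using am Fm by (subst law.nn_integral_fst[symmetric]) auto
  also have "\<dots> = (\<Sum>i. (\<integral>\<^sup>+ \<omega>. ?a (i, \<omega>) * F (pt i \<omega>) \<partial>law))"
    by (rule nn_integral_count_space_nat)
  also have "\<dots> = (\<integral>\<^sup>+ \<omega>. (\<Sum>i. ?a (i, \<omega>) * F (pt i \<omega>)) \<partial>law)"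
  proof (rule nn_integral_suminf[symmetric])
    fix i
    show "(\<lambda>\<omega>. ?a (i, \<omega>) * F (pt i \<omega>)) \<in> borel_measurable law"
      using a unfolding weight_def by (auto intro!: borel_measurable_times_ennreal measurable_compose[OF pt_measurable F])
  qed
  also have "\<dots> = (\<integral>\<^sup>+ \<omega>. (\<integral>\<^sup>+ x. F x * a \<omega> x \<partial>count_space (fst \<omega>)) \<partial>law)"
  proof (rule nn_integral_cong)
    fix \<omega> assume "\<omega> \<in> space law"
    then show "(\<Sum>i. ?a (i, \<omega>) * F (pt i \<omega>)) = (\<integral>\<^sup>+ x. F x * a \<omega> x \<partial>count_space (fst \<omega>))"
      using nn_sum_pieces[of \<omega> "\<lambda>x. F x * a \<omega> x"] by (simp add: if_distrib if_distribR mult.commute cong: if_cong)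
  qed
  finally show ?thesis .
qed

section \<open>Invariance of Campbell measures\<close>

lemma act_config_configs: "\<omega> \<in> configs \<Longrightarrow> act_config act g \<omega> \<in> configs"
proof -
  assume "\<omega> \<in> configs"
  then have "act g ` fst \<omega> \<in> separated_sets"
    unfolding configs_def separated_sets_def by (fastforce simp: act_isometry)
  then show ?thesis unfolding configs_def act_config_def by (auto simp: case_prod_unfold)
qed

text \<open>
  The measurability of the action is a consequence of the invariance of the law: a set that is not
  measurable has measure zero by convention, so preimages of sets of positive measure are
  measurable.
\<close>

lemma act_config_measurable: "act_config act g \<in> \<mu> \<rightarrow>\<^sub>M \<mu>"
proof -
  interpret prob_space \<mu> by (rule probability)
  let ?f = "act_config act g" and ?m = "\<lambda>A. emeasure \<mu> (act_config act g -` A \<inter> space \<mu>)"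
  have inv: "measure_of (space \<mu>) (sets \<mu>) ?m = \<mu>"
    using invariant[of g] unfolding distr_def .
  \<comment> \<open>If the image set function were not a measure, \<open>measure_of\<close> would
    return the zero measure; by invariance it returns the probability measure \<mu>.\<close>
  have "measure_space (space \<mu>) (sigma_sets (space \<mu>) (sets \<mu>)) ?m"
  proof (rule ccontr)
    assume "\<not> ?thesis"
    then have "emeasure (measure_of (space \<mu>) (sets \<mu>) ?m) (space \<mu>) = 0"
      by (subst emeasure_measure_of_conv) simp
    then show False unfolding inv emeasure_space_1 by simp
  qed
  then have pre: "?m A = emeasure \<mu> A" if "A \<in> sets \<mu>" for A
    using that arg_cong[OF inv, of "\<lambda>M. emeasure M A"]
    by (subst (asm) emeasure_measure_of_conv) (auto simp: sets.sigma_sets_eq)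
  have pos: "?f -` A \<inter> space \<mu> \<in> sets \<mu>" if "A \<in> sets \<mu>" "emeasure \<mu> A \<noteq> 0" for A
    using pre[OF that(1)] that(2) emeasure_notin_sets by metis
  have into: "?f \<in> space \<mu> \<rightarrow> space \<mu>" using act_config_configs by auto
  show ?thesis
  proof (rule measurableI)
    fix A assume A: "A \<in> sets \<mu>"
    show "?f -` A \<inter> space \<mu> \<in> sets \<mu>"
    proof (cases "emeasure \<mu> A = 0")
      \<comment> \<open>For a null set the complement has measure 1, hence a measurable preimage,
        and the preimage of the set is the complement of that.\<close>
      case True
      have "emeasure \<mu> (space \<mu> - A) = 1"
        using True A emeasure_compl[OF A] emeasure_space_1 by simp
      then have "?f -` (space \<mu> - A) \<inter> space \<mu> \<in> sets \<mu>" using sets.compl_sets[OF A] by (intro pos) simp_all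
      then have "space \<mu> - (?f -` (space \<mu> - A) \<inter> space \<mu>) \<in> sets \<mu>" by (rule sets.compl_sets)
      moreover have "space \<mu> - (?f -` (space \<mu> - A) \<inter> space \<mu>) = ?f -` A \<inter> space \<mu>" using into by auto
      ultimately show ?thesis by simp
    qed (use pos A in blast)
  qed (use into in auto)
qed

lemma AE_act_Omega: "AE \<omega> in \<mu>. act_config act g \<omega> \<in> \<Omega>"
proof -
  have "AE \<omega> in distr \<mu> \<mu> (act_config act g). \<omega> \<in> \<Omega>" unfolding invariant by (rule AE_Omega)
  moreover have "{\<omega> \<in> space \<mu>. \<omega> \<in> \<Omega>} = \<Omega>" using Omega_configs by auto
  ultimately show ?thesis using act_config_measurable Omega_sets by (subst (asm) AE_distr_iff) simp_all
qed

text \<open>The condition is asked where the translated configuration is again in \<Omega>, which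
  \<open>AE_act_Omega\<close> provides almost surely for each \<open>g\<close>.\<close>

definition covariant :: "(('x, 'c) config \<Rightarrow> 'x \<Rightarrow> ennreal) \<Rightarrow> bool" where
  "covariant a \<longleftrightarrow> (\<forall>g. \<forall>\<omega>\<in>\<Omega>. act_config act g \<omega> \<in> \<Omega> \<longrightarrow>
     (\<forall>x\<in>fst \<omega>. a (act_config act g \<omega>) (act g x) = a \<omega> x))"

text \<open>Relabelling points by \<open>g\<close> identifies the weighted sum of \<open>F\<close>
  over the translated configuration with that of \<open>F (act g x)\<close> over \<omega>, by
  covariance; invariance of \<mu> then removes the translation of the configuration.\<close>

lemma campbell_invariant:
  assumes a: "weight a" "covariant a" and F: "F \<in> borel_measurable borel"
  shows "(\<integral>\<^sup>+ x. F (act g x) \<partial>campbell a) = (\<integral>\<^sup>+ x. F x \<partial>campbell a)"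
proof -
  define \<Psi> where "\<Psi> F \<omega> = (\<integral>\<^sup>+ x. F x * a \<omega> x \<partial>count_space (fst \<omega>))" for F \<omega>
  have am: "act g \<in> borel_measurable borel"
  proof -
    have "continuous_on UNIV ((\<lambda>(g, x). act g x) \<circ> (\<lambda>x. (g, x)))"
      by (intro continuous_on_compose continuous_intros continuous_on_subset[OF act_continuous]) auto
    then show ?thesis by (intro borel_measurable_continuous_onI) (simp add: comp_def)
  qed
  have Fg: "(\<lambda>x. F (act g x)) \<in> borel_measurable borel" using am F by (rule measurable_compose)
  have law_int: "(\<integral>\<^sup>+ \<omega>. \<Psi> F \<omega> \<partial>law) = (\<integral>\<^sup>+ \<omega>. \<Psi> F \<omega> * indicator \<Omega> \<omega> \<partial>\<mu>)" for F
    using Omega_configs by (subst nn_integral_restrict_space) (auto simp: Int_absorb2 mult.commute)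
  have meas: "(\<lambda>\<omega>. \<Psi> F \<omega> * indicator \<Omega> \<omega>) \<in> borel_measurable \<mu>"
    using nn_sum_measurable[OF a(1) F] Omega_configs unfolding \<Psi>_def[symmetric]
    by (subst (asm) borel_measurable_restrict_space_iff_ennreal) (auto simp: Int_absorb2 mult.commute)
  have shift: "\<Psi> F (act_config act g \<omega>) = \<Psi> (\<lambda>x. F (act g x)) \<omega>"
    if "\<omega> \<in> \<Omega>" "act_config act g \<omega> \<in> \<Omega>" for \<omega>
  proof -
    have "bij_betw (act g) (fst \<omega>) (fst (act_config act g \<omega>))"
      using act_inj[of g] by (auto simp: act_config_def case_prod_unfold bij_betw_def intro: inj_on_subset)
    from nn_integral_bij_count_space[OF this, of "\<lambda>x. F x * a (act_config act g \<omega>) x"]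
    have "\<Psi> F (act_config act g \<omega>) = (\<integral>\<^sup>+ x. F (act g x) * a (act_config act g \<omega>) (act g x) \<partial>count_space (fst \<omega>))"
      unfolding \<Psi>_def by simp
    also have "\<dots> = \<Psi> (\<lambda>x. F (act g x)) \<omega>"
      unfolding \<Psi>_def using a(2) that by (intro nn_integral_cong) (simp add: covariant_def)
    finally show ?thesis .
  qed
  have "(\<integral>\<^sup>+ \<omega>. \<Psi> F \<omega> * indicator \<Omega> \<omega> \<partial>\<mu>) = (\<integral>\<^sup>+ \<omega>. \<Psi> F \<omega> * indicator \<Omega> \<omega> \<partial>distr \<mu> \<mu> (act_config act g))"
    unfolding invariant ..
  also have "\<dots> = (\<integral>\<^sup>+ \<omega>. \<Psi> F (act_config act g \<omega>) * indicator \<Omega> (act_config act g \<omega>) \<partial>\<mu>)"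
    using meas by (intro nn_integral_distr act_config_measurable) simp
  also have "\<dots> = (\<integral>\<^sup>+ \<omega>. \<Psi> (\<lambda>x. F (act g x)) \<omega> * indicator \<Omega> \<omega> \<partial>\<mu>)"
  proof (rule nn_integral_cong_AE)
    show "AE \<omega> in \<mu>. \<Psi> F (act_config act g \<omega>) * indicator \<Omega> (act_config act g \<omega>) = \<Psi> (\<lambda>x. F (act g x)) \<omega> * indicator \<Omega> \<omega>"
      using AE_Omega AE_act_Omega[of g] by eventually_elim (simp add: shift)
  qed
  finally have "(\<integral>\<^sup>+ \<omega>. \<Psi> F \<omega> \<partial>law) = (\<integral>\<^sup>+ \<omega>. \<Psi> (\<lambda>x. F (act g x)) \<omega> \<partial>law)"
    unfolding law_int .
  then show ?thesis unfolding nn_integral_campbell[OF a(1) F] nn_integral_campbell[OF a(1) Fg] \<Psi>_def by simp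
qed

lemma campbell_finite:
  assumes a: "weight a" "\<And>\<omega> x. \<omega> \<in> \<Omega> \<Longrightarrow> x \<in> fst \<omega> \<Longrightarrow> a \<omega> x \<le> 1" and B: "B \<in> sets borel" "B \<subseteq> K" "compact K"
  shows "emeasure (campbell a) B < \<infinity>"
proof -
  interpret law: prob_space law by (rule law_prob_space)
  obtain N where N: "\<And>A. A \<in> separated_sets \<Longrightarrow> finite (A \<inter> K) \<and> card (A \<inter> K) \<le> N"
    using separated_sets_card_compact[OF B(3)] by blast
  have "emeasure (campbell a) B = (\<integral>\<^sup>+ x. indicator B x \<partial>campbell a)" using B by simp
  also have "\<dots> = (\<integral>\<^sup>+ \<omega>. (\<integral>\<^sup>+ x. indicator B x * a \<omega> x \<partial>count_space (fst \<omega>)) \<partial>law)"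
    using a B by (intro nn_integral_campbell) auto
  also have "\<dots> \<le> (\<integral>\<^sup>+ \<omega>. of_nat N \<partial>law)"
  proof (rule nn_integral_mono)
    fix \<omega> assume "\<omega> \<in> space law"
    then have \<omega>: "\<omega> \<in> \<Omega>" by simp
    note fin = N[OF config_separated[OF \<omega>]]
    have "(\<integral>\<^sup>+ x. indicator B x * a \<omega> x \<partial>count_space (fst \<omega>)) \<le> (\<integral>\<^sup>+ x. indicator (fst \<omega> \<inter> K) x \<partial>count_space (fst \<omega>))"
      using a(2)[OF \<omega>] B(2) by (intro nn_integral_mono) (auto split: split_indicator)
    also have "\<dots> = of_nat (card (fst \<omega> \<inter> K))" using fin by simp
    also have "\<dots> \<le> of_nat N" using fin by simp
    finally show "(\<integral>\<^sup>+ x. indicator B x * a \<omega> x \<partial>count_space (fst \<omega>)) \<le> of_nat N" .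
  qed
  also have "\<dots> < \<infinity>" by (simp add: law.emeasure_space_1[simplified] less_top[symmetric])
  finally show ?thesis .
qed

lemma campbell_sigma_finite:
  assumes a: "weight a" "\<And>\<omega> x. \<omega> \<in> \<Omega> \<Longrightarrow> x \<in> fst \<omega> \<Longrightarrow> a \<omega> x \<le> 1"
  shows "sigma_finite_measure (campbell a)"
proof
  have "emeasure (campbell a) (translate act (gball n) F') < \<infinity>" for n
  proof -
    obtain K where "compact K" "translate act (gball n) F' \<subseteq> K" using translate_precompact[OF gball_compact] .
    then show ?thesis using translate_borel[OF gball_compact] by (intro campbell_finite[OF a])
  qed
  then show "\<exists>A. countable A \<and> A \<subseteq> sets (campbell a) \<and> \<Union>A = space (campbell a) \<and> (\<forall>B\<in>A. emeasure (campbell a) B \<noteq> \<infinity>)"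
    using translate_cover translate_borel[OF gball_compact]
    by (intro exI[of _ "range (\<lambda>n. translate act (gball n) F')"]) (auto simp: less_top[symmetric])
qed

lemma campbell_translate:
  assumes a: "weight a" "\<And>\<omega> x. \<omega> \<in> \<Omega> \<Longrightarrow> x \<in> fst \<omega> \<Longrightarrow> a \<omega> x \<le> 1" "covariant a"
    and I: "compact I" and J: "compact J"
  shows "emeasure (campbell a) (translate act I F') * emeasure haar J
     = emeasure (campbell a) (translate act J F') * emeasure haar I"
  using campbell_sigma_finite[OF a(1,2)] campbell_invariant[OF a(1,3)] I J
  by (intro invariant_measure_translate) auto

section \<open>The density of points\<close>

lemma intensity_campbell:
  assumes "B \<in> sets borel"
  shows "intensity \<mu> \<Omega> B = emeasure (campbell (\<lambda>_ _. 1)) B"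
proof -
  have "emeasure (campbell (\<lambda>_ _. 1)) B = (\<integral>\<^sup>+ x. indicator B x \<partial>campbell (\<lambda>_ _. 1))" using assms by simp
  also have "\<dots> = (\<integral>\<^sup>+ \<omega>. (\<integral>\<^sup>+ x. indicator B x * 1 \<partial>count_space (fst \<omega>)) \<partial>law)"
    using assms by (intro nn_integral_campbell) auto
  also have "\<dots> = intensity \<mu> \<Omega> B"
    unfolding intensity_def
  proof (rule nn_integral_cong)
    fix \<omega>
    have "(\<integral>\<^sup>+ x. indicator B x * 1 \<partial>count_space (fst \<omega>)) = (\<integral>\<^sup>+ x. indicator (B \<inter> fst \<omega>) x \<partial>count_space UNIV)"
      by (subst nn_integral_count_space_indicator, simp, intro nn_integral_cong) (simp split: split_indicator)
    also have "\<dots> = emeasure (count_space UNIV) (B \<inter> fst \<omega>)" by (rule nn_integral_indicator) simp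
    finally show "(\<integral>\<^sup>+ x. indicator B x * 1 \<partial>count_space (fst \<omega>)) = emeasure (count_space UNIV) (B \<inter> fst \<omega>)" .
  qed
  finally show ?thesis ..
qed

text \<open>If this set had no points on average, proportionality would give the same for all
  compact translates, which exhaust the space, and almost every configuration would be empty. But
  \<Omega> contains a nonempty configuration, and those charging a small neighbourhood of one of its
  points form an open set of positive measure.\<close>

lemma campbell_pos: "emeasure (campbell (\<lambda>_ _. 1)) (translate act (gball 0) F') > 0"
proof (rule ccontr)
  let ?C = "campbell (\<lambda>_ _. 1)"
  assume "\<not> ?thesis"
  then have 0: "emeasure ?C (translate act (gball 0) F') = 0" by simp
  have z0: "emeasure ?C (translate act (gball n) F') * emeasure haar (gball 0) = 0" for n
    using campbell_translate[of "\<lambda>_ _. 1" "gball n" "gball 0"] 0 by (simp add: covariant_def gball_compact)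
  have "emeasure haar (gball 0) \<noteq> 0" using gball_pos[of 0] by simp
  then have "emeasure ?C (translate act (gball n) F') = 0" for n
    using z0[of n] by (metis mult_eq_0_iff)
  then have "(\<Union>n. translate act (gball n) F') \<in> null_sets ?C"
    using translate_borel[OF gball_compact] by (intro null_sets_UN null_setsI) auto
  then have "emeasure ?C UNIV = 0" unfolding translate_cover by auto
  then have z: "(\<integral>\<^sup>+ \<omega>. (\<integral>\<^sup>+ x. 1 \<partial>count_space (fst \<omega>)) \<partial>law) = 0"
    using nn_integral_campbell[of "\<lambda>_ _. 1" "\<lambda>_. 1"] by simp
  have "AE \<omega> in law. (\<integral>\<^sup>+ x. 1 \<partial>count_space (fst \<omega>)) = 0"
    using z nn_sum_measurable[of "\<lambda>_ _. 1" "\<lambda>_. 1"] by (subst (asm) nn_integral_0_iff_AE) auto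
  then have empty: "AE \<omega> in law. fst \<omega> = {}"
    by eventually_elim (auto simp: emeasure_count_space split: if_splits)
  obtain \<omega>0 x0 where \<omega>0: "\<omega>0 \<in> \<Omega>" "x0 \<in> fst \<omega>0" using not_only_empty by blast
  obtain i where i: "x0 \<in> piece i" using piece_exists by blast
  define f where "f x = complex_of_real (max 0 (1 - dist x x0 / radius x0))" for x
  have f_cont: "continuous_on UNIV f" unfolding f_def using radius(1)[of x0] by (intro continuous_intros) auto
  have f_supp: "f x = 0" if "x \<notin> cball x0 (2 * radius x0)" for x
    using that radius(1)[of x0] unfolding f_def by (auto simp: field_simps dist_commute)
  have f: "f \<in> Cc euclidean" using f_cont radius(3) f_supp by (rule Cc_euclideanI)
  define S where "S \<omega> = (\<Sum>\<^sub>\<infinity>x\<in>fst \<omega>. f x)" for \<omega> :: "('x, 'c) config"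
  define U where "U = {\<omega> \<in> topspace config_topology. S \<omega> \<in> - {0}}"
  have U: "openin config_topology U"
    unfolding U_def S_def by (intro openin_continuous_map_preimage[OF continuous_map_point_sum[OF f]]) auto
  \<comment> \<open>All other points of the configuration are at distance at least 1, beyond the
    reach of the tent \<open>f\<close>, whose radius is at most 1/4.\<close>
  have "S \<omega>0 = f x0"
  proof -
    have "S \<omega>0 = (\<Sum>\<^sub>\<infinity>x\<in>{x0}. f x)"
      unfolding S_def
    proof (rule infsum_cong_neutral)
      fix x assume x: "x \<in> fst \<omega>0 - {x0}"
      then have "1 \<le> dist x x0" using separated_sets_eq[OF config_separated[OF \<omega>0(1)], of x x0] \<omega>0(2) by force
      then show "f x = 0" using radius(1,2)[of x0] unfolding f_def by (auto simp: field_simps)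
    qed (use \<omega>0 in auto)
    then show ?thesis by simp
  qed
  then have "\<omega>0 \<in> U" using \<omega>0 Omega_configs unfolding U_def f_def by auto
  then have pos: "emeasure \<mu> (U \<inter> \<Omega>) > 0" using U \<omega>0 by (intro support_open)
  have "AE \<omega> in law. \<omega> \<notin> U"
    using empty by eventually_elim (auto simp: U_def S_def)
  then have "AE \<omega> in \<mu>. \<omega> \<in> \<Omega> \<longrightarrow> \<omega> \<notin> U"
    using Omega_configs by (subst (asm) AE_restrict_space_iff) (auto simp: Int_absorb2)
  then have "emeasure \<mu> (U \<inter> \<Omega>) = 0"
    using open_measurable[OF U] Omega_configs
    by (subst (asm) AE_iff_measurable[of "U \<inter> \<Omega>"]) auto
  with pos show False by simp
qed

definition dens :: real where "dens = density_of act F' haar \<mu> \<Omega>"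

text \<open>The ratio \<open>c\<close> for the reference ball works for every compact
  \<open>I\<close> by proportionality. The reference ball, of positive finite measure, also forces
  uniqueness and so identifies the definite description.\<close>

lemma dens:
  "dens > 0"
  "\<And>I. compact I \<Longrightarrow> emeasure (campbell (\<lambda>_ _. 1)) (translate act I F') = ennreal dens * emeasure haar I"
proof -
  let ?C = "campbell (\<lambda>_ _. 1)"
  define h where "h = emeasure haar (gball 0)"
  have h: "0 < h" "h < \<infinity>" unfolding h_def using gball_pos haar_compact[OF gball_compact] by auto
  define m where "m = emeasure ?C (translate act (gball 0) F')"
  obtain K where K: "compact K" "translate act (gball 0) F' \<subseteq> K" using translate_precompact[OF gball_compact] .
  have m: "0 < m" "m < \<infinity>"
    unfolding m_def using campbell_pos campbell_finite[OF _ _ translate_borel[OF gball_compact] K(2,1), of "\<lambda>_ _. 1"] by auto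
  define c where "c = enn2real (m / h)"
  have mh: "m / h = ennreal c" "c > 0"
  proof -
    have "h \<noteq> 0" using h by auto
    then have "m / h < \<infinity>" using m h by (simp add: less_top[symmetric] ennreal_divide_eq_top_iff)
    then show "m / h = ennreal c" unfolding c_def by (simp add: less_top)
    moreover have "m / h > 0" using m h by (simp add: ennreal_zero_less_divide)
    ultimately show "c > 0" by simp
  qed
  have I: "emeasure ?C (translate act I F') = ennreal c * emeasure haar I" if "compact I" for I
  proof -
    have "emeasure ?C (translate act I F') * h = m * emeasure haar I"
      unfolding h_def m_def using that by (intro campbell_translate) (auto simp: covariant_def gball_compact)
    then have "emeasure ?C (translate act I F') * h / h = m * emeasure haar I / h" by simp
    moreover have "emeasure ?C (translate act I F') * h / h = emeasure ?C (translate act I F')"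
      using h by (intro ennreal_mult_divide_eq) auto
    moreover have "m * emeasure haar I / h = ennreal c * emeasure haar I"
      unfolding mh(1)[symmetric] by (simp add: ennreal_divide_times mult.commute divide_ennreal_def mult.left_commute)
    ultimately show ?thesis by simp
  qed
  have "density_of act F' haar \<mu> \<Omega> = c"
    unfolding density_of_def
  proof (rule the_equality)
    show "c > 0 \<and> (\<forall>I. compact I \<longrightarrow> emeasure haar I \<noteq> 0 \<longrightarrow> intensity \<mu> \<Omega> (translate act I F') = ennreal c * emeasure haar I)"
      using mh(2) I by (simp add: intensity_campbell translate_borel)
    fix d assume d: "d > 0 \<and> (\<forall>I. compact I \<longrightarrow> emeasure haar I \<noteq> 0 \<longrightarrow> intensity \<mu> \<Omega> (translate act I F') = ennreal d * emeasure haar I)"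
    then have "intensity \<mu> \<Omega> (translate act (gball 0) F') = ennreal d * h"
      using h gball_compact unfolding h_def by auto
    moreover have "intensity \<mu> \<Omega> (translate act (gball 0) F') = ennreal c * h"
      using I[OF gball_compact] unfolding h_def by (simp add: intensity_campbell translate_borel gball_compact)
    ultimately have "h * ennreal d = h * ennreal c" by (simp add: mult.commute)
    then have "ennreal d = ennreal c" using h by (auto simp: ennreal_mult_cancel_left)
    then show "d = c" using d mh(2) by simp
  qed
  then show "dens > 0" "\<And>I. compact I \<Longrightarrow> emeasure ?C (translate act I F') = ennreal dens * emeasure haar I"
    using mh(2) I unfolding dens_def by auto
qed

end

section \<open>The random Hamiltonian\<close>

lemma (in semi_hilbert) operator_bounded_by_mono:
  assumes "operator_bounded_by V c T" "c \<le> c'"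
  shows "operator_bounded_by V c' T"
  unfolding operator_bounded_by_def
proof (intro conjI ballI allI)
  fix v assume v: "v \<in> Vec V"
  then show "T v \<in> Vec V" using assms(1) unfolding operator_bounded_by_def by blast
  have "vnorm V (T v) \<le> c * vnorm V v" using assms(1) v unfolding operator_bounded_by_def by blast
  also have "\<dots> \<le> c' * vnorm V v" using v assms(2) Ip_nonneg by (intro mult_right_mono) auto
  finally show "vnorm V (T v) \<le> c' * vnorm V v" .
qed (use assms(1) in \<open>simp add: operator_bounded_by_def\<close>)

locale random_hamiltonian = configuration_process act F' haar \<iota> \<mu> \<Omega>
  for act :: "'g::{metric_space, topological_group_add} \<Rightarrow>
      'x::{metric_space, second_countable_topology} \<Rightarrow> 'x"
    and F' :: "'x set" and haar :: "'g measure"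
    and \<iota> :: "complex \<Rightarrow> 'c::t2_space"
    and \<mu> :: "('x, 'c) config measure" and \<Omega> :: "('x, 'c) config set" +
  fixes s :: "'g \<Rightarrow> 'x \<Rightarrow> complex"
  assumes s_unit: "cmod (s g x) = 1"
    and condition_A: "condition_A act s \<iota> \<mu> \<Omega>"
begin

abbreviation Hfib :: "('x, 'c) config \<Rightarrow> 'x operator" where "Hfib \<equiv> fiber_op \<iota>"

abbreviation Hop :: "(('x, 'c) config \<times> 'x) operator" where "Hop \<equiv> direct_integral_op \<iota>"

lemma section_Hop: "section_at (Hop v) \<omega> = Hfib \<omega> (section_at v \<omega>)"
  unfolding direct_integral_op_def by simp

lemma section_Hop_pow: "section_at ((Hop ^^ k) v) \<omega> = (Hfib \<omega> ^^ k) (section_at v \<omega>)"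
proof (induction k)
  case (Suc k)
  then show ?case using section_Hop[of "(Hop ^^ k) v" \<omega>] by simp
qed simp

lemma Hop_sym: "v \<in> Vec DI \<Longrightarrow> w \<in> Vec DI \<Longrightarrow> Ip DI (Hop v) w = Ip DI v (Hop w)"
  using condition_A unfolding condition_A_def selfadjoint_def by blast

text \<open>One constant serves all fibres and \<open>H\<close> itself, so that their spectral
  functionals live on the same interval and are compared on the same truncated powers.\<close>

definition op_bound :: real where
  "op_bound = (SOME c. c > 0 \<and> (\<forall>\<omega>\<in>\<Omega>. operator_bounded_by (l2 (fst \<omega>)) c (Hfib \<omega>)) \<and> operator_bounded_by DI c Hop)"

lemma op_bound:
  shows op_bound_pos: "op_bound > 0"
    and Hfib_bounded: "\<omega> \<in> \<Omega> \<Longrightarrow> operator_bounded_by (l2 (fst \<omega>)) op_bound (Hfib \<omega>)"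
    and Hop_bounded: "operator_bounded_by DI op_bound Hop"
proof -
  obtain c1 where c1: "\<And>\<omega>. \<omega> \<in> \<Omega> \<Longrightarrow> operator_bounded_by (l2 (fst \<omega>)) c1 (Hfib \<omega>)"
    using condition_A unfolding condition_A_def by blast
  obtain c2 where c2: "operator_bounded_by DI c2 Hop"
    using condition_A unfolding condition_A_def selfadjoint_def by blast
  define c where "c = max 1 (max c1 c2)"
  have "operator_bounded_by (l2 (fst \<omega>)) c (Hfib \<omega>)" if "\<omega> \<in> \<Omega>" for \<omega>
    by (rule semi_hilbert.operator_bounded_by_mono[OF semi_hilbert_l2 c1[OF that]]) (simp add: c_def)
  moreover have "operator_bounded_by DI c Hop"
    by (rule semi_hilbert.operator_bounded_by_mono[OF semi_hilbert_DI c2]) (simp add: c_def)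
  moreover have "c > 0" by (simp add: c_def)
  ultimately have "\<exists>c. c > 0 \<and> (\<forall>\<omega>\<in>\<Omega>. operator_bounded_by (l2 (fst \<omega>)) c (Hfib \<omega>)) \<and> operator_bounded_by DI c Hop"
    by blast
  from someI_ex[OF this] show "op_bound > 0" "\<omega> \<in> \<Omega> \<Longrightarrow> operator_bounded_by (l2 (fst \<omega>)) op_bound (Hfib \<omega>)"
    "operator_bounded_by DI op_bound Hop"
    unfolding op_bound_def[symmetric] by auto
qed

text \<open>A matrix element is an inner product with unit vectors. It lies in a fixed disc, where
  the continuous function of \<open>compactification_inverse\<close> agrees with the inverse of
  \<iota>.\<close>

lemma hopping_bound:
  assumes \<omega>: "\<omega> \<in> \<Omega>" and x: "x \<in> fst \<omega>" and y: "y \<in> fst \<omega>"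
  shows "cmod (hopping \<iota> \<omega> x y) \<le> op_bound"
proof -
  interpret semi_hilbert "l2 (fst \<omega>)" by (rule semi_hilbert_l2)
  have T: "Hfib \<omega> (delta y) \<in> Vec (l2 (fst \<omega>))" "vnorm (l2 (fst \<omega>)) (Hfib \<omega> (delta y)) \<le> op_bound"
    using Hfib_bounded[OF \<omega>] delta_Vec[OF y] vnorm_delta[OF y] unfolding operator_bounded_by_def by force+
  have "hopping \<iota> \<omega> x y = Ip (l2 (fst \<omega>)) (delta x) (Hfib \<omega> (delta y))"
    using x y by (simp add: l2_Ip_delta fiber_op_delta)
  then have "cmod (hopping \<iota> \<omega> x y) \<le> vnorm (l2 (fst \<omega>)) (delta x) * vnorm (l2 (fst \<omega>)) (Hfib \<omega> (delta y))"
    using Cauchy_Schwarz[OF delta_Vec[OF x] T(1)] by simp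
  then show ?thesis using T(2) vnorm_delta[OF x] by simp
qed

section \<open>Hermitian symmetry on the whole support\<close>

definition pair_sum :: "('x \<Rightarrow> complex) \<Rightarrow> ('x \<Rightarrow> complex) \<Rightarrow> ('x, 'c) config \<Rightarrow> complex" where
  "pair_sum f g \<omega> = (\<Sum>\<^sub>\<infinity>x\<in>fst \<omega>. f x * (\<Sum>\<^sub>\<infinity>y\<in>fst \<omega>. g y * hopping \<iota> \<omega> x y))"

lemma pair_sum_continuous:
  assumes f: "f \<in> Cc euclidean" and g: "g \<in> Cc euclidean"
  obtains P where "continuous_map config_topology euclidean P" "\<And>\<omega>. \<omega> \<in> \<Omega> \<Longrightarrow> P \<omega> = pair_sum f g \<omega>"
proof -
  obtain \<theta> where \<theta>: "continuous_on UNIV \<theta>" "\<And>z. cmod z \<le> op_bound \<Longrightarrow> \<theta> (\<iota> z) = z"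
    using compactification_inverse[OF compactification, of op_bound] op_bound_pos by auto
  have emb: "homeomorphic_map euclidean (subtopology euclidean (range \<iota>)) \<iota>"
    using compactification unfolding compactification_def embedding_map_def by simp
  have inj: "inj \<iota>" using homeomorphic_imp_injective_map[OF emb] by simp
  have C: "compact (UNIV :: 'c set)" using compactification unfolding compactification_def by simp
  have hop: "\<theta> (snd \<omega> (x, y)) = hopping \<iota> \<omega> x y" if xy: "\<omega> \<in> \<Omega>" "x \<in> fst \<omega>" "y \<in> fst \<omega>" for \<omega> x y
  proof -
    have "snd \<omega> (x, y) \<in> range \<iota>" using condition_A xy unfolding condition_A_def by simp
    then obtain z where z: "snd \<omega> (x, y) = \<iota> z" by blast
    then have "hopping \<iota> \<omega> x y = z" unfolding hopping_def using inj by simp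
    then show ?thesis using z \<theta>(2) hopping_bound[OF xy] by simp
  qed
  show ?thesis
  proof (rule that)
    show "continuous_map config_topology euclidean (\<lambda>\<omega>. \<Sum>\<^sub>\<infinity>x\<in>fst \<omega>. f x * (\<Sum>\<^sub>\<infinity>y\<in>fst \<omega>. g y * \<theta> (snd \<omega> (x, y))))"
      by (rule continuous_map_pair_sum[OF C f g \<theta>(1)])
    show "(\<Sum>\<^sub>\<infinity>x\<in>fst \<omega>. f x * (\<Sum>\<^sub>\<infinity>y\<in>fst \<omega>. g y * \<theta> (snd \<omega> (x, y)))) = pair_sum f g \<omega>" if "\<omega> \<in> \<Omega>" for \<omega>
      unfolding pair_sum_def using that by (intro infsum_cong arg_cong2[where f="(*)"] refl) (simp add: hop)
  qed
qed

text \<open>A deterministic function \<open>f\<close>, switched on only for configurations in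
  \<open>U\<close>: the set \<open>U\<close> localises identities in configuration space,
  \<open>f\<close> localises them in \<open>X\<close>.\<close>

definition test_section :: "('x, 'c) config set \<Rightarrow> ('x \<Rightarrow> complex) \<Rightarrow> ('x, 'c) config \<times> 'x \<Rightarrow> complex" where
  "test_section U f = (\<lambda>(\<omega>, x). if \<omega> \<in> U \<and> x \<in> fst \<omega> then f x else 0)"

lemma test_section_Vec:
  assumes U: "U \<in> sets \<mu>" and f: "f \<in> borel_measurable borel" "\<And>x. cmod (f x) \<le> C" "\<And>x. x \<notin> K \<Longrightarrow> f x = 0" and K: "compact K"
  shows "test_section U f \<in> Vec DI"
proof -
  interpret law: prob_space law by (rule law_prob_space)
  have C: "C \<ge> 0" using f(2)[of undefined] norm_ge_zero order_trans by blast
  obtain N where N: "\<And>A. A \<in> separated_sets \<Longrightarrow> finite (A \<inter> K) \<and> card (A \<inter> K) \<le> N"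
    using separated_sets_card_compact[OF K] by blast
  have sec: "section_at (test_section U f) \<omega> = (\<lambda>x. if x \<in> fst \<omega> \<inter> K then (if \<omega> \<in> U then f x else 0) else 0)" for \<omega>
    unfolding test_section_def using f(3) by auto
  show ?thesis
  proof (rule DI_VecI[where g="\<lambda>_. real N * C\<^sup>2"])
    show "coords_measurable (test_section U f)"
      unfolding coords_measurable_def
    proof
      fix i
      have [measurable]: "Measurable.pred law (\<lambda>\<omega>. \<omega> \<in> U)"
        using U Omega_configs by (auto simp: pred_def sets_restrict_space Int_def intro!: image_eqI[of _ _ U])
      have [measurable]: "(\<lambda>\<omega>. f (pt i \<omega>)) \<in> borel_measurable law"
        using pt_measurable f(1) by (rule measurable_compose)
      have "(\<lambda>\<omega>. if occ i \<omega> \<and> \<omega> \<in> U then f (pt i \<omega>) else 0) \<in> borel_measurable law" by measurable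
      moreover have "(\<lambda>\<omega>. if occ i \<omega> then test_section U f (\<omega>, pt i \<omega>) else 0) = (\<lambda>\<omega>. if occ i \<omega> \<and> \<omega> \<in> U then f (pt i \<omega>) else 0)"
        unfolding test_section_def using pt by auto
      ultimately show "(\<lambda>\<omega>. if occ i \<omega> then test_section U f (\<omega>, pt i \<omega>) else 0) \<in> borel_measurable law" by simp
    qed
    fix \<omega> assume \<omega>: "\<omega> \<in> \<Omega>"
    note fin = N[OF config_separated[OF \<omega>]]
    show "section_at (test_section U f) \<omega> \<in> Vec (l2 (fst \<omega>))"
      unfolding sec using fin by (intro finite_restrict_l2) auto
    have "(vnorm (l2 (fst \<omega>)) (section_at (test_section U f) \<omega>))\<^sup>2 = (\<Sum>x\<in>fst \<omega> \<inter> K. (cmod (section_at (test_section U f) \<omega> x))\<^sup>2)"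
      unfolding l2_vnorm_sq using config_separated[OF \<omega>] K f(3) by (intro infsum_compact_support) (auto simp: test_section_def)
    also have "\<dots> \<le> (\<Sum>x\<in>fst \<omega> \<inter> K. C\<^sup>2)"
      using f(2) C by (intro sum_mono power_mono) (auto simp: test_section_def)
    also have "\<dots> \<le> real N * C\<^sup>2"
      using fin by (simp add: mult_right_mono)
    finally show "(vnorm (l2 (fst \<omega>)) (section_at (test_section U f) \<omega>))\<^sup>2 \<le> real N * C\<^sup>2" .
  qed simp
qed

lemma test_section_Cc:
  assumes U: "U \<in> sets \<mu>" and f: "f \<in> Cc euclidean"
  shows "test_section U f \<in> Vec DI"
proof -
  obtain K where K: "continuous_on UNIV f" "compact K" "\<And>x. x \<notin> K \<Longrightarrow> f x = 0" using Cc_euclideanE[OF f] by metis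
  have "bounded (f ` K)" using K by (intro compact_imp_bounded compact_continuous_image continuous_on_subset[OF K(1)]) auto
  then obtain C where C: "\<And>x. x \<in> K \<Longrightarrow> cmod (f x) \<le> C" unfolding bounded_iff by auto
  have "cmod (f x) \<le> max 0 C" for x using C[of x] K(3)[of x] by (cases "x \<in> K") auto
  then show ?thesis using K by (intro test_section_Vec[OF U _ _ K(3,2)] borel_measurable_continuous_onI) auto
qed

text \<open>Symmetry of \<open>H\<close> between the test sections of \<open>f\<close> and
  \<open>g\<close> over the same \<open>U\<close>. The defect \<open>D\<close> has integral 0 over
  every measurable \<open>U\<close>, which is the averaged form of Hermitian symmetry.\<close>

lemma pair_sum_sym_integral:
  assumes U: "U \<in> sets \<mu>" and f: "f \<in> Cc euclidean" and g: "g \<in> Cc euclidean"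
  defines "D \<equiv> \<lambda>\<omega>. pair_sum (\<lambda>x. cnj (f x)) g \<omega> - cnj (pair_sum (\<lambda>x. cnj (g x)) f \<omega>)"
  shows "integrable law (\<lambda>\<omega>. indicator U \<omega> * D \<omega>)" and "(LINT \<omega>|law. indicator U \<omega> * D \<omega>) = 0"
proof -
  let ?v = "test_section U f" and ?w = "test_section U g"
  have v: "?v \<in> Vec DI" and w: "?w \<in> Vec DI" using U f g by (auto intro: test_section_Cc)
  have Hv: "Hop ?v \<in> Vec DI" and Hw: "Hop ?w \<in> Vec DI"
    using v w Hop_bounded unfolding operator_bounded_by_def by auto
  have H: "Hfib \<omega> (section_at (test_section U h) \<omega>) x = indicator U \<omega> * (\<Sum>\<^sub>\<infinity>y\<in>fst \<omega>. h y * hopping \<iota> \<omega> x y)"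
    if "x \<in> fst \<omega>" for \<omega> x h
    using that by (auto simp: fiber_op_def test_section_def mult.commute split: split_indicator intro!: infsum_cong)
  have 1: "Ip (l2 (fst \<omega>)) (section_at ?v \<omega>) (section_at (Hop ?w) \<omega>) = indicator U \<omega> * pair_sum (\<lambda>x. cnj (f x)) g \<omega>" for \<omega>
  proof (cases "\<omega> \<in> U")
    case True
    have "Ip (l2 (fst \<omega>)) (section_at ?v \<omega>) (section_at (Hop ?w) \<omega>) = pair_sum (\<lambda>x. cnj (f x)) g \<omega>"
      unfolding l2_Ip section_Hop pair_sum_def using True
      by (intro infsum_cong) (simp add: H, simp add: test_section_def)
    then show ?thesis using True by simp
  qed (simp add: l2_Ip test_section_def)
  have 2: "Ip (l2 (fst \<omega>)) (section_at (Hop ?v) \<omega>) (section_at ?w \<omega>) = indicator U \<omega> * cnj (pair_sum (\<lambda>x. cnj (g x)) f \<omega>)" for \<omega>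
  proof (cases "\<omega> \<in> U")
    case True
    have "Ip (l2 (fst \<omega>)) (section_at (Hop ?v) \<omega>) (section_at ?w \<omega>) = cnj (pair_sum (\<lambda>x. cnj (g x)) f \<omega>)"
      unfolding l2_Ip section_Hop pair_sum_def infsum_cnj[symmetric] using True
      by (intro infsum_cong) (simp add: H, simp add: test_section_def mult.commute)
    then show ?thesis using True by simp
  qed (simp add: l2_Ip test_section_def)
  have i1: "integrable law (\<lambda>\<omega>. indicator U \<omega> * pair_sum (\<lambda>x. cnj (f x)) g \<omega>)"
    using DI_Ip_integrable[OF v Hw] unfolding 1 .
  have i2: "integrable law (\<lambda>\<omega>. indicator U \<omega> * cnj (pair_sum (\<lambda>x. cnj (g x)) f \<omega>))"
    using DI_Ip_integrable[OF Hv w] unfolding 2 .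
  have eq: "(\<lambda>\<omega>. indicator U \<omega> * D \<omega>) = (\<lambda>\<omega>. indicator U \<omega> * pair_sum (\<lambda>x. cnj (f x)) g \<omega> - indicator U \<omega> * cnj (pair_sum (\<lambda>x. cnj (g x)) f \<omega>))"
    unfolding D_def by (simp add: right_diff_distrib)
  show "integrable law (\<lambda>\<omega>. indicator U \<omega> * D \<omega>)" unfolding eq using i1 i2 by (rule Bochner_Integration.integrable_diff)
  have "(LINT \<omega>|law. indicator U \<omega> * D \<omega>) = Ip DI ?v (Hop ?w) - Ip DI (Hop ?v) ?w"
    unfolding eq DI_Ip 1 2 using i1 i2 by (rule Bochner_Integration.integral_diff)
  then show "(LINT \<omega>|law. indicator U \<omega> * D \<omega>) = 0" using Hop_sym[OF v w] by simp
qed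

text \<open>
  Symmetry holds for every configuration in the support, not only for almost every one, because the
  matrix elements depend continuously on the configuration.
\<close>

lemma hopping_sym:
  assumes \<omega>0: "\<omega>0 \<in> \<Omega>" and x0: "x0 \<in> fst \<omega>0" and y0: "y0 \<in> fst \<omega>0"
  shows "hopping \<iota> \<omega>0 x0 y0 = cnj (hopping \<iota> \<omega>0 y0 x0)"
proof (rule ccontr)
  assume neq: "\<not> ?thesis"
  define f where "f z x = complex_of_real (max 0 (1 - dist x z / radius z))" for z x
  have f_cont: "continuous_on UNIV (f z)" for z unfolding f_def using radius(1)[of z] by (intro continuous_intros) auto
  have f_supp: "f z x = 0" if "x \<notin> cball z (2 * radius z)" for x z
    using that radius(1)[of z] unfolding f_def by (auto simp: field_simps dist_commute)
  have f: "f z \<in> Cc euclidean" for z using f_cont radius(3) f_supp by (rule Cc_euclideanI)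
  have f_cnj: "(\<lambda>x. cnj (f z x)) = f z" for z unfolding f_def by simp
  have f_eq: "f z x = (if x = z then 1 else 0)" if "x \<in> fst \<omega>0" "z \<in> fst \<omega>0" for x z
  proof (cases "x = z")
    case False
    then have "1 \<le> dist x z" using separated_sets_eq[OF config_separated[OF \<omega>0] that] by force
    then show ?thesis using radius(1,2)[of z] False unfolding f_def by (auto simp: field_simps)
  qed (simp add: f_def)
  have f_sum: "(\<Sum>\<^sub>\<infinity>x\<in>fst \<omega>0. f z x * F x) = F z" if z: "z \<in> fst \<omega>0" for z and F :: "'x \<Rightarrow> complex"
  proof -
    have "(\<Sum>\<^sub>\<infinity>x\<in>fst \<omega>0. f z x * F x) = (\<Sum>\<^sub>\<infinity>x\<in>{z}. F x)"
      using z by (intro infsum_cong_neutral) (auto simp: f_eq)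
    then show ?thesis by simp
  qed
  define D where "D \<omega> = pair_sum (f x0) (f y0) \<omega> - cnj (pair_sum (f y0) (f x0) \<omega>)" for \<omega>
  obtain P1 where P1: "continuous_map config_topology euclidean P1" "\<And>\<omega>. \<omega> \<in> \<Omega> \<Longrightarrow> P1 \<omega> = pair_sum (f x0) (f y0) \<omega>"
    using pair_sum_continuous[OF f f] by metis
  obtain P2 where P2: "continuous_map config_topology euclidean P2" "\<And>\<omega>. \<omega> \<in> \<Omega> \<Longrightarrow> P2 \<omega> = pair_sum (f y0) (f x0) \<omega>"
    using pair_sum_continuous[OF f f] by metis
  define z where "z = D \<omega>0"
  have "z = hopping \<iota> \<omega>0 x0 y0 - cnj (hopping \<iota> \<omega>0 y0 x0)"
    unfolding z_def D_def pair_sum_def using x0 y0 by (simp add: f_sum)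
  then have z: "z \<noteq> 0" using neq by simp
  \<comment> \<open>Multiplication by the conjugate of the defect \<open>z\<close> at \<omega>0
    makes the value there real and positive. On the open set \<open>R > 0\<close> the integral of
    \<open>R\<close> is 0 by \<open>pair_sum_sym_integral\<close>, so this set is null, although it
    is a neighbourhood of \<omega>0 in the support.\<close>
  define R where "R \<omega> = Re (cnj z * (P1 \<omega> - cnj (P2 \<omega>)))" for \<omega>
  have R_D: "R \<omega> = Re (cnj z * D \<omega>)" if "\<omega> \<in> \<Omega>" for \<omega>
    unfolding R_def D_def using P1(2) P2(2) that by simp
  define U where "U = {\<omega> \<in> topspace config_topology. R \<omega> \<in> {0<..}}"
  have "continuous_map config_topology euclidean R"
    using P1(1) P2(1) unfolding R_def continuous_map_atin by (auto intro!: tendsto_intros)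
  then have U: "openin config_topology U"
    unfolding U_def by (rule openin_continuous_map_preimage) simp
  have "cnj z * z = complex_of_real ((cmod z)\<^sup>2)" using complex_norm_square[of z] by (simp add: mult.commute)
  then have "R \<omega>0 = (cmod z)\<^sup>2" using R_D[OF \<omega>0] unfolding z_def[symmetric] by simp
  then have "\<omega>0 \<in> U" using \<omega>0 Omega_configs z unfolding U_def by auto
  then have pos: "emeasure \<mu> (U \<inter> \<Omega>) > 0" using U \<omega>0 by (intro support_open)
  have Um: "U \<in> sets \<mu>" using U by (rule open_measurable)
  note int = pair_sum_sym_integral[OF Um f[of x0] f[of y0], unfolded f_cnj, folded D_def]
  have intR: "integrable law (\<lambda>\<omega>. Re (cnj z * (indicator U \<omega> * D \<omega>)))"
    using int(1) by (intro integrable_Re integrable_mult_right)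
  have "(LINT \<omega>|law. Re (cnj z * (indicator U \<omega> * D \<omega>))) = Re (cnj z * (LINT \<omega>|law. indicator U \<omega> * D \<omega>))"
  proof -
    have "(LINT \<omega>|law. Re (cnj z * (indicator U \<omega> * D \<omega>))) = Re (LINT \<omega>|law. cnj z * (indicator U \<omega> * D \<omega>))"
      using int(1) by (intro integral_Re integrable_mult_right)
    then show ?thesis by (simp only: Bochner_Integration.integral_mult_right_zero)
  qed
  then have 0: "(LINT \<omega>|law. Re (cnj z * (indicator U \<omega> * D \<omega>))) = 0" using int(2) by simp
  have eqR: "Re (cnj z * (indicator U \<omega> * D \<omega>)) = indicator U \<omega> * R \<omega>" if "\<omega> \<in> \<Omega>" for \<omega>
    using R_D[OF that] by (auto split: split_indicator)
  have nonneg: "AE \<omega> in law. 0 \<le> Re (cnj z * (indicator U \<omega> * D \<omega>))"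
  proof (rule AE_I2)
    fix \<omega> assume "\<omega> \<in> space law"
    then have "\<omega> \<in> \<Omega>" by simp
    from eqR[OF this] show "0 \<le> Re (cnj z * (indicator U \<omega> * D \<omega>))"
      by (auto simp: U_def split: split_indicator)
  qed
  have "AE \<omega> in law. Re (cnj z * (indicator U \<omega> * D \<omega>)) = 0"
    using 0 integral_nonneg_eq_0_iff_AE[OF intR nonneg] by simp
  then have "AE \<omega> in law. \<omega> \<notin> U"
  proof (rule AE_mp, intro AE_I2 impI)
    fix \<omega> assume "\<omega> \<in> space law" "Re (cnj z * (indicator U \<omega> * D \<omega>)) = 0"
    then have "indicator U \<omega> * R \<omega> = 0" using eqR[of \<omega>] by simp
    then show "\<omega> \<notin> U" by (auto simp: U_def)
  qed
  then have "AE \<omega> in \<mu>. \<omega> \<in> \<Omega> \<longrightarrow> \<omega> \<notin> U"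
    using Omega_configs by (subst (asm) AE_restrict_space_iff) (auto simp: Int_absorb2)
  then have "emeasure \<mu> (U \<inter> \<Omega>) = 0"
    using Um Omega_configs by (subst (asm) AE_iff_measurable[of "U \<inter> \<Omega>"]) auto
  with pos show False by simp
qed

lemma fiber_selfadjoint: "\<omega> \<in> \<Omega> \<Longrightarrow> l2_selfadjoint (fst \<omega>) (Hfib \<omega>) op_bound"
  by (intro l2_selfadjoint_fiber_op Hfib_bounded op_bound_pos hopping_sym)

lemma fiber_bounded_selfadjoint: "\<omega> \<in> \<Omega> \<Longrightarrow> bounded_selfadjoint (l2 (fst \<omega>)) (Hfib \<omega>) op_bound"
  using fiber_selfadjoint by (rule l2_selfadjoint.axioms)

lemma DI_bounded_selfadjoint: "bounded_selfadjoint DI Hop op_bound"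
proof -
  interpret semi_hilbert DI by (rule semi_hilbert_DI)
  show ?thesis by unfold_locales (auto intro: Hop_bounded Hop_sym op_bound_pos)
qed

end

context random_hamiltonian
begin

subsection \<open>Fibrewise functional calculus\<close>

abbreviation Qfib :: "('x, 'c) config \<Rightarrow> ('x \<Rightarrow> complex) \<Rightarrow> ('x \<Rightarrow> complex) \<Rightarrow> (real \<Rightarrow> complex) \<Rightarrow> complex" where
  "Qfib \<omega> \<equiv> bounded_selfadjoint.Q (l2 (fst \<omega>)) (Hfib \<omega>) op_bound"

abbreviation spec_fib :: "('x, 'c) config \<Rightarrow> ('x \<Rightarrow> complex) \<Rightarrow> real measure" where
  "spec_fib \<omega> \<equiv> bounded_selfadjoint.spec (l2 (fst \<omega>)) (Hfib \<omega>) op_bound"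

abbreviation fun_fib :: "('x, 'c) config \<Rightarrow> (real \<Rightarrow> complex) \<Rightarrow> 'x operator" where
  "fun_fib \<omega> \<equiv> l2_selfadjoint.fun_op (fst \<omega>) (Hfib \<omega>) op_bound"

lemma Hop_pow_Vec: "v \<in> Vec DI \<Longrightarrow> (Hop ^^ k) v \<in> Vec DI"
  by (rule bounded_selfadjoint.pow_Vec[OF DI_bounded_selfadjoint])

lemma Qfib_power:
  assumes "\<omega> \<in> \<Omega>" "v \<in> Vec (l2 (fst \<omega>))" "w \<in> Vec (l2 (fst \<omega>))"
  shows "Qfib \<omega> v w (trunc_power op_bound k) = Ip (l2 (fst \<omega>)) v ((Hfib \<omega> ^^ k) w)"
  using assms by (intro bounded_selfadjoint.Q_power fiber_bounded_selfadjoint)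

lemma Qfib_sigma:
  assumes "\<omega> \<in> \<Omega>" "v \<in> Vec (l2 (fst \<omega>))" "w \<in> Vec (l2 (fst \<omega>))"
  shows "sigma_functional op_bound (Qfib \<omega> v w)"
  using assms by (intro bounded_selfadjoint.Q_sigma fiber_bounded_selfadjoint)

text \<open>For powers the value is a coordinate of \<open>H^k v\<close>, a vector of the direct
  integral and hence measurable. The other rules of the moment induction preserve
  measurability.\<close>

lemma Qfib_delta_measurable:
  assumes v: "v \<in> Vec DI" and f: "f \<in> bdd_borel"
  shows "(\<lambda>\<omega>. if occ i \<omega> then Qfib \<omega> (delta (pt i \<omega>)) (section_at v \<omega>) f else 0) \<in> borel_measurable law"
proof -
  let ?q = "\<lambda>f \<omega>. if occ i \<omega> then Qfib \<omega> (delta (pt i \<omega>)) (section_at v \<omega>) f else 0"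
  have sig: "sigma_functional op_bound (\<lambda>f. ?q f \<omega>)" if "\<omega> \<in> \<Omega>" for \<omega>
  proof (cases "occ i \<omega>")
    case True
    then show ?thesis using Qfib_sigma[OF that delta_Vec[OF pt(1)[OF True]] DI_section[OF v that]] by simp
  qed simp
  from f have "?q f \<in> borel_measurable law"
  proof (induction f rule: bdd_borel_moment_induct[where c=op_bound])
    case (off f)
    have "?q f \<omega> = 0" if "\<omega> \<in> space law" for \<omega>
      using sigma_functionalD(2)[OF sig off] that by simp
    then show ?case by (subst measurable_cong[where g="\<lambda>_. 0"]) simp_all
  next
    case (power k)
    have "?q (trunc_power op_bound k) \<omega> = (if occ i \<omega> then ((Hop ^^ k) v) (\<omega>, pt i \<omega>) else 0)" if "\<omega> \<in> space law" for \<omega>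
    proof (cases "occ i \<omega>")
      case True
      have \<omega>: "\<omega> \<in> \<Omega>" using that by simp
      have "?q (trunc_power op_bound k) \<omega> = Ip (l2 (fst \<omega>)) (delta (pt i \<omega>)) (section_at ((Hop ^^ k) v) \<omega>)"
        using True Qfib_power[OF \<omega> delta_Vec[OF pt(1)[OF True]] DI_section[OF v \<omega>]] by (simp add: section_Hop_pow)
      then show ?thesis using True l2_Ip_delta[OF pt(1)[OF True]] by simp
    qed simp
    moreover have "(\<lambda>\<omega>. if occ i \<omega> then ((Hop ^^ k) v) (\<omega>, pt i \<omega>) else 0) \<in> borel_measurable law"
      using DI_coords[OF Hop_pow_Vec[OF v]] unfolding coords_measurable_def by blast
    ultimately show ?case
      by (subst measurable_cong[where g="\<lambda>\<omega>. if occ i \<omega> then ((Hop ^^ k) v) (\<omega>, pt i \<omega>) else 0"]) simp_all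
  next
    case (add f g)
    then have "(\<lambda>\<omega>. ?q f \<omega> + ?q g \<omega>) \<in> borel_measurable law" by (intro borel_measurable_add)
    moreover have "?q (\<lambda>t. f t + g t) \<omega> = ?q f \<omega> + ?q g \<omega>" if "\<omega> \<in> space law" for \<omega>
      using sigma_functional_add[OF sig add(1,2)] that by simp
    ultimately show ?case by (subst measurable_cong[where g="\<lambda>\<omega>. ?q f \<omega> + ?q g \<omega>"]) simp_all
  next
    case (scale a f)
    then have "(\<lambda>\<omega>. a * ?q f \<omega>) \<in> borel_measurable law" by (intro borel_measurable_times) auto
    moreover have "?q (\<lambda>t. a * f t) \<omega> = a * ?q f \<omega>" if "\<omega> \<in> space law" for \<omega>
      using sigma_functional_scale[OF sig scale(1)] that by simp
    ultimately show ?case by (subst measurable_cong[where g="\<lambda>\<omega>. a * ?q f \<omega>"]) simp_all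
  next
    case (lim F f C)
    show ?case
    proof (rule borel_measurable_LIMSEQ_metric[where f="\<lambda>n. ?q (F n)"])
      show "?q (F n) \<in> borel_measurable law" for n by (rule lim(5))
      show "(\<lambda>n. ?q (F n) \<omega>) \<longlonglongrightarrow> ?q f \<omega>" if "\<omega> \<in> space law" for \<omega>
        using that by (intro sigma_functionalD(3)[OF sig lim(1,2,3,4)]) simp
    qed
  qed
  then show ?thesis .
qed

definition fun_section :: "(real \<Rightarrow> complex) \<Rightarrow> (('x, 'c) config \<times> 'x \<Rightarrow> complex) \<Rightarrow> ('x, 'c) config \<times> 'x \<Rightarrow> complex" where
  "fun_section f v = (\<lambda>(\<omega>, x). fun_fib \<omega> f (section_at v \<omega>) x)"

lemma section_fun_section: "section_at (fun_section f v) \<omega> = fun_fib \<omega> f (section_at v \<omega>)"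
  unfolding fun_section_def by simp

lemma fun_section_Vec:
  assumes v: "v \<in> Vec DI" and f: "f \<in> bdd_borel"
  shows "fun_section f v \<in> Vec DI"
proof -
  obtain C where C: "\<And>t. cmod (f t) \<le> C" using f by (metis bdd_borel_bound)
  show ?thesis
  proof (rule DI_VecI[where g="\<lambda>\<omega>. (4 * C)\<^sup>2 * (vnorm (l2 (fst \<omega>)) (section_at v \<omega>))\<^sup>2"])
    show "coords_measurable (fun_section f v)"
      unfolding coords_measurable_def
    proof
      fix i
      have eq: "(if occ i \<omega> then fun_section f v (\<omega>, pt i \<omega>) else 0)
         = (if occ i \<omega> then Qfib \<omega> (delta (pt i \<omega>)) (section_at v \<omega>) f else 0)" if "\<omega> \<in> space law" for \<omega>
        using pt(1)[of i \<omega>] that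
        by (simp add: fun_section_def l2_selfadjoint.fun_op_def[OF fiber_selfadjoint])
      show "(\<lambda>\<omega>. if occ i \<omega> then fun_section f v (\<omega>, pt i \<omega>) else 0) \<in> borel_measurable law"
        using Qfib_delta_measurable[OF v f, of i] by (subst measurable_cong[OF eq])
    qed
    show "integrable law (\<lambda>\<omega>. (4 * C)\<^sup>2 * (vnorm (l2 (fst \<omega>)) (section_at v \<omega>))\<^sup>2)"
      using DI_norm_integrable[OF v] by simp
    fix \<omega> assume \<omega>: "\<omega> \<in> \<Omega>"
    note op = l2_selfadjoint.fun_op[OF fiber_selfadjoint[OF \<omega>] f C DI_section[OF v \<omega>]]
    show sec: "section_at (fun_section f v) \<omega> \<in> Vec (l2 (fst \<omega>))"
      unfolding section_fun_section by (rule op(1))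
    have "(vnorm (l2 (fst \<omega>)) (section_at (fun_section f v) \<omega>))\<^sup>2 \<le> (4 * C * vnorm (l2 (fst \<omega>)) (section_at v \<omega>))\<^sup>2"
      using op(2) semi_hilbert.Ip_nonneg[OF semi_hilbert_l2 sec] semi_hilbert.vnorm_nonneg[OF semi_hilbert_l2]
      unfolding section_fun_section by (intro power_mono) auto
    then show "(vnorm (l2 (fst \<omega>)) (section_at (fun_section f v) \<omega>))\<^sup>2 \<le> (4 * C)\<^sup>2 * (vnorm (l2 (fst \<omega>)) (section_at v \<omega>))\<^sup>2"
      by (simp add: power_mult_distrib)
  qed
qed

lemma Qfib_fun_section:
  assumes v: "v \<in> Vec DI" and w: "w \<in> Vec DI" and f: "f \<in> bdd_borel" and \<omega>: "\<omega> \<in> \<Omega>"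
  shows "Qfib \<omega> (section_at v \<omega>) (section_at w \<omega>) f = Ip (l2 (fst \<omega>)) (section_at v \<omega>) (section_at (fun_section f w) \<omega>)"
proof -
  obtain C where C: "\<And>t. cmod (f t) \<le> C" using f by (metis bdd_borel_bound)
  show ?thesis
    unfolding section_fun_section
    using l2_selfadjoint.fun_op(3)[OF fiber_selfadjoint[OF \<omega>] f C DI_section[OF w \<omega>] DI_section[OF v \<omega>]] ..
qed

lemma Qfib_integrable:
  assumes v: "v \<in> Vec DI" and w: "w \<in> Vec DI" and f: "f \<in> bdd_borel"
  shows "integrable law (\<lambda>\<omega>. Qfib \<omega> (section_at v \<omega>) (section_at w \<omega>) f)"
  using DI_Ip_integrable[OF v fun_section_Vec[OF w f]]
  by (subst Bochner_Integration.integrable_cong[OF refl]) (auto simp: Qfib_fun_section[OF v w f])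

lemma Qfib_bound:
  assumes v: "v \<in> Vec DI" and w: "w \<in> Vec DI" and f: "f \<in> bdd_borel" "\<And>t. cmod (f t) \<le> C" and \<omega>: "\<omega> \<in> \<Omega>"
  shows "cmod (Qfib \<omega> (section_at v \<omega>) (section_at w \<omega>) f) \<le>
    4 * C * ((vnorm (l2 (fst \<omega>)) (section_at v \<omega>))\<^sup>2 + (vnorm (l2 (fst \<omega>)) (section_at w \<omega>))\<^sup>2)"
proof -
  let ?a = "vnorm (l2 (fst \<omega>)) (section_at v \<omega>)" and ?b = "vnorm (l2 (fst \<omega>)) (section_at w \<omega>)"
  have C: "C \<ge> 0" using f(2)[of 0] norm_ge_zero order_trans by blast
  have "cmod (Qfib \<omega> (section_at v \<omega>) (section_at w \<omega>) f) \<le> 4 * C * ?a * ?b"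
    by (rule bounded_selfadjoint.Q_bound[OF fiber_bounded_selfadjoint[OF \<omega>] DI_section[OF v \<omega>] DI_section[OF w \<omega>] f])
  also have "\<dots> = 4 * C * (?a * ?b)" by simp
  also have "?a * ?b \<le> ?a\<^sup>2 + ?b\<^sup>2"
    using zero_le_power2[of "?a - ?b"] zero_le_power2[of ?a] zero_le_power2[of ?b] unfolding power2_diff by linarith
  finally show ?thesis using C by (simp add: mult_left_mono)
qed

text \<open>Both sides are sigma functionals of \<open>f\<close> with the same moments, because
  \<open>H^k\<close> acts fibre by fibre. Continuity of the left side is dominated convergence, with
  \<open>Qfib_bound\<close> as majorant.\<close>

lemma Q_DI:
  assumes v: "v \<in> Vec DI" and w: "w \<in> Vec DI" and f: "f \<in> bdd_borel"
  shows "(LINT \<omega>|law. Qfib \<omega> (section_at v \<omega>) (section_at w \<omega>) f) = bounded_selfadjoint.Q DI Hop op_bound v w f"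
proof (rule bounded_selfadjoint.Q_eqI[OF DI_bounded_selfadjoint v w f])
  let ?q = "\<lambda>f \<omega>. Qfib \<omega> (section_at v \<omega>) (section_at w \<omega>) f"
  have sig: "sigma_functional op_bound (\<lambda>f. ?q f \<omega>)" if "\<omega> \<in> \<Omega>" for \<omega>
    using Qfib_sigma[OF that DI_section[OF v that] DI_section[OF w that]] by simp
  show "(LINT \<omega>|law. ?q (trunc_power op_bound k) \<omega>) = Ip DI v ((Hop ^^ k) w)" for k
    unfolding DI_Ip section_Hop_pow
    by (intro Bochner_Integration.integral_cong refl) (simp add: Qfib_power DI_section v w)
  show "sigma_functional op_bound (\<lambda>f. LINT \<omega>|law. ?q f \<omega>)"
    unfolding sigma_functional_def
  proof (intro conjI ballI allI impI)
    fix f g a assume f: "f \<in> bdd_borel" and g: "g \<in> bdd_borel"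
    have "(LINT \<omega>|law. ?q (\<lambda>t. a * f t + g t) \<omega>) = (LINT \<omega>|law. a * ?q f \<omega> + ?q g \<omega>)"
      using sigma_functionalD(1)[OF sig f g] by (intro Bochner_Integration.integral_cong refl) simp
    also have "\<dots> = a * (LINT \<omega>|law. ?q f \<omega>) + (LINT \<omega>|law. ?q g \<omega>)"
      using Qfib_integrable[OF v w f] Qfib_integrable[OF v w g] by simp
    finally show "(LINT \<omega>|law. ?q (\<lambda>t. a * f t + g t) \<omega>) = a * (LINT \<omega>|law. ?q f \<omega>) + (LINT \<omega>|law. ?q g \<omega>)" .
  next
    fix f assume f: "f \<in> bdd_borel" "\<forall>t. \<bar>t\<bar> \<le> op_bound \<longrightarrow> f t = 0"
    have "(LINT \<omega>|law. ?q f \<omega>) = (LINT \<omega>|law. 0)"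
      using sigma_functionalD(2)[OF sig f(1)] f(2) by (intro Bochner_Integration.integral_cong refl) simp
    then show "(LINT \<omega>|law. ?q f \<omega>) = 0" by simp
  next
    fix F f C
    assume F: "f \<in> bdd_borel" "\<forall>n. F n \<in> bdd_borel" "\<forall>n t. cmod (F n t) \<le> C" "\<forall>t. (\<lambda>n. F n t) \<longlonglongrightarrow> f t"
    let ?g = "\<lambda>\<omega>. 4 * C * ((vnorm (l2 (fst \<omega>)) (section_at v \<omega>))\<^sup>2 + (vnorm (l2 (fst \<omega>)) (section_at w \<omega>))\<^sup>2)"
    show "(\<lambda>n. LINT \<omega>|law. ?q (F n) \<omega>) \<longlonglongrightarrow> (LINT \<omega>|law. ?q f \<omega>)"
    proof (rule integral_dominated_convergence[where w="?g"])
      show "?q f \<in> borel_measurable law" "?q (F n) \<in> borel_measurable law" for n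
        using Qfib_integrable[OF v w] F by (auto intro: borel_measurable_integrable)
      show "integrable law ?g"
        using DI_norm_integrable[OF v] DI_norm_integrable[OF w] by simp
      show "AE \<omega> in law. (\<lambda>n. ?q (F n) \<omega>) \<longlonglongrightarrow> ?q f \<omega>"
        using F by (intro AE_I2 sigma_functionalD(3)[OF sig, where C=C]) auto
      show "AE \<omega> in law. norm (?q (F n) \<omega>) \<le> ?g \<omega>" for n
        using F by (intro AE_I2 Qfib_bound[OF v w]) auto
    qed
  qed
qed

lemma DI_is_spectral_family: "is_spectral_family DI Hop (\<lambda>B. fun_section (indicator B))"
proof (rule bounded_selfadjoint.spectral_familyI[OF DI_bounded_selfadjoint])
  fix B :: "real set" and v w assume B: "B \<in> sets borel" and w: "w \<in> Vec DI"
  have ind: "indicator B \<in> bdd_borel" using B by (rule bdd_borel_indicator)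
  show "fun_section (indicator B) w \<in> Vec DI" using w ind by (rule fun_section_Vec)
  assume v: "v \<in> Vec DI"
  have "Ip DI v (fun_section (indicator B) w) = (LINT \<omega>|law. Qfib \<omega> (section_at v \<omega>) (section_at w \<omega>) (indicator B))"
    unfolding DI_Ip using Qfib_fun_section[OF v w ind] by (intro Bochner_Integration.integral_cong refl) simp
  then show "Ip DI v (fun_section (indicator B) w) = bounded_selfadjoint.Q DI Hop op_bound v w (indicator B)"
    using Q_DI[OF v w ind] by simp
qed

text \<open>The squared norm of \<open>E(B) v\<close> is the mass of \<open>B\<close> under the
  spectral measure of \<open>v\<close>, by uniqueness of the spectral family, and
  \<open>Q_DI\<close> writes this mass as an integral over the fibres.\<close>

lemma spectral_projection_zero_iff:
  assumes B: "B \<in> sets borel"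
  shows "operator_zero DI (spectral_family DI Hop B) \<longleftrightarrow>
    (\<forall>v\<in>Vec DI. (LINT \<omega>|law. Qfib \<omega> (section_at v \<omega>) (section_at v \<omega>) (indicator B)) = 0)"
proof -
  interpret bounded_selfadjoint DI Hop op_bound by (rule DI_bounded_selfadjoint)
  let ?E = "spectral_family DI Hop"
  have E: "is_spectral_family DI Hop ?E"
    unfolding spectral_family_def by (rule someI[where P="is_spectral_family DI Hop", OF DI_is_spectral_family])
  have "veq DI (?E B v) (\<lambda>_. 0) \<longleftrightarrow> Q v v (indicator B) = 0" if v: "v \<in> Vec DI" for v
  proof -
    have "Q v v (indicator B) = complex_of_real ((vnorm DI (?E B v))\<^sup>2)"
      using Q_indicator_self[OF v B] projection_measure_norm[OF E v B] by simp
    then show ?thesis unfolding veq_def by simp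
  qed
  then show ?thesis unfolding operator_zero_def using Q_DI[OF _ _ bdd_borel_indicator[OF B]] by auto
qed

end

context random_hamiltonian
begin

subsection \<open>Covariance\<close>

lemma hopping_act:
  assumes "\<omega> \<in> \<Omega>" "x \<in> fst \<omega>" "y \<in> fst \<omega>"
  shows "hopping \<iota> (act_config act g \<omega>) (act g x) (act g y) = cnj (s g x) * s g y * hopping \<iota> \<omega> x y"
proof -
  have sx: "cnj (s g x) * s g x = 1" for x
    using complex_norm_square[of "s g x"] s_unit[of g x] by (simp add: mult.commute)
  have "s g x * hopping \<iota> (act_config act g \<omega>) (act g x) (act g y) * cnj (s g y) = hopping \<iota> \<omega> x y"
    using condition_A assms unfolding condition_A_def by simp
  then have "cnj (s g x) * s g y * hopping \<iota> \<omega> x y = cnj (s g x) * s g y *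
      (s g x * hopping \<iota> (act_config act g \<omega>) (act g x) (act g y) * cnj (s g y))"
    by (simp only:)
  also have "\<dots> = (cnj (s g x) * s g x) * (cnj (s g y) * s g y) * hopping \<iota> (act_config act g \<omega>) (act g x) (act g y)"
    by (simp only: mult_ac)
  finally show ?thesis unfolding sx by simp
qed

lemma fst_act_config: "fst (act_config act g \<omega>) = act g ` fst \<omega>"
  unfolding act_config_def by (simp add: case_prod_unfold)

text \<open>Translation by \<open>g\<close> from functions on \<open>X(\<omega>)\<close> to
  functions on the translated configuration, twisted by the conjugate phases. It intertwines the two
  fibre operators (\<open>Hfib_gauge\<close>).\<close>

definition gauge :: "'g \<Rightarrow> ('x, 'c) config \<Rightarrow> ('x \<Rightarrow> complex) \<Rightarrow> 'x \<Rightarrow> complex" where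
  "gauge g \<omega> v y = (if y \<in> act g ` fst \<omega> then cnj (s g (act (- g) y)) * v (act (- g) y) else 0)"

lemma Hfib_gauge:
  assumes \<omega>: "\<omega> \<in> \<Omega>"
  shows "Hfib (act_config act g \<omega>) (gauge g \<omega> v) = gauge g \<omega> (Hfib \<omega> v)"
proof
  fix z
  show "Hfib (act_config act g \<omega>) (gauge g \<omega> v) z = gauge g \<omega> (Hfib \<omega> v) z"
  proof (cases "z \<in> act g ` fst \<omega>")
    case True
    then obtain x where x: "x \<in> fst \<omega>" "z = act g x" by blast
    have unit: "s g y * cnj (s g y) = 1" for y
      using complex_norm_square[of "s g y"] s_unit[of g y] by simp
    have "Hfib (act_config act g \<omega>) (gauge g \<omega> v) z
        = (\<Sum>\<^sub>\<infinity>y\<in>act g ` fst \<omega>. hopping \<iota> (act_config act g \<omega>) z y * gauge g \<omega> v y)"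
      using True unfolding fiber_op_def by (simp add: fst_act_config)
    also have "\<dots> = (\<Sum>\<^sub>\<infinity>y\<in>fst \<omega>. hopping \<iota> (act_config act g \<omega>) z (act g y) * gauge g \<omega> v (act g y))"
      using infsum_reindex[OF inj_on_subset[OF act_inj subset_UNIV]] by (simp add: comp_def)
    also have "\<dots> = (\<Sum>\<^sub>\<infinity>y\<in>fst \<omega>. cnj (s g x) * (hopping \<iota> \<omega> x y * v y))"
    proof (rule infsum_cong)
      fix y assume y: "y \<in> fst \<omega>"
      have "hopping \<iota> (act_config act g \<omega>) z (act g y) * gauge g \<omega> v (act g y)
          = cnj (s g x) * (s g y * cnj (s g y)) * hopping \<iota> \<omega> x y * v y"
        using y hopping_act[OF \<omega> x(1) y] unfolding x(2) gauge_def by (simp add: mult_ac)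
      then show "hopping \<iota> (act_config act g \<omega>) z (act g y) * gauge g \<omega> v (act g y) = cnj (s g x) * (hopping \<iota> \<omega> x y * v y)"
        unfolding unit by simp
    qed
    also have "\<dots> = cnj (s g x) * Hfib \<omega> v x"
      using x(1) unfolding fiber_op_def by (simp add: infsum_cmult_right')
    also have "\<dots> = gauge g \<omega> (Hfib \<omega> v) z" using x True unfolding gauge_def by simp
    finally show ?thesis .
  qed (simp add: fiber_op_def gauge_def fst_act_config)
qed

lemma Hfib_pow_gauge:
  "\<omega> \<in> \<Omega> \<Longrightarrow> (Hfib (act_config act g \<omega>) ^^ k) (gauge g \<omega> v) = gauge g \<omega> ((Hfib \<omega> ^^ k) v)"
  by (induction k) (auto simp: Hfib_gauge)

lemma Hfib_scale: "Hfib \<omega> (\<lambda>y. a * v y) = (\<lambda>y. a * Hfib \<omega> v y)"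
proof -
  have "(\<Sum>\<^sub>\<infinity>y\<in>fst \<omega>. hopping \<iota> \<omega> x y * (a * v y)) = a * (\<Sum>\<^sub>\<infinity>y\<in>fst \<omega>. hopping \<iota> \<omega> x y * v y)" for x
    unfolding mult.left_commute[of _ a] by (rule infsum_cmult_right')
  then show ?thesis unfolding fiber_op_def by auto
qed

lemma Hfib_pow_scale: "(Hfib \<omega> ^^ k) (\<lambda>y. a * v y) = (\<lambda>y. a * (Hfib \<omega> ^^ k) v y)"
  by (induction k) (auto simp: Hfib_scale)

text \<open>The gauge maps \<open>delta x\<close> to a nonzero multiple of
  \<open>delta (act g x)\<close>, and the scalar drops out of the diagonal entries of every power.
  Equal moments give the same measure, since \<open>moment_measure\<close> is a function of the
  moments.\<close>

lemma spec_fib_covariant: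
  assumes \<omega>: "\<omega> \<in> \<Omega>" "act_config act g \<omega> \<in> \<Omega>" and x: "x \<in> fst \<omega>"
  shows "spec_fib (act_config act g \<omega>) (delta (act g x)) = spec_fib \<omega> (delta x)"
proof -
  let ?\<omega> = "act_config act g \<omega>"
  have x': "act g x \<in> fst ?\<omega>" using x by (simp add: fst_act_config)
  have s0: "cnj (s g x) \<noteq> 0" using s_unit[of g x] by auto
  have diag: "((Hfib ?\<omega> ^^ k) (delta (act g x))) (act g x) = ((Hfib \<omega> ^^ k) (delta x)) x" for k
  proof -
    have "gauge g \<omega> (delta x) = (\<lambda>y. cnj (s g x) * delta (act g x) y)"
    proof
      fix y
      have "act (- g) y = x \<longleftrightarrow> y = act g x" by auto
      then show "gauge g \<omega> (delta x) y = cnj (s g x) * delta (act g x) y"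
        using x unfolding gauge_def delta_def by auto
    qed
    then have "(\<lambda>y. cnj (s g x) * ((Hfib ?\<omega> ^^ k) (delta (act g x))) y) = gauge g \<omega> ((Hfib \<omega> ^^ k) (delta x))"
      using Hfib_pow_gauge[OF \<omega>(1), where g=g and k=k and v="delta x"] by (simp add: Hfib_pow_scale)
    then have "cnj (s g x) * ((Hfib ?\<omega> ^^ k) (delta (act g x))) (act g x) = gauge g \<omega> ((Hfib \<omega> ^^ k) (delta x)) (act g x)"
      by (rule fun_cong)
    also have "\<dots> = cnj (s g x) * ((Hfib \<omega> ^^ k) (delta x)) x" using x unfolding gauge_def by simp
    finally show ?thesis using s0 by simp
  qed
  show ?thesis
    unfolding bounded_selfadjoint.spec_def[OF fiber_bounded_selfadjoint[OF \<omega>(1)]]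
      bounded_selfadjoint.spec_def[OF fiber_bounded_selfadjoint[OF \<omega>(2)]]
      bounded_selfadjoint.moment_def[OF fiber_bounded_selfadjoint[OF \<omega>(1)]]
      bounded_selfadjoint.moment_def[OF fiber_bounded_selfadjoint[OF \<omega>(2)]]
    by (simp add: l2_Ip_delta x x' diag)
qed

subsection \<open>The spectral measures at the points of a configuration\<close>

text \<open>This is \<open>\<langle>\<delta>\<^sub>x, E\<^sub>\<omega>(B)
  \<delta>\<^sub>x\<rangle>\<close>; as a function of \<open>B\<close> it is a probability measure
  for every point of a configuration in \<Omega>.\<close>

definition kap :: "real set \<Rightarrow> ('x, 'c) config \<Rightarrow> 'x \<Rightarrow> ennreal" where
  "kap B \<omega> x = emeasure (spec_fib \<omega> (delta x)) B"

lemma spec_fib_delta: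
  assumes "\<omega> \<in> \<Omega>" "x \<in> fst \<omega>"
  shows "finite_measure (spec_fib \<omega> (delta x))" "sets (spec_fib \<omega> (delta x)) = sets borel"
    "emeasure (spec_fib \<omega> (delta x)) (- {-op_bound..op_bound}) = 0" "emeasure (spec_fib \<omega> (delta x)) UNIV = 1"
proof -
  note sa = fiber_bounded_selfadjoint[OF assms(1)] and d = delta_Vec[OF assms(2)]
  show 1: "finite_measure (spec_fib \<omega> (delta x))" "sets (spec_fib \<omega> (delta x)) = sets borel"
    "emeasure (spec_fib \<omega> (delta x)) (- {-op_bound..op_bound}) = 0"
    using bounded_selfadjoint.spec_finite[OF sa d] bounded_selfadjoint.spec_sets[OF sa d]
      bounded_selfadjoint.spec_supp[OF sa d] by auto
  interpret finite_measure "spec_fib \<omega> (delta x)" by (rule 1)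
  show "emeasure (spec_fib \<omega> (delta x)) UNIV = 1"
    using bounded_selfadjoint.spec_UNIV[OF sa d] vnorm_delta[OF assms(2)] by (simp add: emeasure_eq_measure)
qed

lemma kap_le_1: "\<omega> \<in> \<Omega> \<Longrightarrow> x \<in> fst \<omega> \<Longrightarrow> kap B \<omega> x \<le> 1"
proof -
  assume a: "\<omega> \<in> \<Omega>" "x \<in> fst \<omega>"
  have "kap B \<omega> x \<le> emeasure (spec_fib \<omega> (delta x)) UNIV"
    unfolding kap_def using emeasure_space[of "spec_fib \<omega> (delta x)" B] sets_eq_imp_space_eq[OF spec_fib_delta(2)[OF a]] by simp
  then show ?thesis using spec_fib_delta(4)[OF a] by simp
qed

lemma kap_covariant: "covariant (kap B)"
  unfolding covariant_def kap_def by (simp add: spec_fib_covariant)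

text \<open>A vector of the direct integral whose value at \<omega> is the unit vector at the point
  in piece \<open>i\<close>, or 0 if there is none. These countably many vectors detect whether a
  spectral projection vanishes.\<close>

definition point_section :: "nat \<Rightarrow> ('x, 'c) config \<times> 'x \<Rightarrow> complex" where
  "point_section i = test_section configs (indicator (piece i))"

lemma point_section_Vec: "point_section i \<in> Vec DI"
  unfolding point_section_def
proof (rule test_section_Vec)
  show "configs \<in> sets \<mu>" using sets.top[of \<mu>] by simp
  show "indicator (piece i) x = (0 :: complex)" if "x \<notin> cball (center i) (2 * radius (center i))" for x
  proof -
    have "x \<notin> piece i" using that radius(1)[of "center i"] unfolding piece_def by auto
    then show ?thesis by simp
  qed
  show "cmod (indicator (piece i) x) \<le> 1" for x by (simp add: indicator_def)
qed (simp_all add: radius)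

lemma section_point_section:
  assumes \<omega>: "\<omega> \<in> \<Omega>"
  shows "section_at (point_section i) \<omega> = (if occ i \<omega> then delta (pt i \<omega>) else (\<lambda>_. 0))"
proof
  fix x
  show "section_at (point_section i) \<omega> x = (if occ i \<omega> then delta (pt i \<omega>) else (\<lambda>_. 0)) x"
  proof -
    have "\<omega> \<in> configs" using \<omega> Omega_configs by (rule subsetD[rotated])
    then have val: "section_at (point_section i) \<omega> x = (if x \<in> fst \<omega> \<and> x \<in> piece i then 1 else 0)"
      by (simp add: point_section_def test_section_def indicator_def)
    show ?thesis
    proof (cases "x \<in> fst \<omega> \<and> x \<in> piece i")
      case True
      then have "occ i \<omega> \<and> pt i \<omega> = x" by (intro pt_eq[OF \<omega>]) simp_all
      then show ?thesis unfolding val using True by (simp add: delta_def)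
    next
      case False
      have "pt i \<omega> \<noteq> x" if "occ i \<omega>" using pt[OF that] False by metis
      then show ?thesis unfolding val using False by (auto simp: delta_def)
    qed
  qed
qed

lemma Qfib_self:
  assumes "\<omega> \<in> \<Omega>" "v \<in> Vec (l2 (fst \<omega>))" "f \<in> bdd_borel"
  shows "Qfib \<omega> v v f = (LINT t|spec_fib \<omega> v. f t)"
  using assms by (intro bounded_selfadjoint.Q_self fiber_bounded_selfadjoint)

definition point_integral :: "(real \<Rightarrow> complex) \<Rightarrow> nat \<Rightarrow> ('x, 'c) config \<Rightarrow> complex" where
  "point_integral f i \<omega> = (if occ i \<omega> then LINT t|spec_fib \<omega> (delta (pt i \<omega>)). f t else 0)"

lemma point_integral_measurable [measurable]:
  assumes f: "f \<in> bdd_borel"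
  shows "point_integral f i \<in> borel_measurable law"
proof -
  have "point_integral f i \<omega> = (if occ i \<omega> then Qfib \<omega> (delta (pt i \<omega>)) (section_at (point_section i) \<omega>) f else 0)"
    if "\<omega> \<in> space law" for \<omega>
    using that f pt(1)[of i \<omega>] by (simp add: point_integral_def section_point_section Qfib_self delta_Vec)
  then show ?thesis
    using Qfib_delta_measurable[OF point_section_Vec f, of i i]
    by (subst measurable_cong[where g="\<lambda>\<omega>. if occ i \<omega> then Qfib \<omega> (delta (pt i \<omega>)) (section_at (point_section i) \<omega>) f else 0"]) auto
qed

lemma point_integral_sigma: "\<omega> \<in> \<Omega> \<Longrightarrow> sigma_functional op_bound (\<lambda>f. point_integral f i \<omega>)"
  unfolding point_integral_def using pt(1)[of i \<omega>] spec_fib_delta[of \<omega> "pt i \<omega>"]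
  by (cases "occ i \<omega>") (auto intro!: sigma_functional_integral)

lemma point_integral_indicator:
  assumes "\<omega> \<in> \<Omega>" "B \<in> sets borel"
  shows "point_integral (indicator B) i \<omega> = (if occ i \<omega> then complex_of_real (measure (spec_fib \<omega> (delta (pt i \<omega>))) B) else 0)"
  using assms pt(1)[of i \<omega>] sets_eq_imp_space_eq[OF spec_fib_delta(2), of \<omega> "pt i \<omega>"]
  by (simp add: point_integral_def integral_complex_indicator)

lemma point_integral_bound:
  assumes \<omega>: "\<omega> \<in> \<Omega>" and f: "f \<in> bdd_borel" "\<And>t. cmod (f t) \<le> C"
  shows "cmod (point_integral f i \<omega>) \<le> C"
proof (cases "occ i \<omega>")
  case True
  let ?m = "spec_fib \<omega> (delta (pt i \<omega>))"
  note sp = spec_fib_delta[OF \<omega> pt(1)[OF True]]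
  interpret finite_measure ?m by (rule sp)
  have "cmod (LINT t|?m. f t) \<le> (LINT t|?m. C)"
    using bdd_borel_integrable[OF sp(1,2) f(1)] f(2)
    by (intro order.trans[OF integral_norm_bound] integral_mono) auto
  also have "\<dots> = C" using sp(4) sets_eq_imp_space_eq[OF sp(2)] by (simp add: measure_def)
  finally show ?thesis using True by (simp add: point_integral_def)
next
  case False
  have "0 \<le> C" using f(2)[of 0] norm_ge_zero order_trans by blast
  then show ?thesis using False by (simp add: point_integral_def)
qed

lemma kap_weight:
  assumes B: "B \<in> sets borel" shows "weight (kap B)"
  unfolding weight_def
proof
  fix i
  have "(if occ i \<omega> then kap B \<omega> (pt i \<omega>) else 0) = ennreal (Re (point_integral (indicator B) i \<omega>))" if "\<omega> \<in> space law" for \<omega>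
    using that B finite_measure.emeasure_eq_measure[OF spec_fib_delta(1)] pt(1)[of i \<omega>]
    by (simp add: point_integral_indicator kap_def)
  moreover have "(\<lambda>\<omega>. ennreal (Re (point_integral (indicator B) i \<omega>))) \<in> borel_measurable law"
    using point_integral_measurable[OF bdd_borel_indicator[OF B], of i] by measurable
  ultimately show "(\<lambda>\<omega>. if occ i \<omega> then kap B \<omega> (pt i \<omega>) else 0) \<in> borel_measurable law"
    by (subst measurable_cong[where g="\<lambda>\<omega>. ennreal (Re (point_integral (indicator B) i \<omega>))"]) simp_all
qed

subsection \<open>The density of states measure\<close>

text \<open>The indicator of \<open>cell\<close> divided by \<open>cell_mass\<close> has orbit
  integral 1 at every point, so it can stand in for any admissible function.\<close>

definition cell :: "'x set" where "cell = translate act (gball 0) F'"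

definition cell_mass :: real where "cell_mass = measure haar (gball 0)"

lemma cell_borel [measurable]: "cell \<in> sets borel"
  unfolding cell_def by (rule translate_borel[OF gball_compact])

lemma cell_mass: "cell_mass > 0" "emeasure haar (gball 0) = ennreal cell_mass"
proof -
  have "emeasure haar (gball 0) < \<infinity>" using haar_compact[OF gball_compact] .
  then show "emeasure haar (gball 0) = ennreal cell_mass"
    unfolding cell_mass_def by (simp add: emeasure_eq_ennreal_measure less_top)
  then show "cell_mass > 0" using gball_pos[of 0] by simp
qed

lemma campbell_cell_finite:
  assumes "weight a" "\<And>\<omega> x. \<omega> \<in> \<Omega> \<Longrightarrow> x \<in> fst \<omega> \<Longrightarrow> a \<omega> x \<le> 1"
  shows "emeasure (campbell a) cell < \<infinity>"
proof -
  obtain K where "compact K" "translate act (gball 0) F' \<subseteq> K" using translate_precompact[OF gball_compact] .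
  then show ?thesis unfolding cell_def using translate_borel[OF gball_compact] by (intro campbell_finite[OF assms])
qed

text \<open>Mass transport against the indicator of \<open>cell\<close>, whose orbit integral is
  constant. Inversion of the group variable brings the orbit integral of \<open>p\<close> into the
  form used in \<open>admissible\<close>.\<close>

lemma campbell_transport:
  assumes a: "weight a" "\<And>\<omega> x. \<omega> \<in> \<Omega> \<Longrightarrow> x \<in> fst \<omega> \<Longrightarrow> a \<omega> x \<le> 1" "covariant a"
    and p: "p \<in> borel_measurable borel"
  shows "(\<integral>\<^sup>+ x. p x \<partial>campbell a) * ennreal cell_mass =
    (\<integral>\<^sup>+ x. indicator cell x * (\<integral>\<^sup>+ g. p (act (- g) x) \<partial>haar) \<partial>campbell a)"
proof -
  have "(\<integral>\<^sup>+ x. p x * (\<integral>\<^sup>+ g. indicator cell (act (- g) x) \<partial>haar) \<partial>campbell a)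
     = (\<integral>\<^sup>+ x. indicator cell x * (\<integral>\<^sup>+ g. p (act g x) \<partial>haar) \<partial>campbell a)"
    using p by (intro transport_space campbell_sigma_finite[OF a(1,2)] campbell_invariant[OF a(1,3)]) auto
  moreover have "(\<integral>\<^sup>+ g. indicator cell (act (- g) x) \<partial>haar) = ennreal cell_mass" for x
    unfolding cell_def translate_haar(2)[OF gball_compact] cell_mass ..
  moreover have "(\<integral>\<^sup>+ g. p (act g x) \<partial>haar) = (\<integral>\<^sup>+ g. p (act (- g) x) \<partial>haar)" for x
  proof -
    have "(\<lambda>g. act g x) \<in> borel_measurable borel"
      using measurable_compose[OF measurable_Pair2'[of x borel borel] act_measurable(1)] by simp
    then show ?thesis using p by (intro haar_uminus[symmetric] measurable_compose[OF _ p])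
  qed
  moreover have "p \<in> borel_measurable (campbell a)"
    using p by (simp add: measurable_cong_sets[OF sets_campbell refl])
  ultimately show ?thesis by (simp add: nn_integral_multc)
qed

text \<open>On average \<open>cell\<close> contains \<open>dens * cell_mass\<close> points and each
  carries total weight 1, so the factor normalises the measure to a mean per point, without
  reference to any \<open>u\<close>.\<close>

definition dos :: "real measure" where
  "dos = measure_of UNIV (sets borel) (\<lambda>B. ennreal (1 / (dens * cell_mass)) * emeasure (campbell (kap B)) cell)"

lemma sets_dos [simp]: "sets dos = sets borel"
  unfolding dos_def using sets.sigma_sets_eq[of "borel :: real measure"] by simp

lemma space_dos [simp]: "space dos = UNIV"
  unfolding dos_def by (simp add: space_measure_of_conv)

lemma emeasure_campbell_kap:
  assumes "B \<in> sets borel"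
  shows "emeasure (campbell (kap B)) cell = (\<integral>\<^sup>+ \<omega>. (\<integral>\<^sup>+ x. indicator cell x * kap B \<omega> x \<partial>count_space (fst \<omega>)) \<partial>law)"
  using nn_integral_campbell[OF kap_weight[OF assms], of "indicator cell"] by simp

lemma emeasure_dos:
  assumes B: "B \<in> sets borel"
  shows "emeasure dos B = ennreal (1 / (dens * cell_mass)) * emeasure (campbell (kap B)) cell"
  unfolding dos_def
proof (rule emeasure_measure_of_sigma)
  show "sigma_algebra UNIV (sets (borel :: real measure))"
    using sets.sigma_algebra_axioms[of "borel :: real measure"] by simp
  show "positive (sets borel) (\<lambda>B. ennreal (1 / (dens * cell_mass)) * emeasure (campbell (kap B)) cell)"
    unfolding positive_def by (simp add: emeasure_campbell_kap kap_def)
  show "countably_additive (sets borel) (\<lambda>B. ennreal (1 / (dens * cell_mass)) * emeasure (campbell (kap B)) cell)"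
  proof (rule countably_additiveI)
    fix A :: "nat \<Rightarrow> real set" assume A: "range A \<subseteq> sets borel" "disjoint_family A"
    have An: "A i \<in> sets borel" for i using A by auto
    have Un: "(\<Union>i. A i) \<in> sets borel" using An by auto
    have "(\<Sum>i. emeasure (campbell (kap (A i))) cell)
       = (\<integral>\<^sup>+ \<omega>. (\<Sum>i. (\<integral>\<^sup>+ x. indicator cell x * kap (A i) \<omega> x \<partial>count_space (fst \<omega>))) \<partial>law)"
      unfolding emeasure_campbell_kap[OF An] using kap_weight[OF An]
      by (intro nn_integral_suminf[symmetric] nn_sum_measurable) auto
    also have "\<dots> = (\<integral>\<^sup>+ \<omega>. (\<integral>\<^sup>+ x. indicator cell x * kap (\<Union>i. A i) \<omega> x \<partial>count_space (fst \<omega>)) \<partial>law)"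
    proof (rule nn_integral_cong)
      fix \<omega> assume "\<omega> \<in> space law"
      then have \<omega>: "\<omega> \<in> \<Omega>" by simp
      have "(\<Sum>i. (\<integral>\<^sup>+ x. indicator cell x * kap (A i) \<omega> x \<partial>count_space (fst \<omega>)))
         = (\<integral>\<^sup>+ x. (\<Sum>i. indicator cell x * kap (A i) \<omega> x) \<partial>count_space (fst \<omega>))"
        by (intro nn_integral_suminf[symmetric]) simp
      also have "\<dots> = (\<integral>\<^sup>+ x. indicator cell x * kap (\<Union>i. A i) \<omega> x \<partial>count_space (fst \<omega>))"
      proof (rule nn_integral_cong)
        fix x assume "x \<in> space (count_space (fst \<omega>))"
        then have x: "x \<in> fst \<omega>" by simp
        have "(\<Sum>i. kap (A i) \<omega> x) = kap (\<Union>i. A i) \<omega> x"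
          unfolding kap_def using A spec_fib_delta(2)[OF \<omega> x] by (intro suminf_emeasure) auto
        then show "(\<Sum>i. indicator cell x * kap (A i) \<omega> x) = indicator cell x * kap (\<Union>i. A i) \<omega> x" by simp
      qed
      finally show "(\<Sum>i. (\<integral>\<^sup>+ x. indicator cell x * kap (A i) \<omega> x \<partial>count_space (fst \<omega>))) =
        (\<integral>\<^sup>+ x. indicator cell x * kap (\<Union>i. A i) \<omega> x \<partial>count_space (fst \<omega>))" .
    qed
    finally show "(\<Sum>i. ennreal (1 / (dens * cell_mass)) * emeasure (campbell (kap (A i))) cell)
      = ennreal (1 / (dens * cell_mass)) * emeasure (campbell (kap (\<Union>i. A i))) cell"
      using emeasure_campbell_kap[OF Un] by simp
  qed
qed (rule B)

lemma dos_finite: "finite_measure dos"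
  using campbell_cell_finite[OF kap_weight kap_le_1, of UNIV]
  by (intro finite_measureI) (simp add: emeasure_dos ennreal_mult_eq_top_iff less_top[symmetric])

lemma dos_support: "emeasure dos (- {-op_bound..op_bound}) = 0"
proof -
  have "emeasure (campbell (kap (- {-op_bound..op_bound}))) cell = (\<integral>\<^sup>+ \<omega>. 0 \<partial>law)"
    unfolding emeasure_campbell_kap[OF borel_open[OF open_Compl[OF closed_atLeastAtMost]]]
  proof (rule nn_integral_cong)
    fix \<omega> assume "\<omega> \<in> space law"
    then have "(\<integral>\<^sup>+ x. indicator cell x * kap (- {-op_bound..op_bound}) \<omega> x \<partial>count_space (fst \<omega>))
      = (\<integral>\<^sup>+ x. 0 \<partial>count_space (fst \<omega>))"
      using spec_fib_delta(3)[of \<omega>] by (intro nn_integral_cong) (simp add: kap_def)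
    then show "(\<integral>\<^sup>+ x. indicator cell x * kap (- {-op_bound..op_bound}) \<omega> x \<partial>count_space (fst \<omega>)) = 0" by simp
  qed
  then show ?thesis by (simp add: emeasure_dos)
qed

lemma dos_measure:
  "B \<in> sets borel \<Longrightarrow> dens * measure dos B = measure (campbell (kap B)) cell / cell_mass"
  using dens(1) cell_mass(1) by (simp add: measure_def emeasure_dos enn2real_mult)

lemma nn_sum_pieces_finite:
  assumes \<omega>: "\<omega> \<in> \<Omega>" and N: "\<And>x i. x \<in> K \<Longrightarrow> x \<in> piece i \<Longrightarrow> i < N"
    and F: "\<And>x. x \<in> fst \<omega> \<Longrightarrow> x \<notin> K \<Longrightarrow> F x = (0::ennreal)"
  shows "(\<integral>\<^sup>+ x. F x \<partial>count_space (fst \<omega>)) = (\<Sum>i<N. if occ i \<omega> then F (pt i \<omega>) else 0)"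
proof -
  have "F (pt i \<omega>) = 0" if "occ i \<omega>" "\<not> i < N" for i
    using F[OF pt(1)[OF that(1)]] N[OF _ pt(2)[OF that(1)]] that(2) by blast
  then show ?thesis unfolding nn_sum_pieces[OF \<omega>, symmetric] by (intro suminf_finite) auto
qed

end

text \<open>Since \<open>\<i> ^ (3 * j)\<close> is the conjugate of \<open>\<i> ^ j\<close>, the
  parts for \<open>j = 0, 1, 2, 3\<close> are the positive parts of \<open>Re z\<close>,
  \<open>Im z\<close>, \<open>- Re z\<close> and \<open>- Im z\<close>. The splitting makes Tonelli
  available for complex \<open>u\<close>.\<close>

definition complex_part :: "nat \<Rightarrow> complex \<Rightarrow> real" where
  "complex_part j z = max 0 (Re (z * \<i> ^ (3 * j)))"

lemma complex_part_nonneg [simp]: "0 \<le> complex_part j z"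
  unfolding complex_part_def by simp

lemma complex_part_le: "complex_part j z \<le> cmod z"
proof -
  have "Re (z * \<i> ^ (3 * j)) \<le> cmod (z * \<i> ^ (3 * j))" by (rule complex_Re_le_cmod)
  then show ?thesis unfolding complex_part_def by (simp add: norm_mult norm_power)
qed

lemma complex_part_zero [simp]: "complex_part j 0 = 0"
  unfolding complex_part_def by simp

lemma complex_part_sum: "(\<Sum>j<4. \<i> ^ j * complex_of_real (complex_part j z)) = z"
  by (simp add: complex_part_def numeral_eq_Suc complex_eq_iff max_def)

lemma complex_part_measurable [measurable]: "complex_part j \<in> borel_measurable borel"
  unfolding complex_part_def[abs_def] by (intro borel_measurable_continuous_onI continuous_intros)

context random_hamiltonian
begin

text \<open>
  By invariance, averaging over the group replaces the admissible function by the indicator function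
  of a fixed cell.
\<close>

context
  fixes u :: "'x \<Rightarrow> complex"
  assumes adm: "admissible act haar u"
begin

lemma u_measurable [measurable]: "u \<in> borel_measurable borel"
  using adm unfolding admissible_def by simp

definition supp_u :: "'x set" where "supp_u = closure {x. u x \<noteq> 0}"

lemma supp_u: "compact supp_u" "x \<notin> supp_u \<Longrightarrow> u x = 0"
proof -
  show "compact supp_u" using adm unfolding admissible_def supp_u_def by simp
  show "u x = 0" if "x \<notin> supp_u" using that closure_subset[of "{x. u x \<noteq> 0}"] unfolding supp_u_def by blast
qed

text \<open>The compact support of \<open>u\<close> meets only finitely many pieces, so every trace
  is a sum over one finite index set, the same for all configurations.\<close>

definition u_pieces :: nat where
  "u_pieces = (SOME N. \<forall>x\<in>supp_u. \<forall>i. x \<in> piece i \<longrightarrow> i < N)"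

lemma u_pieces: "x \<in> supp_u \<Longrightarrow> x \<in> piece i \<Longrightarrow> i < u_pieces"
proof -
  obtain N where "\<And>x i. x \<in> supp_u \<Longrightarrow> x \<in> piece i \<Longrightarrow> i < N" using compact_pieces[OF supp_u(1)] by blast
  then have "\<exists>N. \<forall>x\<in>supp_u. \<forall>i. x \<in> piece i \<longrightarrow> i < N" by blast
  from someI_ex[OF this] show "x \<in> supp_u \<Longrightarrow> x \<in> piece i \<Longrightarrow> i < u_pieces"
    unfolding u_pieces_def[symmetric] by blast
qed

lemma u_orbit_bound: "\<exists>C::real. C \<ge> 0 \<and> (\<forall>x. (\<integral>\<^sup>+ g. ennreal (cmod (u (act (- g) x))) \<partial>haar) \<le> ennreal C)"
proof -
  obtain C :: real where C: "\<And>x. (\<integral>\<^sup>+ g. ennreal (cmod (u (act (- g) x))) \<partial>haar) \<le> ennreal C"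
    using adm unfolding admissible_def by blast
  have "(\<integral>\<^sup>+ g. ennreal (cmod (u (act (- g) x))) \<partial>haar) \<le> ennreal (max 0 C)" for x
    using C[of x] by (rule order.trans) (simp add: ennreal_leI)
  then show ?thesis by (intro exI[of _ "max 0 C"]) auto
qed

lemma orbit_measurable: "(\<lambda>g. act (- g) x) \<in> haar \<rightarrow>\<^sub>M borel"
  using measurable_compose[OF measurable_Pair2'[of x borel borel] act_measurable(2)]
  by (simp add: measurable_cong_sets[OF haar_sets refl])

text \<open>The orbit integral of a single part may depend on \<open>x\<close>; only the combination
  with the powers of \<i> is constant (\<open>orbit_part_sum\<close>). The four parts are therefore
  carried as integrals over \<open>cell\<close> until they are recombined.\<close>

definition orbit_part :: "nat \<Rightarrow> 'x \<Rightarrow> real" where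
  "orbit_part j x = (LINT g|haar. complex_part j (u (act (- g) x)))"

lemma orbit_integrable: "integrable haar (\<lambda>g. u (act (- g) x))"
proof (rule integrableI_bounded)
  show "(\<lambda>g. u (act (- g) x)) \<in> borel_measurable haar"
    using orbit_measurable u_measurable by (rule measurable_compose)
  obtain C :: real where "(\<integral>\<^sup>+ g. ennreal (cmod (u (act (- g) x))) \<partial>haar) \<le> ennreal C" using u_orbit_bound by blast
  then show "(\<integral>\<^sup>+ g. ennreal (norm (u (act (- g) x))) \<partial>haar) < \<infinity>"
    using ennreal_less_top[of C] by (metis infinity_ennreal_def order_le_less_trans)
qed

lemma orbit_part_integrable: "integrable haar (\<lambda>g. complex_part j (u (act (- g) x)))"
proof (rule Bochner_Integration.integrable_bound[OF orbit_integrable[of x]])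
  show "(\<lambda>g. complex_part j (u (act (- g) x))) \<in> borel_measurable haar"
    using borel_measurable_integrable[OF orbit_integrable[of x]] complex_part_measurable by (rule measurable_compose)
  show "AE g in haar. norm (complex_part j (u (act (- g) x))) \<le> norm (u (act (- g) x))"
    by (intro AE_I2) (simp add: complex_part_le)
qed

lemma orbit_part_sum: "(\<Sum>j<4. \<i> ^ j * complex_of_real (orbit_part j x)) = 1"
proof -
  have "(\<Sum>j<4. \<i> ^ j * complex_of_real (orbit_part j x))
     = (LINT g|haar. (\<Sum>j<4. \<i> ^ j * complex_of_real (complex_part j (u (act (- g) x)))))"
    unfolding orbit_part_def using orbit_part_integrable by (subst Bochner_Integration.integral_sum) auto
  also have "\<dots> = (LINT g|haar. u (act (- g) x))" unfolding complex_part_sum ..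
  also have "\<dots> = 1" using adm unfolding admissible_def by simp
  finally show ?thesis .
qed

lemma orbit_part_nn: "(\<integral>\<^sup>+ g. ennreal (complex_part j (u (act (- g) x))) \<partial>haar) = ennreal (orbit_part j x)"
  unfolding orbit_part_def by (intro nn_integral_eq_integral orbit_part_integrable) simp

lemma orbit_part_nonneg [simp]: "0 \<le> orbit_part j x"
  unfolding orbit_part_def by (intro integral_nonneg_AE) simp

lemma orbit_part_bound: "\<exists>C\<ge>0. \<forall>j x. orbit_part j x \<le> C"
proof -
  obtain C :: real where C: "C \<ge> 0" "\<And>x. (\<integral>\<^sup>+ g. ennreal (cmod (u (act (- g) x))) \<partial>haar) \<le> ennreal C"
    using u_orbit_bound by blast
  have "ennreal (orbit_part j x) \<le> ennreal C" for j x
    unfolding orbit_part_nn[symmetric]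
    by (rule order.trans[OF nn_integral_mono C(2)[of x]]) (simp add: ennreal_leI complex_part_le)
  then show ?thesis using C(1) by (intro exI[of _ C]) (simp add: ennreal_le_iff)
qed

lemma orbit_part_measurable: "orbit_part j \<in> borel_measurable borel"
proof -
  interpret H: sigma_finite_measure haar by (rule haar_sigma_finite)
  have "(\<lambda>p. complex_part j (u (act (- snd p) (fst p)))) \<in> borel_measurable (borel \<Otimes>\<^sub>M haar)"
  proof -
    have "(\<lambda>p. (snd p, fst p)) \<in> borel \<Otimes>\<^sub>M haar \<rightarrow>\<^sub>M (borel :: 'g measure) \<Otimes>\<^sub>M (borel :: 'x measure)"
      by measurable
    from measurable_compose[OF this act_measurable(2)]
    have "(\<lambda>p. act (- snd p) (fst p)) \<in> borel \<Otimes>\<^sub>M haar \<rightarrow>\<^sub>M borel" by simp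
    then show ?thesis by measurable
  qed
  then have "(\<lambda>x. LINT g|haar. complex_part j (u (act (- g) x))) \<in> borel_measurable borel"
    by (intro H.borel_measurable_lebesgue_integral) (simp add: case_prod_unfold)
  then show ?thesis unfolding orbit_part_def[abs_def] .
qed

definition u_at :: "nat \<Rightarrow> ('x, 'c) config \<Rightarrow> complex" where
  "u_at i \<omega> = (if occ i \<omega> then u (pt i \<omega>) else 0)"

lemma u_at_measurable [measurable]: "u_at i \<in> borel_measurable law"
  unfolding u_at_def[abs_def] by measurable

lemma campbell_part:
  assumes B: "B \<in> sets borel"
  shows "(\<integral>\<^sup>+ x. ennreal (complex_part j (u x)) \<partial>campbell (kap B)) * ennreal cell_mass =
    ennreal (LINT x|campbell (kap B). indicator cell x * orbit_part j x)"
    and "integrable (campbell (kap B)) (\<lambda>x. indicator cell x * orbit_part j x)"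
proof -
  have cong: "borel_measurable (campbell (kap B)) = borel_measurable borel"
    by (rule measurable_cong_sets) simp_all
  obtain C where C: "C \<ge> 0" "\<And>j x. orbit_part j x \<le> C" using orbit_part_bound by blast
  have fin: "emeasure (campbell (kap B)) cell < \<infinity>"
    using kap_weight[OF B] kap_le_1 by (rule campbell_cell_finite)
  show int: "integrable (campbell (kap B)) (\<lambda>x. indicator cell x * orbit_part j x)"
  proof (rule Bochner_Integration.integrable_bound)
    show "integrable (campbell (kap B)) (\<lambda>x. C * indicator cell x)"
      using fin by (intro integrable_mult_right integrable_real_indicator) auto
    show "(\<lambda>x. indicator cell x * orbit_part j x) \<in> borel_measurable (campbell (kap B))"
      unfolding cong using orbit_part_measurable by measurable
  qed (use C in \<open>auto split: split_indicator\<close>)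
  have "(\<integral>\<^sup>+ x. ennreal (complex_part j (u x)) \<partial>campbell (kap B)) * ennreal cell_mass =
    (\<integral>\<^sup>+ x. indicator cell x * (\<integral>\<^sup>+ g. ennreal (complex_part j (u (act (- g) x))) \<partial>haar) \<partial>campbell (kap B))"
    using B kap_le_1 by (intro campbell_transport kap_weight kap_covariant) auto
  also have "\<dots> = (\<integral>\<^sup>+ x. ennreal (indicator cell x * orbit_part j x) \<partial>campbell (kap B))"
    unfolding orbit_part_nn by (intro nn_integral_cong) (auto split: split_indicator)
  also have "\<dots> = ennreal (LINT x|campbell (kap B). indicator cell x * orbit_part j x)"
    using int by (rule nn_integral_eq_integral) simp
  finally show "(\<integral>\<^sup>+ x. ennreal (complex_part j (u x)) \<partial>campbell (kap B)) * ennreal cell_mass =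
    ennreal (LINT x|campbell (kap B). indicator cell x * orbit_part j x)" .
qed

definition part_at :: "real set \<Rightarrow> nat \<Rightarrow> nat \<Rightarrow> ('x, 'c) config \<Rightarrow> real" where
  "part_at B j i \<omega> = (if occ i \<omega> then complex_part j (u (pt i \<omega>)) * measure (spec_fib \<omega> (delta (pt i \<omega>))) B else 0)"

lemma part_at_eq:
  "\<omega> \<in> \<Omega> \<Longrightarrow> B \<in> sets borel \<Longrightarrow> part_at B j i \<omega> = complex_part j (u_at i \<omega>) * Re (point_integral (indicator B) i \<omega>)"
  unfolding part_at_def u_at_def by (simp add: point_integral_indicator)

text \<open>The mean over configurations is turned into an integral over \<open>cell\<close> by the
  Campbell formula and \<open>campbell_part\<close>. Integrability comes out of the same identity,
  because its right side is finite.\<close>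

lemma part_at_integral:
  assumes B: "B \<in> sets borel"
  shows "integrable law (\<lambda>\<omega>. \<Sum>i<u_pieces. part_at B j i \<omega>)"
    and "(LINT \<omega>|law. (\<Sum>i<u_pieces. part_at B j i \<omega>)) * cell_mass = (LINT x|campbell (kap B). indicator cell x * orbit_part j x)"
proof -
  let ?S = "\<lambda>\<omega>. \<Sum>i<u_pieces. part_at B j i \<omega>"
  have nonneg: "0 \<le> part_at B j i \<omega>" for i \<omega> unfolding part_at_def by simp
  have meas: "?S \<in> borel_measurable law"
  proof -
    have "(\<lambda>\<omega>. \<Sum>i<u_pieces. complex_part j (u_at i \<omega>) * Re (point_integral (indicator B) i \<omega>)) \<in> borel_measurable law"
      using point_integral_measurable[OF bdd_borel_indicator[OF B]] by measurable
    then show ?thesis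
      by (subst measurable_cong[where g="\<lambda>\<omega>. \<Sum>i<u_pieces. complex_part j (u_at i \<omega>) * Re (point_integral (indicator B) i \<omega>)"])
         (simp_all add: part_at_eq B)
  qed
  have "(\<integral>\<^sup>+ x. ennreal (complex_part j (u x)) \<partial>campbell (kap B))
     = (\<integral>\<^sup>+ \<omega>. (\<integral>\<^sup>+ x. ennreal (complex_part j (u x)) * kap B \<omega> x \<partial>count_space (fst \<omega>)) \<partial>law)"
    by (rule nn_integral_campbell[OF kap_weight[OF B]]) measurable
  also have "\<dots> = (\<integral>\<^sup>+ \<omega>. ennreal (?S \<omega>) \<partial>law)"
  proof (rule nn_integral_cong)
    fix \<omega> assume "\<omega> \<in> space law"
    then have \<omega>: "\<omega> \<in> \<Omega>" by simp
    have "(\<integral>\<^sup>+ x. ennreal (complex_part j (u x)) * kap B \<omega> x \<partial>count_space (fst \<omega>))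
      = (\<Sum>i<u_pieces. if occ i \<omega> then ennreal (complex_part j (u (pt i \<omega>))) * kap B \<omega> (pt i \<omega>) else 0)"
      by (intro nn_sum_pieces_finite[OF \<omega> u_pieces]) (auto dest: supp_u(2))
    also have "\<dots> = (\<Sum>i<u_pieces. ennreal (part_at B j i \<omega>))"
    proof (rule sum.cong[OF refl])
      fix i
      show "(if occ i \<omega> then ennreal (complex_part j (u (pt i \<omega>))) * kap B \<omega> (pt i \<omega>) else 0) = ennreal (part_at B j i \<omega>)"
        using finite_measure.emeasure_eq_measure[OF spec_fib_delta(1)[OF \<omega> pt(1)[of i \<omega>]]]
        by (simp add: part_at_def kap_def ennreal_mult)
    qed
    also have "\<dots> = ennreal (?S \<omega>)" using nonneg by simp
    finally show "(\<integral>\<^sup>+ x. ennreal (complex_part j (u x)) * kap B \<omega> x \<partial>count_space (fst \<omega>)) = ennreal (?S \<omega>)" .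
  qed
  finally have nn: "(\<integral>\<^sup>+ \<omega>. ennreal (?S \<omega>) \<partial>law) * ennreal cell_mass = ennreal (LINT x|campbell (kap B). indicator cell x * orbit_part j x)"
    using campbell_part(1)[OF B, of j] by simp
  have fin: "(\<integral>\<^sup>+ \<omega>. ennreal (?S \<omega>) \<partial>law) \<noteq> \<infinity>"
  proof
    assume "(\<integral>\<^sup>+ \<omega>. ennreal (?S \<omega>) \<partial>law) = \<infinity>"
    then have "\<infinity> = ennreal (LINT x|campbell (kap B). indicator cell x * orbit_part j x)"
      using nn cell_mass(1) by (simp add: ennreal_top_mult)
    then show False by simp
  qed
  show int: "integrable law ?S"
    using meas fin nonneg by (intro integrableI_nonneg) (auto simp: sum_nonneg less_top)
  have "ennreal (LINT \<omega>|law. ?S \<omega>) * ennreal cell_mass = ennreal (LINT x|campbell (kap B). indicator cell x * orbit_part j x)"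
    using nn nn_integral_eq_integral[OF int] nonneg by (simp add: sum_nonneg)
  then have "ennreal ((LINT \<omega>|law. ?S \<omega>) * cell_mass) = ennreal (LINT x|campbell (kap B). indicator cell x * orbit_part j x)"
    using nonneg cell_mass(1) by (simp add: ennreal_mult integral_nonneg_AE sum_nonneg)
  moreover have "0 \<le> (LINT \<omega>|law. ?S \<omega>) * cell_mass"
    using nonneg cell_mass(1) by (intro mult_nonneg_nonneg integral_nonneg_AE AE_I2 sum_nonneg) simp_all
  moreover have "0 \<le> (LINT x|campbell (kap B). indicator cell x * orbit_part j x)"
    by (intro integral_nonneg_AE) simp
  ultimately show "(LINT \<omega>|law. ?S \<omega>) * cell_mass = (LINT x|campbell (kap B). indicator cell x * orbit_part j x)"
    by (simp only: ennreal_inj)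
qed

definition trace_at :: "(real \<Rightarrow> complex) \<Rightarrow> ('x, 'c) config \<Rightarrow> complex" where
  "trace_at f \<omega> = (\<Sum>i<u_pieces. u_at i \<omega> * point_integral f i \<omega>)"

text \<open>Recombining the four parts replaces the orbit integrals by the constant 1, and
  \<open>u\<close> disappears: what remains is the Campbell measure of \<open>cell\<close>, that is,
  \<open>dos\<close> up to its normalisation.\<close>

lemma trace_at_indicator:
  assumes B: "B \<in> sets borel"
  shows "(LINT \<omega>|law. trace_at (indicator B) \<omega>) = complex_of_real (dens * measure dos B)"
proof -
  let ?S = "\<lambda>j \<omega>. \<Sum>i<u_pieces. part_at B j i \<omega>"
  let ?I = "\<lambda>j. LINT x|campbell (kap B). indicator cell x * orbit_part j x"
  have eq: "trace_at (indicator B) \<omega> = (\<Sum>j<4. \<i> ^ j * complex_of_real (?S j \<omega>))" if "\<omega> \<in> \<Omega>" for \<omega>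
  proof -
    have "trace_at (indicator B) \<omega> = (\<Sum>i<u_pieces. (\<Sum>j<4. \<i> ^ j * complex_of_real (complex_part j (u_at i \<omega>))) * point_integral (indicator B) i \<omega>)"
      unfolding trace_at_def complex_part_sum ..
    also have "\<dots> = (\<Sum>i<u_pieces. \<Sum>j<4. \<i> ^ j * complex_of_real (part_at B j i \<omega>))"
      unfolding sum_distrib_right using that B
      by (intro sum.cong refl) (simp add: part_at_eq point_integral_indicator)
    also have "\<dots> = (\<Sum>j<4. \<Sum>i<u_pieces. \<i> ^ j * complex_of_real (part_at B j i \<omega>))" by (rule sum.swap)
    finally show ?thesis by (simp add: sum_distrib_left)
  qed
  have "(LINT \<omega>|law. trace_at (indicator B) \<omega>) * complex_of_real cell_mass
     = (LINT \<omega>|law. (\<Sum>j<4. \<i> ^ j * complex_of_real (?S j \<omega>))) * complex_of_real cell_mass"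
    using eq by (intro arg_cong2[where f="(*)"] refl Bochner_Integration.integral_cong) auto
  also have "(LINT \<omega>|law. (\<Sum>j<4. \<i> ^ j * complex_of_real (?S j \<omega>))) = (\<Sum>j<4. \<i> ^ j * complex_of_real (LINT \<omega>|law. ?S j \<omega>))"
    using part_at_integral(1)[OF B] by (subst Bochner_Integration.integral_sum) (auto simp del: of_real_sum)
  also have "\<dots> * complex_of_real cell_mass = (\<Sum>j<4. \<i> ^ j * complex_of_real (?I j))"
    unfolding part_at_integral(2)[OF B, symmetric] by (simp add: sum_distrib_right mult.assoc)
  also have "\<dots> = (LINT x|campbell (kap B). (\<Sum>j<4. \<i> ^ j * complex_of_real (indicator cell x * orbit_part j x)))"
    using campbell_part(2)[OF B] by (subst Bochner_Integration.integral_sum) (auto simp del: of_real_mult)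
  also have "\<dots> = (LINT x|campbell (kap B). indicator cell x)"
  proof (rule Bochner_Integration.integral_cong[OF refl])
    fix x
    have "(\<Sum>j<4. \<i> ^ j * complex_of_real (indicator cell x * orbit_part j x))
       = indicator cell x * (\<Sum>j<4. \<i> ^ j * complex_of_real (orbit_part j x))"
      by (auto split: split_indicator)
    then show "(\<Sum>j<4. \<i> ^ j * complex_of_real (indicator cell x * orbit_part j x)) = indicator cell x"
      unfolding orbit_part_sum by simp
  qed
  also have "\<dots> = complex_of_real (measure (campbell (kap B)) cell)" by (simp add: integral_complex_indicator)
  also have "\<dots> = complex_of_real (dens * measure dos B * cell_mass)"
    using dos_measure[OF B] cell_mass(1) by simp
  finally show ?thesis using cell_mass(1) by simp
qed

text \<open>The uniform bound on the orbit integrals of \<open>\<bar>u\<bar>\<close> becomes, by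
  transport, a finite mean of the sum of \<open>\<bar>u\<bar>\<close> over the points of a
  configuration, and this sum dominates each single term.\<close>

lemma u_at_integrable: "integrable law (u_at i)"
proof (rule integrableI_bounded)
  obtain C :: real where C: "C \<ge> 0" "\<And>x. (\<integral>\<^sup>+ g. ennreal (cmod (u (act (- g) x))) \<partial>haar) \<le> ennreal C"
    using u_orbit_bound by blast
  let ?M = "campbell (\<lambda>_ _. 1)"
  have "(\<integral>\<^sup>+ x. ennreal (cmod (u x)) \<partial>?M) * ennreal cell_mass
     = (\<integral>\<^sup>+ x. indicator cell x * (\<integral>\<^sup>+ g. ennreal (cmod (u (act (- g) x))) \<partial>haar) \<partial>?M)"
    by (intro campbell_transport) (auto simp: covariant_def)
  also have "\<dots> \<le> (\<integral>\<^sup>+ x. ennreal C * indicator cell x \<partial>?M)"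
    using C(2) by (intro nn_integral_mono) (auto split: split_indicator)
  also have "\<dots> = ennreal C * emeasure ?M cell" by (simp add: nn_integral_cmult_indicator)
  also have "\<dots> < \<infinity>" using campbell_cell_finite[of "\<lambda>_ _. 1"] by (simp add: ennreal_mult_less_top)
  finally have "(\<integral>\<^sup>+ x. ennreal (cmod (u x)) \<partial>?M) * ennreal cell_mass < \<infinity>" .
  then have fin: "(\<integral>\<^sup>+ x. ennreal (cmod (u x)) \<partial>?M) < \<infinity>"
    using cell_mass(1) by (auto simp: ennreal_mult_less_top)
  have "(\<integral>\<^sup>+ \<omega>. ennreal (norm (u_at i \<omega>)) \<partial>law) \<le> (\<integral>\<^sup>+ \<omega>. (\<integral>\<^sup>+ x. ennreal (cmod (u x)) * 1 \<partial>count_space (fst \<omega>)) \<partial>law)"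
  proof (rule nn_integral_mono)
    fix \<omega> assume "\<omega> \<in> space law"
    then have \<omega>: "\<omega> \<in> \<Omega>" by simp
    have "ennreal (norm (u_at i \<omega>)) = (\<Sum>k\<in>{i}. if occ k \<omega> then ennreal (cmod (u (pt k \<omega>))) else 0)"
      by (simp add: u_at_def)
    also have "\<dots> \<le> (\<Sum>k. if occ k \<omega> then ennreal (cmod (u (pt k \<omega>))) else 0)"
      by (rule sum_le_suminf) auto
    also have "\<dots> = (\<integral>\<^sup>+ x. ennreal (cmod (u x)) * 1 \<partial>count_space (fst \<omega>))"
      using nn_sum_pieces[OF \<omega>, of "\<lambda>x. ennreal (cmod (u x))"] by simp
    finally show "ennreal (norm (u_at i \<omega>)) \<le> (\<integral>\<^sup>+ x. ennreal (cmod (u x)) * 1 \<partial>count_space (fst \<omega>))" .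
  qed
  also have "\<dots> = (\<integral>\<^sup>+ x. ennreal (cmod (u x)) \<partial>?M)"
    by (rule nn_integral_campbell[symmetric]) auto
  finally show "(\<integral>\<^sup>+ \<omega>. ennreal (norm (u_at i \<omega>)) \<partial>law) < \<infinity>" using fin by (rule order_le_less_trans)
qed measurable

lemma u_point_integrable:
  assumes f: "f \<in> bdd_borel"
  shows "integrable law (\<lambda>\<omega>. u_at i \<omega> * point_integral f i \<omega>)"
proof -
  obtain C where C: "\<And>t. cmod (f t) \<le> C" using f by (metis bdd_borel_bound)
  show ?thesis
  proof (rule Bochner_Integration.integrable_bound)
    show "integrable law (\<lambda>\<omega>. complex_of_real C * u_at i \<omega>)" using u_at_integrable by (rule integrable_mult_right)
    show "(\<lambda>\<omega>. u_at i \<omega> * point_integral f i \<omega>) \<in> borel_measurable law"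
      using point_integral_measurable[OF f] by measurable
    show "AE \<omega> in law. norm (u_at i \<omega> * point_integral f i \<omega>) \<le> norm (complex_of_real C * u_at i \<omega>)"
    proof (rule AE_I2)
      fix \<omega> assume "\<omega> \<in> space law"
      then have "cmod (point_integral f i \<omega>) \<le> \<bar>C\<bar>" using point_integral_bound[of \<omega> f C i] f C by force
      then show "norm (u_at i \<omega> * point_integral f i \<omega>) \<le> norm (complex_of_real C * u_at i \<omega>)"
        by (simp add: norm_mult mult.commute[of "\<bar>C\<bar>"] mult_left_mono)
    qed
  qed
qed

lemma u_point_sigma: "sigma_functional op_bound (\<lambda>f. LINT \<omega>|law. u_at i \<omega> * point_integral f i \<omega>)"
  unfolding sigma_functional_def
proof (intro conjI ballI allI impI)
  fix f g a assume f: "f \<in> bdd_borel" and g: "g \<in> bdd_borel"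
  have "(LINT \<omega>|law. u_at i \<omega> * point_integral (\<lambda>t. a * f t + g t) i \<omega>)
      = (LINT \<omega>|law. a * (u_at i \<omega> * point_integral f i \<omega>) + u_at i \<omega> * point_integral g i \<omega>)"
    using sigma_functionalD(1)[OF point_integral_sigma f g]
    by (intro Bochner_Integration.integral_cong refl) (simp add: algebra_simps)
  also have "\<dots> = a * (LINT \<omega>|law. u_at i \<omega> * point_integral f i \<omega>) + (LINT \<omega>|law. u_at i \<omega> * point_integral g i \<omega>)"
    using u_point_integrable[OF f, of i] u_point_integrable[OF g, of i] by simp
  finally show "(LINT \<omega>|law. u_at i \<omega> * point_integral (\<lambda>t. a * f t + g t) i \<omega>)
    = a * (LINT \<omega>|law. u_at i \<omega> * point_integral f i \<omega>) + (LINT \<omega>|law. u_at i \<omega> * point_integral g i \<omega>)" .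
next
  fix f assume f: "f \<in> bdd_borel" "\<forall>t. \<bar>t\<bar> \<le> op_bound \<longrightarrow> f t = 0"
  have "(LINT \<omega>|law. u_at i \<omega> * point_integral f i \<omega>) = (LINT \<omega>|law. 0)"
    using sigma_functionalD(2)[OF point_integral_sigma f(1)] f(2) by (intro Bochner_Integration.integral_cong refl) simp
  then show "(LINT \<omega>|law. u_at i \<omega> * point_integral f i \<omega>) = 0" by simp
next
  fix F f C
  assume F: "f \<in> bdd_borel" "\<forall>n. F n \<in> bdd_borel" "\<forall>n t. cmod (F n t) \<le> C" "\<forall>t. (\<lambda>n. F n t) \<longlonglongrightarrow> f t"
  show "(\<lambda>n. LINT \<omega>|law. u_at i \<omega> * point_integral (F n) i \<omega>) \<longlonglongrightarrow> (LINT \<omega>|law. u_at i \<omega> * point_integral f i \<omega>)"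
  proof (rule integral_dominated_convergence[where w="\<lambda>\<omega>. C * cmod (u_at i \<omega>)"])
    show "(\<lambda>\<omega>. u_at i \<omega> * point_integral f i \<omega>) \<in> borel_measurable law"
      using u_point_integrable F by (auto intro: borel_measurable_integrable)
    show "(\<lambda>\<omega>. u_at i \<omega> * point_integral (F n) i \<omega>) \<in> borel_measurable law" for n
      using u_point_integrable F by (auto intro: borel_measurable_integrable)
    show "integrable law (\<lambda>\<omega>. C * cmod (u_at i \<omega>))"
      using u_at_integrable by (intro integrable_mult_right integrable_norm)
    show "AE \<omega> in law. (\<lambda>n. u_at i \<omega> * point_integral (F n) i \<omega>) \<longlonglongrightarrow> u_at i \<omega> * point_integral f i \<omega>"
      using F by (intro AE_I2 tendsto_mult tendsto_const sigma_functionalD(3)[OF point_integral_sigma, where C=C]) auto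
    show "AE \<omega> in law. norm (u_at i \<omega> * point_integral (F n) i \<omega>) \<le> C * cmod (u_at i \<omega>)" for n
    proof (rule AE_I2)
      fix \<omega> assume "\<omega> \<in> space law"
      then have "cmod (point_integral (F n) i \<omega>) \<le> C" using point_integral_bound[of \<omega> "F n" C i] F by simp
      then show "norm (u_at i \<omega> * point_integral (F n) i \<omega>) \<le> C * cmod (u_at i \<omega>)"
        by (simp add: norm_mult mult.commute[of C] mult_left_mono)
    qed
  qed
qed

lemma trace_at_integrable: "f \<in> bdd_borel \<Longrightarrow> integrable law (trace_at f)"
  unfolding trace_at_def[abs_def] by (intro Bochner_Integration.integrable_sum u_point_integrable)

text \<open>Both sides are sigma functionals of \<open>f\<close>, so the identity for indicators
  extends to all bounded Borel functions and in particular to \<open>Cc euclidean\<close>.\<close>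

lemma trace_at_integral:
  assumes f: "f \<in> bdd_borel"
  shows "(LINT \<omega>|law. trace_at f \<omega>) = complex_of_real dens * (LINT t|dos. f t)"
proof (rule sigma_functional_eqI_indicator[OF _ _ _ f])
  have "(LINT \<omega>|law. trace_at f \<omega>) = (\<Sum>i<u_pieces. 1 * (LINT \<omega>|law. u_at i \<omega> * point_integral f i \<omega>))"
    if "f \<in> bdd_borel" for f
    unfolding trace_at_def using u_point_integrable[OF that] by (simp add: Bochner_Integration.integral_sum)
  moreover have sums: "sigma_functional op_bound (\<lambda>f. \<Sum>i<u_pieces. 1 * (LINT \<omega>|law. u_at i \<omega> * point_integral f i \<omega>))"
    by (intro sigma_functional_sums u_point_sigma)
  ultimately show "sigma_functional op_bound (\<lambda>f. LINT \<omega>|law. trace_at f \<omega>)"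
    unfolding sigma_functional_def by (simp add: bdd_borel_add bdd_borel_scale)
  show "sigma_functional op_bound (\<lambda>f. complex_of_real dens * (LINT t|dos. f t))"
    by (intro sigma_functional_cmult sigma_functional_integral dos_finite dos_support sets_dos)
  show "(LINT \<omega>|law. trace_at (indicator B) \<omega>) = complex_of_real dens * (LINT t|dos. indicator B t)"
    if "B \<in> sets borel" for B
    using trace_at_indicator[OF that] by (simp add: integral_complex_indicator)
qed

lemma trace_at_eq:
  assumes \<omega>: "\<omega> \<in> \<Omega>" and f: "f \<in> bdd_borel"
  shows "l2_trace (fst \<omega>) (\<lambda>v x. u x * functional_calculus (l2 (fst \<omega>)) (Hfib \<omega>) f v x) = trace_at f \<omega>"
proof -
  have "l2_trace (fst \<omega>) (\<lambda>v x. u x * functional_calculus (l2 (fst \<omega>)) (Hfib \<omega>) f v x)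
     = (\<Sum>\<^sub>\<infinity>x\<in>fst \<omega>. u x * (LINT t|spec_fib \<omega> (delta x). f t))"
    by (rule l2_selfadjoint.l2_trace_functional_calculus[OF fiber_selfadjoint[OF \<omega>] f])
  also have "\<dots> = (\<Sum>i<u_pieces. if occ i \<omega> then u (pt i \<omega>) * (LINT t|spec_fib \<omega> (delta (pt i \<omega>)). f t) else 0)"
    by (intro infsum_pieces_finite[OF \<omega> u_pieces]) (auto dest: supp_u(2))
  also have "\<dots> = trace_at f \<omega>"
    unfolding trace_at_def u_at_def point_integral_def by (intro sum.cong) auto
  finally show ?thesis .
qed

lemma is_nu_dos: "is_nu dens \<iota> \<mu> \<Omega> u dos"
  unfolding is_nu_def Let_def
proof (intro conjI allI impI ballI)
  show "emeasure dos K < \<infinity>" for K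
    using finite_measure.emeasure_finite[OF dos_finite, of K] by (simp add: less_top)
  fix \<phi> :: "real \<Rightarrow> complex" assume \<phi>: "\<phi> \<in> Cc euclidean"
  obtain K where K: "continuous_on UNIV \<phi>" "compact K" "\<And>x. x \<notin> K \<Longrightarrow> \<phi> x = 0" using Cc_euclideanE[OF \<phi>] by metis
  have "bounded (\<phi> ` K)" using K by (intro compact_imp_bounded compact_continuous_image continuous_on_subset[OF K(1)]) auto
  then obtain C where C: "\<And>x. x \<in> K \<Longrightarrow> cmod (\<phi> x) \<le> C" unfolding bounded_iff by auto
  have "cmod (\<phi> x) \<le> max 0 C" for x using C[of x] K(3)[of x] by (cases "x \<in> K") auto
  then have f: "\<phi> \<in> bdd_borel" using borel_measurable_continuous_onI[OF K(1)] by (intro bdd_borelI)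
  let ?tr = "\<lambda>\<omega>. l2_trace (fst \<omega>) (\<lambda>v x. u x * functional_calculus (l2 (fst \<omega>)) (Hfib \<omega>) \<phi> v x)"
  show "integrable law ?tr"
    using trace_at_integrable[OF f] by (subst Bochner_Integration.integrable_cong[OF refl]) (auto simp: trace_at_eq f)
  have "(LINT \<omega>|law. ?tr \<omega>) = (LINT \<omega>|law. trace_at \<phi> \<omega>)"
    by (intro Bochner_Integration.integral_cong refl) (simp add: trace_at_eq f)
  then show "(LINT t|dos. \<phi> t) = complex_of_real (1 / dens) * (LINT \<omega>|law. ?tr \<omega>)"
    using trace_at_integral[OF f] dens(1) by simp
qed simp

end

lemma is_nu_unique: "is_nu d \<iota> \<mu> \<Omega> u \<nu> \<Longrightarrow> is_nu d \<iota> \<mu> \<Omega> u \<nu>' \<Longrightarrow> \<nu> = \<nu>'"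
  unfolding is_nu_def Let_def by (intro radon_measure_eqI) auto

lemma nu_eq_dos: "admissible act haar u \<Longrightarrow> nu dens \<iota> \<mu> \<Omega> u = dos"
  unfolding nu_def using is_nu_dos is_nu_unique by (intro the_equality) blast+

subsection \<open>Null sets of the density of states measure\<close>

text \<open>If \<open>cell\<close> is null for the invariant measure
  \<open>campbell (kap B)\<close>, proportionality makes the translates by all the balls null. They
  exhaust the space, so the mean of the sum of all weights is 0.\<close>

lemma dos_null_iff:
  assumes B: "B \<in> sets borel"
  shows "emeasure dos B = 0 \<longleftrightarrow> (AE \<omega> in law. \<forall>x\<in>fst \<omega>. kap B \<omega> x = 0)"
proof -
  let ?C = "campbell (kap B)"
  have h0: "emeasure haar (gball 0) \<noteq> 0" using gball_pos[of 0] by simp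
  have "1 / (dens * cell_mass) > 0" using dens(1) cell_mass(1) by simp
  then have "emeasure dos B = 0 \<longleftrightarrow> emeasure ?C cell = 0" using B by (auto simp: emeasure_dos)
  also have "\<dots> \<longleftrightarrow> emeasure ?C UNIV = 0"
  proof
    assume 0: "emeasure ?C cell = 0"
    have z0: "emeasure ?C (translate act (gball n) F') * emeasure haar (gball 0) = 0" for n
      using campbell_translate[OF kap_weight[OF B] kap_le_1 kap_covariant gball_compact gball_compact, of n 0] 0
      unfolding cell_def by simp
    have "emeasure ?C (translate act (gball n) F') = 0" for n
      using z0[of n] h0 by (metis mult_eq_0_iff)
    then have "(\<Union>n. translate act (gball n) F') \<in> null_sets ?C"
      using translate_borel[OF gball_compact] by (intro null_sets_UN null_setsI) auto
    then show "emeasure ?C UNIV = 0" unfolding translate_cover by auto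
  next
    assume 0: "emeasure ?C UNIV = 0"
    have "emeasure ?C cell \<le> emeasure ?C UNIV" by (rule emeasure_mono) auto
    then show "emeasure ?C cell = 0" using 0 by simp
  qed
  also have "emeasure ?C UNIV = (\<integral>\<^sup>+ \<omega>. (\<integral>\<^sup>+ x. 1 * kap B \<omega> x \<partial>count_space (fst \<omega>)) \<partial>law)"
    using nn_integral_campbell[OF kap_weight[OF B], of "\<lambda>_. 1"] by simp
  also have "\<dots> = 0 \<longleftrightarrow> (AE \<omega> in law. (\<integral>\<^sup>+ x. 1 * kap B \<omega> x \<partial>count_space (fst \<omega>)) = 0)"
    by (rule nn_integral_0_iff_AE) (intro nn_sum_measurable kap_weight B borel_measurable_const)
  also have "\<dots> \<longleftrightarrow> (AE \<omega> in law. \<forall>x\<in>fst \<omega>. kap B \<omega> x = 0)"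
    by (simp add: nn_integral_0_iff_AE AE_count_space)
  finally show ?thesis .
qed

text \<open>Forward, the countably many vectors \<open>point_section i\<close> already give the
  vanishing of all weights almost surely. Backward, a vanishing weight at \<open>x\<close> means
  \<open>E(B) \<delta>\<^sub>x = 0\<close>, and if this holds at all points of a configuration then
  \<open>E(B)\<close> is 0 on its fibre.\<close>

lemma projection_null_iff:
  assumes B: "B \<in> sets borel"
  shows "(\<forall>v\<in>Vec DI. (LINT \<omega>|law. Qfib \<omega> (section_at v \<omega>) (section_at v \<omega>) (indicator B)) = 0) \<longleftrightarrow>
    (AE \<omega> in law. \<forall>x\<in>fst \<omega>. kap B \<omega> x = 0)"
proof
  have ind: "indicator B \<in> bdd_borel" using B by (rule bdd_borel_indicator)
  assume all: "\<forall>v\<in>Vec DI. (LINT \<omega>|law. Qfib \<omega> (section_at v \<omega>) (section_at v \<omega>) (indicator B)) = 0"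
  have "AE \<omega> in law. occ i \<omega> \<longrightarrow> kap B \<omega> (pt i \<omega>) = 0" for i
  proof -
    let ?q = "\<lambda>\<omega>. Qfib \<omega> (section_at (point_section i) \<omega>) (section_at (point_section i) \<omega>) (indicator B)"
    have q: "?q \<omega> = complex_of_real (measure (spec_fib \<omega> (section_at (point_section i) \<omega>)) B)" if "\<omega> \<in> \<Omega>" for \<omega>
      using bounded_selfadjoint.Q_indicator_self[OF fiber_bounded_selfadjoint[OF that] DI_section[OF point_section_Vec that] B] .
    have int: "integrable law ?q" by (rule Qfib_integrable[OF point_section_Vec point_section_Vec ind])
    have intR: "integrable law (\<lambda>\<omega>. Re (?q \<omega>))" using int by (rule integrable_Re)
    have "(LINT \<omega>|law. Re (?q \<omega>)) = Re (LINT \<omega>|law. ?q \<omega>)" using int by (rule integral_Re)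
    also have "\<dots> = 0" using all point_section_Vec[of i] by simp
    finally have 0: "(LINT \<omega>|law. Re (?q \<omega>)) = 0" .
    have "AE \<omega> in law. 0 \<le> Re (?q \<omega>)" using q by (intro AE_I2) simp
    then have "AE \<omega> in law. Re (?q \<omega>) = 0"
      using 0 integral_nonneg_eq_0_iff_AE[OF intR] by simp
    then show ?thesis
    proof (rule AE_mp, intro AE_I2 impI)
      fix \<omega> assume "\<omega> \<in> space law" and 0: "Re (?q \<omega>) = 0" and o: "occ i \<omega>"
      then have \<omega>: "\<omega> \<in> \<Omega>" by simp
      have "measure (spec_fib \<omega> (delta (pt i \<omega>))) B = 0"
        using 0 q[OF \<omega>] o section_point_section[OF \<omega>, of i] by simp
      then show "kap B \<omega> (pt i \<omega>) = 0"
        unfolding kap_def finite_measure.emeasure_eq_measure[OF spec_fib_delta(1)[OF \<omega> pt(1)[OF o]]] by simp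
    qed
  qed
  then have "AE \<omega> in law. \<forall>i. occ i \<omega> \<longrightarrow> kap B \<omega> (pt i \<omega>) = 0" by (simp add: AE_all_countable)
  then show "AE \<omega> in law. \<forall>x\<in>fst \<omega>. kap B \<omega> x = 0"
  proof (rule AE_mp, intro AE_I2 impI ballI)
    fix \<omega> x assume "\<omega> \<in> space law" and a: "\<forall>i. occ i \<omega> \<longrightarrow> kap B \<omega> (pt i \<omega>) = 0" and x: "x \<in> fst \<omega>"
    then have \<omega>: "\<omega> \<in> \<Omega>" by simp
    obtain i where "x \<in> piece i" using piece_exists by blast
    then show "kap B \<omega> x = 0" using pt_eq[OF \<omega> x] a by metis
  qed
next
  have ind: "indicator B \<in> bdd_borel" using B by (rule bdd_borel_indicator)
  have ind1: "cmod (indicator B t) \<le> 1" for t by (auto split: split_indicator)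
  assume null: "AE \<omega> in law. \<forall>x\<in>fst \<omega>. kap B \<omega> x = 0"
  show "\<forall>v\<in>Vec DI. (LINT \<omega>|law. Qfib \<omega> (section_at v \<omega>) (section_at v \<omega>) (indicator B)) = 0"
  proof
    fix v assume v: "v \<in> Vec DI"
    have "AE \<omega> in law. Qfib \<omega> (section_at v \<omega>) (section_at v \<omega>) (indicator B) = 0"
      using null
    proof (rule AE_mp, intro AE_I2 impI)
      fix \<omega> assume "\<omega> \<in> space law" and 0: "\<forall>x\<in>fst \<omega>. kap B \<omega> x = 0"
      then have \<omega>: "\<omega> \<in> \<Omega>" by simp
      interpret l2_selfadjoint "fst \<omega>" "Hfib \<omega>" op_bound by (rule fiber_selfadjoint[OF \<omega>])
      let ?v = "section_at v \<omega>"
      have vV: "?v \<in> Vec (l2 (fst \<omega>))" by (rule DI_section[OF v \<omega>])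
      \<comment> \<open>The weight at \<open>x\<close> is the squared norm of \<open>E(B)\<close>
        applied to \<open>delta x\<close>. Cauchy-Schwarz kills its inner product with the section,
        and conjugation yields the coordinate at \<open>x\<close> of \<open>E(B)\<close> applied to
        the section.\<close>
      have "Q (delta x) ?v (indicator B) = 0" if x: "x \<in> fst \<omega>" for x
      proof -
        note d = delta_Vec[OF x]
        have "vnorm (l2 (fst \<omega>)) (fun_op (indicator B) (delta x)) = 0"
          using 0 x projection_measure_norm[OF is_spectral_family_fun_op d B]
          by (simp add: kap_def measure_def)
        then have "cmod (Ip (l2 (fst \<omega>)) ?v (fun_op (indicator B) (delta x))) \<le> 0"
          using Cauchy_Schwarz[OF vV fun_op_Vec[OF ind ind1 d]] by simp
        then have "Q ?v (delta x) (indicator B) = 0" using fun_op_Ip[OF ind ind1 d vV] by simp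
        moreover have "(\<lambda>t. cnj (indicator B t)) = (indicator B :: real \<Rightarrow> complex)" by (auto split: split_indicator)
        ultimately show ?thesis using Q_cnj[OF vV d ind] by simp
      qed
      then have "fun_op (indicator B) ?v = (\<lambda>_. 0)" unfolding fun_op_def by auto
      then show "Q ?v ?v (indicator B) = 0"
        using fun_op_Ip[OF ind ind1 vV vV] Ip_zero_right[OF vV] by simp
    qed
    then show "(LINT \<omega>|law. Qfib \<omega> (section_at v \<omega>) (section_at v \<omega>) (indicator B)) = 0"
      by (rule integral_eq_zero_AE)
  qed
qed

end

theorem theorem2p1:
  fixes act :: "'g::{metric_space, topological_group_add} \<Rightarrow>
      'x::{metric_space, second_countable_topology} \<Rightarrow> 'x"
    and F' :: "'x set"
    and haar :: "'g measure"
    and \<iota> :: "complex \<Rightarrow> 'c::t2_space"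
    and \<mu> :: "('x, 'c) config measure"
    and \<Omega> :: "('x, 'c) config set"
    and s :: "'g \<Rightarrow> 'x \<Rightarrow> complex"
    and u :: "'x \<Rightarrow> complex"
  assumes "geometric_setting act F' haar"
    and "random_configuration act \<iota> \<mu> \<Omega>"
    and "\<forall>g x. cmod (s g x) = 1"
    and "condition_A act s \<iota> \<mu> \<Omega>"
    and "admissible act haar u"
  shows "let dens = density_of act F' haar \<mu> \<Omega> in
    (\<exists>!\<nu>. is_nu dens \<iota> \<mu> \<Omega> u \<nu>) \<and>
    (\<forall>u'. admissible act haar u' \<longrightarrow> nu dens \<iota> \<mu> \<Omega> u' = nu dens \<iota> \<mu> \<Omega> u) \<and>
    (\<forall>B\<in>sets borel. emeasure (nu dens \<iota> \<mu> \<Omega> u) B = 0 \<longleftrightarrow>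
       operator_zero (direct_integral \<mu> \<Omega>)
         (spectral_family (direct_integral \<mu> \<Omega>) (direct_integral_op \<iota>) B))"
proof -
  interpret geometric_setting act F' haar by fact
  interpret random_configuration act \<iota> \<mu> \<Omega> by fact
  interpret random_hamiltonian act F' haar \<iota> \<mu> \<Omega> s
    by unfold_locales (use assms in auto)
  show ?thesis
    unfolding Let_def dens_def[symmetric]
  proof (intro conjI ballI allI impI)
    show "\<exists>!\<nu>. is_nu dens \<iota> \<mu> \<Omega> u \<nu>"
      using is_nu_dos[OF assms(5)] is_nu_unique by blast
    show "nu dens \<iota> \<mu> \<Omega> u' = nu dens \<iota> \<mu> \<Omega> u" if "admissible act haar u'" for u'
      using nu_eq_dos that assms(5) by simp
    show "emeasure (nu dens \<iota> \<mu> \<Omega> u) B = 0 \<longleftrightarrow> operator_zero DI (spectral_family DI Hop B)" if "B \<in> sets borel" for B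
      using nu_eq_dos[OF assms(5)] dos_null_iff[OF that] projection_null_iff[OF that] spectral_projection_zero_iff[OF that]
      by simp
  qed
qed

end
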